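(* Let $m,p\ge 1$ and let $x:M^m\to\mathbb{R}^{m+p}$ be a properly immersed, complete and $W$-stable $\xi$-submanifold (with $M$ connected) whose normal bundle is flat. If the Weingarten map $A_\xi$ vanishes identically, then $x(M^m)$ is an $m$-plane.
   Context: For a smooth immersion $x:M^m\to\mathbb{R}^{m+p}$ of a smooth manifold: $\langle\cdot,\cdot\rangle$ is the Euclidean inner product, $D$ the flat connection of $\mathbb{R}^{m+p}$, $g$ the induced metric, $dV$ its volume element, $h(X,Y)=(D_XY)^\perp$ the second fundamental form, $H=\mathrm{tr}_g h$ the (unnormalized) mean curvature vector, $D^\perp$ the normal connection, and $A_\eta$ the Weingarten operator, $\langle A_\eta X,Y\rangle=\langle h(X,Y),\eta\rangle$. $x^\perp$ is the normal component of the position vector $x$. $x$ is a $\xi$-submanifold if $H+x^\perp=\xi$ for a normal vector field $\xi$ with $D^\perp\xi=0$. For such $x$ put $f=\tfrac12|x-\xi|^2$, and for an immersion $y:M\to\mathbb{R}^{m+p}$ put $V_\xi(y)=\int_M e^{-\frac12|y-\xi|^2}dV_y$, with $\xi:M\to\mathbb{R}^{m+p}$ kept fixed and $dV_y$ the volume element induced by $y$. A variation of $x$ is a smooth map $F:M\times(-\varepsilon,\varepsilon)\to\mathbb{R}^{m+p}$ such that each $x_t=F(\cdot,t)$ is an immersion and $x_0=x$; its variation vector field is $\eta=\partial F/\partial t|_{t=0}$. It is compact if there is a relatively compact open $B\subset M$ containing the support of $\partial F/\partial t(\cdot,t)$ for every $t$; normal if $\eta$ is a normal field along $x$; $SN$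 if it is normal and $\partial^2F/\partial t^2|_{t=0}=0$. An $SN$-variation is $VP$ if $\int_M\langle\eta,N\rangle e^{-f}dV=0$ for every normal field $N$ on $M$ with $D^\perp N\equiv 0$. A $\xi$-submanifold $x$ is $W$-stable if $V_\xi(x)<+\infty$ and $V_\xi''(0):=\frac{d^2}{dt^2}\big|_{t=0}V_\xi(x_t)\ge 0$ for every compact $VP$-variation. An $m$-plane is a (not necessarily linear) affine $m$-dimensional subspace of $\mathbb{R}^{m+p}$. *)

theory Defs
  imports "HOL-Analysis.Analysis"
begin

section \<open>Smooth functions on open subsets of normed spaces\<close>

text \<open>
  The two notions below are meant for open sets \<open>S\<close>. Only values of \<open>f\<close> on \<open>S\<close> matter.
\<close>

primrec C_order_on :: "nat \<Rightarrow> ('a::real_normed_vector \<Rightarrow> 'b::real_normed_vector) \<Rightarrow> 'a set \<Rightarrow> bool" where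
  "C_order_on 0 f S \<longleftrightarrow> continuous_on S f"
| "C_order_on (Suc k) f S \<longleftrightarrow>
     (\<forall>u\<in>S. f differentiable (at u)) \<and>
     (\<forall>v. C_order_on k (\<lambda>u. frechet_derivative f (at u) v) S)"

definition C_infinity_on :: "('a::real_normed_vector \<Rightarrow> 'b::real_normed_vector) \<Rightarrow> 'a set \<Rightarrow> bool" where
  "C_infinity_on f S \<longleftrightarrow> (\<forall>k. C_order_on k f S)"


section \<open>Smooth manifolds\<close>

text \<open>
  The underlying space of the manifold is a whole type \<open>'a\<close> of class
  \<open>{t2_space, second_countable_topology}\<close>; its dimension is \<open>CARD('m)\<close>. A chart is a pair of
  its domain \<open>U\<close> and the coordinate map; the coordinate map is irrelevant outside \<open>U\<close>.
\<close>

type_synonym ('a, 'm) chart = "'a set \<times> ('a \<Rightarrow> real ^ 'm)"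

definition chart_image :: "('a, 'm) chart \<Rightarrow> (real ^ 'm) set" where
  "chart_image c = snd c ` fst c"

definition chart_inv :: "('a, 'm) chart \<Rightarrow> real ^ 'm \<Rightarrow> 'a" where
  "chart_inv c = inv_into (fst c) (snd c)"

definition smooth_atlas :: "('a::{t2_space, second_countable_topology}, 'm::finite) chart set \<Rightarrow> bool" where
  "smooth_atlas \<A> \<longleftrightarrow>
     (\<Union>c\<in>\<A>. fst c) = UNIV \<and>
     (\<forall>c\<in>\<A>. open (fst c) \<and> open (chart_image c) \<and>
        homeomorphism (fst c) (chart_image c) (snd c) (chart_inv c)) \<and>
     (\<forall>c\<in>\<A>. \<forall>d\<in>\<A>. C_infinity_on (snd d \<circ> chart_inv c) (snd c ` (fst c \<inter> fst d)))"

definition smooth_in_chart :: "('a, 'm::finite) chart \<Rightarrow> ('a \<Rightarrow> 'e::real_normed_vector) \<Rightarrow> bool" where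
  "smooth_in_chart c Y \<longleftrightarrow> C_infinity_on (Y \<circ> chart_inv c) (chart_image c)"

definition smooth_map :: "('a, 'm::finite) chart set \<Rightarrow> ('a \<Rightarrow> 'e::real_normed_vector) \<Rightarrow> bool" where
  "smooth_map \<A> Y \<longleftrightarrow> (\<forall>c\<in>\<A>. smooth_in_chart c Y)"

text \<open>
  Tangent vectors at a point of the domain of a chart \<open>c\<close> are written as coordinate vectors
  \<open>v :: real ^ 'm\<close>, standing for \<open>\<Sum>i. v $ i \<partial>\<^sub>i\<close>. For \<open>Y\<close> with values in Euclidean space,
  \<open>chart_D c Y q v\<close> is the flat derivative \<open>D\<^sub>v Y\<close> at \<open>q\<close>; for an immersion \<open>x\<close>,
  \<open>chart_D c x q v\<close> is the image of \<open>v\<close> under \<open>dx\<close>.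
\<close>

definition chart_D :: "('a, 'm::finite) chart \<Rightarrow> ('a \<Rightarrow> 'e::euclidean_space) \<Rightarrow> 'a \<Rightarrow> real ^ 'm \<Rightarrow> 'e" where
  "chart_D c Y q v = frechet_derivative (Y \<circ> chart_inv c) (at (snd c q)) v"


section \<open>Immersions and their induced geometry\<close>

definition immersion :: "('a, 'm::finite) chart set \<Rightarrow> ('a \<Rightarrow> 'e::euclidean_space) \<Rightarrow> bool" where
  "immersion \<A> x \<longleftrightarrow> smooth_map \<A> x \<and> (\<forall>c\<in>\<A>. \<forall>q\<in>fst c. inj (chart_D c x q))"

definition induced_metric ::
    "('a, 'm::finite) chart \<Rightarrow> ('a \<Rightarrow> 'e::euclidean_space) \<Rightarrow> 'a \<Rightarrow> real ^ 'm \<Rightarrow> real ^ 'm \<Rightarrow> real" where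
  "induced_metric c x q v w = chart_D c x q v \<bullet> chart_D c x q w"

definition metric_matrix ::
    "('a, 'm::finite) chart \<Rightarrow> ('a \<Rightarrow> 'e::euclidean_space) \<Rightarrow> 'a \<Rightarrow> real ^ 'm ^ 'm" where
  "metric_matrix c x q = (\<chi> i j. induced_metric c x q (axis i 1) (axis j 1))"

text \<open>
  The Riemannian volume element, as the Borel measure on the manifold whose restriction to every
  chart domain has density \<open>sqrt (det g)\<close> in the coordinates. It does not need an orientation.
\<close>

definition volume_measure ::
    "('a::{t2_space, second_countable_topology}, 'm::finite) chart set \<Rightarrow>
     ('a \<Rightarrow> 'e::euclidean_space) \<Rightarrow> 'a measure" where
  "volume_measure \<A> y = (THE \<mu>. sets \<mu> = sets borel \<and>
     (\<forall>c\<in>\<A>. \<forall>E\<in>sets borel. E \<subseteq> fst c \<longrightarrow>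
        emeasure \<mu> E =
          (\<integral>\<^sup>+ u \<in> snd c ` E. ennreal (sqrt (det (metric_matrix c y (chart_inv c u)))) \<partial>lborel)))"

definition tangent_space ::
    "('a, 'm::finite) chart set \<Rightarrow> ('a \<Rightarrow> 'e::euclidean_space) \<Rightarrow> 'a \<Rightarrow> 'e set" where
  "tangent_space \<A> x q = (\<Union>c\<in>{c\<in>\<A>. q \<in> fst c}. range (chart_D c x q))"

definition normal_space ::
    "('a, 'm::finite) chart set \<Rightarrow> ('a \<Rightarrow> 'e::euclidean_space) \<Rightarrow> 'a \<Rightarrow> 'e set" where
  "normal_space \<A> x q = orthogonal_comp (tangent_space \<A> x q)"

definition normal_part ::
    "('a, 'm::finite) chart set \<Rightarrow> ('a \<Rightarrow> 'e::euclidean_space) \<Rightarrow> 'a \<Rightarrow> 'e \<Rightarrow> 'e" where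
  "normal_part \<A> x q w =
     (THE n. n \<in> normal_space \<A> x q \<and> w - n \<in> tangent_space \<A> x q)"

definition normal_field ::
    "('a, 'm::finite) chart set \<Rightarrow> ('a \<Rightarrow> 'e::euclidean_space) \<Rightarrow> ('a \<Rightarrow> 'e) \<Rightarrow> bool" where
  "normal_field \<A> x N \<longleftrightarrow> smooth_map \<A> N \<and> (\<forall>q. N q \<in> normal_space \<A> x q)"

text \<open>
  \<open>h(X,Y) = (D\<^sub>X Y)\<^sup>\<bottom>\<close>, where the tangent vector \<open>w\<close> is extended to the coordinate vector field
  with the same constant coefficients in the chart \<open>c\<close>.
\<close>

definition second_fundamental_form ::
    "('a, 'm::finite) chart set \<Rightarrow> ('a, 'm) chart \<Rightarrow> ('a \<Rightarrow> 'e::euclidean_space) \<Rightarrow> 'a \<Rightarrow>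
     real ^ 'm \<Rightarrow> real ^ 'm \<Rightarrow> 'e" where
  "second_fundamental_form \<A> c x q v w =
     normal_part \<A> x q (chart_D c (\<lambda>r. chart_D c x r w) q v)"

definition mean_curvature_vector ::
    "('a, 'm::finite) chart set \<Rightarrow> ('a, 'm) chart \<Rightarrow> ('a \<Rightarrow> 'e::euclidean_space) \<Rightarrow> 'a \<Rightarrow> 'e" where
  "mean_curvature_vector \<A> c x q =
     (\<Sum>i\<in>UNIV. \<Sum>j\<in>UNIV. (matrix_inv (metric_matrix c x q) $ i $ j) *\<^sub>R
        second_fundamental_form \<A> c x q (axis i 1) (axis j 1))"

definition normal_connection ::
    "('a, 'm::finite) chart set \<Rightarrow> ('a, 'm) chart \<Rightarrow> ('a \<Rightarrow> 'e::euclidean_space) \<Rightarrow>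
     ('a \<Rightarrow> 'e) \<Rightarrow> 'a \<Rightarrow> real ^ 'm \<Rightarrow> 'e" where
  "normal_connection \<A> c x N q v = normal_part \<A> x q (chart_D c N q v)"

definition parallel_normal_field ::
    "('a, 'm::finite) chart set \<Rightarrow> ('a \<Rightarrow> 'e::euclidean_space) \<Rightarrow> ('a \<Rightarrow> 'e) \<Rightarrow> bool" where
  "parallel_normal_field \<A> x N \<longleftrightarrow>
     normal_field \<A> x N \<and> (\<forall>c\<in>\<A>. \<forall>q\<in>fst c. \<forall>v. normal_connection \<A> c x N q v = 0)"

definition weingarten ::
    "('a, 'm::finite) chart set \<Rightarrow> ('a, 'm) chart \<Rightarrow> ('a \<Rightarrow> 'e::euclidean_space) \<Rightarrow>
     ('a \<Rightarrow> 'e) \<Rightarrow> 'a \<Rightarrow> real ^ 'm \<Rightarrow> real ^ 'm" where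
  "weingarten \<A> c x \<eta> q v =
     (THE a. \<forall>w. induced_metric c x q a w = second_fundamental_form \<A> c x q v w \<bullet> \<eta> q)"

text \<open>
  \<open>R\<^sup>\<bottom>(X,Y)N = D\<^sup>\<bottom>\<^sub>X D\<^sup>\<bottom>\<^sub>Y N - D\<^sup>\<bottom>\<^sub>Y D\<^sup>\<bottom>\<^sub>X N - D\<^sup>\<bottom>\<^bsub>[X,Y]\<^esub> N\<close> for the coordinate vector fields \<open>X = v\<close>,
  \<open>Y = w\<close> (constant coefficients in the chart), whose bracket vanishes.
\<close>

definition normal_curvature ::
    "('a, 'm::finite) chart set \<Rightarrow> ('a, 'm) chart \<Rightarrow> ('a \<Rightarrow> 'e::euclidean_space) \<Rightarrow>
     ('a \<Rightarrow> 'e) \<Rightarrow> 'a \<Rightarrow> real ^ 'm \<Rightarrow> real ^ 'm \<Rightarrow> 'e" where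
  "normal_curvature \<A> c x N q v w =
     normal_connection \<A> c x (\<lambda>r. normal_connection \<A> c x N r w) q v -
     normal_connection \<A> c x (\<lambda>r. normal_connection \<A> c x N r v) q w"

definition flat_normal_bundle ::
    "('a, 'm::finite) chart set \<Rightarrow> ('a \<Rightarrow> 'e::euclidean_space) \<Rightarrow> bool" where
  "flat_normal_bundle \<A> x \<longleftrightarrow>
     (\<forall>c\<in>\<A>. \<forall>N. smooth_in_chart c N \<and> (\<forall>q\<in>fst c. N q \<in> normal_space \<A> x q) \<longrightarrow>
        (\<forall>q\<in>fst c. \<forall>v w. normal_curvature \<A> c x N q v w = 0))"


section \<open>Properness and completeness\<close>

definition properly_immersed ::
    "('a::topological_space, 'm::finite) chart set \<Rightarrow> ('a \<Rightarrow> 'e::euclidean_space) \<Rightarrow> bool" where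
  "properly_immersed \<A> x \<longleftrightarrow> immersion \<A> x \<and> (\<forall>K. compact K \<longrightarrow> compact (x -` K))"

definition piecewise_C1_curve ::
    "('a::topological_space, 'm::finite) chart set \<Rightarrow> (real \<Rightarrow> 'a) \<Rightarrow> bool" where
  "piecewise_C1_curve \<A> \<gamma> \<longleftrightarrow> path \<gamma> \<and>
     (\<forall>c\<in>\<A>. \<forall>a b. 0 \<le> a \<and> a < b \<and> b \<le> 1 \<and> \<gamma> ` {a..b} \<subseteq> fst c \<longrightarrow>
        (snd c \<circ> \<gamma>) piecewise_C1_differentiable_on {a..b})"

text \<open>
  The length of a curve in the induced metric is the Euclidean length of its image. It is taken in
  \<open>ennreal\<close>, since a curve in the above sense may have infinite length (one-sided derivatives
  at the break points need not exist); such curves do not affect the infimum below, which is finite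
  on a connected manifold.
\<close>

definition curve_length :: "('a \<Rightarrow> 'e::euclidean_space) \<Rightarrow> (real \<Rightarrow> 'a) \<Rightarrow> ennreal" where
  "curve_length x \<gamma> =
     (\<integral>\<^sup>+ t \<in> {0..1}. ennreal (norm (vector_derivative (x \<circ> \<gamma>) (at t))) \<partial>lborel)"

definition riemannian_dist ::
    "('a::topological_space, 'm::finite) chart set \<Rightarrow> ('a \<Rightarrow> 'e::euclidean_space) \<Rightarrow>
     'a \<Rightarrow> 'a \<Rightarrow> real" where
  "riemannian_dist \<A> x q r = enn2real
     (INF \<gamma>\<in>{\<gamma>. piecewise_C1_curve \<A> \<gamma> \<and> pathstart \<gamma> = q \<and> pathfinish \<gamma> = r}. curve_length x \<gamma>)"

definition complete_immersion ::
    "('a::topological_space, 'm::finite) chart set \<Rightarrow> ('a \<Rightarrow> 'e::euclidean_space) \<Rightarrow> bool" where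
  "complete_immersion \<A> x \<longleftrightarrow> Metric_space.mcomplete UNIV (riemannian_dist \<A> x)"


section \<open>\<open>\<xi>\<close>-submanifolds and \<open>W\<close>-stability\<close>

definition xi_submanifold ::
    "('a, 'm::finite) chart set \<Rightarrow> ('a \<Rightarrow> 'e::euclidean_space) \<Rightarrow> ('a \<Rightarrow> 'e) \<Rightarrow> bool" where
  "xi_submanifold \<A> x \<xi> \<longleftrightarrow>
     immersion \<A> x \<and> parallel_normal_field \<A> x \<xi> \<and>
     (\<forall>c\<in>\<A>. \<forall>q\<in>fst c. mean_curvature_vector \<A> c x q + normal_part \<A> x q (x q) = \<xi> q)"

definition V_functional ::
    "('a::{t2_space, second_countable_topology}, 'm::finite) chart set \<Rightarrow>
     ('a \<Rightarrow> 'e::euclidean_space) \<Rightarrow> ('a \<Rightarrow> 'e) \<Rightarrow> ennreal" where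
  "V_functional \<A> \<xi> y =
     (\<integral>\<^sup>+ q. ennreal (exp (- (1/2) * (norm (y q - \<xi> q))\<^sup>2)) \<partial>(volume_measure \<A> y))"

text \<open>
  A variation is given by \<open>F :: 'a \<Rightarrow> real \<Rightarrow> 'e\<close>; its values at times outside
  \<open>(-\<epsilon>,\<epsilon>)\<close> are irrelevant.
\<close>

definition variation ::
    "('a, 'm::finite) chart set \<Rightarrow> ('a \<Rightarrow> 'e::euclidean_space) \<Rightarrow> real \<Rightarrow>
     ('a \<Rightarrow> real \<Rightarrow> 'e) \<Rightarrow> bool" where
  "variation \<A> x \<epsilon> F \<longleftrightarrow> 0 < \<epsilon> \<and>
     (\<forall>c\<in>\<A>. C_infinity_on (\<lambda>(u, t). F (chart_inv c u) t) (chart_image c \<times> {-\<epsilon><..<\<epsilon>})) \<and>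
     (\<forall>t\<in>{-\<epsilon><..<\<epsilon>}. immersion \<A> (\<lambda>q. F q t)) \<and>
     (\<forall>q. F q 0 = x q)"

definition time_deriv :: "('a \<Rightarrow> real \<Rightarrow> 'e::euclidean_space) \<Rightarrow> 'a \<Rightarrow> real \<Rightarrow> 'e" where
  "time_deriv F q t = vector_derivative (F q) (at t)"

definition variation_field :: "('a \<Rightarrow> real \<Rightarrow> 'e::euclidean_space) \<Rightarrow> 'a \<Rightarrow> 'e" where
  "variation_field F q = time_deriv F q 0"

definition compact_variation ::
    "('a::topological_space, 'm::finite) chart set \<Rightarrow> ('a \<Rightarrow> 'e::euclidean_space) \<Rightarrow> real \<Rightarrow>
     ('a \<Rightarrow> real \<Rightarrow> 'e) \<Rightarrow> bool" where
  "compact_variation \<A> x \<epsilon> F \<longleftrightarrow> variation \<A> x \<epsilon> F \<and>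
     (\<exists>B. open B \<and> compact (closure B) \<and>
        (\<forall>t\<in>{-\<epsilon><..<\<epsilon>}. closure {q. time_deriv F q t \<noteq> 0} \<subseteq> B))"

definition SN_variation ::
    "('a, 'm::finite) chart set \<Rightarrow> ('a \<Rightarrow> 'e::euclidean_space) \<Rightarrow> real \<Rightarrow>
     ('a \<Rightarrow> real \<Rightarrow> 'e) \<Rightarrow> bool" where
  "SN_variation \<A> x \<epsilon> F \<longleftrightarrow> variation \<A> x \<epsilon> F \<and>
     normal_field \<A> x (variation_field F) \<and>
     (\<forall>q. time_deriv (time_deriv F) q 0 = 0)"

definition VP_variation ::
    "('a::{t2_space, second_countable_topology}, 'm::finite) chart set \<Rightarrow>
     ('a \<Rightarrow> 'e::euclidean_space) \<Rightarrow> ('a \<Rightarrow> 'e) \<Rightarrow> real \<Rightarrow> ('a \<Rightarrow> real \<Rightarrow> 'e) \<Rightarrow> bool" where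
  "VP_variation \<A> x \<xi> \<epsilon> F \<longleftrightarrow> SN_variation \<A> x \<epsilon> F \<and>
     (\<forall>N. parallel_normal_field \<A> x N \<longrightarrow>
        (LINT q|volume_measure \<A> x.
           (variation_field F q \<bullet> N q) * exp (- (1/2) * (norm (x q - \<xi> q))\<^sup>2)) = 0)"

text \<open>
  For a compact variation of \<open>x\<close> with \<open>V_functional \<A> \<xi> x < \<infinity>\<close>, the values \<open>V_functional \<A> \<xi> x\<^sub>t\<close>
  are finite and smooth in \<open>t\<close>, because \<open>x\<^sub>t = x\<close> outside a compact set.
\<close>

definition W_stable ::
    "('a::{t2_space, second_countable_topology}, 'm::finite) chart set \<Rightarrow>
     ('a \<Rightarrow> 'e::euclidean_space) \<Rightarrow> ('a \<Rightarrow> 'e) \<Rightarrow> bool" where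
  "W_stable \<A> x \<xi> \<longleftrightarrow> xi_submanifold \<A> x \<xi> \<and> V_functional \<A> \<xi> x < \<infinity> \<and>
     (\<forall>\<epsilon> F. compact_variation \<A> x \<epsilon> F \<and> VP_variation \<A> x \<xi> \<epsilon> F \<longrightarrow>
        (deriv ^^ 2) (\<lambda>t. enn2real (V_functional \<A> \<xi> (\<lambda>q. F q t))) 0 \<ge> 0)"

definition m_plane :: "nat \<Rightarrow> 'e::euclidean_space set \<Rightarrow> bool" where
  "m_plane m S \<longleftrightarrow> affine S \<and> aff_dim S = int m"

end

(* Proof idea. Since A_xi = 0 and xi is parallel, the flat derivative of xi vanishes, so xi is constant and
   y = x - xi is a self-shrinker, i.e. a critical point of the weighted volume with Lagrangian
   l(y, dy) = exp(-|y|^2/2) sqrt(det g). For a constant vector a and a cutoff phi = phi(|y|^2) the second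
   variation along phi a^perp agrees with the one along phi a, because tangential directions lie in the
   kernel of the second variation at a critical point; the latter is computed pointwise and gives
       V''(0) = int e^{-f} (|grad phi|^2 - phi^2) |a^perp|^2 dV.
   A parallel normal field is determined by its value at one point, so VP costs at most p linear
   conditions on a. If the space Z of all a with a^perp = 0 everywhere had dimension < m, there would be,
   for every radius R, a unit vector a_R orthogonal to Z that is admissible for the cutoff at radius R. As
   |grad phi_R|^2 = O(1/R^2), stability and R -> infinity produce a unit vector a orthogonal to Z with
   int e^{-f} |a^perp|^2 dV = 0, hence a in Z, a contradiction. So Z has dimension m and is the tangent
   space at every point; the image of x is open and closed in an affine translate of Z. *)
theory Submission
  imports Defs
begin

section \<open>Calculus of smooth functions on open sets\<close>

text \<open>Working with a Lagrangian on first-order jets turns the geometric identities into linear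
  algebra at a point plus one divergence theorem. Its behaviour under linear changes of the
  velocities is used three times: densities become independent of charts, the tangential
  Euler-Lagrange equations hold automatically, and its derivative makes tangential second variations
  vanish. The second-variation density along \<open>phi a\<close> alone contains cross terms without
  a sign. Adding the first variation along \<open>phi^2 <y,a> a\<close>, whose integral is zero for
  a critical immersion, cancels them and leaves the common factor \<open>|a^perp|^2\<close>; the
  coefficient \<open>-phi^2\<close> expresses that translating across the submanifold lowers the
  weighted volume to second order. The test vector has to depend on the radius because the
  constraint integrals contain the cutoff; compactness of the unit sphere supplies the limit.
  Properness enters because the cutoff is a function of |y|^2, whose sublevel sets must be compact;
  finiteness of the weighted volume makes the gradient term tend to zero.\<close>

lemma C_order_on_cong:
  assumes "open S" "\<And>u. u \<in> S \<Longrightarrow> f u = g u"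
  shows "C_order_on k f S \<longleftrightarrow> C_order_on k g S"
proof -
  have "C_order_on k g S" if "C_order_on k f S" "\<And>u. u \<in> S \<Longrightarrow> f u = g u" for f g
    using that
  proof (induction k arbitrary: f g)
    case 0
    then show ?case by (simp cong: continuous_on_cong)
  next
    case (Suc k)
    have df: "(g has_derivative frechet_derivative f (at u)) (at u)" if "u \<in> S" for u
      using Suc.prems that \<open>open S\<close>
      by (metis C_order_on.simps(2) frechet_derivative_works has_derivative_transform_within_open)
    then have "frechet_derivative g (at u) = frechet_derivative f (at u)" if "u \<in> S" for u
      using that by (metis frechet_derivative_at)
    then have eq: "frechet_derivative f (at u) v = frechet_derivative g (at u) v" if "u \<in> S" for u v
      using that by metis
    have "C_order_on k (\<lambda>u. frechet_derivative g (at u) v) S" for v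
      by (rule Suc.IH[of "\<lambda>u. frechet_derivative f (at u) v"]) (use Suc.prems eq in auto)
    moreover have "g differentiable at u" if "u \<in> S" for u
      using df[OF that] differentiable_def by blast
    ultimately show ?case by simp
  qed
  then show ?thesis using assms(2) by metis
qed

lemma C_order_on_subset:
  assumes "C_order_on k f S" "T \<subseteq> S"
  shows "C_order_on k f T"
  using assms by (induction k arbitrary: f) (auto intro: continuous_on_subset)

text \<open>At positive order the recursion asks for differentiability, not continuity, of
  \<open>f\<close>; the base case turns the first into the second.\<close>

lemma C_order_on_Suc_imp: "C_order_on (Suc k) f S \<Longrightarrow> C_order_on k f S"
proof (induction k arbitrary: f)
  case 0
  then show ?case
    by (simp add: continuous_at_imp_continuous_on differentiable_imp_continuous_within)
next
  case (Suc k)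
  then show ?case by (metis C_order_on.simps(2))
qed

text \<open>Any explicit derivative may be supplied, since uniqueness identifies it with
  \<open>frechet_derivative\<close>. Most closure properties below are inductions on the order
  through this rule.\<close>

lemma C_order_on_Suc_I:
  assumes "open S" "\<And>u. u \<in> S \<Longrightarrow> (f has_derivative f' u) (at u)"
    and "\<And>v. C_order_on k (\<lambda>u. f' u v) S"
  shows "C_order_on (Suc k) f S"
proof -
  have "frechet_derivative f (at u) = f' u" if "u \<in> S" for u
    using assms(2)[OF that] by (metis frechet_derivative_at)
  then show ?thesis
    using assms C_order_on_cong[OF assms(1), of "\<lambda>u. frechet_derivative f (at u) v" "\<lambda>u. f' u v" k for v]
    by (auto simp: differentiable_def)
qed

lemma C_order_on_Suc_D:
  assumes "C_order_on (Suc k) f S" "u \<in> S"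
  shows "(f has_derivative frechet_derivative f (at u)) (at u)"
  using assms by (simp flip: frechet_derivative_works)

lemma C_order_on_const [simp]: "C_order_on k (\<lambda>u. c) S"
proof (induction k arbitrary: c)
  case (Suc k)
  show ?case using Suc[of 0] by simp
qed simp

section \<open>Closure of smooth functions under linear and bilinear operations\<close>

lemma C_order_on_bounded_linear_compose:
  assumes "bounded_linear L" "open S" "C_order_on k f S"
  shows "C_order_on k (\<lambda>u. L (f u)) S"
  using assms(3)
proof (induction k arbitrary: f)
  case 0
  then show ?case
    using assms(1) by (simp add: bounded_linear.continuous_on)
next
  case (Suc k)
  show ?case
  proof (rule C_order_on_Suc_I[OF assms(2)])
    show "((\<lambda>u. L (f u)) has_derivative (\<lambda>v. L (frechet_derivative f (at u) v))) (at u)" if "u \<in> S" for u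
      using C_order_on_Suc_D[OF Suc.prems that] by (rule bounded_linear.has_derivative[OF assms(1)])
    show "C_order_on k (\<lambda>u. L (frechet_derivative f (at u) v)) S" for v
      using Suc by simp
  qed
qed

lemma C_order_on_id [simp]: "C_order_on k (\<lambda>u. u) S"
  by (cases k) simp_all

lemma C_order_on_add:
  assumes "open S" "C_order_on k f S" "C_order_on k g S"
  shows "C_order_on k (\<lambda>u. f u + g u) S"
  using assms(2,3)
proof (induction k arbitrary: f g)
  case 0
  then show ?case by (simp add: continuous_on_add)
next
  case (Suc k)
  show ?case
  proof (rule C_order_on_Suc_I[OF assms(1)])
    show "((\<lambda>u. f u + g u) has_derivative
        (\<lambda>v. frechet_derivative f (at u) v + frechet_derivative g (at u) v)) (at u)" if "u \<in> S" for u
      using C_order_on_Suc_D[OF Suc.prems(1) that] C_order_on_Suc_D[OF Suc.prems(2) that]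
      by (rule has_derivative_add)
    show "C_order_on k (\<lambda>u. frechet_derivative f (at u) v + frechet_derivative g (at u) v) S" for v
      using Suc by simp
  qed
qed

lemma (in bounded_bilinear) C_order_on:
  assumes "open S" "C_order_on k f S" "C_order_on k g S"
  shows "C_order_on k (\<lambda>u. prod (f u) (g u)) S"
  using assms(2,3)
proof (induction k arbitrary: f g)
  case 0
  then show ?case by (simp add: continuous_on)
next
  case (Suc k)
  show ?case
  proof (rule C_order_on_Suc_I[OF assms(1)])
    show "((\<lambda>u. prod (f u) (g u)) has_derivative
        (\<lambda>v. prod (f u) (frechet_derivative g (at u) v) + prod (frechet_derivative f (at u) v) (g u))) (at u)"
      if "u \<in> S" for u
      using C_order_on_Suc_D[OF Suc.prems(1) that] C_order_on_Suc_D[OF Suc.prems(2) that]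
      by (rule FDERIV)
    show "C_order_on k (\<lambda>u. prod (f u) (frechet_derivative g (at u) v) +
        prod (frechet_derivative f (at u) v) (g u)) S" for v
      using Suc C_order_on_Suc_imp[OF Suc.prems(1)] C_order_on_Suc_imp[OF Suc.prems(2)]
      by (intro C_order_on_add assms(1)) auto
  qed
qed

lemma C_infinity_on_D:
  assumes "C_infinity_on f S" "u \<in> S"
  shows "(f has_derivative frechet_derivative f (at u)) (at u)"
  using assms C_order_on_Suc_D unfolding C_infinity_on_def by blast

lemma C_infinity_on_differentiable: "C_infinity_on f S \<Longrightarrow> u \<in> S \<Longrightarrow> f differentiable (at u)"
  using C_infinity_on_D differentiable_def by blast

lemma C_infinity_on_continuous: "C_infinity_on f S \<Longrightarrow> continuous_on S f"
  unfolding C_infinity_on_def by (metis C_order_on.simps(1))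

lemma C_infinity_on_frechet:
  assumes "C_infinity_on f S"
  shows "C_infinity_on (\<lambda>u. frechet_derivative f (at u) v) S"
  using assms unfolding C_infinity_on_def by (metis C_order_on.simps(2))

lemma C_infinity_on_cong:
  assumes "open S" "\<And>u. u \<in> S \<Longrightarrow> f u = g u"
  shows "C_infinity_on f S \<longleftrightarrow> C_infinity_on g S"
  unfolding C_infinity_on_def using C_order_on_cong[OF assms(1), of f g] assms(2) by blast

lemma C_infinity_on_subset: "C_infinity_on f S \<Longrightarrow> T \<subseteq> S \<Longrightarrow> C_infinity_on f T"
  unfolding C_infinity_on_def by (metis C_order_on_subset)

text \<open>Smoothness is a local property; this is what allows extension by zero and gluing over
  charts.\<close>

lemma C_order_on_local:
  assumes "\<And>u. u \<in> S \<Longrightarrow> \<exists>T. u \<in> T \<and> open T \<and> C_order_on k f T"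
  shows "C_order_on k f S"
  using assms
proof (induction k arbitrary: f)
  case 0
  have "isCont f u" if "u \<in> S" for u
  proof -
    from 0[OF that] obtain T where "u \<in> T" "open T" "continuous_on T f" by auto
    then show ?thesis using continuous_on_eq_continuous_at by blast
  qed
  then show ?case by (simp add: continuous_at_imp_continuous_on)
next
  case (Suc k)
  have "f differentiable at u" if "u \<in> S" for u using Suc.prems[OF that] by auto
  moreover have "C_order_on k (\<lambda>u. frechet_derivative f (at u) v) S" for v
    by (rule Suc.IH) (use Suc.prems in fastforce)
  ultimately show ?case by simp
qed

lemma C_infinity_on_local:
  assumes "\<And>u. u \<in> S \<Longrightarrow> \<exists>T. u \<in> T \<and> open T \<and> C_infinity_on f T"
  shows "C_infinity_on f S"
  using assms unfolding C_infinity_on_def by (meson C_order_on_local)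

lemma C_infinity_on_const [simp]: "C_infinity_on (\<lambda>u. c) S"
  by (simp add: C_infinity_on_def)

lemma C_infinity_on_id [simp]: "C_infinity_on (\<lambda>u. u) S"
  by (simp add: C_infinity_on_def)

lemma C_infinity_on_bounded_linear_compose:
  "bounded_linear L \<Longrightarrow> open S \<Longrightarrow> C_infinity_on f S \<Longrightarrow> C_infinity_on (\<lambda>u. L (f u)) S"
  by (simp add: C_infinity_on_def C_order_on_bounded_linear_compose)

lemma C_infinity_on_add:
  "open S \<Longrightarrow> C_infinity_on f S \<Longrightarrow> C_infinity_on g S \<Longrightarrow> C_infinity_on (\<lambda>u. f u + g u) S"
  by (simp add: C_infinity_on_def C_order_on_add)

lemma (in bounded_bilinear) C_infinity_on:
  "open S \<Longrightarrow> C_infinity_on f S \<Longrightarrow> C_infinity_on g S \<Longrightarrow> C_infinity_on (\<lambda>u. prod (f u) (g u)) S"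
  by (simp add: C_infinity_on_def C_order_on)

lemmas C_infinity_on_mult = bounded_bilinear.C_infinity_on[OF bounded_bilinear_mult]
lemmas C_infinity_on_scaleR = bounded_bilinear.C_infinity_on[OF bounded_bilinear_scaleR]
lemmas C_infinity_on_inner = bounded_bilinear.C_infinity_on[OF bounded_bilinear_inner]
lemmas C_infinity_on_vec_nth = C_infinity_on_bounded_linear_compose[OF bounded_linear_vec_nth]
lemmas C_infinity_on_fst = C_infinity_on_bounded_linear_compose[OF bounded_linear_fst]
lemmas C_infinity_on_snd = C_infinity_on_bounded_linear_compose[OF bounded_linear_snd]

lemma C_infinity_on_minus: "open S \<Longrightarrow> C_infinity_on f S \<Longrightarrow> C_infinity_on (\<lambda>u. - f u) S"
  by (rule C_infinity_on_bounded_linear_compose) (auto intro: bounded_linear_minus bounded_linear_ident)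

lemma C_infinity_on_diff:
  "open S \<Longrightarrow> C_infinity_on f S \<Longrightarrow> C_infinity_on g S \<Longrightarrow> C_infinity_on (\<lambda>u. f u - g u) S"
  using C_infinity_on_add[of S f "\<lambda>u. - g u"] C_infinity_on_minus by auto

lemma C_infinity_on_sum:
  assumes "open S" "\<And>i. i \<in> I \<Longrightarrow> C_infinity_on (f i) S"
  shows "C_infinity_on (\<lambda>u. \<Sum>i\<in>I. f i u) S"
  using assms(2)
  by (induction I rule: infinite_finite_induct) (auto intro!: C_infinity_on_add assms(1))

lemma C_infinity_on_prod:
  fixes f :: "'i \<Rightarrow> 'a::real_normed_vector \<Rightarrow> real"
  assumes "open S" "\<And>i. i \<in> I \<Longrightarrow> C_infinity_on (f i) S"
  shows "C_infinity_on (\<lambda>u. \<Prod>i\<in>I. f i u) S"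
  using assms(2)
  by (induction I rule: infinite_finite_induct) (auto intro!: C_infinity_on_mult assms(1))

lemma C_infinity_on_Pair:
  fixes f :: "'a::real_normed_vector \<Rightarrow> 'b::real_normed_vector"
    and g :: "'a \<Rightarrow> 'c::real_normed_vector"
  assumes "open S" "C_infinity_on f S" "C_infinity_on g S"
  shows "C_infinity_on (\<lambda>u. (f u, g u)) S"
proof -
  have "C_infinity_on (\<lambda>u. (f u, 0::'c)) S"
    by (rule C_infinity_on_bounded_linear_compose[where L="\<lambda>y. (y, 0)"])
      (auto intro: assms bounded_linear_Pair bounded_linear_ident bounded_linear_zero)
  moreover have "C_infinity_on (\<lambda>u. (0::'b, g u)) S"
    by (rule C_infinity_on_bounded_linear_compose[where L="\<lambda>y. (0, y)"])
      (auto intro: assms bounded_linear_Pair bounded_linear_ident bounded_linear_zero)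
  ultimately have "C_infinity_on (\<lambda>u. (f u, 0::'c) + (0, g u)) S"
    by (rule C_infinity_on_add[OF assms(1)])
  then show ?thesis by simp
qed

lemma bounded_linear_axis: "bounded_linear (axis i :: 'b::real_normed_vector \<Rightarrow> 'b ^ 'n::finite)"
proof (rule bounded_linear_intro[where K=1])
  show "axis i (x + y) = (axis i x + axis i y :: 'b ^ 'n)" for x y
    by (simp add: vec_eq_iff axis_def)
  show "axis i (r *\<^sub>R x) = (r *\<^sub>R axis i x :: 'b ^ 'n)" for r x
    by (simp add: vec_eq_iff axis_def)
  show "norm (axis i x :: 'b ^ 'n) \<le> norm x * 1" for x
    unfolding norm_vec_def axis_def
    by (auto simp: L2_set_def if_distrib[of norm] if_distrib[of "\<lambda>x. x\<^sup>2"] cong: if_cong)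
qed

lemma C_infinity_on_vec:
  fixes f :: "'n::finite \<Rightarrow> 'a::real_normed_vector \<Rightarrow> 'b::real_normed_vector"
  assumes "open S" "\<And>i. C_infinity_on (f i) S"
  shows "C_infinity_on (\<lambda>u. \<chi> i. f i u) S"
proof -
  have "C_infinity_on (\<lambda>u. \<Sum>i\<in>UNIV. axis i (f i u) :: 'b ^ 'n) S"
    by (intro C_infinity_on_sum assms(1) C_infinity_on_bounded_linear_compose[OF bounded_linear_axis] assms)
  also have "(\<lambda>u. \<Sum>i\<in>UNIV. axis i (f i u) :: 'b ^ 'n) = (\<lambda>u. \<chi> i. f i u)"
    by (auto simp: vec_eq_iff axis_def)
  finally show ?thesis .
qed

lemma C_order_on_sum:
  assumes "open S" "\<And>i. i \<in> I \<Longrightarrow> C_order_on k (f i) S"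
  shows "C_order_on k (\<lambda>u. \<Sum>i\<in>I. f i u) S"
  using assms(2)
  by (induction I rule: infinite_finite_induct) (auto intro!: C_order_on_add assms(1))

text \<open>The chain rule produces \<open>g' (f u) (f' u v)\<close>, where the direction moves with
  \<open>u\<close>, whereas the recursion controls the derivatives of \<open>g\<close> in fixed
  directions. Expanding the direction in the basis of the Euclidean middle space gives a finite sum
  to which the induction hypothesis applies.\<close>

lemma C_order_on_compose:
  fixes f :: "'a::real_normed_vector \<Rightarrow> 'b::euclidean_space"
    and g :: "'b \<Rightarrow> 'c::real_normed_vector"
  assumes "open S" "open T" "C_order_on k f S" "C_order_on k g T" "f ` S \<subseteq> T"
  shows "C_order_on k (\<lambda>u. g (f u)) S"
  using assms(3,4)
proof (induction k arbitrary: g)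
  case 0
  then show ?case using assms(5) by (auto intro: continuous_on_compose2)
next
  case (Suc k)
  define f' where "f' u = frechet_derivative f (at u)" for u
  define g' where "g' y = frechet_derivative g (at y)" for y
  have f': "(f has_derivative f' u) (at u)" if "u \<in> S" for u
    using C_order_on_Suc_D[OF Suc.prems(1) that] f'_def by simp
  have g': "(g has_derivative g' (f u)) (at (f u))" if "u \<in> S" for u
    unfolding g'_def by (rule C_order_on_Suc_D[OF Suc.prems(2)]) (use that assms(5) in auto)
  have eq: "g' (f u) v = (\<Sum>b\<in>Basis. (v \<bullet> b) *\<^sub>R g' (f u) b)" if "u \<in> S" for u v
  proof -
    have "linear (g' (f u))" using g'[OF that] has_derivative_linear by blast
    then have "g' (f u) (\<Sum>b\<in>Basis. (v \<bullet> b) *\<^sub>R b) = (\<Sum>b\<in>Basis. (v \<bullet> b) *\<^sub>R g' (f u) b)"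
      by (simp add: linear_sum linear_cmul)
    then show ?thesis by (simp add: euclidean_representation)
  qed
  show ?case
  proof (rule C_order_on_Suc_I[OF assms(1)])
    show "((\<lambda>u. g (f u)) has_derivative (\<lambda>v. \<Sum>b\<in>Basis. (f' u v \<bullet> b) *\<^sub>R g' (f u) b)) (at u)"
      if "u \<in> S" for u
      unfolding eq[OF that, symmetric] by (rule has_derivative_compose[OF f'[OF that] g'[OF that]])
    show "C_order_on k (\<lambda>u. \<Sum>b\<in>Basis. (f' u v \<bullet> b) *\<^sub>R g' (f u) b) S" for v
    proof (intro C_order_on_sum[OF assms(1)] bounded_bilinear.C_order_on[OF bounded_bilinear_scaleR assms(1)])
      fix b :: 'b
      show "C_order_on k (\<lambda>u. f' u v \<bullet> b) S"
        by (rule C_order_on_bounded_linear_compose[OF bounded_linear_inner_left assms(1)])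
          (use Suc.prems in \<open>simp add: f'_def\<close>)
      show "C_order_on k (\<lambda>u. g' (f u) b) S"
        using Suc.IH[of "\<lambda>y. g' y b"] Suc.prems(2) C_order_on_Suc_imp[OF Suc.prems(1)]
        by (simp add: g'_def)
    qed
  qed
qed

lemma C_infinity_on_compose:
  fixes f :: "'a::real_normed_vector \<Rightarrow> 'b::euclidean_space"
  assumes "open S" "open T" "C_infinity_on f S" "C_infinity_on g T" "f ` S \<subseteq> T"
  shows "C_infinity_on (\<lambda>u. g (f u)) S"
  using assms C_order_on_compose unfolding C_infinity_on_def by blast

section \<open>Elementary real functions, determinants and inverse matrices\<close>

lemma C_infinity_on_exp_real: "C_infinity_on (exp :: real \<Rightarrow> real) S"
proof -
  have "C_order_on k (exp :: real \<Rightarrow> real) UNIV" for k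
  proof (induction k)
    case 0
    show ?case by (simp add: continuous_on_exp)
  next
    case (Suc k)
    show ?case
    proof (rule C_order_on_Suc_I)
      show "(exp has_derivative (\<lambda>v. exp u * v)) (at u)" for u :: real
        by (auto intro!: derivative_eq_intros)
      show "C_order_on k (\<lambda>u. exp u * v) UNIV" for v :: real
        using bounded_bilinear.C_order_on[OF bounded_bilinear_mult open_UNIV Suc C_order_on_const] .
    qed simp
  qed
  then show ?thesis unfolding C_infinity_on_def using C_order_on_subset subset_UNIV by blast
qed

text \<open>Up to sign the derivative is the function times itself, so the induction on the order
  closes through the product rule.\<close>

lemma C_infinity_on_inverse_real: "C_infinity_on (inverse :: real \<Rightarrow> real) (- {0})"
proof -
  have op: "open (- {0::real})" by auto
  have "C_order_on k (inverse :: real \<Rightarrow> real) (- {0})" for k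
  proof (induction k)
    case 0
    show ?case by (auto simp: intro!: continuous_on_inverse continuous_on_id)
  next
    case (Suc k)
    show ?case
    proof (rule C_order_on_Suc_I)
      show "(inverse has_derivative (\<lambda>v. (inverse u * inverse u) * - v)) (at u)" if "u \<in> - {0}" for u :: real
        using that by (auto intro!: derivative_eq_intros simp: algebra_simps)
      show "C_order_on k (\<lambda>u. (inverse u * inverse u) * - v) (- {0})" for v :: real
        by (intro bounded_bilinear.C_order_on[OF bounded_bilinear_mult op] Suc C_order_on_const)
    qed (rule op)
  qed
  then show ?thesis unfolding C_infinity_on_def by blast
qed

text \<open>The derivative is a multiple of \<open>inverse (sqrt u)\<close>, so the induction
  hypothesis for \<open>sqrt\<close> is composed with the smooth map \<open>inverse\<close>.\<close>

lemma C_infinity_on_sqrt: "C_infinity_on sqrt {0<..}"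
proof -
  have op: "open {0::real<..}" by auto
  have "C_order_on k sqrt {0<..}" for k
  proof (induction k)
    case 0
    show ?case by (auto intro!: continuous_intros)
  next
    case (Suc k)
    show ?case
    proof (rule C_order_on_Suc_I)
      show "(sqrt has_derivative (\<lambda>v. inverse (sqrt u) * (v / 2))) (at u)" if "u \<in> {0<..}" for u :: real
        using that by (auto intro!: derivative_eq_intros simp: field_simps)
      show "C_order_on k (\<lambda>u. inverse (sqrt u) * (v / 2)) {0<..}" for v :: real
      proof (intro bounded_bilinear.C_order_on[OF bounded_bilinear_mult op] C_order_on_const)
        show "C_order_on k (\<lambda>u. inverse (sqrt u)) {0<..}"
          by (rule C_order_on_compose[OF op _ Suc, of "- {0}" inverse])
            (use C_infinity_on_inverse_real in \<open>auto simp: C_infinity_on_def\<close>)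
      qed
    qed (rule op)
  qed
  then show ?thesis unfolding C_infinity_on_def by blast
qed

lemma C_infinity_on_exp:
  fixes f :: "'a::real_normed_vector \<Rightarrow> real"
  assumes "open S" "C_infinity_on f S"
  shows "C_infinity_on (\<lambda>u. exp (f u)) S"
  by (rule C_infinity_on_compose[OF assms(1) open_UNIV assms(2) C_infinity_on_exp_real]) simp

lemma C_infinity_on_inverse:
  fixes f :: "'a::real_normed_vector \<Rightarrow> real"
  assumes "open S" "C_infinity_on f S" "\<And>u. u \<in> S \<Longrightarrow> f u \<noteq> 0"
  shows "C_infinity_on (\<lambda>u. inverse (f u)) S"
  by (rule C_infinity_on_compose[OF assms(1) _ assms(2) C_infinity_on_inverse_real]) (use assms in auto)

lemma C_infinity_on_divide:
  fixes f g :: "'a::real_normed_vector \<Rightarrow> real"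
  assumes "open S" "C_infinity_on f S" "C_infinity_on g S" "\<And>u. u \<in> S \<Longrightarrow> g u \<noteq> 0"
  shows "C_infinity_on (\<lambda>u. f u / g u) S"
  using C_infinity_on_mult[OF assms(1,2) C_infinity_on_inverse[OF assms(1,3,4)]]
  by (simp add: divide_inverse)

lemma C_infinity_on_sqrt_compose:
  fixes f :: "'a::real_normed_vector \<Rightarrow> real"
  assumes "open S" "C_infinity_on f S" "\<And>u. u \<in> S \<Longrightarrow> f u > 0"
  shows "C_infinity_on (\<lambda>u. sqrt (f u)) S"
  by (rule C_infinity_on_compose[OF assms(1) _ assms(2) C_infinity_on_sqrt]) (use assms in auto)

lemma C_infinity_on_det:
  fixes A :: "'a::real_normed_vector \<Rightarrow> real ^ 'n::finite ^ 'n"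
  assumes "open S" "\<And>i j. C_infinity_on (\<lambda>u. A u $ i $ j) S"
  shows "C_infinity_on (\<lambda>u. det (A u)) S"
  unfolding det_def
  by (intro C_infinity_on_sum C_infinity_on_mult C_infinity_on_prod assms C_infinity_on_const)

lemma matrix_inv_cancel:
  fixes A :: "'a::field ^ 'n::finite ^ 'n"
  assumes "det A \<noteq> 0"
  shows "A ** matrix_inv A = mat 1" "matrix_inv A ** A = mat 1"
proof -
  have "\<exists>B. A ** B = mat 1 \<and> B ** A = mat 1"
    using assms invertible_det_nz invertible_def by metis
  then have "A ** matrix_inv A = mat 1 \<and> matrix_inv A ** A = mat 1"
    unfolding matrix_inv_def by (rule someI_ex)
  then show "A ** matrix_inv A = mat 1" "matrix_inv A ** A = mat 1" by auto
qed

text \<open>Cramer's rule for the columns of the inverse. It writes every entry as a quotient of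
  polynomials in the entries of \<open>A\<close>, from which smoothness of the inverse
  follows.\<close>

lemma matrix_inv_cramer:
  fixes A :: "real ^ 'n::finite ^ 'n"
  assumes "det A \<noteq> 0"
  shows "matrix_inv A $ i $ j = det (\<chi> k l. if l = i then (axis j 1 :: real ^ 'n) $ k else A $ k $ l) / det A"
proof -
  have "A *v (matrix_inv A *v axis j 1) = axis j 1"
    by (simp add: matrix_vector_mul_assoc matrix_inv_cancel[OF assms])
  then have "matrix_inv A *v axis j 1 =
      (\<chi> i. det (\<chi> k l. if l = i then (axis j 1 :: real ^ 'n) $ k else A $ k $ l) / det A)"
    by (rule cramer[OF assms, THEN iffD1])
  moreover have "matrix_inv A $ i $ j = (matrix_inv A *v axis j 1) $ i"
    by (simp add: matrix_vector_mult_basis column_def)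
  ultimately show ?thesis
    by (simp only: vec_lambda_beta)
qed

lemma C_infinity_on_matrix_inv:
  fixes A :: "'a::real_normed_vector \<Rightarrow> real ^ 'n::finite ^ 'n"
  assumes "open S" "\<And>i j. C_infinity_on (\<lambda>u. A u $ i $ j) S" "\<And>u. u \<in> S \<Longrightarrow> det (A u) \<noteq> 0"
  shows "C_infinity_on (\<lambda>u. matrix_inv (A u) $ i $ j) S"
proof -
  have "C_infinity_on (\<lambda>u. det (\<chi> k l. if l = i then (axis j 1 :: real ^ 'n) $ k else A u $ k $ l) / det (A u)) S"
  proof (rule C_infinity_on_divide[OF assms(1) C_infinity_on_det[OF assms(1)] C_infinity_on_det[OF assms(1,2)] assms(3)])
    show "C_infinity_on (\<lambda>u. (\<chi> k l. if l = i then (axis j 1 :: real ^ 'n) $ k else A u $ k $ l) $ k $ l) S" for k l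
      by (cases "l = i") (simp_all add: assms(2))
  qed
  also have "?this \<longleftrightarrow> ?thesis"
    by (rule C_infinity_on_cong[OF assms(1)]) (rule matrix_inv_cramer[OF assms(3), symmetric])
  finally show ?thesis .
qed

section \<open>A smooth bump function\<close>

text \<open>
  The family \<open>x\<^sup>-\<^sup>n exp (-1/x)\<close> is closed under differentiation up to linear combinations, which gives
  smoothness of all its members at once.
\<close>

definition flat_exp :: "nat \<Rightarrow> real \<Rightarrow> real" where
  "flat_exp n s = (if 0 < s then inverse s ^ n * exp (- inverse s) else 0)"

text \<open>Substituting \<open>t = inverse s\<close> turns the right-hand limit into that of
  \<open>t ^ n / exp t\<close> at infinity; on the left the function is zero.\<close>

lemma flat_exp_tendsto_0: "(flat_exp n \<longlongrightarrow> 0) (at 0)"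
proof (rule filterlim_split_at)
  have "((\<lambda>x. x ^ n / exp x) \<longlongrightarrow> 0) (at_top :: real filter)"
    by (rule tendsto_power_div_exp_0)
  then have "((\<lambda>s. inverse s ^ n / exp (inverse s)) \<longlongrightarrow> 0) (at_right (0::real))"
    by (rule filterlim_compose) (rule filterlim_inverse_at_top_right)
  then show "(flat_exp n \<longlongrightarrow> 0) (at_right 0)"
    by (rule Lim_transform_eventually)
      (auto simp: flat_exp_def eventually_at_filter exp_minus field_simps)
  show "(flat_exp n \<longlongrightarrow> 0) (at_left 0)"
    by (rule Lim_transform_eventually[of "\<lambda>_. 0"]) (auto simp: flat_exp_def eventually_at_filter)
qed

lemma flat_exp_derivative:
  "(flat_exp n has_real_derivative (flat_exp (n + 2) s - real n * flat_exp (Suc n) s)) (at s)"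
proof -
  consider "s < 0" | "s = 0" | "0 < s" by linarith
  then show ?thesis
  proof cases
    case 1
    have "((\<lambda>s. 0) has_real_derivative 0) (at s)" by simp
    then have "(flat_exp n has_real_derivative 0) (at s)"
      by (rule DERIV_cong_ev[THEN iffD1, rotated -1])
        (use 1 eventually_nhds_in_open[of "{..<0}" s] in \<open>auto simp: flat_exp_def elim!: eventually_mono\<close>)
    then show ?thesis using 1 by (simp add: flat_exp_def)
  next
    case 2
    \<comment> \<open>The difference quotient of \<open>flat_exp n\<close> at 0 is
      \<open>flat_exp (Suc n)\<close>, so the limit for the next index is the derivative.\<close>
    have "((\<lambda>h. (flat_exp n (0 + h) - flat_exp n 0) / h) \<longlongrightarrow> 0) (at 0)"
      using flat_exp_tendsto_0[of "Suc n"]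
      by (rule Lim_transform_eventually) (auto simp: flat_exp_def eventually_at_filter field_simps)
    then show ?thesis using 2 by (simp add: DERIV_def flat_exp_def)
  next
    case 3
    have "((\<lambda>s. inverse s ^ n * exp (- inverse s)) has_real_derivative
        (flat_exp (n + 2) s - real n * flat_exp (Suc n) s)) (at s)"
    proof (cases n)
      case 0
      show ?thesis
        using 3 unfolding 0 by (auto intro!: derivative_eq_intros simp: flat_exp_def power2_eq_square)
    next
      case (Suc k)
      have "((\<lambda>s. inverse s) has_real_derivative - (inverse s * inverse s)) (at s)"
        using 3 by (auto intro!: derivative_eq_intros)
      moreover have "((\<lambda>s. exp (- inverse s)) has_real_derivative
          exp (- inverse s) * (inverse s * inverse s)) (at s)"
        using 3 by (auto intro!: derivative_eq_intros)
      ultimately have "((\<lambda>s. inverse s ^ Suc k * exp (- inverse s)) has_real_derivative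
          (1 + real k) * (- (inverse s * inverse s) * inverse s ^ k) * exp (- inverse s) +
          exp (- inverse s) * (inverse s * inverse s) * inverse s ^ Suc k) (at s)"
        by (intro DERIV_mult DERIV_power_Suc)
      then show ?thesis
        using 3 unfolding Suc by (simp add: flat_exp_def algebra_simps)
    qed
    then show ?thesis
      by (rule DERIV_cong_ev[THEN iffD1, rotated -1])
        (use 3 eventually_nhds_in_open[of "{0<..}" s] in \<open>auto simp: flat_exp_def elim!: eventually_mono\<close>)
  qed
qed

lemma C_infinity_on_flat_exp: "C_infinity_on (flat_exp n) UNIV"
proof -
  have "C_order_on k (flat_exp n) UNIV" for k
  proof (induction k arbitrary: n)
    case 0
    show ?case
      unfolding C_order_on.simps
      by (intro continuous_at_imp_continuous_on ballI DERIV_isCont[OF flat_exp_derivative])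
  next
    case (Suc k)
    show ?case
    proof (rule C_order_on_Suc_I)
      show "(flat_exp n has_derivative (\<lambda>v. (flat_exp (n + 2) s + - real n * flat_exp (Suc n) s) * v)) (at s)" for s
        using flat_exp_derivative[of n s] by (simp add: has_field_derivative_def)
      show "C_order_on k (\<lambda>s. (flat_exp (n + 2) s + - real n * flat_exp (Suc n) s) * v) UNIV" for v
        by (intro bounded_bilinear.C_order_on[OF bounded_bilinear_mult] C_order_on_add C_order_on_const Suc) simp_all
    qed simp
  qed
  then show ?thesis by (simp add: C_infinity_on_def)
qed

text \<open>A profile in the squared distance: it is composed with multiples of squared norms, which
  are smooth at the origin as well. The normalisation gives the value 1 at 0.\<close>

definition bump :: "real \<Rightarrow> real" where
  "bump s = flat_exp 0 (1 - s) / flat_exp 0 1"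

lemma C_infinity_on_bump: "C_infinity_on bump UNIV"
proof -
  have "C_infinity_on (\<lambda>s. inverse (flat_exp 0 1) * flat_exp 0 (1 - s)) UNIV"
    by (intro C_infinity_on_mult C_infinity_on_const C_infinity_on_compose[OF _ _ _ C_infinity_on_flat_exp]
        C_infinity_on_diff C_infinity_on_id) auto
  moreover have "bump = (\<lambda>s. inverse (flat_exp 0 1) * flat_exp 0 (1 - s))"
    by (simp add: bump_def fun_eq_iff divide_inverse mult.commute)
  ultimately show ?thesis by simp
qed

lemma bump_simps: "bump 0 = 1" "s < 1 \<Longrightarrow> 0 < bump s" "1 \<le> s \<Longrightarrow> bump s = 0" "0 \<le> bump s"
  by (auto simp: bump_def flat_exp_def)

lemma bump_le_1: "0 \<le> s \<Longrightarrow> bump s \<le> 1"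
  by (auto simp: bump_def flat_exp_def field_simps one_le_inverse_iff)

section \<open>Symmetry of second derivatives\<close>

text \<open>Both mixed second derivatives are limits of the same second difference quotient.\<close>

lemma second_difference_mean_value:
  fixes f :: "'a::real_normed_vector \<Rightarrow> real"
  assumes f: "\<And>z. z \<in> ball x e \<Longrightarrow> (f has_derivative f' z) (at z)"
    and f'': "\<And>z. z \<in> ball x e \<Longrightarrow> ((\<lambda>z. f' z v) has_derivative f'' z) (at z)"
    and s: "0 < s" "s * norm v + s * norm w < e"
  shows "\<exists>a b. 0 < a \<and> a < s \<and> 0 < b \<and> b < s \<and>
     f (x + s *\<^sub>R v + s *\<^sub>R w) - f (x + s *\<^sub>R v) - f (x + s *\<^sub>R w) + f x =
       s * s * f'' (x + a *\<^sub>R v + b *\<^sub>R w) w"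
proof -
  have inb: "x + a *\<^sub>R v + b *\<^sub>R w \<in> ball x e" if "0 \<le> a" "a \<le> s" "0 \<le> b" "b \<le> s" for a b
  proof -
    have "norm (a *\<^sub>R v + b *\<^sub>R w) \<le> a * norm v + b * norm w"
      using norm_triangle_ineq[of "a *\<^sub>R v" "b *\<^sub>R w"] that by simp
    also have "\<dots> \<le> s * norm v + s * norm w"
      using that by (intro add_mono mult_right_mono) auto
    finally have "norm (a *\<^sub>R v + b *\<^sub>R w) < e" using s(2) by linarith
    moreover have "dist x (x + a *\<^sub>R v + b *\<^sub>R w) = norm (a *\<^sub>R v + b *\<^sub>R w)"
      by (simp only: dist_norm norm_minus_commute[of x] add.assoc add_diff_cancel_left')
    ultimately show ?thesis by simp
  qed
  \<comment> \<open>\<open>g\<close> is the first difference in direction \<open>w\<close>. The mean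
    value theorem along \<open>v\<close> turns \<open>g s - g 0\<close> into a difference of first
    derivatives, and a second application along \<open>w\<close> reaches the mixed
    derivative.\<close>
  define g where "g a = f (x + a *\<^sub>R v + s *\<^sub>R w) - f (x + a *\<^sub>R v)" for a
  have lin: "linear (f' z)" "linear (f'' z)" if "z \<in> ball x e" for z
    using f[OF that] f''[OF that] has_derivative_linear by auto
  have fd: "((\<lambda>a. f (x + a *\<^sub>R v + b *\<^sub>R w)) has_real_derivative f' (x + a *\<^sub>R v + b *\<^sub>R w) v) (at a)"
    if "0 \<le> a" "a \<le> s" "0 \<le> b" "b \<le> s" for a b
  proof -
    have "((\<lambda>a. f (x + a *\<^sub>R v + b *\<^sub>R w)) has_derivative (\<lambda>h. f' (x + a *\<^sub>R v + b *\<^sub>R w) (h *\<^sub>R v))) (at a)"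
      by (rule has_derivative_compose[where f="\<lambda>a. x + a *\<^sub>R v + b *\<^sub>R w", OF _ f[OF inb[OF that]]])
        (auto intro!: derivative_eq_intros)
    then show ?thesis
      unfolding has_field_derivative_def
      using lin(1)[OF inb[OF that]] by (simp add: linear_cmul mult.commute[of _ "f' _ v"])
  qed
  have "\<exists>a. 0 < a \<and> a < s \<and>
      g s - g 0 = (s - 0) * (f' (x + a *\<^sub>R v + s *\<^sub>R w) v - f' (x + a *\<^sub>R v) v)"
  proof (rule MVT2[OF s(1)])
    fix a assume "0 \<le> a" "a \<le> s"
    then show "(g has_real_derivative f' (x + a *\<^sub>R v + s *\<^sub>R w) v - f' (x + a *\<^sub>R v) v) (at a)"
      unfolding g_def using fd[of a s] fd[of a 0] s(1) by (auto intro!: DERIV_diff)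
  qed
  then obtain a where a: "0 < a" "a < s"
    "g s - g 0 = s * (f' (x + a *\<^sub>R v + s *\<^sub>R w) v - f' (x + a *\<^sub>R v) v)" by auto
  have "\<exists>b. 0 < b \<and> b < s \<and> f' (x + a *\<^sub>R v + s *\<^sub>R w) v - f' (x + a *\<^sub>R v + 0 *\<^sub>R w) v =
      (s - 0) * f'' (x + a *\<^sub>R v + b *\<^sub>R w) w"
  proof (rule MVT2[OF s(1)])
    fix b assume b: "0 \<le> b" "b \<le> s"
    have z: "x + a *\<^sub>R v + b *\<^sub>R w \<in> ball x e" using inb a b by simp
    have "((\<lambda>b. f' (x + a *\<^sub>R v + b *\<^sub>R w) v) has_derivative (\<lambda>h. f'' (x + a *\<^sub>R v + b *\<^sub>R w) (h *\<^sub>R w))) (at b)"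
      by (rule has_derivative_compose[where f="\<lambda>b. x + a *\<^sub>R v + b *\<^sub>R w", OF _ f''[OF z]])
        (auto intro!: derivative_eq_intros)
    then show "((\<lambda>b. f' (x + a *\<^sub>R v + b *\<^sub>R w) v) has_real_derivative f'' (x + a *\<^sub>R v + b *\<^sub>R w) w) (at b)"
      unfolding has_field_derivative_def
      using lin(2)[OF z] by (simp add: linear_cmul mult.commute[of _ "f'' _ w"])
  qed
  then obtain b where "0 < b" "b < s"
    "f' (x + a *\<^sub>R v + s *\<^sub>R w) v - f' (x + a *\<^sub>R v) v = s * f'' (x + a *\<^sub>R v + b *\<^sub>R w) w" by auto
  with a show ?thesis
    by (intro exI[of _ a] exI[of _ b]) (simp add: g_def)
qed

lemma second_derivative_symmetric_real:
  fixes f :: "'a::real_normed_vector \<Rightarrow> real"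
  assumes "open S" "x \<in> S" "C_order_on 2 f S"
  shows "frechet_derivative (\<lambda>u. frechet_derivative f (at u) v) (at x) w =
         frechet_derivative (\<lambda>u. frechet_derivative f (at u) w) (at x) v"
proof -
  define D where "D v u = frechet_derivative f (at u) v" for v u
  define DD where "DD v w u = frechet_derivative (D v) (at u) w" for v w u
  have fd: "(f has_derivative (\<lambda>v. D v u)) (at u)" if "u \<in> S" for u
    using C_order_on_Suc_D[OF _ that, of 1 f] assms(3) by (simp add: D_def numeral_2_eq_2)
  have C1: "C_order_on (Suc 0) (D v) S" for v
    using assms(3) unfolding numeral_2_eq_2 C_order_on.simps(2)[of "Suc 0" f] by (simp add: D_def[abs_def])
  have Dd: "(D v has_derivative (\<lambda>w. DD v w u)) (at u)" if "u \<in> S" for u v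
    using C_order_on_Suc_D[OF C1 that] by (simp add: DD_def)
  have cont: "continuous_on S (DD v w)" for v w
    using C1[of v] by (auto simp: DD_def[abs_def])
  have "\<bar>DD v w x - DD w v x\<bar> \<le> \<epsilon>" if "\<epsilon> > 0" for \<epsilon>
  proof -
    have "isCont (DD v w) x" "isCont (DD w v) x"
      using cont assms(1,2) continuous_on_eq_continuous_at by blast+
    then obtain d1 d2 where d: "d1 > 0" "d2 > 0"
      "\<And>z. dist z x < d1 \<Longrightarrow> dist (DD v w z) (DD v w x) < \<epsilon>/2"
      "\<And>z. dist z x < d2 \<Longrightarrow> dist (DD w v z) (DD w v x) < \<epsilon>/2"
      using \<open>\<epsilon> > 0\<close> unfolding continuous_at_eps_delta by (metis half_gt_zero)
    obtain d3 where d3: "d3 > 0" "ball x d3 \<subseteq> S" using assms(1,2) openE by blast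
    define e where "e = min d1 (min d2 d3)"
    have e: "e > 0" "ball x e \<subseteq> S" "e \<le> d1" "e \<le> d2" using d d3 by (auto simp: e_def)
    \<comment> \<open>The factor 2 and the summand 1 make the increments strictly shorter than
      \<open>e\<close>, also when \<open>v\<close> and \<open>w\<close> are zero.\<close>
    define s where "s = e / (2 * (norm v + norm w + 1))"
    have pos: "norm v + norm w + 1 > 0" by (smt (verit) norm_ge_zero)
    then have s: "s > 0" using e by (simp add: s_def)
    have "s * norm v + s * norm w = e * ((norm v + norm w) / (2 * (norm v + norm w + 1)))"
      by (simp add: s_def add_divide_distrib algebra_simps)
    also have "\<dots> < e * 1"
    proof (rule mult_strict_left_mono[OF _ e(1)])
      have "norm v + norm w < 2 * (norm v + norm w + 1)" by (smt (verit) norm_ge_zero)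
      then show "(norm v + norm w) / (2 * (norm v + norm w + 1)) < 1" using pos by simp
    qed
    finally have s2: "s * norm v + s * norm w < e" by simp
    have s2': "s * norm w + s * norm v < e" using s2 by simp
    have fdb: "(f has_derivative (\<lambda>v. D v z)) (at z)" if "z \<in> ball x e" for z
      using fd e(2) that by blast
    have Ddb: "(D v has_derivative (\<lambda>w. DD v w z)) (at z)" if "z \<in> ball x e" for z v
      using Dd e(2) that by blast
    obtain a b where ab: "0 < a" "a < s" "0 < b" "b < s"
      "f (x + s *\<^sub>R v + s *\<^sub>R w) - f (x + s *\<^sub>R v) - f (x + s *\<^sub>R w) + f x =
       s * s * DD v w (x + a *\<^sub>R v + b *\<^sub>R w)"
      using second_difference_mean_value[OF fdb Ddb s s2] by blast
    obtain a' b' where ab': "0 < a'" "a' < s" "0 < b'" "b' < s"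
      "f (x + s *\<^sub>R w + s *\<^sub>R v) - f (x + s *\<^sub>R w) - f (x + s *\<^sub>R v) + f x =
       s * s * DD w v (x + a' *\<^sub>R w + b' *\<^sub>R v)"
      using second_difference_mean_value[OF fdb Ddb s s2'] by blast
    have close: "dist (x + a *\<^sub>R v' + b *\<^sub>R w') x < e" if "0 < a" "a < s" "0 < b" "b < s"
      "s * norm v' + s * norm w' < e" for a b v' w'
    proof -
      have "norm (a *\<^sub>R v' + b *\<^sub>R w') \<le> a * norm v' + b * norm w'"
        using norm_triangle_ineq[of "a *\<^sub>R v'" "b *\<^sub>R w'"] that by simp
      also have "\<dots> \<le> s * norm v' + s * norm w'"
        using that by (intro add_mono mult_right_mono) auto
      finally show ?thesis using that by (simp add: dist_norm add.assoc)
    qed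
    \<comment> \<open>The second difference is symmetric in \<open>v\<close> and \<open>w\<close>,
      so the two mean value points carry equal mixed derivatives; both points lie in the ball where
      these are close to their values at \<open>x\<close>.\<close>
    have "s * s * DD v w (x + a *\<^sub>R v + b *\<^sub>R w) = s * s * DD w v (x + a' *\<^sub>R w + b' *\<^sub>R v)"
      using ab(5) ab'(5) by (simp add: algebra_simps)
    then have "DD v w (x + a *\<^sub>R v + b *\<^sub>R w) = DD w v (x + a' *\<^sub>R w + b' *\<^sub>R v)" using s by simp
    moreover have "dist (DD v w (x + a *\<^sub>R v + b *\<^sub>R w)) (DD v w x) < \<epsilon>/2"
      using d(3) close[OF ab(1-4) s2] e(3) by auto
    moreover have "dist (DD w v (x + a' *\<^sub>R w + b' *\<^sub>R v)) (DD w v x) < \<epsilon>/2"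
      using d(4) close[OF ab'(1-4), of w v] s2 e(4) by (auto simp: add.commute)
    ultimately show ?thesis unfolding dist_real_def by (smt (verit) field_sum_of_halves)
  qed
  then have "\<bar>DD v w x - DD w v x\<bar> \<le> 0" by (rule field_le_epsilon[of _ 0, simplified]) 
  then show ?thesis by (simp add: DD_def D_def[abs_def])
qed

lemma second_derivative_symmetric:
  fixes f :: "'a::real_normed_vector \<Rightarrow> 'b::euclidean_space"
  assumes "open S" "x \<in> S" "C_infinity_on f S"
  shows "frechet_derivative (\<lambda>u. frechet_derivative f (at u) v) (at x) w =
         frechet_derivative (\<lambda>u. frechet_derivative f (at u) w) (at x) v"
proof (rule euclidean_eqI)
  fix b :: 'b assume "b \<in> Basis"
  have eq: "frechet_derivative (\<lambda>u. g u \<bullet> b) (at u) v = frechet_derivative g (at u) v \<bullet> b"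
    if "C_infinity_on g S" "u \<in> S" for g u v
    using has_derivative_inner_left[OF C_infinity_on_D[OF that], of b] frechet_derivative_at by metis
  have eq2: "frechet_derivative (\<lambda>u. frechet_derivative (\<lambda>u. f u \<bullet> b) (at u) v) (at x) w =
      frechet_derivative (\<lambda>u. frechet_derivative f (at u) v) (at x) w \<bullet> b" for v w
  proof -
    have "((\<lambda>u. frechet_derivative f (at u) v \<bullet> b) has_derivative
        (\<lambda>w. frechet_derivative (\<lambda>u. frechet_derivative f (at u) v) (at x) w \<bullet> b)) (at x)"
      by (rule has_derivative_inner_left[OF C_infinity_on_D[OF C_infinity_on_frechet[OF assms(3)] assms(2)]])
    then have "((\<lambda>u. frechet_derivative (\<lambda>u. f u \<bullet> b) (at u) v) has_derivative
        (\<lambda>w. frechet_derivative (\<lambda>u. frechet_derivative f (at u) v) (at x) w \<bullet> b)) (at x)"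
      by (rule has_derivative_transform_within_open[OF _ assms(1,2)]) (simp add: eq[OF assms(3)])
    then show ?thesis by (metis frechet_derivative_at)
  qed
  have "C_infinity_on (\<lambda>u. f u \<bullet> b) S"
    by (intro C_infinity_on_inner assms C_infinity_on_const)
  then have "C_order_on 2 (\<lambda>u. f u \<bullet> b) S" by (simp only: C_infinity_on_def)
  from second_derivative_symmetric_real[OF assms(1,2) this, of v w]
  show "frechet_derivative (\<lambda>u. frechet_derivative f (at u) v) (at x) w \<bullet> b =
        frechet_derivative (\<lambda>u. frechet_derivative f (at u) w) (at x) v \<bullet> b"
    unfolding eq2 .
qed

section \<open>Derivatives of determinants\<close>

text \<open>If \<open>k\<close> is moved then so is \<open>p k\<close>, by injectivity; one of these
  two points avoids \<open>i\<close>.\<close>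

lemma permutes_id_or_two_moved:
  assumes "p permutes UNIV" "p \<noteq> id"
  shows "\<exists>j. j \<noteq> i \<and> p j \<noteq> j"
proof -
  obtain k where k: "p k \<noteq> k" using assms(2) by (auto simp: fun_eq_iff)
  have "p (p k) \<noteq> p k" using k permutes_inj[OF assms(1)] by (auto dest: injD)
  with k show ?thesis by metis
qed

text \<open>In the Leibniz expansion the term of a non-identity permutation has at least two
  off-diagonal factors, hence still a vanishing one after one factor has been differentiated. Only
  the identity contributes, and it contributes the trace.\<close>

lemma DERIV_det_at_one:
  fixes A :: "real \<Rightarrow> real ^ 'n::finite ^ 'n"
  assumes "\<And>i j. ((\<lambda>t. A t $ i $ j) has_real_derivative A' i j) (at t0)" "A t0 = mat 1"
  shows "((\<lambda>t. det (A t)) has_real_derivative (\<Sum>i\<in>UNIV. A' i i)) (at t0)"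
proof -
  define D where "D p = (\<Sum>i\<in>UNIV. A' i (p i) * (\<Prod>j\<in>UNIV - {i}. A t0 $ j $ p j))" for p
  have prod: "((\<lambda>t. \<Prod>i\<in>UNIV. A t $ i $ p i) has_real_derivative D p) (at t0)" for p
  proof -
    have "((\<lambda>t. \<Prod>i\<in>UNIV. A t $ i $ p i) has_derivative
        (\<lambda>y. \<Sum>i\<in>UNIV. (A' i (p i) * y) * (\<Prod>j\<in>UNIV - {i}. A t0 $ j $ p j))) (at t0)"
      by (rule has_derivative_prod) (use assms(1) in \<open>simp add: has_field_derivative_def\<close>)
    also have "(\<lambda>y. \<Sum>i\<in>UNIV. (A' i (p i) * y) * (\<Prod>j\<in>UNIV - {i}. A t0 $ j $ p j)) = (*) (D p)"
      by (auto simp: fun_eq_iff D_def sum_distrib_left mult_ac)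
    finally show ?thesis by (simp add: has_field_derivative_def)
  qed
  have D0: "D p = 0" if p: "p permutes UNIV" "p \<noteq> id" for p
    unfolding D_def
  proof (rule sum.neutral, rule ballI)
    fix i
    obtain j where "j \<noteq> i" "p j \<noteq> j" using permutes_id_or_two_moved[OF p] by blast
    then have "(\<Prod>j\<in>UNIV - {i}. A t0 $ j $ p j) = 0"
      by (intro prod_zero) (auto simp: assms(2) mat_def intro!: bexI[of _ j])
    then show "A' i (p i) * (\<Prod>j\<in>UNIV - {i}. A t0 $ j $ p j) = 0" by simp
  qed
  have Did: "D id = (\<Sum>i\<in>UNIV. A' i i)"
    by (simp add: D_def assms(2) mat_def)
  have "((\<lambda>t. det (A t)) has_real_derivative
      (\<Sum>p\<in>{p. p permutes UNIV}. of_int (sign p) * D p)) (at t0)"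
    unfolding det_def by (intro DERIV_sum DERIV_cmult prod)
  also have "(\<Sum>p\<in>{p. p permutes (UNIV::'n set)}. of_int (sign p) * D p) =
      (\<Sum>p\<in>{id}. of_int (sign p) * D p)"
    by (rule sum.mono_neutral_right) (auto simp: D0 permutes_id)
  also have "\<dots> = (\<Sum>i\<in>UNIV. A' i i)"
    by (simp add: Did sign_id)
  finally show ?thesis .
qed

text \<open>Jacobi's formula. Multiplication by the inverse of \<open>A t0\<close> moves the base
  point to the identity matrix, where the derivative is a trace.\<close>

lemma DERIV_det:
  fixes A :: "real \<Rightarrow> real ^ 'n::finite ^ 'n"
  assumes "\<And>i j. ((\<lambda>t. A t $ i $ j) has_real_derivative A' i j) (at t0)" "det (A t0) \<noteq> 0"
  shows "((\<lambda>t. det (A t)) has_real_derivative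
    det (A t0) * (\<Sum>i\<in>UNIV. \<Sum>k\<in>UNIV. matrix_inv (A t0) $ i $ k * A' k i)) (at t0)"
proof -
  define B where "B = matrix_inv (A t0)"
  have B: "A t0 ** B = mat 1" "B ** A t0 = mat 1"
    using matrix_inv_cancel[OF assms(2)] by (auto simp: B_def)
  have "((\<lambda>t. det (B ** A t)) has_real_derivative (\<Sum>i\<in>UNIV. \<Sum>k\<in>UNIV. B $ i $ k * A' k i)) (at t0)"
  proof (rule DERIV_det_at_one[where A'="\<lambda>i j. \<Sum>k\<in>UNIV. B $ i $ k * A' k j"])
    show "((\<lambda>t. (B ** A t) $ i $ j) has_real_derivative (\<Sum>k\<in>UNIV. B $ i $ k * A' k j)) (at t0)" for i j
      unfolding matrix_matrix_mult_def by (auto intro!: DERIV_sum DERIV_cmult assms(1))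
  qed (rule B)
  from DERIV_cmult[OF this, of "det (A t0)"]
  have "((\<lambda>t. det (A t0) * det (B ** A t)) has_real_derivative
      det (A t0) * (\<Sum>i\<in>UNIV. \<Sum>k\<in>UNIV. B $ i $ k * A' k i)) (at t0)" .
  also have "(\<lambda>t. det (A t0) * det (B ** A t)) = (\<lambda>t. det (A t))"
    using B by (metis det_mul matrix_mul_assoc matrix_mul_lid)
  finally show ?thesis by (simp add: B_def)
qed

lemma matrix_inv_eqI:
  fixes A B :: "'a::field ^ 'n::finite ^ 'n"
  assumes "A ** B = mat 1"
  shows "matrix_inv A = B"
proof -
  have "det A * det B = 1" using assms det_mul det_I by metis
  then have "det A \<noteq> 0" by auto
  then show ?thesis
    using matrix_inv_cancel(2)[of A] assms by (metis matrix_mul_assoc matrix_mul_lid matrix_mul_rid)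
qed

lemma matrix_inv_symmetric:
  fixes A :: "'a::field ^ 'n::finite ^ 'n"
  assumes "det A \<noteq> 0" "transpose A = A"
  shows "transpose (matrix_inv A) = matrix_inv A"
proof -
  have "transpose (matrix_inv A ** A) = mat 1"
    using matrix_inv_cancel(2)[OF assms(1)] by (simp add: transpose_mat)
  then have "A ** transpose (matrix_inv A) = mat 1" by (simp add: matrix_transpose_mul assms(2))
  then show ?thesis using matrix_inv_eqI by metis
qed

section \<open>The Lagrangian of the weighted volume\<close>

text \<open>
  The first-order jet of a parametrised submanifold is a pair \<open>(y, p)\<close> of a position and a family of
  partial derivatives. The weighted volume functional has the Lagrangian \<open>lagr\<close> on the open set of
  jets of immersions.
\<close>

definition gram :: "'e::euclidean_space ^ 'm::finite \<Rightarrow> real ^ 'm ^ 'm" where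
  "gram p = (\<chi> i j. p $ i \<bullet> p $ j)"

definition regular_jets :: "('e::euclidean_space \<times> ('e ^ 'm::finite)) set" where
  "regular_jets = {j. 0 < det (gram (snd j))}"

definition lagr :: "'e::euclidean_space \<times> ('e ^ 'm::finite) \<Rightarrow> real" where
  "lagr j = exp (- (1/2) * (fst j \<bullet> fst j)) * sqrt (det (gram (snd j)))"

definition dlagr :: "'e::euclidean_space \<times> ('e ^ 'm::finite) \<Rightarrow> 'e \<times> ('e ^ 'm) \<Rightarrow> real" where
  "dlagr j k = frechet_derivative lagr (at j) k"

definition ddlagr ::
    "'e::euclidean_space \<times> ('e ^ 'm::finite) \<Rightarrow> 'e \<times> ('e ^ 'm) \<Rightarrow> 'e \<times> ('e ^ 'm) \<Rightarrow> real" where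
  "ddlagr j k k' = frechet_derivative (\<lambda>j. dlagr j k) (at j) k'"

lemma gram_nth [simp]: "gram p $ i $ j = p $ i \<bullet> p $ j"
  by (simp add: gram_def)

lemma transpose_gram [simp]: "transpose (gram p) = gram p"
  by (simp add: vec_eq_iff transpose_def inner_commute)

lemma C_infinity_on_gram: "open S \<Longrightarrow> C_infinity_on (\<lambda>j. gram (snd j) $ i $ k) S"
  for S :: "('e::euclidean_space \<times> ('e ^ 'm::finite)) set"
  unfolding gram_nth
  by (intro C_infinity_on_inner C_infinity_on_vec_nth C_infinity_on_snd C_infinity_on_id)

lemma open_regular_jets: "open (regular_jets :: ('e::euclidean_space \<times> ('e ^ 'm::finite)) set)"
proof -
  have "continuous_on UNIV (\<lambda>j :: 'e \<times> ('e ^ 'm). det (gram (snd j)))"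
    by (intro C_infinity_on_continuous C_infinity_on_det C_infinity_on_gram) auto
  then show ?thesis
    unfolding regular_jets_def by (intro open_Collect_less) auto
qed

lemma C_infinity_on_lagr: "C_infinity_on lagr (regular_jets :: ('e::euclidean_space \<times> ('e ^ 'm::finite)) set)"
  unfolding lagr_def
  by (intro C_infinity_on_mult C_infinity_on_exp C_infinity_on_sqrt_compose C_infinity_on_det
      C_infinity_on_gram C_infinity_on_inner C_infinity_on_fst C_infinity_on_const C_infinity_on_id
      open_regular_jets) (simp add: regular_jets_def)

lemma lagr_pos: "j \<in> regular_jets \<Longrightarrow> 0 < lagr j"
  by (simp add: lagr_def regular_jets_def)

lemma has_derivative_lagr:
  "j \<in> regular_jets \<Longrightarrow> (lagr has_derivative dlagr j) (at j)"
  using C_infinity_on_D[OF C_infinity_on_lagr] by (simp add: dlagr_def[abs_def])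

lemma C_infinity_on_dlagr_const:
  "C_infinity_on (\<lambda>j. dlagr j k) (regular_jets :: ('e::euclidean_space \<times> ('e ^ 'm::finite)) set)"
  using C_infinity_on_frechet[OF C_infinity_on_lagr] by (simp add: dlagr_def[abs_def])

lemma C_infinity_on_ddlagr_const:
  "C_infinity_on (\<lambda>j. ddlagr j k k') (regular_jets :: ('e::euclidean_space \<times> ('e ^ 'm::finite)) set)"
  using C_infinity_on_frechet[OF C_infinity_on_dlagr_const] by (simp add: ddlagr_def[abs_def])

lemma has_derivative_dlagr_const:
  "j \<in> regular_jets \<Longrightarrow> ((\<lambda>j. dlagr j k) has_derivative ddlagr j k) (at j)"
  using C_infinity_on_D[OF C_infinity_on_dlagr_const] by (simp add: ddlagr_def[abs_def])

lemma linear_dlagr: "j \<in> regular_jets \<Longrightarrow> linear (dlagr j)"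
  using has_derivative_lagr has_derivative_linear by blast

lemma linear_ddlagr: "j \<in> regular_jets \<Longrightarrow> linear (ddlagr j k)"
  using has_derivative_dlagr_const has_derivative_linear by blast

lemma ddlagr_commute:
  "j \<in> regular_jets \<Longrightarrow> ddlagr j k k' = ddlagr j k' k"
  using second_derivative_symmetric[OF open_regular_jets _ C_infinity_on_lagr]
  by (simp add: ddlagr_def dlagr_def[abs_def])

lemma linear_ddlagr_left: "j \<in> regular_jets \<Longrightarrow> linear (\<lambda>k. ddlagr j k k')"
  using linear_ddlagr ddlagr_commute by (simp add: ddlagr_commute[of j _ k'])

lemma linear_euclidean_expand:
  fixes L :: "'a::euclidean_space \<Rightarrow> 'b::real_vector"
  assumes "linear L"
  shows "L v = (\<Sum>b\<in>Basis. (v \<bullet> b) *\<^sub>R L b)"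
proof -
  have "L (\<Sum>b\<in>Basis. (v \<bullet> b) *\<^sub>R b) = (\<Sum>b\<in>Basis. (v \<bullet> b) *\<^sub>R L b)"
    by (simp add: linear_sum[OF assms] linear_cmul[OF assms])
  then show ?thesis by (simp add: euclidean_representation)
qed

text \<open>Smoothness is known for fixed directions; as \<open>dlagr\<close> is linear in the
  direction, a basis expansion extends it to directions depending on \<open>u\<close>.\<close>

lemma C_infinity_on_dlagr:
  assumes "open S" "C_infinity_on f S" "C_infinity_on g S" "f ` S \<subseteq> regular_jets"
  shows "C_infinity_on (\<lambda>u. dlagr (f u) (g u)) S"
proof -
  have "C_infinity_on (\<lambda>u. \<Sum>b\<in>Basis. (g u \<bullet> b) *\<^sub>R dlagr (f u) b) S"
    by (intro C_infinity_on_sum C_infinity_on_scaleR C_infinity_on_inner assms C_infinity_on_const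
        C_infinity_on_compose[OF assms(1) open_regular_jets assms(2) C_infinity_on_dlagr_const assms(4)])
  also have "?this \<longleftrightarrow> ?thesis"
    by (rule C_infinity_on_cong[OF assms(1)], rule linear_euclidean_expand[symmetric])
      (use assms(4) in \<open>auto intro: linear_dlagr\<close>)
  finally show ?thesis .
qed

lemma C_infinity_on_ddlagr:
  assumes "open S" "C_infinity_on f S" "C_infinity_on g S" "C_infinity_on h S" "f ` S \<subseteq> regular_jets"
  shows "C_infinity_on (\<lambda>u. ddlagr (f u) (g u) (h u)) S"
proof -
  have "C_infinity_on (\<lambda>u. \<Sum>b\<in>Basis. (h u \<bullet> b) *\<^sub>R (\<Sum>b'\<in>Basis. (g u \<bullet> b') *\<^sub>R ddlagr (f u) b' b)) S"
    by (intro C_infinity_on_sum C_infinity_on_scaleR C_infinity_on_inner assms C_infinity_on_const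
        C_infinity_on_compose[OF assms(1) open_regular_jets assms(2) C_infinity_on_ddlagr_const assms(5)])
  also have "?this \<longleftrightarrow> ?thesis"
  proof (rule C_infinity_on_cong[OF assms(1)])
    fix u assume "u \<in> S"
    then have reg: "f u \<in> regular_jets" using assms(5) by auto
    have "(\<Sum>b'\<in>Basis. (g u \<bullet> b') *\<^sub>R ddlagr (f u) b' b) = ddlagr (f u) (g u) b" for b
      using linear_euclidean_expand[OF linear_ddlagr_left[OF reg], of "g u" b] by simp
    then show "(\<Sum>b\<in>Basis. (h u \<bullet> b) *\<^sub>R (\<Sum>b'\<in>Basis. (g u \<bullet> b') *\<^sub>R ddlagr (f u) b' b)) =
        ddlagr (f u) (g u) (h u)"
      using linear_euclidean_expand[OF linear_ddlagr[OF reg], of "g u" "h u"] by simp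
  qed
  finally show ?thesis .
qed

text \<open>A product rule, \<open>dlagr\<close> being linear in its direction: the moving jet
  contributes \<open>ddlagr\<close>, the moving direction contributes \<open>dlagr\<close>
  again.\<close>

lemma has_derivative_dlagr:
  assumes f: "(f has_derivative f') (at u)" and g: "(g has_derivative g') (at u)"
    and T: "open T" "u \<in> T" "\<And>v. v \<in> T \<Longrightarrow> f v \<in> regular_jets"
  shows "((\<lambda>u. dlagr (f u) (g u)) has_derivative
           (\<lambda>v. ddlagr (f u) (g u) (f' v) + dlagr (f u) (g' v))) (at u)"
proof -
  note reg = T(3)[OF T(2)]
  have 1: "((\<lambda>u. \<Sum>b\<in>Basis. (g u \<bullet> b) * dlagr (f u) b) has_derivative
      (\<lambda>v. \<Sum>b\<in>Basis. (g u \<bullet> b) * ddlagr (f u) b (f' v) + (g' v \<bullet> b) * dlagr (f u) b)) (at u)"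
    by (intro has_derivative_sum has_derivative_mult has_derivative_inner_left g
        has_derivative_compose[OF f has_derivative_dlagr_const[OF reg]])
  have 2: "(\<Sum>b\<in>Basis. (g u \<bullet> b) * ddlagr (f u) b (f' v) + (g' v \<bullet> b) * dlagr (f u) b) =
      ddlagr (f u) (g u) (f' v) + dlagr (f u) (g' v)" for v
    unfolding sum.distrib
    using linear_euclidean_expand[OF linear_ddlagr_left[OF reg], of "g u" "f' v"]
      linear_euclidean_expand[OF linear_dlagr[OF reg], of "g' v"] by simp
  show ?thesis
  proof (rule has_derivative_transform_within_open[OF 1[unfolded 2] T(1,2)])
    fix v assume "v \<in> T"
    then show "(\<Sum>b\<in>Basis. (g v \<bullet> b) * dlagr (f v) b) = dlagr (f v) (g v)"
      using linear_euclidean_expand[OF linear_dlagr[OF T(3)], of v "g v"] by simp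
  qed
qed

lemma DERIV_along_line:
  assumes "(f has_derivative f') (at (j + s *\<^sub>R k))"
  shows "((\<lambda>t. f (j + t *\<^sub>R k)) has_real_derivative f' k) (at s)"
proof -
  have "((\<lambda>t. f (j + t *\<^sub>R k)) has_derivative (\<lambda>h. f' (h *\<^sub>R k))) (at s)"
    by (rule has_derivative_compose[where f="\<lambda>t. j + t *\<^sub>R k", OF _ assms]) (auto intro!: derivative_eq_intros)
  moreover have "linear f'" using assms has_derivative_linear by blast
  ultimately show ?thesis
    by (simp add: has_field_derivative_def linear_cmul mult.commute[of _ "f' k"])
qed

lemma DERIV_gram:
  "((\<lambda>t. gram (p + t *\<^sub>R q) $ i $ j) has_real_derivative (q $ i \<bullet> p $ j + p $ i \<bullet> q $ j)) (at 0)"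
proof -
  have eq: "gram (p + t *\<^sub>R q) $ i $ j =
      p $ i \<bullet> p $ j + t * (q $ i \<bullet> p $ j + p $ i \<bullet> q $ j) + t\<^sup>2 * (q $ i \<bullet> q $ j)" for t
    by (simp add: inner_add_left inner_add_right algebra_simps power2_eq_square)
  show ?thesis unfolding eq by (auto intro!: derivative_eq_intros)
qed

text \<open>The conjugate momenta, that is, the partial derivatives of \<open>lagr\<close> with
  respect to the velocities \<open>snd j $ i\<close>; \<open>dlagr_eq\<close> confirms this.\<close>

definition momentum :: "'e::euclidean_space \<times> ('e ^ 'm::finite) \<Rightarrow> 'e ^ 'm" where
  "momentum j = (\<chi> i. lagr j *\<^sub>R (\<Sum>k\<in>UNIV. (matrix_inv (gram (snd j)) $ i $ k) *\<^sub>R snd j $ k))"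

lemma regular_jets_det: "j \<in> regular_jets \<Longrightarrow> det (gram (snd j)) \<noteq> 0"
  by (simp add: regular_jets_def)

lemma matrix_inv_gram_commute:
  assumes "det (gram p) \<noteq> 0"
  shows "matrix_inv (gram p) $ i $ k = matrix_inv (gram p) $ k $ i"
proof -
  have "transpose (matrix_inv (gram p)) $ i $ k = matrix_inv (gram p) $ i $ k"
    using matrix_inv_symmetric[OF assms transpose_gram] by simp
  then show ?thesis by (simp add: transpose_def)
qed

lemma C_infinity_on_momentum:
  "C_infinity_on momentum (regular_jets :: ('e::euclidean_space \<times> ('e ^ 'm::finite)) set)"
  unfolding momentum_def
  by (intro C_infinity_on_vec C_infinity_on_scaleR C_infinity_on_sum C_infinity_on_matrix_inv
      C_infinity_on_gram C_infinity_on_vec_nth C_infinity_on_snd C_infinity_on_id C_infinity_on_lagr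
      open_regular_jets regular_jets_det)

text \<open>Jacobi's formula for the Gram determinant. The two halves of the derivative of a Gram
  entry contribute equally because the inverse is symmetric, and the resulting factor 2 is absorbed
  by the square root. The Gaussian factor accounts for the term in \<open>z\<close>.\<close>

lemma dlagr_eq:
  fixes j :: "'e::euclidean_space \<times> ('e ^ 'm::finite)"
  assumes "j \<in> regular_jets"
  shows "dlagr j (z, q) = (\<Sum>i\<in>UNIV. momentum j $ i \<bullet> q $ i) - lagr j * (fst j \<bullet> z)"
proof -
  obtain y p where j: "j = (y, p)" by (cases j)
  define B where "B = matrix_inv (gram p)"
  define G where "G = det (gram p)"
  have G: "G > 0" using assms by (simp add: G_def j regular_jets_def)
  define S where "S = (\<Sum>i\<in>UNIV. \<Sum>k\<in>UNIV. B $ i $ k * (q $ i \<bullet> p $ k))"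
  have "(\<Sum>i\<in>UNIV. \<Sum>k\<in>UNIV. B $ i $ k * (q $ k \<bullet> p $ i + p $ k \<bullet> q $ i)) =
      (\<Sum>i\<in>UNIV. \<Sum>k\<in>UNIV. B $ i $ k * (q $ k \<bullet> p $ i)) + S"
    by (simp add: S_def algebra_simps sum.distrib inner_commute)
  also have "(\<Sum>i\<in>UNIV. \<Sum>k\<in>UNIV. B $ i $ k * (q $ k \<bullet> p $ i)) = S"
    unfolding S_def by (subst sum.swap)
      (use G matrix_inv_gram_commute[of p] in \<open>simp add: B_def G_def\<close>)
  finally have S2: "(\<Sum>i\<in>UNIV. \<Sum>k\<in>UNIV. B $ i $ k * (q $ k \<bullet> p $ i + p $ k \<bullet> q $ i)) = 2 * S" by simp
  have det': "((\<lambda>t. det (gram (p + t *\<^sub>R q))) has_real_derivative G * (2 * S)) (at 0)"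
    using DERIV_det[of "\<lambda>t. gram (p + t *\<^sub>R q)", OF DERIV_gram] G
    by (simp add: G_def flip: S2 B_def)
  have "((\<lambda>t. lagr (j + t *\<^sub>R (z, q))) has_real_derivative lagr j * (S - y \<bullet> z)) (at 0)"
  proof -
    have sq: "((\<lambda>t. sqrt (det (gram (p + t *\<^sub>R q)))) has_real_derivative sqrt G * S) (at 0)"
    proof -
      have "((\<lambda>t. sqrt (det (gram (p + t *\<^sub>R q)))) has_real_derivative
          inverse (sqrt G) / 2 * (G * (2 * S))) (at 0)"
        by (rule DERIV_chain2[OF _ det']) (use DERIV_real_sqrt[OF G] in \<open>simp add: G_def\<close>)
      moreover have "inverse (sqrt G) * G = sqrt G"
        using G by (simp add: real_div_sqrt divide_inverse[symmetric] mult.commute)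
      then have "inverse (sqrt G) / 2 * (G * (2 * S)) = sqrt G * S"
        by (metis (no_types, opaque_lifting) times_divide_eq_left mult.assoc mult.commute
            nonzero_mult_div_cancel_left zero_neq_numeral)
      ultimately show ?thesis by (simp only:)
    qed
    have eq: "(y + t *\<^sub>R z) \<bullet> (y + t *\<^sub>R z) = y \<bullet> y + t * (2 * (y \<bullet> z)) + t\<^sup>2 * (z \<bullet> z)" for t
      by (simp add: inner_add_left inner_add_right algebra_simps power2_eq_square inner_commute)
    have ex: "((\<lambda>t. exp (- (1/2) * ((y + t *\<^sub>R z) \<bullet> (y + t *\<^sub>R z)))) has_real_derivative
        exp (- (1/2) * (y \<bullet> y)) * - (y \<bullet> z)) (at 0)"
      unfolding eq by (auto intro!: derivative_eq_intros)
    from DERIV_mult[OF ex sq] show ?thesis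
      by (simp add: j lagr_def G_def algebra_simps)
  qed
  moreover have "((\<lambda>t. lagr (j + t *\<^sub>R (z, q))) has_real_derivative dlagr j (z, q)) (at 0)"
    by (rule DERIV_along_line) (use has_derivative_lagr[OF assms] in \<open>simp only: scaleR_zero_left add_0_right\<close>)
  ultimately have "dlagr j (z, q) = lagr j * (S - y \<bullet> z)" using DERIV_unique by blast
  moreover have "(\<Sum>i\<in>UNIV. momentum j $ i \<bullet> q $ i) = lagr j * S"
    by (simp add: momentum_def S_def B_def j inner_sum_left sum_distrib_left mult_ac
        inner_commute[of "q $ i" "p $ k" for i k])
  ultimately show ?thesis by (simp add: j algebra_simps)
qed

text \<open>Up to the factor \<open>lagr j\<close> the momenta form the dual basis of the frame,
  since they arise from it by the inverse Gram matrix.\<close>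

lemma momentum_inner:
  assumes "j \<in> regular_jets"
  shows "momentum j $ i \<bullet> snd j $ k = (if i = k then lagr j else 0)"
proof -
  have "(\<Sum>l\<in>UNIV. matrix_inv (gram (snd j)) $ i $ l * gram (snd j) $ l $ k) = (mat 1 :: real ^ 'b ^ 'b) $ i $ k"
    using matrix_inv_cancel(2)[OF regular_jets_det[OF assms]]
    by (simp add: vec_eq_iff matrix_matrix_mult_def)
  then show ?thesis
    by (auto simp: momentum_def inner_sum_left mat_def)
qed

text \<open>Infinitesimal reparametrisation invariance: a matrix acting on the velocities changes
  the volume density to first order by its trace.\<close>

lemma dlagr_reparametrize:
  fixes B :: "'m \<Rightarrow> 'm::finite \<Rightarrow> real"
  assumes "j \<in> regular_jets"
  shows "dlagr j (0, \<chi> i. \<Sum>k\<in>UNIV. B i k *\<^sub>R snd j $ k) = (\<Sum>i\<in>UNIV. B i i) * lagr j"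
  by (simp add: dlagr_eq[OF assms] inner_sum_right momentum_inner[OF assms] sum_distrib_right
      if_distrib[of "(*) _"] cong: if_cong)

text \<open>The derivative of the previous identity in the direction of a second jet.\<close>

lemma ddlagr_reparametrize:
  fixes B :: "'m \<Rightarrow> 'm::finite \<Rightarrow> real" and j k :: "'e::euclidean_space \<times> ('e ^ 'm)"
  assumes "j \<in> regular_jets"
  shows "ddlagr j k (0, \<chi> i. \<Sum>l\<in>UNIV. B i l *\<^sub>R snd j $ l) +
         dlagr j (0, \<chi> i. \<Sum>l\<in>UNIV. B i l *\<^sub>R snd k $ l) = (\<Sum>i\<in>UNIV. B i i) * dlagr j k"
proof -
  define M :: "'e \<times> ('e ^ 'm) \<Rightarrow> 'e \<times> ('e ^ 'm)" where "M k = (0, \<chi> i. \<Sum>l\<in>UNIV. B i l *\<^sub>R snd k $ l)" for k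
  have "linear M"
    by (rule linearI)
      (auto simp: M_def vec_eq_iff sum.distrib scaleR_right.sum algebra_simps)
  then have "bounded_linear M" by (simp add: linear_conv_bounded_linear)
  then have M: "(M has_derivative M) (at j)" by (rule bounded_linear_imp_has_derivative)
  have "((\<lambda>j. dlagr j (M j)) has_derivative (\<lambda>v. ddlagr j (M j) v + dlagr j (M v))) (at j)"
    by (rule has_derivative_dlagr[OF has_derivative_ident M open_regular_jets assms])
  moreover have "((\<lambda>j. dlagr j (M j)) has_derivative (\<lambda>v. (\<Sum>i\<in>UNIV. B i i) * dlagr j v)) (at j)"
    by (rule has_derivative_transform_within_open[OF _ open_regular_jets assms,
          where f="\<lambda>j. (\<Sum>i\<in>UNIV. B i i) * lagr j"])
      (auto simp: M_def dlagr_reparametrize intro!: has_derivative_mult_right has_derivative_lagr assms)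
  ultimately have "(\<lambda>v. ddlagr j (M j) v + dlagr j (M v)) = (\<lambda>v. (\<Sum>i\<in>UNIV. B i i) * dlagr j v)"
    using has_derivative_unique by blast
  then have "ddlagr j (M j) k + dlagr j (M k) = (\<Sum>i\<in>UNIV. B i i) * dlagr j k" by metis
  then show ?thesis by (simp add: ddlagr_commute[OF assms, of k] M_def)
qed

text \<open>The Gram matrix transforms by congruence, so its determinant gains the square of
  \<open>det A\<close> and the square root gains \<open>\<bar>det A\<bar>\<close>. For
  \<open>A\<close> the Jacobian of a coordinate change this is the transformation law of
  densities.\<close>

lemma lagr_compose:
  fixes A :: "real ^ 'm::finite ^ 'm" and p :: "'e::euclidean_space ^ 'm"
  shows "gram (\<chi> i. \<Sum>k\<in>UNIV. (A $ k $ i) *\<^sub>R p $ k) = transpose A ** gram p ** A"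
    and "lagr (y, \<chi> i. \<Sum>k\<in>UNIV. (A $ k $ i) *\<^sub>R p $ k) = \<bar>det A\<bar> * lagr (y, p)"
proof -
  have "(\<Sum>k\<in>UNIV. (A $ k $ i) *\<^sub>R p $ k) \<bullet> (\<Sum>l\<in>UNIV. (A $ l $ j) *\<^sub>R p $ l) =
      (\<Sum>l\<in>UNIV. (\<Sum>k\<in>UNIV. A $ k $ i * (p $ k \<bullet> p $ l)) * A $ l $ j)" for i j
  proof -
    have "(\<Sum>k\<in>UNIV. (A $ k $ i) *\<^sub>R p $ k) \<bullet> (\<Sum>l\<in>UNIV. (A $ l $ j) *\<^sub>R p $ l) =
        (\<Sum>l\<in>UNIV. \<Sum>k\<in>UNIV. A $ l $ j * (A $ k $ i * (p $ k \<bullet> p $ l)))"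
      by (simp only: inner_sum_left inner_sum_right inner_scaleR_left inner_scaleR_right sum_distrib_left)
    also have "\<dots> = (\<Sum>l\<in>UNIV. (\<Sum>k\<in>UNIV. A $ k $ i * (p $ k \<bullet> p $ l)) * A $ l $ j)"
      by (rule sum.cong[OF refl]) (simp only: sum_distrib_left[symmetric] mult.commute)
    finally show ?thesis .
  qed
  then show *: "gram (\<chi> i. \<Sum>k\<in>UNIV. (A $ k $ i) *\<^sub>R p $ k) = transpose A ** gram p ** A"
    by (simp add: vec_eq_iff matrix_matrix_mult_def transpose_def)
  show "lagr (y, \<chi> i. \<Sum>k\<in>UNIV. (A $ k $ i) *\<^sub>R p $ k) = \<bar>det A\<bar> * lagr (y, p)"
  proof -
    have "det (transpose A ** gram p ** A) = (det A)\<^sup>2 * det (gram p)"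
      by (simp add: det_mul power2_eq_square)
    then show ?thesis by (simp add: lagr_def * real_sqrt_mult)
  qed
qed


section \<open>Gram determinants and independence, derivative of the inverse matrix\<close>

lemma gram_quadratic_form: "v \<bullet> (gram p *v v) = (norm (\<Sum>i\<in>UNIV. v $ i *\<^sub>R p $ i))\<^sup>2"
  by (simp add: power2_norm_eq_inner inner_sum_left inner_sum_right matrix_vector_mult_def inner_vec_def
      sum_distrib_left mult_ac) (simp add: inner_commute)

text \<open>The segment from the identity to the Gram matrix consists of positive definite, hence
  invertible, matrices. The determinant starts at 1 and never vanishes along it, so it stays
  positive by the intermediate value theorem.\<close>

lemma independent_imp_det_gram_pos:
  fixes p :: "'e::euclidean_space ^ 'm::finite"
  assumes "\<And>v. (\<Sum>i\<in>UNIV. v $ i *\<^sub>R p $ i) = 0 \<Longrightarrow> v = 0"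
  shows "0 < det (gram p)"
proof (rule ccontr)
  assume neg: "\<not> 0 < det (gram p)"
  define A where "A t = (1 - t) *\<^sub>R mat 1 + t *\<^sub>R gram p" for t :: real
  have nz: "det (A t) \<noteq> 0" if "0 \<le> t" "t \<le> 1" for t
  proof -
    have "v = 0" if "A t *v v = 0" for v
    proof -
      have "0 = v \<bullet> (A t *v v)" using that by simp
      also have "\<dots> = (1 - t) * (v \<bullet> v) + t * (norm (\<Sum>i\<in>UNIV. v $ i *\<^sub>R p $ i))\<^sup>2"
        by (simp add: A_def matrix_vector_mult_add_rdistrib scaleR_matrix_vector_assoc[symmetric]
            inner_add_right gram_quadratic_form)
      finally have "(1 - t) * (v \<bullet> v) = 0 \<and> t * (norm (\<Sum>i\<in>UNIV. v $ i *\<^sub>R p $ i))\<^sup>2 = 0"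
        using \<open>0 \<le> t\<close> \<open>t \<le> 1\<close> by (smt (verit) inner_ge_zero mult_nonneg_nonneg zero_le_power2)
      then show ?thesis using assms by (cases "t = 1") auto
    qed
    then have "invertible (A t)"
      using matrix_left_invertible_ker[of "A t"] invertible_left_inverse by blast
    then show ?thesis by (simp add: invertible_det_nz)
  qed
  have cont: "continuous_on {0..1} (\<lambda>t. det (A t))"
    unfolding A_def
    by (intro C_infinity_on_continuous[OF C_infinity_on_subset[OF C_infinity_on_det[OF open_UNIV]]])
      (auto simp: mat_def intro!: C_infinity_on_add C_infinity_on_mult C_infinity_on_diff)
  have "det (A 0) = 1" "det (A 1) \<le> 0" using neg by (auto simp: A_def)
  then obtain t where "0 \<le> t" "t \<le> 1" "det (A t) = 0"
    using IVT2'[of "\<lambda>t. det (A t)" 1 0 0] cont by auto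
  with nz show False by blast
qed

lemma det_gram_pos_imp_independent:
  fixes p :: "'e::euclidean_space ^ 'm::finite"
  assumes "det (gram p) \<noteq> 0" "(\<Sum>i\<in>UNIV. v $ i *\<^sub>R p $ i) = 0"
  shows "v = 0"
proof -
  have "(gram p *v v) $ k = p $ k \<bullet> (\<Sum>i\<in>UNIV. v $ i *\<^sub>R p $ i)" for k
    by (simp add: matrix_vector_mult_def inner_sum_right mult.commute)
  then have "gram p *v v = 0" using assms(2) by (simp add: vec_eq_iff)
  then have "matrix_inv (gram p) *v (gram p *v v) = 0" by simp
  then show ?thesis
    by (simp add: matrix_vector_mul_assoc matrix_inv_cancel[OF assms(1)])
qed

text \<open>Differentiability of the entries of the inverse comes from Cramer's rule;
  differentiating the relation between the matrix and its inverse then determines the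
  derivative.\<close>

lemma DERIV_matrix_inv:
  fixes A :: "real \<Rightarrow> real ^ 'n::finite ^ 'n"
  assumes S: "open S" "t0 \<in> S" "\<And>i j. C_infinity_on (\<lambda>t. A t $ i $ j) S" "\<And>t. t \<in> S \<Longrightarrow> det (A t) \<noteq> 0"
    and A': "\<And>i j. ((\<lambda>t. A t $ i $ j) has_real_derivative A' $ i $ j) (at t0)"
  shows "((\<lambda>t. matrix_inv (A t) $ i $ j) has_real_derivative
           - (matrix_inv (A t0) ** A' ** matrix_inv (A t0)) $ i $ j) (at t0)"
proof -
  define B where "B t = matrix_inv (A t)" for t
  have "\<exists>d. ((\<lambda>t. B t $ i $ j) has_real_derivative d) (at t0)" for i j
    using C_infinity_on_differentiable[OF C_infinity_on_matrix_inv[OF S(1,3,4)] S(2)]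
    unfolding B_def real_differentiable_def by blast
  then obtain d where d: "\<And>i j. ((\<lambda>t. B t $ i $ j) has_real_derivative d i j) (at t0)" by metis
  define B' where "B' = (\<chi> i j. d i j)"
  have "B' ** A t0 + B t0 ** A' = 0"
    unfolding vec_eq_iff
  proof (intro allI)
    fix i j
    have "((\<lambda>t. \<Sum>l\<in>UNIV. B t $ i $ l * A t $ l $ j) has_real_derivative
        (\<Sum>l\<in>UNIV. d i l * A t0 $ l $ j + A' $ l $ j * B t0 $ i $ l)) (at t0)"
      by (intro DERIV_sum DERIV_mult d A')
    moreover have "((\<lambda>t. \<Sum>l\<in>UNIV. B t $ i $ l * A t $ l $ j) has_real_derivative 0) (at t0)"
    proof (rule has_field_derivative_transform_within_open[OF DERIV_const S(1,2)])
      fix t assume "t \<in> S"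
      then have "(B t ** A t) $ i $ j = (mat 1 :: real ^ 'n ^ 'n) $ i $ j"
        using matrix_inv_cancel(2)[OF S(4)] by (simp add: B_def)
      then show "(mat 1 :: real ^ 'n ^ 'n) $ i $ j = (\<Sum>l\<in>UNIV. B t $ i $ l * A t $ l $ j)"
        by (simp add: matrix_matrix_mult_def)
    qed
    ultimately have "(\<Sum>l\<in>UNIV. d i l * A t0 $ l $ j + A' $ l $ j * B t0 $ i $ l) = 0"
      using DERIV_unique by blast
    then show "(B' ** A t0 + B t0 ** A') $ i $ j = 0 $ i $ j"
      by (simp add: matrix_matrix_mult_def B'_def sum.distrib mult.commute)
  qed
  then have "B' ** A t0 = - (B t0 ** A')" by (simp add: eq_neg_iff_add_eq_0)
  then have "B' ** A t0 ** B t0 = - (B t0 ** A') ** B t0" by simp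
  moreover have "B' ** A t0 ** B t0 = B'"
    using matrix_inv_cancel(1)[OF S(4)[OF S(2)]] by (simp add: B_def flip: matrix_mul_assoc)
  moreover have "- (B t0 ** A') ** B t0 = - (B t0 ** A' ** B t0)"
    by (simp add: vec_eq_iff matrix_matrix_mult_def sum_negf)
  ultimately show ?thesis using d[of i j] by (simp add: B_def B'_def vec_eq_iff)
qed

lemma dlagr_constant_direction:
  fixes j :: "'e::euclidean_space \<times> ('e ^ 'm::finite)"
  assumes "j \<in> regular_jets"
  shows "dlagr j (z, \<chi> i. c $ i *\<^sub>R a) =
    lagr j * (c \<bullet> (matrix_inv (gram (snd j)) *v (\<chi> i. a \<bullet> snd j $ i)) - fst j \<bullet> z)"
  by (simp add: dlagr_eq[OF assms] momentum_def inner_vec_def[of c] matrix_vector_mult_def inner_sum_left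
      right_diff_distrib sum_distrib_left inner_commute[of a "snd j $ i" for i] mult_ac)

text \<open>
  The second variation of the Lagrangian along \<open>\<phi> a\<close> with \<open>a\<close> a constant vector and \<open>\<alpha> = d\<phi>\<close>,
  corrected by the first variation along \<open>\<phi>\<^sup>2 \<langle>y, a\<rangle> a\<close>.
\<close>

lemma ddlagr_constant_direction:
  fixes j :: "'e::euclidean_space \<times> ('e ^ 'm::finite)" and \<alpha> :: "real ^ 'm" and a :: 'e and \<phi> :: real
  assumes reg: "j \<in> regular_jets"
  defines "B \<equiv> matrix_inv (gram (snd j))" and "b \<equiv> \<chi> i. a \<bullet> snd j $ i" and "u \<equiv> fst j \<bullet> a"
    and "k \<equiv> (\<phi> *\<^sub>R a, \<chi> i. \<alpha> $ i *\<^sub>R a)"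
  shows "ddlagr j k k + dlagr j ((\<phi>\<^sup>2 * u) *\<^sub>R a, \<chi> i. ((2 * \<phi> * u) *\<^sub>R \<alpha> + \<phi>\<^sup>2 *\<^sub>R b) $ i *\<^sub>R a) =
    lagr j * ((\<alpha> \<bullet> (B *v \<alpha>) - \<phi>\<^sup>2) * (a \<bullet> a - b \<bullet> (B *v b)))"
proof -
  obtain y p where j: "j = (y, p)" by (cases j)
  define q where "q = (\<chi> i. \<alpha> $ i *\<^sub>R a)"
  define P where "P s = p + s *\<^sub>R q" for s
  define G' where "G' = (\<chi> i l. \<alpha> $ i * b $ l + \<alpha> $ l * b $ i)"
  define bs where "bs s = b + (s * (a \<bullet> a)) *\<^sub>R \<alpha>" for s
  \<comment> \<open>\<open>m\<close> is the logarithmic derivative of \<open>lagr\<close> along the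
    line, so the second derivative at 0 is \<open>lagr j\<close> times the sum of the square of
    \<open>m 0\<close> and the derivative of \<open>m\<close>.\<close>
  define m where "m s = \<alpha> \<bullet> (matrix_inv (gram (P s)) *v bs s) - (y + (s * \<phi>) *\<^sub>R a) \<bullet> (\<phi> *\<^sub>R a)" for s
  define S where "S = {s. det (gram (P s)) > 0}"
  have jk: "j + s *\<^sub>R k = (y + (s * \<phi>) *\<^sub>R a, P s)" for s
    by (simp add: j k_def P_def q_def)
  have Cg: "C_infinity_on (\<lambda>s. gram (P s) $ i $ l) UNIV" for i l
    unfolding gram_nth P_def
    by (auto intro!: C_infinity_on_inner C_infinity_on_vec_nth C_infinity_on_add C_infinity_on_scaleR)
  have "continuous_on UNIV (\<lambda>s. det (gram (P s)))"
    by (intro C_infinity_on_continuous C_infinity_on_det Cg open_UNIV)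
  then have S: "open S" unfolding S_def by (intro open_Collect_less) auto
  have S0: "0 \<in> S" using reg by (simp add: S_def P_def j regular_jets_def)
  have Cgs: "C_infinity_on (\<lambda>s. gram (P s) $ i $ l) S" for i l
    using Cg C_infinity_on_subset by blast
  have regs: "j + s *\<^sub>R k \<in> regular_jets" if "s \<in> S" for s
    using that by (simp add: jk regular_jets_def S_def)
  have dl: "dlagr (j + s *\<^sub>R k) k = lagr (j + s *\<^sub>R k) * m s" if "s \<in> S" for s
  proof -
    have "(\<chi> i. a \<bullet> P s $ i) = bs s"
      by (simp add: vec_eq_iff P_def q_def bs_def b_def j inner_add_right)
    then have "dlagr (j + s *\<^sub>R k) (\<phi> *\<^sub>R a, \<chi> i. \<alpha> $ i *\<^sub>R a) = lagr (j + s *\<^sub>R k) * m s"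
      using dlagr_constant_direction[OF regs[OF that], of "\<phi> *\<^sub>R a" \<alpha> a]
      by (simp only: m_def jk fst_conv snd_conv)
    then show ?thesis by (simp only: k_def)
  qed
  have symB: "v \<bullet> (B *v w) = w \<bullet> (B *v v)" for v w
  proof -
    have "transpose B = B"
      unfolding B_def by (rule matrix_inv_symmetric[OF regular_jets_det[OF reg] transpose_gram])
    then show ?thesis by (metis dot_lmul_matrix inner_commute transpose_matrix_vector)
  qed
  have gB: "((\<lambda>s. gram (P s) $ i $ l) has_real_derivative G' $ i $ l) (at 0)" for i l
    using DERIV_gram[of p q i l] by (simp add: P_def G'_def q_def b_def j inner_commute)
  have dB: "((\<lambda>s. matrix_inv (gram (P s)) $ i $ l) has_real_derivative - (B ** G' ** B) $ i $ l) (at 0)" for i l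
    using DERIV_matrix_inv[OF S S0 Cgs _ gB, of i l]
    by (simp add: S_def B_def P_def j) 
  have m': "(m has_real_derivative
      - (\<alpha> \<bullet> ((B ** G' ** B) *v b)) + (a \<bullet> a) * (\<alpha> \<bullet> (B *v \<alpha>)) - \<phi>\<^sup>2 * (a \<bullet> a)) (at 0)"
  proof -
    have m_eq: "m s = (\<Sum>i\<in>UNIV. \<Sum>l\<in>UNIV. \<alpha> $ i * (matrix_inv (gram (P s)) $ i $ l * (b $ l + s * (a \<bullet> a) * \<alpha> $ l)))
        - (\<phi> * (y \<bullet> a) + s * (\<phi>\<^sup>2 * (a \<bullet> a)))" for s
      by (simp add: m_def inner_vec_def[of \<alpha>] matrix_vector_mult_def bs_def sum_distrib_left
          inner_add_left algebra_simps power2_eq_square)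
    have "((\<lambda>s. b $ l + s * (a \<bullet> a) * \<alpha> $ l) has_real_derivative (a \<bullet> a) * \<alpha> $ l) (at 0)" for l
      by (auto intro!: derivative_eq_intros)
    from DERIV_mult[OF dB this]
    have "((\<lambda>s. matrix_inv (gram (P s)) $ i $ l * (b $ l + s * (a \<bullet> a) * \<alpha> $ l)) has_real_derivative
        - (B ** G' ** B) $ i $ l * b $ l + (a \<bullet> a) * (B $ i $ l * \<alpha> $ l)) (at 0)" for i l
      by (simp add: P_def B_def j mult_ac)
    then have "((\<lambda>s. \<Sum>i\<in>UNIV. \<Sum>l\<in>UNIV. \<alpha> $ i * (matrix_inv (gram (P s)) $ i $ l * (b $ l + s * (a \<bullet> a) * \<alpha> $ l)))
       has_real_derivative (\<Sum>i\<in>UNIV. \<Sum>l\<in>UNIV. \<alpha> $ i *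
          (- (B ** G' ** B) $ i $ l * b $ l + (a \<bullet> a) * (B $ i $ l * \<alpha> $ l)))) (at 0)"
      by (intro DERIV_sum DERIV_cmult)
    also have "(\<Sum>i\<in>UNIV. \<Sum>l\<in>UNIV. \<alpha> $ i *
          (- (B ** G' ** B) $ i $ l * b $ l + (a \<bullet> a) * (B $ i $ l * \<alpha> $ l))) =
        - (\<alpha> \<bullet> ((B ** G' ** B) *v b)) + (a \<bullet> a) * (\<alpha> \<bullet> (B *v \<alpha>))"
      by (simp add: inner_vec_def[of \<alpha>] matrix_vector_mult_def sum_distrib_left sum.distrib sum_negf sum_subtractf
          algebra_simps)
    finally have "((\<lambda>s. \<Sum>i\<in>UNIV. \<Sum>l\<in>UNIV. \<alpha> $ i * (matrix_inv (gram (P s)) $ i $ l * (b $ l + s * (a \<bullet> a) * \<alpha> $ l)))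
       has_real_derivative - (\<alpha> \<bullet> ((B ** G' ** B) *v b)) + (a \<bullet> a) * (\<alpha> \<bullet> (B *v \<alpha>))) (at 0)" .
    moreover have "((\<lambda>s. \<phi> * (y \<bullet> a) + s * (\<phi>\<^sup>2 * (a \<bullet> a))) has_real_derivative \<phi>\<^sup>2 * (a \<bullet> a)) (at 0)"
      by (auto intro!: derivative_eq_intros)
    ultimately show ?thesis unfolding m_eq[abs_def] by (rule DERIV_diff)
  qed
  \<comment> \<open>\<open>G'\<close> is the symmetrised product of \<alpha> and \<open>b\<close>,
    so the sandwich with \<open>B\<close> splits into products of pairings of these two vectors. The
    square term cancels later against the one in the square of \<open>m 0\<close>.\<close>
  have BGB: "\<alpha> \<bullet> ((B ** G' ** B) *v b) = (b \<bullet> (B *v b)) * (\<alpha> \<bullet> (B *v \<alpha>)) + (\<alpha> \<bullet> (B *v b))\<^sup>2"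
  proof -
    have G'v: "G' *v w = (b \<bullet> w) *\<^sub>R \<alpha> + (\<alpha> \<bullet> w) *\<^sub>R b" for w
      by (simp add: vec_eq_iff G'_def matrix_vector_mult_def inner_vec_def sum_distrib_left
          sum.distrib algebra_simps)
    have "\<alpha> \<bullet> ((B ** G' ** B) *v b) = \<alpha> \<bullet> (B *v (G' *v (B *v b)))"
      by (simp add: matrix_vector_mul_assoc matrix_mul_assoc)
    also have "\<dots> = (G' *v (B *v b)) \<bullet> (B *v \<alpha>)" by (rule symB)
    also have "\<dots> = (b \<bullet> (B *v b)) * (\<alpha> \<bullet> (B *v \<alpha>)) + (\<alpha> \<bullet> (B *v b)) * (b \<bullet> (B *v \<alpha>))"
      by (simp add: G'v inner_add_left)
    finally show ?thesis by (simp add: symB[of b \<alpha>] power2_eq_square)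
  qed
  have m0: "m 0 = \<alpha> \<bullet> (B *v b) - \<phi> * u"
    by (simp add: m_def bs_def P_def B_def j u_def)
  have dl0: "dlagr j k = lagr j * m 0" using dl[OF S0] by simp
  have "((\<lambda>s. lagr (j + s *\<^sub>R k)) has_real_derivative dlagr j k) (at 0)"
    by (rule DERIV_along_line) (use has_derivative_lagr[OF reg] in simp)
  from DERIV_mult[OF this m']
  have "((\<lambda>s. lagr (j + s *\<^sub>R k) * m s) has_real_derivative lagr j * ((m 0)\<^sup>2
      - (\<alpha> \<bullet> ((B ** G' ** B) *v b)) + (a \<bullet> a) * (\<alpha> \<bullet> (B *v \<alpha>)) - \<phi>\<^sup>2 * (a \<bullet> a))) (at 0)"
    by (simp add: dl0 algebra_simps power2_eq_square)
  then have "((\<lambda>s. dlagr (j + s *\<^sub>R k) k) has_real_derivative lagr j * ((m 0)\<^sup>2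
      - (\<alpha> \<bullet> ((B ** G' ** B) *v b)) + (a \<bullet> a) * (\<alpha> \<bullet> (B *v \<alpha>)) - \<phi>\<^sup>2 * (a \<bullet> a))) (at 0)"
    by (rule has_field_derivative_transform_within_open[OF _ S S0]) (simp add: dl)
  moreover have "((\<lambda>s. dlagr (j + s *\<^sub>R k) k) has_real_derivative ddlagr j k k) (at 0)"
    by (rule DERIV_along_line) (use has_derivative_dlagr_const[OF reg] in simp)
  ultimately have "ddlagr j k k = lagr j * ((m 0)\<^sup>2
      - (\<alpha> \<bullet> ((B ** G' ** B) *v b)) + (a \<bullet> a) * (\<alpha> \<bullet> (B *v \<alpha>)) - \<phi>\<^sup>2 * (a \<bullet> a))"
    using DERIV_unique by blast
  \<comment> \<open>This correction cancels the terms of the square of \<open>m 0\<close> that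
    involve \<open>u\<close>, and its term in \<open>b \<bullet> (B *v b)\<close> completes the term
    in \<open>a \<bullet> a\<close> to the common factor.\<close>
  moreover have "dlagr j ((\<phi>\<^sup>2 * u) *\<^sub>R a, \<chi> i. ((2 * \<phi> * u) *\<^sub>R \<alpha> + \<phi>\<^sup>2 *\<^sub>R b) $ i *\<^sub>R a) =
      lagr j * (2 * \<phi> * u * (\<alpha> \<bullet> (B *v b)) + \<phi>\<^sup>2 * (b \<bullet> (B *v b)) - \<phi>\<^sup>2 * u\<^sup>2)"
    unfolding dlagr_constant_direction[OF reg] B_def[symmetric] b_def[symmetric]
    by (simp add: inner_add_left u_def power2_eq_square)
  ultimately show ?thesis
    unfolding m0 BGB by (simp add: algebra_simps power2_eq_square)
qed

section \<open>Differentiation under the integral and the divergence theorem\<close>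

text \<open>The mean value theorem bounds every difference quotient by \<open>w\<close>, so
  dominated convergence along sequences tending to \<open>t0\<close> gives the derivative.
  Measurability of \<open>f' t0\<close> follows since it is a limit of the quotients.\<close>

lemma has_real_derivative_integral:
  fixes f f' :: "real \<Rightarrow> 'a \<Rightarrow> real"
  assumes \<delta>: "0 < \<delta>"
    and int: "\<And>t. \<bar>t - t0\<bar> < \<delta> \<Longrightarrow> integrable M (f t)"
    and der: "\<And>t x. \<bar>t - t0\<bar> < \<delta> \<Longrightarrow> x \<in> space M \<Longrightarrow> ((\<lambda>t. f t x) has_real_derivative f' t x) (at t)"
    and bound: "\<And>t x. \<bar>t - t0\<bar> < \<delta> \<Longrightarrow> x \<in> space M \<Longrightarrow> \<bar>f' t x\<bar> \<le> w x"
    and w: "integrable M w"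
  shows "((\<lambda>t. \<integral>x. f t x \<partial>M) has_real_derivative (\<integral>x. f' t0 x \<partial>M)) (at t0)"
    and "integrable M (f' t0)"
proof -
  have key: "(\<lambda>n. ((\<integral>x. f (X n) x \<partial>M) - (\<integral>x. f t0 x \<partial>M)) / (X n - t0)) \<longlonglongrightarrow> (\<integral>x. f' t0 x \<partial>M)
      \<and> integrable M (f' t0)"
    if X: "X \<longlonglongrightarrow> t0" and ne: "\<And>n. X n \<noteq> t0" and near: "\<And>n. \<bar>X n - t0\<bar> < \<delta>" for X
  proof -
    define s where "s n x = (f (X n) x - f t0 x) / (X n - t0)" for n x
    have [measurable]: "s n \<in> borel_measurable M" for n
      unfolding s_def using int[OF near[of n]] int[of t0] \<delta>
      by (auto dest!: borel_measurable_integrable)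
    have lim: "(\<lambda>n. s n x) \<longlonglongrightarrow> f' t0 x" if "x \<in> space M" for x
    proof -
      have "((\<lambda>t. (f t x - f t0 x) / (t - t0)) \<longlongrightarrow> f' t0 x) (at t0)"
        using der[of t0 x] \<delta> that by (simp add: has_field_derivative_iff)
      then show ?thesis
        unfolding s_def using X ne by (auto simp: tendsto_at_iff_sequentially comp_def)
    qed
    have meas: "f' t0 \<in> borel_measurable M"
      by (rule borel_measurable_LIMSEQ_real[OF lim]) auto
    have sb: "\<bar>s n x\<bar> \<le> w x" if x: "x \<in> space M" for n x
    proof -
      have "\<exists>z. \<bar>z - t0\<bar> < \<delta> \<and> f (X n) x - f t0 x = (X n - t0) * f' z x"
      proof (cases "X n > t0")
        case True
        have "\<exists>z. z > t0 \<and> z < X n \<and> f (X n) x - f t0 x = (X n - t0) * f' z x"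
          by (rule MVT2[OF True]) (use near[of n] x in \<open>auto intro!: der\<close>)
        then show ?thesis using near[of n] by force
      next
        case False
        then have lt: "X n < t0" using ne[of n] by linarith
        have "\<exists>z. z > X n \<and> z < t0 \<and> f t0 x - f (X n) x = (t0 - X n) * f' z x"
          by (rule MVT2[OF lt]) (use near[of n] x in \<open>auto intro!: der\<close>)
        then obtain z where "z > X n" "z < t0" "f t0 x - f (X n) x = (t0 - X n) * f' z x" by blast
        then show ?thesis using near[of n] by (intro exI[of _ z]) (auto simp: algebra_simps)
      qed
      then obtain z where z: "\<bar>z - t0\<bar> < \<delta>" "f (X n) x - f t0 x = (X n - t0) * f' z x" by blast
      have "s n x = f' z x" using z(2) ne[of n] by (simp add: s_def)
      then show ?thesis using bound[OF z(1) x] by simp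
    qed
    have "(\<lambda>n. integral\<^sup>L M (s n)) \<longlonglongrightarrow> integral\<^sup>L M (f' t0)" "integrable M (f' t0)"
      using integral_dominated_convergence[OF meas _ w, of s] integrable_dominated_convergence[OF meas _ w, of s] lim sb
      by auto
    moreover have "integral\<^sup>L M (s n) = ((\<integral>x. f (X n) x \<partial>M) - (\<integral>x. f t0 x \<partial>M)) / (X n - t0)" for n
      unfolding s_def using int[OF near[of n]] int[of t0] \<delta> by simp
    ultimately show ?thesis by simp
  qed
  \<comment> \<open>An explicit sequence inside the radius serves to conclude integrability of
    \<open>f' t0\<close>.\<close>
  have "(\<lambda>n. t0 + \<delta> / 2 * inverse (real (Suc n))) \<longlonglongrightarrow> t0 + \<delta> / 2 * 0"
    by (intro tendsto_add tendsto_mult tendsto_const LIMSEQ_inverse_real_of_nat)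
  moreover have "\<bar>\<delta> / 2 * inverse (real (Suc n))\<bar> < \<delta>" for n
  proof -
    have "\<delta> / 2 * inverse (real (Suc n)) \<le> \<delta> / 2 * 1"
      using \<delta> by (intro mult_left_mono) (auto simp: inverse_le_1_iff)
    then show ?thesis using \<delta> by (simp add: abs_mult)
  qed
  ultimately show "integrable M (f' t0)"
    using key[of "\<lambda>n. t0 + \<delta> / 2 * inverse (real (Suc n))"] \<delta> by simp
  show "((\<lambda>t. \<integral>x. f t x \<partial>M) has_real_derivative (\<integral>x. f' t0 x \<partial>M)) (at t0)"
    unfolding has_field_derivative_iff tendsto_at_iff_sequentially comp_def
  proof (intro allI impI)
    fix X :: "nat \<Rightarrow> real" assume X: "\<forall>i. X i \<in> UNIV - {t0}" "X \<longlonglongrightarrow> t0"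
    \<comment> \<open>Only a tail of the sequence is known to stay within the radius; a shift does
      not change the limit.\<close>
    obtain N where N: "\<And>n. n \<ge> N \<Longrightarrow> \<bar>X n - t0\<bar> < \<delta>"
      using LIMSEQ_D[OF X(2) \<delta>] by auto
    have "(\<lambda>n. ((\<integral>x. f (X (n + N)) x \<partial>M) - (\<integral>x. f t0 x \<partial>M)) / (X (n + N) - t0)) \<longlonglongrightarrow> (\<integral>x. f' t0 x \<partial>M)"
      using key[of "\<lambda>n. X (n + N)"] X N LIMSEQ_ignore_initial_segment[OF X(2), of N] by simp
    then show "(\<lambda>n. ((\<integral>x. f (X n) x \<partial>M) - (\<integral>x. f t0 x \<partial>M)) / (X n - t0)) \<longlonglongrightarrow> (\<integral>x. f' t0 x \<partial>M)"
      by (rule LIMSEQ_offset)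
  qed
qed

lemma frechet_derivative_eqI: "(f has_derivative f') (at u) \<Longrightarrow> frechet_derivative f (at u) = f'"
  by (metis frechet_derivative_at)

lemma frechet_derivative_vanishing:
  assumes "open T" "u \<in> T" "\<And>v. v \<in> T \<Longrightarrow> f v = 0"
  shows "frechet_derivative f (at u) = (\<lambda>_. 0)"
  by (rule frechet_derivative_eqI, rule has_derivative_transform_within_open[OF _ assms(1,2), of "\<lambda>_. 0"])
    (use assms in auto)

text \<open>\<open>U\<close> and the complement of \<open>K\<close> form an open cover, and on each
  of the two the extension is visibly smooth.\<close>

lemma C_infinity_on_extend_zero:
  assumes "open U" "C_infinity_on f U" "closed K" "K \<subseteq> U" "\<And>u. u \<in> U - K \<Longrightarrow> f u = 0"
  shows "C_infinity_on (\<lambda>u. if u \<in> U then f u else 0) UNIV"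
proof (rule C_infinity_on_local)
  fix u
  show "\<exists>T. u \<in> T \<and> open T \<and> C_infinity_on (\<lambda>u. if u \<in> U then f u else 0) T"
  proof (cases "u \<in> U")
    case True
    have "C_infinity_on (\<lambda>u. if u \<in> U then f u else 0) U"
      using C_infinity_on_cong[OF assms(1), of "\<lambda>u. if u \<in> U then f u else 0" f] assms(2) by simp
    with True assms(1) show ?thesis by blast
  next
    case False
    have "C_infinity_on (\<lambda>u. if u \<in> U then f u else 0) (- K)"
      using C_infinity_on_cong[OF open_Compl[OF assms(3)], of "\<lambda>u. if u \<in> U then f u else 0" "\<lambda>_. 0"] assms(5)
      by auto
    with False assms(3,4) show ?thesis by (intro exI[of _ "- K"]) auto
  qed
qed

lemma integrable_compact_support:
  fixes h :: "'a::euclidean_space \<Rightarrow> real"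
  assumes "continuous_on U h" "compact K" "K \<subseteq> U" "\<And>u. u \<in> U - K \<Longrightarrow> h u = 0"
  shows "integrable lborel (\<lambda>u. indicator U u * h u)"
proof -
  have "integrable lborel (\<lambda>u. indicator K u *\<^sub>R h u)"
    by (rule borel_integrable_compact[OF assms(2) continuous_on_subset[OF assms(1,3)]])
  moreover have "(\<lambda>u. indicator K u *\<^sub>R h u) = (\<lambda>u. indicator U u * h u)"
    using assms(3,4) by (auto simp: indicator_def fun_eq_iff)
  ultimately show ?thesis by simp
qed

text \<open>By translation invariance of Lebesgue measure the integrals of the translates of
  \<open>G\<close> along \<open>e\<close> do not depend on the time \<open>t\<close>;
  differentiation under the integral at 0 gives the claim.\<close>

lemma integral_directional_derivative_zero:
  fixes G :: "'a::euclidean_space \<Rightarrow> real"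
  assumes G: "C_infinity_on G UNIV" and K: "compact K" "\<And>u. u \<notin> K \<Longrightarrow> G u = 0"
  shows "(\<integral>u. frechet_derivative G (at u) e \<partial>lborel) = 0"
proof -
  \<comment> \<open>\<open>K'\<close> contains every point that some translation with
    \<open>\<bar>t\<bar> < 1\<close> moves into \<open>K\<close>; it carries the dominating
    function.\<close>
  define K' where "K' = (\<lambda>(x, y). x - y) ` (K \<times> cball 0 (norm e))"
  have K': "compact K'" unfolding K'_def
    by (intro compact_continuous_image compact_Times K compact_cball) (auto intro!: continuous_intros simp: case_prod_beta)
  have inK': "u \<in> K'" if "u + t *\<^sub>R e \<in> K" "\<bar>t\<bar> < 1" for u t
  proof -
    have "norm (t *\<^sub>R e) \<le> 1 * norm e" unfolding norm_scaleR
      by (rule mult_right_mono) (use that in auto)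
    then show ?thesis unfolding K'_def
      by (intro image_eqI[of _ _ "(u + t *\<^sub>R e, t *\<^sub>R e)"]) (use that in auto)
  qed
  have G': "C_infinity_on (\<lambda>u. frechet_derivative G (at u) e) UNIV"
    using C_infinity_on_frechet[OF G] .
  have G'0: "frechet_derivative G (at u) e = 0" if "u \<notin> K" for u
    using frechet_derivative_vanishing[OF open_Compl[OF compact_imp_closed[OF K(1)]], of u G] that K(2) by simp
  have "compact ((\<lambda>u. frechet_derivative G (at u) e) ` K)"
    by (rule compact_continuous_image[OF continuous_on_subset[OF C_infinity_on_continuous[OF G'] subset_UNIV] K(1)])
  from compact_imp_bounded[OF this] obtain C where C: "\<And>u. u \<in> K \<Longrightarrow> \<bar>frechet_derivative G (at u) e\<bar> \<le> C"
    unfolding bounded_iff by auto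
  define f where "f t u = G (u + t *\<^sub>R e)" for t u
  have int: "integrable lborel (f t)" "integral\<^sup>L lborel (f t) = integral\<^sup>L lborel G" for t
  proof -
    have iG: "integrable lborel G"
      using integrable_compact_support[OF C_infinity_on_continuous[OF G] K(1)] K(2) by simp
    have "f t = (\<lambda>u. G (t *\<^sub>R e + u))" by (simp add: f_def fun_eq_iff add.commute)
    moreover have "integrable (distr lborel borel ((+) (t *\<^sub>R e))) G" using iG by (simp add: lborel_distr_plus)
    moreover have "integral\<^sup>L (distr lborel borel ((+) (t *\<^sub>R e))) G = integral\<^sup>L lborel G"
      by (simp add: lborel_distr_plus)
    moreover have "G \<in> borel_measurable borel" using iG by auto
    ultimately show "integrable lborel (f t)" "integral\<^sup>L lborel (f t) = integral\<^sup>L lborel G"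
      by (auto simp: integrable_distr_eq integral_distr)
  qed
  have "((\<lambda>t. \<integral>u. f t u \<partial>lborel) has_real_derivative (\<integral>u. frechet_derivative G (at (u + 0 *\<^sub>R e)) e \<partial>lborel)) (at 0)"
  proof (rule has_real_derivative_integral(1)[where \<delta>=1 and w="\<lambda>u. indicator K' u * C"
        and f'="\<lambda>t u. frechet_derivative G (at (u + t *\<^sub>R e)) e"])
    show "integrable lborel (f t)" for t by (rule int)
    show "((\<lambda>t. f t u) has_real_derivative frechet_derivative G (at (u + t *\<^sub>R e)) e) (at t)" for t u
      unfolding f_def by (rule DERIV_along_line) (use C_infinity_on_D[OF G] in auto)
    show "\<bar>frechet_derivative G (at (u + t *\<^sub>R e)) e\<bar> \<le> indicator K' u * C" if "\<bar>t - 0\<bar> < 1" for t u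
    proof (cases "u + t *\<^sub>R e \<in> K")
      case True
      then show ?thesis using C[OF True] inK'[OF True] that by simp
    next
      case False
      show ?thesis
      proof (cases "u \<in> K'")
        case True
        \<comment> \<open>The bound \<open>C\<close> is forced to be nonnegative only by a point of
          \<open>K\<close>, which the point of \<open>K'\<close> provides.\<close>
        then have "K \<noteq> {}" by (auto simp: K'_def)
        then have "C \<ge> 0" using C by fastforce
        then show ?thesis using G'0[OF False] by simp
      qed (use G'0[OF False] in simp)
    qed
    show "integrable lborel (\<lambda>u. indicator K' u * C)"
      using borel_integrable_compact[OF K' continuous_on_const, of C] by simp
  qed auto
  moreover have "((\<lambda>t. \<integral>u. f t u \<partial>lborel) has_real_derivative 0) (at 0)"
    by (simp add: int)
  ultimately show ?thesis using DERIV_unique by fastforce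
qed

definition divergence :: "(real ^ 'm::finite \<Rightarrow> real ^ 'm) \<Rightarrow> real ^ 'm \<Rightarrow> real" where
  "divergence F u = (\<Sum>i\<in>UNIV. frechet_derivative F (at u) (axis i 1) $ i)"

text \<open>After extension by zero, each component is a compactly supported smooth function on the
  whole space, and its partial derivative integrates to zero.\<close>

lemma integral_divergence_zero:
  fixes F :: "real ^ 'm::finite \<Rightarrow> real ^ 'm"
  assumes U: "open U" "C_infinity_on F U" and K: "compact K" "K \<subseteq> U" "\<And>u. u \<in> U - K \<Longrightarrow> F u = 0"
  shows "(\<integral>u. indicator U u * divergence F u \<partial>lborel) = 0"
proof -
  define F0 where "F0 u = (if u \<in> U then F u else 0)" for u
  have F0: "C_infinity_on F0 UNIV"
    unfolding F0_def by (rule C_infinity_on_extend_zero[OF U compact_imp_closed[OF K(1)] K(2,3)])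
  have F0i: "C_infinity_on (\<lambda>u. F0 u $ i) UNIV" for i
    by (intro C_infinity_on_vec_nth F0 open_UNIV)
  have F0K: "F0 u = 0" if "u \<notin> K" for u using that K by (auto simp: F0_def)
  have comp: "frechet_derivative (\<lambda>u. F0 u $ i) (at u) v = frechet_derivative F0 (at u) v $ i" for i u v
    by (rule fun_cong[OF frechet_derivative_eqI[OF bounded_linear.has_derivative[OF bounded_linear_vec_nth C_infinity_on_D[OF F0 UNIV_I]]]])
  have "indicator U u * divergence F u = (\<Sum>i\<in>UNIV. frechet_derivative (\<lambda>u. F0 u $ i) (at u) (axis i 1))" for u
  proof (cases "u \<in> U")
    case True
    have "frechet_derivative F0 (at u) = frechet_derivative F (at u)"
      by (rule frechet_derivative_eqI, rule has_derivative_transform_within_open[OF C_infinity_on_D[OF U(2) True] U(1) True])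
        (simp add: F0_def)
    then show ?thesis using True by (simp add: comp divergence_def)
  next
    case False
    then have "frechet_derivative F0 (at u) = (\<lambda>_. 0)"
      using frechet_derivative_vanishing[OF open_Compl[OF compact_imp_closed[OF K(1)]], of u F0] K(2) F0K by auto
    then show ?thesis using False by (simp add: comp)
  qed
  moreover have "integrable lborel (\<lambda>u. frechet_derivative (\<lambda>u. F0 u $ i) (at u) (axis i 1))" for i
  proof -
    have "frechet_derivative (\<lambda>u. F0 u $ i) (at u) (axis i 1) = 0" if "u \<notin> K" for u
      using frechet_derivative_vanishing[OF open_Compl[OF compact_imp_closed[OF K(1)]], of u "\<lambda>u. F0 u $ i"] that F0K
      by simp
    then show ?thesis
      using integrable_compact_support[OF C_infinity_on_continuous[OF C_infinity_on_frechet[OF F0i]] K(1), of i "axis i 1"] by simp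
  qed
  moreover have "(\<integral>u. frechet_derivative (\<lambda>u. F0 u $ i) (at u) (axis i 1) \<partial>lborel) = 0" for i
    by (rule integral_directional_derivative_zero[OF F0i K(1)]) (simp add: F0K)
  ultimately show ?thesis by simp
qed

section \<open>First and second variation in a coordinate patch\<close>

definition jet :: "(real ^ 'm::finite \<Rightarrow> 'e::euclidean_space) \<Rightarrow> real ^ 'm \<Rightarrow> 'e \<times> ('e ^ 'm)" where
  "jet z u = (z u, \<chi> i. frechet_derivative z (at u) (axis i 1))"

lemma C_infinity_on_jet: "open U \<Longrightarrow> C_infinity_on z U \<Longrightarrow> C_infinity_on (jet z) U"
  unfolding jet_def by (intro C_infinity_on_Pair C_infinity_on_vec C_infinity_on_frechet)

lemma frechet_derivative_axis_sum:
  fixes v :: "real ^ 'm::finite"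
  assumes "linear L"
  shows "L v = (\<Sum>i\<in>UNIV. v $ i *\<^sub>R L (axis i 1))"
proof -
  have "v = (\<Sum>i\<in>UNIV. v $ i *\<^sub>R axis i 1)"
    by (simp add: vec_eq_iff axis_def if_distrib cong: if_cong)
  then have "L v = L (\<Sum>i\<in>UNIV. v $ i *\<^sub>R axis i 1)" by simp
  then show ?thesis by (simp add: linear_sum[OF assms] linear_cmul[OF assms])
qed

lemma jet_add:
  assumes "y differentiable (at u)" "z differentiable (at u)"
  shows "jet (\<lambda>u. y u + z u) u = jet y u + jet z u"
  using frechet_derivative_eqI[OF has_derivative_add[OF frechet_derivative_works[THEN iffD1, OF assms(1)]
        frechet_derivative_works[THEN iffD1, OF assms(2)]]]
  by (simp add: jet_def vec_eq_iff)

lemma jet_scaleR: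
  assumes "z differentiable (at u)"
  shows "jet (\<lambda>u. c *\<^sub>R z u) u = c *\<^sub>R jet z u"
  using frechet_derivative_eqI[OF has_derivative_scaleR_right[OF frechet_derivative_works[THEN iffD1, OF assms]]]
  by (simp add: jet_def vec_eq_iff)

lemma jet_vanishing:
  assumes "open T" "u \<in> T" "\<And>v. v \<in> T \<Longrightarrow> z v = 0"
  shows "jet z u = 0"
  using frechet_derivative_vanishing[OF assms] assms by (simp add: jet_def vec_eq_iff zero_prod_def)

lemma frechet_derivative_jet:
  assumes "open U" "C_infinity_on z U" "u \<in> U"
  shows "frechet_derivative (jet z) (at u) v =
    (frechet_derivative z (at u) v,
     \<chi> i. frechet_derivative (\<lambda>u. frechet_derivative z (at u) (axis i 1)) (at u) v)"
proof -
  define d where "d = frechet_derivative (jet z) (at u)"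
  have d: "(jet z has_derivative d) (at u)"
    unfolding d_def by (rule C_infinity_on_D[OF C_infinity_on_jet[OF assms(1,2)] assms(3)])
  have "((\<lambda>u. fst (jet z u)) has_derivative (\<lambda>v. fst (d v))) (at u)"
    by (rule has_derivative_fst[OF d])
  then have 1: "frechet_derivative z (at u) = (\<lambda>v. fst (d v))"
    using frechet_derivative_eqI by (fastforce simp: jet_def)
  have "((\<lambda>u. snd (jet z u) $ i) has_derivative (\<lambda>v. snd (d v) $ i)) (at u)" for i
    by (intro bounded_linear.has_derivative[OF bounded_linear_vec_nth] has_derivative_snd[OF d])
  then have 2: "frechet_derivative (\<lambda>u. frechet_derivative z (at u) (axis i 1)) (at u) = (\<lambda>v. snd (d v) $ i)" for i
    using frechet_derivative_eqI by (fastforce simp: jet_def)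
  have "d v = (fst (d v), \<chi> i. snd (d v) $ i)" by simp
  then show ?thesis unfolding 1 2 d_def[symmetric] .
qed

text \<open>The Euler-Lagrange equation of \<open>lagr\<close>: the divergence of the momenta equals
  the derivative in the position, to which only the Gaussian factor contributes.\<close>

definition critical_on :: "(real ^ 'm::finite) set \<Rightarrow> (real ^ 'm \<Rightarrow> 'e::euclidean_space) \<Rightarrow> bool" where
  "critical_on U y \<longleftrightarrow> open U \<and> C_infinity_on y U \<and> jet y ` U \<subseteq> regular_jets \<and>
    (\<forall>u\<in>U. (\<Sum>i\<in>UNIV. frechet_derivative (\<lambda>u. momentum (jet y u) $ i) (at u) (axis i 1)) =
       - lagr (jet y u) *\<^sub>R y u)"

text \<open>
  The tangential part of the Euler--Lagrange equation holds for every immersion, since the Lagrangian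
  is invariant under reparametrisation; only the normal part has to be assumed.
\<close>

lemma critical_onI:
  fixes y :: "real ^ 'm::finite \<Rightarrow> 'e::euclidean_space"
  assumes U: "open U" and y: "C_infinity_on y U" and reg: "jet y ` U \<subseteq> regular_jets"
    and normal: "\<And>u n. u \<in> U \<Longrightarrow> (\<And>k. n \<bullet> snd (jet y u) $ k = 0) \<Longrightarrow>
      (\<Sum>i\<in>UNIV. \<Sum>k\<in>UNIV. matrix_inv (gram (snd (jet y u))) $ i $ k *\<^sub>R
         frechet_derivative (\<lambda>u. frechet_derivative y (at u) (axis k 1)) (at u) (axis i 1)) \<bullet> n = - (y u \<bullet> n)"
  shows "critical_on U y"
  unfolding critical_on_def
proof (intro conjI ballI U y reg)
  fix u assume u: "u \<in> U"
  have regu: "jet y v \<in> regular_jets" if "v \<in> U" for v using reg that by auto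
  define p where "p k v = frechet_derivative y (at v) (axis k 1)" for k v
  define P where "P i v = momentum (jet y v) $ i" for i v
  define L where "L v = lagr (jet y v)" for v
  define B where "B i k v = matrix_inv (gram (snd (jet y v))) $ i $ k" for i k v
  define d where "d f i = frechet_derivative f (at u) (axis i 1)" for f :: "real ^ 'm \<Rightarrow> 'e" and i
  have snd_jet: "snd (jet y v) $ k = p k v" for k v by (simp add: jet_def p_def)
  have Cj: "C_infinity_on (jet y) U" by (rule C_infinity_on_jet[OF U y])
  have Cp: "C_infinity_on (p k) U" for k unfolding p_def by (rule C_infinity_on_frechet[OF y])
  have CP: "C_infinity_on (P i) U" for i unfolding P_def
    by (intro C_infinity_on_vec_nth C_infinity_on_compose[OF U open_regular_jets Cj C_infinity_on_momentum reg] U)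
  have CL: "C_infinity_on L U" unfolding L_def
    by (rule C_infinity_on_compose[OF U open_regular_jets Cj C_infinity_on_lagr reg])
  have CB: "C_infinity_on (B i k) U" for i k unfolding B_def
    by (intro C_infinity_on_matrix_inv U regular_jets_det regu)
      (use C_infinity_on_compose[OF U open_UNIV Cj C_infinity_on_gram[OF open_UNIV]] in auto)
  note dp = C_infinity_on_D[OF Cp u] and dP = C_infinity_on_D[OF CP u] and dL = C_infinity_on_D[OF CL u]
  \<comment> \<open>\<open>E\<close> is the Euler-Lagrange residual; its tangential and its normal
    pairings are shown to vanish separately.\<close>
  define E where "E = (\<Sum>i\<in>UNIV. d (P i) i) + L u *\<^sub>R y u"
  have sym: "d (p k) i = d (p i) k" for i k
    unfolding d_def p_def by (rule second_derivative_symmetric[OF U u y])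
  have tang: "E \<bullet> p k u = 0" for k
  proof -
    have dLk: "frechet_derivative L (at u) (axis k 1) = (\<Sum>i\<in>UNIV. P i u \<bullet> d (p i) k) - L u * (y u \<bullet> p k u)"
    proof -
      have "(L has_derivative (\<lambda>v. dlagr (jet y u) (frechet_derivative (jet y) (at u) v))) (at u)"
        unfolding L_def
        by (rule has_derivative_compose[OF C_infinity_on_D[OF Cj u] has_derivative_lagr[OF regu[OF u]]])
      then have "frechet_derivative L (at u) (axis k 1) =
          dlagr (jet y u) (frechet_derivative (jet y) (at u) (axis k 1))"
        by (simp add: frechet_derivative_eqI)
      also have "\<dots> = (\<Sum>i\<in>UNIV. P i u \<bullet> d (p i) k) - L u * (y u \<bullet> p k u)"
        unfolding frechet_derivative_jet[OF U y u] dlagr_eq[OF regu[OF u]]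
        by (simp add: P_def d_def p_def[abs_def] L_def) (simp add: jet_def)
      finally show ?thesis .
    qed
    \<comment> \<open>The duality relation \<open>momentum_inner\<close>, differentiated in the i-th
      coordinate. Summed over \<open>i\<close> and compared with the chain rule for
      \<open>L\<close>, it leaves only the tangential pairing of \<open>E\<close>, because second
      derivatives are symmetric.\<close>
    have "d (P i) i \<bullet> p k u + P i u \<bullet> d (p k) i =
        (if i = k then frechet_derivative L (at u) (axis k 1) else 0)" for i
    proof -
      have "((\<lambda>v. P i v \<bullet> p k v) has_derivative
          (\<lambda>v. P i u \<bullet> frechet_derivative (p k) (at u) v + frechet_derivative (P i) (at u) v \<bullet> p k u)) (at u)"
        by (rule has_derivative_inner[OF dP dp])
      moreover have "((\<lambda>v. P i v \<bullet> p k v) has_derivative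
          (\<lambda>v. if i = k then frechet_derivative L (at u) v else 0)) (at u)"
      proof (rule has_derivative_transform_within_open[OF _ U u, where f="\<lambda>v. if i = k then L v else 0"])
        show "((\<lambda>v. if i = k then L v else 0) has_derivative
            (\<lambda>v. if i = k then frechet_derivative L (at u) v else 0)) (at u)"
          using dL by (cases "i = k") auto
        show "(if i = k then L v else 0) = P i v \<bullet> p k v" if "v \<in> U" for v
          using momentum_inner[OF regu[OF that], of i k] by (simp add: P_def snd_jet L_def)
      qed
      ultimately have "(\<lambda>v. P i u \<bullet> frechet_derivative (p k) (at u) v + frechet_derivative (P i) (at u) v \<bullet> p k u) =
          (\<lambda>v. if i = k then frechet_derivative L (at u) v else 0)"
        using has_derivative_unique by blast
      from fun_cong[OF this, of "axis i 1"] show ?thesis by (auto simp: d_def)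
    qed
    then have "(\<Sum>i\<in>UNIV. d (P i) i \<bullet> p k u + P i u \<bullet> d (p k) i) = frechet_derivative L (at u) (axis k 1)"
      by simp
    then have "(\<Sum>i\<in>UNIV. d (P i) i \<bullet> p k u) + (\<Sum>i\<in>UNIV. P i u \<bullet> d (p i) k) =
        (\<Sum>i\<in>UNIV. P i u \<bullet> d (p i) k) - L u * (y u \<bullet> p k u)"
      by (simp add: sum.distrib sym[of k] dLk)
    then show ?thesis by (simp add: E_def inner_add_left inner_sum_left)
  qed
  have norm: "E \<bullet> n = 0" if n: "\<And>k. n \<bullet> p k u = 0" for n
  proof -
    \<comment> \<open>The derivatives of \<open>L\<close> and of \<open>B i k\<close> come
      multiplied by \<open>p k u \<bullet> n\<close>, which is zero for a normal \<open>n\<close>;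
      only second derivatives of the immersion survive.\<close>
    have dPn: "d (P i) i \<bullet> n = L u * (\<Sum>k\<in>UNIV. B i k u * (d (p k) i \<bullet> n))" for i
    proof -
      have dB: "(B i k has_derivative frechet_derivative (B i k) (at u)) (at u)" for k
        by (rule C_infinity_on_D[OF CB u])
      have h1: "((\<lambda>v. L v * (\<Sum>k\<in>UNIV. B i k v * (p k v \<bullet> n))) has_derivative
         (\<lambda>v. L u * (\<Sum>k\<in>UNIV. B i k u * (frechet_derivative (p k) (at u) v \<bullet> n) +
                 frechet_derivative (B i k) (at u) v * (p k u \<bullet> n)) +
              frechet_derivative L (at u) v * (\<Sum>k\<in>UNIV. B i k u * (p k u \<bullet> n)))) (at u)"
        by (intro has_derivative_mult dL has_derivative_sum dB has_derivative_inner_left dp)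
      have h2: "(\<lambda>v. L v * (\<Sum>k\<in>UNIV. B i k v * (p k v \<bullet> n))) = (\<lambda>v. P i v \<bullet> n)"
        by (simp add: P_def momentum_def fun_eq_iff inner_sum_left snd_jet B_def L_def)
      have h3: "((\<lambda>v. P i v \<bullet> n) has_derivative (\<lambda>v. frechet_derivative (P i) (at u) v \<bullet> n)) (at u)"
        by (rule has_derivative_inner_left[OF dP])
      have n': "p k u \<bullet> n = 0" for k using n[of k] by (simp add: inner_commute)
      from fun_cong[OF has_derivative_unique[OF h3 h1[unfolded h2]], of "axis i 1"] show ?thesis
        by (simp add: d_def n')
    qed
    have "(\<Sum>i\<in>UNIV. \<Sum>k\<in>UNIV. B i k u *\<^sub>R d (p k) i) \<bullet> n = - (y u \<bullet> n)"
      using normal[OF u, of n] n by (simp add: snd_jet) (simp add: B_def d_def p_def[abs_def])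
    then have "(\<Sum>i\<in>UNIV. \<Sum>k\<in>UNIV. B i k u * (d (p k) i \<bullet> n)) = - (y u \<bullet> n)"
      by (simp add: inner_sum_left)
    then have "(\<Sum>i\<in>UNIV. d (P i) i \<bullet> n) = - L u * (y u \<bullet> n)"
      by (simp add: dPn flip: sum_distrib_left)
    then show ?thesis by (simp add: E_def inner_add_left inner_sum_left)
  qed
  \<comment> \<open>By \<open>tang\<close> the residual is itself normal, hence a legitimate choice
    of \<open>n\<close>.\<close>
  have "E \<bullet> E = 0" by (rule norm) (rule tang)
  then have "E = 0" by simp
  then show "(\<Sum>i\<in>UNIV. frechet_derivative (\<lambda>u. momentum (jet y u) $ i) (at u) (axis i 1)) =
       - lagr (jet y u) *\<^sub>R y u"
    unfolding E_def d_def P_def L_def by (simp add: eq_neg_iff_add_eq_0)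
qed

text \<open>By the Euler-Lagrange equation the first variation density is the divergence of the
  field whose components pair the momenta with \<open>W\<close>.\<close>

lemma first_variation_zero:
  fixes y :: "real ^ 'm::finite \<Rightarrow> 'e::euclidean_space"
  assumes crit: "critical_on U y" and W: "C_infinity_on W U"
    and K: "compact K" "K \<subseteq> U" "\<And>u. u \<in> U - K \<Longrightarrow> W u = 0"
  shows "(\<integral>u. indicator U u * dlagr (jet y u) (jet W u) \<partial>lborel) = 0"
proof -
  have U: "open U" and y: "C_infinity_on y U" and reg: "jet y ` U \<subseteq> regular_jets"
    using crit by (auto simp: critical_on_def)
  define P where "P i v = momentum (jet y v) $ i" for i v
  define F where "F v = (\<chi> i. P i v \<bullet> W v)" for v
  have CP: "C_infinity_on (P i) U" for i unfolding P_def
    by (intro C_infinity_on_vec_nth C_infinity_on_compose[OF U open_regular_jets C_infinity_on_jet[OF U y] C_infinity_on_momentum reg] U)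
  have CF: "C_infinity_on F U"
    unfolding F_def by (intro C_infinity_on_vec C_infinity_on_inner CP W U)
  have "divergence F u = dlagr (jet y u) (jet W u)" if u: "u \<in> U" for u
  proof -
    have "frechet_derivative F (at u) v $ i =
        P i u \<bullet> frechet_derivative W (at u) v + frechet_derivative (P i) (at u) v \<bullet> W u" for i v
    proof -
      have h1: "((\<lambda>u. F u $ i) has_derivative (\<lambda>v. frechet_derivative F (at u) v $ i)) (at u)"
        by (rule bounded_linear.has_derivative[OF bounded_linear_vec_nth C_infinity_on_D[OF CF u]])
      have h2: "((\<lambda>u. P i u \<bullet> W u) has_derivative
          (\<lambda>v. P i u \<bullet> frechet_derivative W (at u) v + frechet_derivative (P i) (at u) v \<bullet> W u)) (at u)"
        by (rule has_derivative_inner[OF C_infinity_on_D[OF CP u] C_infinity_on_D[OF W u]])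
      have h3: "(\<lambda>u. F u $ i) = (\<lambda>u. P i u \<bullet> W u)" by (simp add: F_def)
      show ?thesis by (rule fun_cong[OF has_derivative_unique[OF h1[unfolded h3] h2]])
    qed
    then have "divergence F u = (\<Sum>i\<in>UNIV. P i u \<bullet> frechet_derivative W (at u) (axis i 1)) +
        (\<Sum>i\<in>UNIV. frechet_derivative (P i) (at u) (axis i 1)) \<bullet> W u"
      by (simp add: divergence_def sum.distrib inner_sum_left)
    also have "(\<Sum>i\<in>UNIV. frechet_derivative (P i) (at u) (axis i 1)) = - lagr (jet y u) *\<^sub>R y u"
      using crit u by (simp add: critical_on_def P_def[abs_def])
    finally have "divergence F u = (\<Sum>i\<in>UNIV. P i u \<bullet> frechet_derivative W (at u) (axis i 1)) - lagr (jet y u) * (y u \<bullet> W u)"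
      by simp
    moreover have "jet y u \<in> regular_jets" "fst (jet y u) = y u" using reg u by (auto simp: jet_def)
    ultimately show ?thesis
      by (simp only: jet_def[of W] dlagr_eq P_def vec_lambda_beta)
  qed
  then have "(\<integral>u. indicator U u * dlagr (jet y u) (jet W u) \<partial>lborel) = (\<integral>u. indicator U u * divergence F u \<partial>lborel)"
    by (intro Bochner_Integration.integral_cong) (simp_all split: split_indicator)
  also have "\<dots> = 0"
  proof (rule integral_divergence_zero[OF U CF K(1,2)])
    show "F u = 0" if "u \<in> U - K" for u
      unfolding F_def K(3)[OF that] by (simp add: vec_eq_iff)
  qed
  finally show ?thesis .
qed

text \<open>Moving along \<open>T\<close> is an infinitesimal reparametrisation: by symmetry of
  second derivatives the jet of the resulting field is the derivative of the jet along
  \<open>T\<close> plus a term in which the derivative of \<open>T\<close> acts on the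
  velocities.\<close>

lemma jet_directional_derivative:
  fixes z :: "real ^ 'm::finite \<Rightarrow> 'e::euclidean_space" and T :: "real ^ 'm \<Rightarrow> real ^ 'm"
  assumes U: "open U" "u \<in> U" and z: "C_infinity_on z U" and T: "C_infinity_on T U"
  shows "jet (\<lambda>u. frechet_derivative z (at u) (T u)) u = frechet_derivative (jet z) (at u) (T u) +
    (0, \<chi> i. \<Sum>k\<in>UNIV. (frechet_derivative T (at u) (axis i 1)) $ k *\<^sub>R snd (jet z u) $ k)"
proof -
  define p where "p k v = frechet_derivative z (at v) (axis k 1)" for k v
  have Cp: "C_infinity_on (p k) U" for k unfolding p_def by (rule C_infinity_on_frechet[OF z])
  have lin: "linear (frechet_derivative z (at v))" if "v \<in> U" for v
    using C_infinity_on_D[OF z that] has_derivative_linear by blast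
  have Tk: "((\<lambda>u. T u $ k) has_derivative (\<lambda>v. frechet_derivative T (at u) v $ k)) (at u)" for k
    by (rule bounded_linear.has_derivative[OF bounded_linear_vec_nth C_infinity_on_D[OF T U(2)]])
  have "((\<lambda>u. \<Sum>k\<in>UNIV. T u $ k *\<^sub>R p k u) has_derivative
      (\<lambda>v. \<Sum>k\<in>UNIV. T u $ k *\<^sub>R frechet_derivative (p k) (at u) v + frechet_derivative T (at u) v $ k *\<^sub>R p k u)) (at u)"
    by (intro has_derivative_sum has_derivative_scaleR Tk C_infinity_on_D[OF Cp U(2)])
  then have "((\<lambda>u. frechet_derivative z (at u) (T u)) has_derivative
      (\<lambda>v. \<Sum>k\<in>UNIV. T u $ k *\<^sub>R frechet_derivative (p k) (at u) v + frechet_derivative T (at u) v $ k *\<^sub>R p k u)) (at u)"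
    by (rule has_derivative_transform_within_open[OF _ U])
      (simp add: frechet_derivative_axis_sum[OF lin, of _ "T _"] p_def)
  note fd = frechet_derivative_eqI[OF this]
  have sym: "frechet_derivative (p k) (at u) (axis i 1) = frechet_derivative (p i) (at u) (axis k 1)" for i k
    unfolding p_def by (rule second_derivative_symmetric[OF U z])
  have "linear (frechet_derivative (p i) (at u))" for i
    using C_infinity_on_D[OF Cp U(2)] has_derivative_linear by blast
  then have "(\<Sum>k\<in>UNIV. T u $ k *\<^sub>R frechet_derivative (p k) (at u) (axis i 1)) = frechet_derivative (p i) (at u) (T u)" for i
    unfolding sym[of _ i] by (rule frechet_derivative_axis_sum[symmetric])
  then show ?thesis
    unfolding jet_def[of "\<lambda>u. frechet_derivative z (at u) (T u)"] fd frechet_derivative_jet[OF U(1) z U(2)]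
    by (simp add: vec_eq_iff sum.distrib) (simp add: p_def[abs_def] jet_def)
qed

text \<open>Pointwise the mixed second variation is the divergence of \<open>F\<close> minus the
  first variation along \<open>W\<close>; \<open>ddlagr_reparametrize\<close> converts the terms
  containing the derivative of \<open>T\<close> into the trace term of that divergence. Both
  integrals vanish, the second one because \<open>y\<close> is critical and \<open>W\<close> is
  supported in \<open>K\<close>.\<close>

lemma second_variation_tangential_zero:
  fixes y \<omega> :: "real ^ 'm::finite \<Rightarrow> 'e::euclidean_space" and T :: "real ^ 'm \<Rightarrow> real ^ 'm"
  assumes crit: "critical_on U y" and T: "C_infinity_on T U" and \<omega>: "C_infinity_on \<omega> U"
    and K: "compact K" "K \<subseteq> U" "\<And>u. u \<in> U - K \<Longrightarrow> T u = 0"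
  shows "(\<integral>u. indicator U u * ddlagr (jet y u) (jet \<omega> u) (jet (\<lambda>u. frechet_derivative y (at u) (T u)) u) \<partial>lborel) = 0"
proof -
  have U: "open U" and y: "C_infinity_on y U" and reg: "jet y ` U \<subseteq> regular_jets"
    using crit by (auto simp: critical_on_def)
  define F where "F v = dlagr (jet y v) (jet \<omega> v) *\<^sub>R T v" for v
  define W where "W v = frechet_derivative \<omega> (at v) (T v)" for v
  note Cjy = C_infinity_on_jet[OF U y] and Cj\<omega> = C_infinity_on_jet[OF U \<omega>]
  have CF: "C_infinity_on F U"
    unfolding F_def by (intro C_infinity_on_scaleR T U C_infinity_on_dlagr Cjy Cj\<omega> reg)
  have lin: "linear (frechet_derivative f (at v))" if "C_infinity_on f U" "v \<in> U" for v and f :: "real ^ 'm \<Rightarrow> 'c::real_normed_vector"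
    using C_infinity_on_D[OF that] has_derivative_linear by blast
  have CW: "C_infinity_on W U"
  proof -
    have "C_infinity_on (\<lambda>v. \<Sum>k\<in>UNIV. T v $ k *\<^sub>R frechet_derivative \<omega> (at v) (axis k 1)) U"
      by (intro C_infinity_on_sum C_infinity_on_scaleR C_infinity_on_vec_nth T C_infinity_on_frechet \<omega> U)
    also have "?this \<longleftrightarrow> ?thesis"
      unfolding W_def by (rule C_infinity_on_cong[OF U]) (rule frechet_derivative_axis_sum[OF lin[OF \<omega>], symmetric])
    finally show ?thesis .
  qed
  have W0: "W v = 0" if "v \<in> U - K" for v
    using K(3)[OF that] lin[OF \<omega>, of v] that by (simp add: W_def linear_0)
  have id: "ddlagr (jet y u) (jet \<omega> u) (jet (\<lambda>u. frechet_derivative y (at u) (T u)) u) =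
      divergence F u - dlagr (jet y u) (jet W u)" if u: "u \<in> U" for u
  proof -
    define j k where "j = jet y u" and "k = jet \<omega> u"
    have regj: "j \<in> regular_jets" using reg u by (auto simp: j_def)
    define jy where "jy = frechet_derivative (jet y) (at u)"
    define j\<omega> where "j\<omega> = frechet_derivative (jet \<omega>) (at u)"
    define B where "B i l = frechet_derivative T (at u) (axis i 1) $ l" for i l
    have "((\<lambda>u. dlagr (jet y u) (jet \<omega> u)) has_derivative (\<lambda>v. ddlagr j k (jy v) + dlagr j (j\<omega> v))) (at u)"
      unfolding j_def k_def jy_def j\<omega>_def
      by (rule has_derivative_dlagr[OF C_infinity_on_D[OF Cjy u] C_infinity_on_D[OF Cj\<omega> u] U u]) (use reg in auto)
    from has_derivative_scaleR[OF this C_infinity_on_D[OF T u]]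
    have "frechet_derivative F (at u) =
      (\<lambda>v. dlagr j k *\<^sub>R frechet_derivative T (at u) v + (ddlagr j k (jy v) + dlagr j (j\<omega> v)) *\<^sub>R T u)"
      unfolding F_def j_def k_def by (rule frechet_derivative_eqI)
    then have "divergence F u = dlagr j k * (\<Sum>i\<in>UNIV. B i i) +
        (\<Sum>i\<in>UNIV. T u $ i *\<^sub>R (ddlagr j k (jy (axis i 1)) + dlagr j (j\<omega> (axis i 1))))"
      by (simp add: divergence_def B_def sum.distrib sum_distrib_left mult.commute)
    also have "(\<Sum>i\<in>UNIV. T u $ i *\<^sub>R (ddlagr j k (jy (axis i 1)) + dlagr j (j\<omega> (axis i 1)))) =
        ddlagr j k (jy (T u)) + dlagr j (j\<omega> (T u))"
    proof (rule frechet_derivative_axis_sum[symmetric])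
      have "linear (\<lambda>v. ddlagr j k (jy v))" "linear (\<lambda>v. dlagr j (j\<omega> v))"
        using linear_compose[OF lin[OF Cjy u] linear_ddlagr[OF regj]] linear_compose[OF lin[OF Cj\<omega> u] linear_dlagr[OF regj]]
        by (auto simp: comp_def jy_def j\<omega>_def)
      then show "linear (\<lambda>v. ddlagr j k (jy v) + dlagr j (j\<omega> v))" by (rule linear_compose_add)
    qed
    finally have div: "divergence F u = dlagr j k * (\<Sum>i\<in>UNIV. B i i) + (ddlagr j k (jy (T u)) + dlagr j (j\<omega> (T u)))" .
    have "ddlagr j k (jet (\<lambda>u. frechet_derivative y (at u) (T u)) u) =
        ddlagr j k (jy (T u)) + ddlagr j k (0, \<chi> i. \<Sum>l\<in>UNIV. B i l *\<^sub>R snd j $ l)"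
      unfolding jet_directional_derivative[OF U u y T] linear_add[OF linear_ddlagr[OF regj]]
      by (simp add: jy_def B_def j_def)
    moreover have "dlagr j (jet W u) = dlagr j (j\<omega> (T u)) + dlagr j (0, \<chi> i. \<Sum>l\<in>UNIV. B i l *\<^sub>R snd k $ l)"
      unfolding W_def jet_directional_derivative[OF U u \<omega> T] linear_add[OF linear_dlagr[OF regj]]
      by (simp add: j\<omega>_def B_def k_def)
    ultimately show ?thesis
      using ddlagr_reparametrize[OF regj, of k B] div by (simp add: j_def[symmetric] k_def[symmetric] mult.commute)
  qed
  have int1: "integrable lborel (\<lambda>u. indicator U u * divergence F u)"
  proof (rule integrable_compact_support[OF _ K(1,2)])
    show "continuous_on U (divergence F)"
      unfolding divergence_def
      by (intro C_infinity_on_continuous C_infinity_on_sum C_infinity_on_vec_nth C_infinity_on_frechet CF U)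
    show "divergence F u = 0" if "u \<in> U - K" for u
    proof -
      have "frechet_derivative F (at u) = (\<lambda>_. 0)"
        by (rule frechet_derivative_vanishing[of "U - K"])
          (use that U K compact_imp_closed in \<open>auto simp: F_def\<close>)
      then show ?thesis by (simp add: divergence_def)
    qed
  qed
  have int2: "integrable lborel (\<lambda>u. indicator U u * dlagr (jet y u) (jet W u))"
  proof (rule integrable_compact_support[OF _ K(1,2)])
    show "continuous_on U (\<lambda>u. dlagr (jet y u) (jet W u))"
      by (intro C_infinity_on_continuous C_infinity_on_dlagr U Cjy C_infinity_on_jet CW reg)
    show "dlagr (jet y u) (jet W u) = 0" if "u \<in> U - K" for u
    proof -
      have "jet W u = 0"
        by (rule jet_vanishing[of "U - K"]) (use that U K compact_imp_closed W0 in auto)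
      then show ?thesis using linear_0[OF linear_dlagr[of "jet y u"]] reg that by auto
    qed
  qed
  have "(\<integral>u. indicator U u * ddlagr (jet y u) (jet \<omega> u) (jet (\<lambda>u. frechet_derivative y (at u) (T u)) u) \<partial>lborel) =
      (\<integral>u. indicator U u * divergence F u - indicator U u * dlagr (jet y u) (jet W u) \<partial>lborel)"
    by (intro Bochner_Integration.integral_cong) (simp_all add: id split: split_indicator)
  also have "\<dots> = (\<integral>u. indicator U u * divergence F u \<partial>lborel) - (\<integral>u. indicator U u * dlagr (jet y u) (jet W u) \<partial>lborel)"
    by (rule Bochner_Integration.integral_diff[OF int1 int2])
  also have "\<dots> = 0"
  proof -
    have "F v = 0" if "v \<in> U - K" for v by (simp add: F_def K(3)[OF that])
    from integral_divergence_zero[OF U CF K(1,2) this] first_variation_zero[OF crit CW K(1,2) W0]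
    show ?thesis by simp
  qed
  finally show ?thesis .
qed

section \<open>Change of variables for nonnegative integrals\<close>

text \<open>
  The library proves the change of variables theorem for index types of class \<open>wellorder\<close> only.
  The following copy of a finite type is well-ordered and serves to remove that restriction.
\<close>

typedef 'm ordered_copy = "{..<CARD('m::finite)}"
  by (rule exI[of _ 0]) simp

instantiation ordered_copy :: (finite) wellorder
begin

definition less_eq_ordered_copy :: "'a ordered_copy \<Rightarrow> 'a ordered_copy \<Rightarrow> bool" where
  "less_eq_ordered_copy x y \<longleftrightarrow> Rep_ordered_copy x \<le> Rep_ordered_copy y"

definition less_ordered_copy :: "'a ordered_copy \<Rightarrow> 'a ordered_copy \<Rightarrow> bool" where
  "less_ordered_copy x y \<longleftrightarrow> Rep_ordered_copy x < Rep_ordered_copy y"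

instance
proof
  fix P :: "'a ordered_copy \<Rightarrow> bool" and a
  assume *: "\<And>x. (\<And>y. y < x \<Longrightarrow> P y) \<Longrightarrow> P x"
  show "P a"
    by (induction a rule: measure_induct_rule[of Rep_ordered_copy]) (rule *, simp add: less_ordered_copy_def)
qed (auto simp: less_eq_ordered_copy_def less_ordered_copy_def Rep_ordered_copy_inject)

end

instance ordered_copy :: (finite) finite
proof
  have "finite (Abs_ordered_copy ` {..<CARD('a)} :: 'a ordered_copy set)" by simp
  then show "finite (UNIV :: 'a ordered_copy set)"
    using type_definition.univ[OF type_definition_ordered_copy] by metis
qed

lemma bij_ordered_copy: "\<exists>h :: 'm::finite ordered_copy \<Rightarrow> 'm. bij h"
proof -
  have "CARD('m ordered_copy) = CARD('m)"
    using type_definition.card[OF type_definition_ordered_copy] by simp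
  then show ?thesis
    using finite_same_card_bij[of "UNIV :: 'm ordered_copy set" "UNIV :: 'm set"] by simp
qed

text \<open>Conjugation by \<open>h\<close> is a sign-preserving bijection between the permutations
  of the two index types, so the Leibniz sums agree term by term.\<close>

lemma det_reindex:
  fixes A :: "real ^ 'm::finite ^ 'm" and h :: "'k::finite \<Rightarrow> 'm"
  assumes "bij h"
  shows "det (\<chi> i j. A $ h i $ h j) = det A"
proof -
  let ?F = "map_permutation UNIV h"
  have inj: "inj h" using assms bij_is_inj by blast
  have bij: "bij_betw ?F {p. p permutes UNIV} {p. p permutes UNIV}"
  proof (rule bij_betw_byWitness[where f'="map_permutation UNIV (inv h)"])
    have ih: "bij_betw h UNIV UNIV" "bij_betw (inv h) UNIV UNIV" using assms bij_imp_bij_inv by auto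
    show "\<forall>a\<in>{p. p permutes UNIV}. map_permutation UNIV (inv h) (?F a) = a"
      using map_permutation_compose_inv[OF ih(1)] by (simp add: inv_f_f[OF inj])
    show "\<forall>a\<in>{p. p permutes UNIV}. ?F (map_permutation UNIV (inv h) a) = a"
      using map_permutation_compose_inv[OF ih(2)] by (simp add: surj_f_inv_f[OF bij_is_surj[OF assms]])
    show "?F ` {p. p permutes UNIV} \<subseteq> {p. p permutes UNIV}"
      using map_permutation_permutes[OF ih(1)] by auto
    show "map_permutation UNIV (inv h) ` {p. p permutes UNIV} \<subseteq> {p. p permutes UNIV}"
      using map_permutation_permutes[OF ih(2)] by auto
  qed
  have "det A = (\<Sum>p\<in>{p. p permutes UNIV}. of_int (sign (?F p)) * (\<Prod>i\<in>UNIV. A $ i $ ?F p i))"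
    unfolding det_def by (rule sum.reindex_bij_betw[OF bij, symmetric])
  also have "\<dots> = (\<Sum>p\<in>{p. p permutes UNIV}. of_int (sign p) * (\<Prod>i\<in>UNIV. A $ h i $ h (p i)))"
  proof (rule sum.cong[OF refl])
    fix p :: "'k \<Rightarrow> 'k" assume "p \<in> {p. p permutes UNIV}"
    then have "sign (?F p) = sign p" using sign_map_permutation[OF inj] by simp
    moreover have "(\<Prod>i\<in>UNIV. A $ i $ ?F p i) = (\<Prod>i\<in>UNIV. A $ h i $ ?F p (h i))"
      by (rule prod.reindex_bij_betw[OF assms, symmetric])
    ultimately show "of_int (sign (?F p)) * (\<Prod>i\<in>UNIV. A $ i $ ?F p i) =
        of_int (sign p) * (\<Prod>i\<in>UNIV. A $ h i $ h (p i))"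
      by (simp add: map_permutation_apply[OF inj])
  qed
  finally show ?thesis by (simp add: det_def)
qed

text \<open>A passage from nonnegative integrals of Borel functions to gauge integrals that includes
  the infinite case; it is applied to both sides of the change of variables formula.\<close>

lemma nn_integral_lborel_eq_set_integrable:
  fixes f :: "'a::euclidean_space \<Rightarrow> real"
  assumes "(\<lambda>v. indicator A v * f v) \<in> borel_measurable borel" "\<And>v. v \<in> A \<Longrightarrow> 0 \<le> f v"
  shows "(\<integral>\<^sup>+v. ennreal (indicator A v * f v) \<partial>lborel) =
    (if f absolutely_integrable_on A then ennreal (integral A f) else \<infinity>)"
proof -
  have nn: "0 \<le> indicator A v * f v" for v using assms(2) by (auto simp: indicator_def)
  have iff: "f absolutely_integrable_on A \<longleftrightarrow> integrable lborel (\<lambda>v. indicator A v * f v)"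
    unfolding set_integrable_def using integrable_completion[of "\<lambda>v. indicator A v * f v" lborel] assms(1) by simp
  show ?thesis
  proof (cases "f absolutely_integrable_on A")
    case True
    then have "(\<integral>\<^sup>+v. ennreal (indicator A v * f v) \<partial>lborel) = ennreal (\<integral>v. indicator A v * f v \<partial>lborel)"
      using nn_integral_eq_integral[of lborel "\<lambda>v. indicator A v * f v"] nn iff by simp
    moreover have "(\<integral>v. indicator A v * f v \<partial>lborel) = integral A f"
      using set_lebesgue_integral_eq_integral(2)[OF True] integral_completion[of "\<lambda>v. indicator A v * f v" lborel] assms(1)
      by (simp add: set_lebesgue_integral_def)
    ultimately show ?thesis using True by simp
  next
    case False
    then have "\<not> (\<integral>\<^sup>+v. ennreal (indicator A v * f v) \<partial>lborel) < \<infinity>"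
      using integrableI_nonneg[of "\<lambda>v. indicator A v * f v" lborel] assms(1) nn iff by auto
    then show ?thesis using False by (simp add: not_less top_unique)
  qed
qed

lemma nn_integral_change_of_variables_wellorder:
  fixes \<psi> :: "real ^ 'm::{finite,wellorder} \<Rightarrow> real ^ 'm::_" and f :: "real ^ 'm::_ \<Rightarrow> real"
  assumes S: "S \<in> sets borel"
    and \<psi>: "\<And>u. u \<in> S \<Longrightarrow> (\<psi> has_derivative \<psi>' u) (at u)" and inj: "inj_on \<psi> S"
    and f: "\<And>v. v \<in> \<psi> ` S \<Longrightarrow> 0 \<le> f v"
    and meas: "(\<lambda>v. indicator (\<psi> ` S) v * f v) \<in> borel_measurable borel"
      "(\<lambda>u. indicator S u * (\<bar>det (matrix (\<psi>' u))\<bar> * f (\<psi> u))) \<in> borel_measurable borel"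
  shows "(\<integral>\<^sup>+v. ennreal (indicator (\<psi> ` S) v * f v) \<partial>lborel) =
    (\<integral>\<^sup>+u. ennreal (indicator S u * (\<bar>det (matrix (\<psi>' u))\<bar> * f (\<psi> u))) \<partial>lborel)"
proof -
  let ?g = "\<lambda>u. \<bar>det (matrix (\<psi>' u))\<bar> * f (\<psi> u)"
  \<comment> \<open>\<open>has_absolute_integral_change_of_variables\<close> concerns functions into
    a coordinate space, so real functions are wrapped as vectors with one component.\<close>
  let ?vec = "\<lambda>r. (\<chi> i. r) :: real ^ 1"
  have vec: "(\<lambda>u. ?vec (k u)) absolutely_integrable_on A \<longleftrightarrow> k absolutely_integrable_on A"
    for k :: "real ^ 'm::_ \<Rightarrow> real" and A
    unfolding absolutely_integrable_componentwise_iff[where f="\<lambda>u. ?vec (k u)"]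
    by (simp add: Basis_vec_def inner_axis)
  have ivec: "integral A (\<lambda>u. ?vec (k u)) = ?vec (integral A k)" if "k absolutely_integrable_on A"
    for k :: "real ^ 'm::_ \<Rightarrow> real" and A
  proof -
    have "integral A (\<lambda>u. ?vec (k u)) $ i = integral A k" for i
      using integral_component_eq_cart[of "\<lambda>u. ?vec (k u)" A i] set_lebesgue_integral_eq_integral(1)[OF vec[THEN iffD2, OF that]]
      by simp
    then show ?thesis by (simp add: vec_eq_iff)
  qed
  have cv: "(\<lambda>u. ?vec (?g u)) absolutely_integrable_on S \<and> integral S (\<lambda>u. ?vec (?g u)) = b \<longleftrightarrow>
      (\<lambda>v. ?vec (f v)) absolutely_integrable_on (\<psi> ` S) \<and> integral (\<psi> ` S) (\<lambda>v. ?vec (f v)) = b" for b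
  proof -
    have "(\<lambda>u. \<bar>det (matrix (\<psi>' u))\<bar> *\<^sub>R ?vec (f (\<psi> u))) = (\<lambda>u. ?vec (?g u))"
      by (simp add: vec_eq_iff fun_eq_iff)
    moreover have "S \<in> sets lebesgue" using S by auto
    from has_absolute_integral_change_of_variables[OF this has_derivative_at_withinI[OF \<psi>] inj, of "\<lambda>v. ?vec (f v)" b]
    have "(\<lambda>u. \<bar>det (matrix (\<psi>' u))\<bar> *\<^sub>R ?vec (f (\<psi> u))) absolutely_integrable_on S \<and>
        integral S (\<lambda>u. \<bar>det (matrix (\<psi>' u))\<bar> *\<^sub>R ?vec (f (\<psi> u))) = b \<longleftrightarrow>
      (\<lambda>v. ?vec (f v)) absolutely_integrable_on (\<psi> ` S) \<and> integral (\<psi> ` S) (\<lambda>v. ?vec (f v)) = b" .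
    ultimately show ?thesis by (simp only:)
  qed
  \<comment> \<open>The equivalence \<open>cv\<close> holds for every candidate value
    \<open>b\<close>; inserting the integral of either side gives one implication each.\<close>
  have iff: "?g absolutely_integrable_on S \<longleftrightarrow> f absolutely_integrable_on (\<psi> ` S)"
    using cv[of "integral S (\<lambda>u. ?vec (?g u))"] cv[of "integral (\<psi> ` S) (\<lambda>v. ?vec (f v))"]
    unfolding vec by argo
  have eq: "integral S ?g = integral (\<psi> ` S) f" if that: "f absolutely_integrable_on (\<psi> ` S)"
  proof -
    have g: "?g absolutely_integrable_on S" using iff that by (simp only:)
    have "integral S (\<lambda>u. ?vec (?g u)) = integral (\<psi> ` S) (\<lambda>v. ?vec (f v))"
      using cv[of "integral (\<psi> ` S) (\<lambda>v. ?vec (f v))"] that unfolding vec by argo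
    then show ?thesis unfolding ivec[OF g] ivec[OF that] by (simp add: vec_eq_iff)
  qed
  have nn: "0 \<le> ?g u" if "u \<in> S" for u using f that by simp
  have 1: "(\<integral>\<^sup>+v. ennreal (indicator (\<psi> ` S) v * f v) \<partial>lborel) =
      (if f absolutely_integrable_on (\<psi> ` S) then ennreal (integral (\<psi> ` S) f) else \<infinity>)"
    by (rule nn_integral_lborel_eq_set_integrable[OF meas(1)]) (rule f)
  have 2: "(\<integral>\<^sup>+u. ennreal (indicator S u * ?g u) \<partial>lborel) =
      (if ?g absolutely_integrable_on S then ennreal (integral S ?g) else \<infinity>)"
    by (rule nn_integral_lborel_eq_set_integrable[OF meas(2)]) (rule nn)
  show ?thesis
    unfolding 1 2 iff using eq by (simp cong: if_cong)
qed

text \<open>Relabelling coordinates pulls boxes back to boxes with the same side lengths, and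
  Lebesgue measure is determined by its values on boxes.\<close>

lemma lborel_reindex:
  fixes h :: "'m::finite \<Rightarrow> 'k::finite"
  assumes "bij h"
  shows "distr lborel borel (\<lambda>v :: real ^ 'k. (\<chi> i. v $ h i) :: real ^ 'm) = lborel"
proof (rule lborel_eqI[symmetric])
  let ?R = "\<lambda>v :: real ^ 'k. (\<chi> i. v $ h i) :: real ^ 'm"
  have meas: "?R \<in> borel_measurable lborel"
  proof -
    have "linear ?R" by (rule linearI) (simp_all add: vec_eq_iff)
    then have "continuous_on UNIV ?R" by (rule linear_continuous_on[OF linear_conv_bounded_linear[THEN iffD1]])
    then show ?thesis using borel_measurable_continuous_onI by auto
  qed
  have surj: "surj h" using assms bij_is_surj by blast
  fix l u :: "real ^ 'm" assume lu: "\<And>b. b \<in> Basis \<Longrightarrow> l \<bullet> b \<le> u \<bullet> b"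
  define l' u' :: "real ^ 'k" where "l' = (\<chi> k. l $ inv h k)" and "u' = (\<chi> k. u $ inv h k)"
  have lu': "l $ i \<le> u $ i" for i using lu[of "axis i 1"] by (simp add: inner_axis)
  have prod: "(\<Prod>b\<in>Basis. (c :: real ^ 'z::finite) \<bullet> b) = (\<Prod>i\<in>UNIV. c $ i)" for c :: "real ^ 'z"
  proof -
    have "(\<Prod>b\<in>range (\<lambda>i. axis i 1). c \<bullet> b) = (\<Prod>i\<in>UNIV. c \<bullet> axis i 1)"
      by (subst prod.reindex) (auto simp: inj_on_def axis_eq_axis)
    moreover have "(Basis :: (real ^ 'z) set) = range (\<lambda>i. axis i 1)" by (auto simp: Basis_vec_def)
    ultimately show ?thesis by (simp add: inner_axis)
  qed
  have "?R -` box l u = box l' u'"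
  proof (rule set_eqI)
    fix v :: "real ^ 'k"
    have "v \<in> ?R -` box l u \<longleftrightarrow> (\<forall>i. l $ i < v $ h i \<and> v $ h i < u $ i)" by (simp add: mem_box_cart)
    also have "\<dots> \<longleftrightarrow> (\<forall>k. l $ inv h k < v $ k \<and> v $ k < u $ inv h k)"
      by (metis assms bij_inv_eq_iff)
    finally show "v \<in> ?R -` box l u \<longleftrightarrow> v \<in> box l' u'" by (simp add: mem_box_cart l'_def u'_def)
  qed
  then have "emeasure (distr lborel borel ?R) (box l u) = emeasure lborel (box l' u')"
    using meas by (simp add: emeasure_distr)
  also have "\<dots> = (\<Prod>b\<in>Basis. (u' - l') \<bullet> b)"
    by (rule emeasure_lborel_box) (auto simp: Basis_vec_def inner_axis l'_def u'_def lu')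
  also have "(\<Prod>b\<in>Basis. (u' - l') \<bullet> b) = (\<Prod>k\<in>UNIV. (u - l) $ inv h k)"
    unfolding prod by (simp add: l'_def u'_def)
  also have "\<dots> = (\<Prod>i\<in>UNIV. (u - l) $ i)"
    by (rule prod.reindex_bij_betw[OF bij_imp_bij_inv[OF assms]])
  finally show "emeasure (distr lborel borel ?R) (box l u) = (\<Prod>b\<in>Basis. (u - l) \<bullet> b)"
    unfolding prod .
qed simp

text \<open>The map \<psi> is conjugated with the coordinate relabelling \<open>R\<close> into the
  well-ordered index type; relabelling preserves Lebesgue measure and, by
  \<open>det_reindex\<close>, the Jacobian determinant.\<close>

lemma nn_integral_change_of_variables:
  fixes \<psi> :: "real ^ 'm::finite \<Rightarrow> real ^ 'm" and f :: "real ^ 'm \<Rightarrow> real"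
  assumes S: "S \<in> sets borel"
    and \<psi>: "\<And>u. u \<in> S \<Longrightarrow> (\<psi> has_derivative \<psi>' u) (at u)" and inj: "inj_on \<psi> S"
    and f: "\<And>v. v \<in> \<psi> ` S \<Longrightarrow> 0 \<le> f v"
    and meas: "(\<lambda>v. indicator (\<psi> ` S) v * f v) \<in> borel_measurable borel"
      "(\<lambda>u. indicator S u * (\<bar>det (matrix (\<psi>' u))\<bar> * f (\<psi> u))) \<in> borel_measurable borel"
  shows "(\<integral>\<^sup>+v. ennreal (indicator (\<psi> ` S) v * f v) \<partial>lborel) =
    (\<integral>\<^sup>+u. ennreal (indicator S u * (\<bar>det (matrix (\<psi>' u))\<bar> * f (\<psi> u))) \<partial>lborel)"
proof -
  obtain h :: "'m ordered_copy \<Rightarrow> 'm" where h: "bij h" using bij_ordered_copy by blast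
  define R :: "real ^ 'm \<Rightarrow> real ^ 'm ordered_copy" where "R u = (\<chi> k. u $ h k)" for u
  define R' :: "real ^ 'm ordered_copy \<Rightarrow> real ^ 'm" where "R' v = (\<chi> i. v $ inv h i)" for v
  have RR': "R (R' v) = v" "R' (R u) = u" for u v
    using h by (auto simp: R_def R'_def vec_eq_iff inv_f_f[OF bij_is_inj] surj_f_inv_f[OF bij_is_surj])
  have linR: "bounded_linear R" "bounded_linear R'"
    unfolding R_def R'_def linear_conv_bounded_linear[symmetric]
    by (auto intro!: linearI simp: vec_eq_iff)
  have contR: "continuous_on A R" "continuous_on B R'" for A B
    using linR bounded_linear.continuous_on[OF _ continuous_on_id] by auto
  have [measurable]: "R \<in> borel_measurable borel" "R' \<in> borel_measurable borel"
    using contR borel_measurable_continuous_onI by auto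
  have lR': "distr lborel borel R' = lborel"
    using lborel_reindex[OF bij_imp_bij_inv[OF h]] by (simp add: R'_def[abs_def])
  have transfer: "(\<integral>\<^sup>+v. ennreal (k v) \<partial>lborel) = (\<integral>\<^sup>+w. ennreal (k (R' w)) \<partial>lborel)"
    if [measurable]: "k \<in> borel_measurable borel" for k :: "real ^ 'm \<Rightarrow> real"
    by (subst lR'[symmetric], subst nn_integral_distr) auto
  define S1 where "S1 = R ` S"
  define \<psi>1 where "\<psi>1 v = R (\<psi> (R' v))" for v
  define \<psi>1' where "\<psi>1' v w = R (\<psi>' (R' v) (R' w))" for v w
  define f1 where "f1 v = f (R' v)" for v
  have inR: "v \<in> R ` A \<longleftrightarrow> R' v \<in> A" for v A
    using RR' by (metis image_iff)
  then have inS1: "v \<in> S1 \<longleftrightarrow> R' v \<in> S" for v unfolding S1_def .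
  have "S1 = R' -` S \<inter> space borel" using inS1 by auto
  then have S1: "S1 \<in> sets borel" using measurable_sets[of R' borel borel S] S by auto
  have im: "v \<in> \<psi>1 ` S1 \<longleftrightarrow> R' v \<in> \<psi> ` S" for v
  proof -
    have "\<psi>1 ` S1 = R ` (\<psi> ` S)" unfolding \<psi>1_def S1_def image_image RR' ..
    then show ?thesis using inR by simp
  qed
  have det: "det (matrix (\<psi>1' v)) = det (matrix (\<psi>' (R' v)))" if "R' v \<in> S" for v
  proof -
    have Rax: "R' (axis k 1) = axis (h k) 1" for k
    proof -
      have "inv h i = k \<longleftrightarrow> i = h k" for i using bij_inv_eq_iff[OF h, of k i] by auto
      then show ?thesis by (simp add: R'_def axis_def vec_eq_iff)
    qed
    have "matrix (\<psi>1' v) = (\<chi> i j. matrix (\<psi>' (R' v)) $ h i $ h j)"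
      by (simp add: matrix_def \<psi>1'_def R_def Rax vec_eq_iff)
    then show ?thesis using det_reindex[OF h, of "matrix (\<psi>' (R' v))"] by (simp only:)
  qed
  have "(\<integral>\<^sup>+v. ennreal (indicator (\<psi>1 ` S1) v * f1 v) \<partial>lborel) =
    (\<integral>\<^sup>+u. ennreal (indicator S1 u * (\<bar>det (matrix (\<psi>1' u))\<bar> * f1 (\<psi>1 u))) \<partial>lborel)"
  proof (rule nn_integral_change_of_variables_wellorder[OF S1])
    show "(\<psi>1 has_derivative \<psi>1' u) (at u)" if "u \<in> S1" for u
      unfolding \<psi>1_def \<psi>1'_def
      by (rule bounded_linear.has_derivative[OF linR(1)],
          rule has_derivative_compose[OF bounded_linear_imp_has_derivative[OF linR(2)] \<psi>])
        (use that inS1 in auto)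
    show "inj_on \<psi>1 S1"
    proof (rule inj_onI)
      fix a b assume ab: "a \<in> S1" "b \<in> S1" "\<psi>1 a = \<psi>1 b"
      then have "R' (\<psi>1 a) = R' (\<psi>1 b)" by simp
      then have "\<psi> (R' a) = \<psi> (R' b)" by (simp add: \<psi>1_def RR')
      then have "R' a = R' b" using ab inS1 inj by (auto dest: inj_onD)
      then show "a = b" using RR'(1) by metis
    qed
    show "0 \<le> f1 v" if "v \<in> \<psi>1 ` S1" for v using that f by (simp add: im f1_def)
    have "(\<lambda>v. indicator (\<psi> ` S) (R' v) * f (R' v)) \<in> borel_measurable borel"
      using meas(1) measurable_compose[of R' borel borel "\<lambda>v. indicator (\<psi> ` S) v * f v"] by simp
    moreover have "(\<lambda>v. indicator (\<psi> ` S) (R' v) * f (R' v)) = (\<lambda>v. indicator (\<psi>1 ` S1) v * f1 v)"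
      using im by (auto simp: f1_def indicator_def fun_eq_iff)
    ultimately show "(\<lambda>v. indicator (\<psi>1 ` S1) v * f1 v) \<in> borel_measurable borel" by simp
    let ?k = "\<lambda>u. indicator S u * (\<bar>det (matrix (\<psi>' u))\<bar> * f (\<psi> u))"
    have "(\<lambda>v. ?k (R' v)) \<in> borel_measurable borel"
      using meas(2) measurable_compose[of R' borel borel ?k] by simp
    moreover have "(\<lambda>v. ?k (R' v)) = (\<lambda>u. indicator S1 u * (\<bar>det (matrix (\<psi>1' u))\<bar> * f1 (\<psi>1 u)))"
      using inS1 det by (auto simp: f1_def \<psi>1_def indicator_def fun_eq_iff RR')
    ultimately show "(\<lambda>u. indicator S1 u * (\<bar>det (matrix (\<psi>1' u))\<bar> * f1 (\<psi>1 u))) \<in> borel_measurable borel"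
      by simp
  qed
  moreover have "ennreal (indicator (\<psi>1 ` S1) v * f1 v) = ennreal (indicator (\<psi> ` S) (R' v) * f (R' v))" for v
    using im by (auto simp: f1_def indicator_def)
  moreover have "ennreal (indicator S1 u * (\<bar>det (matrix (\<psi>1' u))\<bar> * f1 (\<psi>1 u))) =
      ennreal (indicator S (R' u) * (\<bar>det (matrix (\<psi>' (R' u)))\<bar> * f (\<psi> (R' u))))" for u
    using inS1 det by (auto simp: f1_def \<psi>1_def indicator_def RR')
  ultimately show ?thesis
    using transfer[OF meas(1)] transfer[OF meas(2)] by simp
qed

section \<open>Charts, jets in charts and the normal projection\<close>

definition chart_jet :: "('a, 'm::finite) chart \<Rightarrow> ('a \<Rightarrow> 'e::euclidean_space) \<Rightarrow> 'a \<Rightarrow> 'e \<times> ('e ^ 'm)" where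
  "chart_jet c Y q = jet (Y \<circ> chart_inv c) (snd c q)"

text \<open>The action of a coordinate change with Jacobian \<open>A\<close> on jets: the chain rule
  combines the old velocities with the entries of the i-th column of \<open>A\<close>.\<close>

definition jet_map :: "real ^ 'm ^ 'm::finite \<Rightarrow> 'e::euclidean_space \<times> ('e ^ 'm) \<Rightarrow> 'e \<times> ('e ^ 'm)" where
  "jet_map A j = (fst j, \<chi> i. \<Sum>k\<in>UNIV. (A $ k $ i) *\<^sub>R snd j $ k)"

lemma bounded_linear_jet_map: "bounded_linear (jet_map A)"
  unfolding linear_conv_bounded_linear[symmetric]
  by (rule linearI)
    (simp_all add: jet_map_def vec_eq_iff sum.distrib scaleR_right.sum scaleR_add_right mult.commute)

lemma lagr_jet_map: "lagr (jet_map A j) = \<bar>det A\<bar> * lagr j"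
  using lagr_compose(2)[of "fst j" A "snd j"] by (simp add: jet_map_def)

lemma gram_jet_map: "gram (snd (jet_map A j)) = transpose A ** gram (snd j) ** A"
  using lagr_compose(1)[of A "snd j"] by (simp add: jet_map_def)

lemma jet_map_regular:
  assumes "det A \<noteq> 0"
  shows "jet_map A j \<in> regular_jets \<longleftrightarrow> j \<in> regular_jets"
proof -
  have "det (gram (snd (jet_map A j))) = (det A)\<^sup>2 * det (gram (snd j))"
    by (simp add: gram_jet_map det_mul power2_eq_square)
  then show ?thesis using assms by (simp add: regular_jets_def zero_less_mult_iff)
qed

text \<open>The derivative of the scaling law \<open>lagr_jet_map\<close>, as
  \<open>jet_map A\<close> is linear. First variation densities thus transform like volume
  densities, and their ratio does not depend on the chart.\<close>

lemma dlagr_jet_map: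
  assumes "det A \<noteq> 0" "j \<in> regular_jets"
  shows "dlagr (jet_map A j) (jet_map A k) = \<bar>det A\<bar> * dlagr j k"
proof -
  have "((\<lambda>j. lagr (jet_map A j)) has_derivative (\<lambda>k. dlagr (jet_map A j) (jet_map A k))) (at j)"
    by (rule has_derivative_compose[OF bounded_linear_imp_has_derivative[OF bounded_linear_jet_map] has_derivative_lagr])
      (simp add: jet_map_regular assms)
  moreover have "((\<lambda>j. lagr (jet_map A j)) has_derivative (\<lambda>k. \<bar>det A\<bar> * dlagr j k)) (at j)"
    unfolding lagr_jet_map by (intro has_derivative_mult_right has_derivative_lagr assms)
  ultimately show ?thesis by (rule has_derivative_unique[THEN fun_cong])
qed

lemma ddlagr_jet_map:
  assumes "det A \<noteq> 0" "j \<in> regular_jets"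
  shows "ddlagr (jet_map A j) (jet_map A k) (jet_map A k') = \<bar>det A\<bar> * ddlagr j k k'"
proof -
  have "((\<lambda>j. dlagr (jet_map A j) (jet_map A k)) has_derivative
      (\<lambda>k'. ddlagr (jet_map A j) (jet_map A k) (jet_map A k'))) (at j)"
    by (rule has_derivative_compose[OF bounded_linear_imp_has_derivative[OF bounded_linear_jet_map]
          has_derivative_dlagr_const]) (simp add: jet_map_regular assms)
  moreover have "((\<lambda>j. dlagr (jet_map A j) (jet_map A k)) has_derivative (\<lambda>k'. \<bar>det A\<bar> * ddlagr j k k')) (at j)"
    by (rule has_derivative_transform_within_open[OF _ open_regular_jets assms(2), where f="\<lambda>j. \<bar>det A\<bar> * dlagr j k"])
      (use assms in \<open>auto simp: dlagr_jet_map intro!: has_derivative_mult_right has_derivative_dlagr_const\<close>)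
  ultimately show ?thesis by (rule has_derivative_unique[THEN fun_cong])
qed

lemma fst_chart_jet: "q \<in> fst c \<Longrightarrow> inj_on (snd c) (fst c) \<Longrightarrow> fst (chart_jet c Y q) = Y q"
  by (simp add: chart_jet_def jet_def chart_inv_def)

lemma snd_chart_jet: "snd (chart_jet c Y q) $ i = chart_D c Y q (axis i 1)"
  by (simp add: chart_jet_def jet_def chart_D_def)

lemma metric_matrix_eq_gram: "metric_matrix c x q = gram (snd (chart_jet c x q))"
  by (simp add: metric_matrix_def induced_metric_def vec_eq_iff snd_chart_jet)

text \<open>For an independent frame this is the orthogonal projection off its span, written with
  the inverse Gram matrix so that smooth dependence on the frame is evident.\<close>

definition frame_normal :: "'e::euclidean_space ^ 'm::finite \<Rightarrow> 'e \<Rightarrow> 'e" where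
  "frame_normal p w = w - (\<Sum>k\<in>UNIV. (matrix_inv (gram p) *v (\<chi> i. w \<bullet> p $ i)) $ k *\<^sub>R p $ k)"

lemma frame_normal_orthogonal:
  assumes "det (gram p) \<noteq> 0"
  shows "frame_normal p w \<bullet> p $ i = 0"
proof -
  let ?b = "\<chi> i. w \<bullet> p $ i"
  have "(\<Sum>k\<in>UNIV. (matrix_inv (gram p) *v ?b) $ k *\<^sub>R p $ k) \<bullet> p $ i = (gram p *v (matrix_inv (gram p) *v ?b)) $ i"
    by (simp add: matrix_vector_mult_def[of "gram p"] inner_sum_left inner_commute[of "p $ i"] mult.commute)
  also have "\<dots> = w \<bullet> p $ i"
    by (simp add: matrix_vector_mul_assoc matrix_inv_cancel[OF assms])
  finally show ?thesis by (simp add: frame_normal_def inner_diff_left)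
qed

text \<open>Pythagoras. The right-hand side is the last factor in
  \<open>ddlagr_constant_direction\<close>, which is thereby recognised as the squared length of a
  normal component.\<close>

lemma frame_normal_norm:
  assumes "det (gram p) \<noteq> 0"
  shows "frame_normal p w \<bullet> frame_normal p w = w \<bullet> w - (\<chi> i. w \<bullet> p $ i) \<bullet> (matrix_inv (gram p) *v (\<chi> i. w \<bullet> p $ i))"
proof -
  define c where "c = matrix_inv (gram p) *v (\<chi> i. w \<bullet> p $ i)"
  define s where "s = (\<Sum>k\<in>UNIV. c $ k *\<^sub>R p $ k)"
  have fn: "frame_normal p w = w - s" by (simp add: frame_normal_def s_def c_def)
  have "frame_normal p w \<bullet> s = 0"
    using frame_normal_orthogonal[OF assms] by (simp add: s_def inner_sum_right)
  then have "frame_normal p w \<bullet> frame_normal p w = w \<bullet> w - w \<bullet> s"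
    by (simp add: fn inner_diff_left inner_diff_right inner_commute)
  also have "w \<bullet> s = (\<chi> i. w \<bullet> p $ i) \<bullet> c"
    by (simp add: s_def inner_sum_right inner_vec_def mult.commute)
  finally show ?thesis by (simp add: c_def)
qed

lemma C_infinity_on_frame_normal:
  assumes "open S" "C_infinity_on p S" "\<And>u. u \<in> S \<Longrightarrow> det (gram (p u)) \<noteq> 0" "C_infinity_on w S"
  shows "C_infinity_on (\<lambda>u. frame_normal (p u) (w u)) S"
proof -
  have "C_infinity_on (\<lambda>u. gram (p u) $ i $ k) S" for i k
    unfolding gram_nth by (intro C_infinity_on_inner C_infinity_on_vec_nth assms)
  note inv = C_infinity_on_matrix_inv[OF assms(1) this assms(3)]
  show ?thesis
    unfolding frame_normal_def matrix_vector_mult_def vec_lambda_beta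
    by (intro C_infinity_on_diff C_infinity_on_sum C_infinity_on_scaleR C_infinity_on_mult C_infinity_on_inner
        inv C_infinity_on_vec_nth assms)
qed

section \<open>Atlases, transition maps and jets in different charts\<close>

locale manifold =
  fixes \<A> :: "('a::{t2_space, second_countable_topology}, 'm::finite) chart set"
  assumes atlas: "smooth_atlas \<A>"
begin

lemma chart_cover: "\<exists>c\<in>\<A>. q \<in> fst c"
  using atlas unfolding smooth_atlas_def by blast

lemma chart_open: "c \<in> \<A> \<Longrightarrow> open (fst c)" "c \<in> \<A> \<Longrightarrow> open (chart_image c)"
  using atlas unfolding smooth_atlas_def by blast+

lemma chart_homeo: "c \<in> \<A> \<Longrightarrow> homeomorphism (fst c) (chart_image c) (snd c) (chart_inv c)"
  using atlas unfolding smooth_atlas_def by blast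

lemma chart_cont:
  assumes "c \<in> \<A>"
  shows "continuous_on (fst c) (snd c)" "continuous_on (chart_image c) (chart_inv c)"
  using chart_homeo[OF assms] by (auto simp: homeomorphism_def)

lemma chart_inverse:
  assumes "c \<in> \<A>"
  shows "q \<in> fst c \<Longrightarrow> chart_inv c (snd c q) = q" "q \<in> fst c \<Longrightarrow> snd c q \<in> chart_image c"
    "u \<in> chart_image c \<Longrightarrow> snd c (chart_inv c u) = u" "u \<in> chart_image c \<Longrightarrow> chart_inv c u \<in> fst c"
proof -
  note h = chart_homeo[OF assms, unfolded homeomorphism_def]
  show "q \<in> fst c \<Longrightarrow> chart_inv c (snd c q) = q" using h by blast
  show "q \<in> fst c \<Longrightarrow> snd c q \<in> chart_image c" by (simp add: chart_image_def)
  show "u \<in> chart_image c \<Longrightarrow> snd c (chart_inv c u) = u" using h by blast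
  show "u \<in> chart_image c \<Longrightarrow> chart_inv c u \<in> fst c" using h by blast
qed

lemma chart_image_inter:
  assumes "c \<in> \<A>" "V \<subseteq> fst c"
  shows "snd c ` V = chart_image c \<inter> chart_inv c -` V"
proof (rule set_eqI)
  fix u
  show "u \<in> snd c ` V \<longleftrightarrow> u \<in> chart_image c \<inter> chart_inv c -` V"
  proof
    assume "u \<in> snd c ` V"
    then obtain q where "q \<in> V" "u = snd c q" by blast
    moreover from this have "q \<in> fst c" using assms(2) by blast
    ultimately show "u \<in> chart_image c \<inter> chart_inv c -` V"
      by (simp add: chart_inverse(1,2)[OF assms(1)])
  next
    assume u: "u \<in> chart_image c \<inter> chart_inv c -` V"
    then have "u = snd c (chart_inv c u)" by (simp add: chart_inverse(3)[OF assms(1)])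
    with u show "u \<in> snd c ` V" by blast
  qed
qed

lemma chart_image_open:
  assumes "c \<in> \<A>" "open V" "V \<subseteq> fst c"
  shows "open (snd c ` V)"
  unfolding chart_image_inter[OF assms(1,3)]
  using continuous_open_preimage[OF chart_cont(2)[OF assms(1)] chart_open(2)[OF assms(1)] assms(2)] .

lemma inj_on_chart: "c \<in> \<A> \<Longrightarrow> inj_on (snd c) (fst c)"
  by (rule inj_on_inverseI[of _ "chart_inv c"]) (rule chart_inverse(1))

lemma fst_chart_jet': "c \<in> \<A> \<Longrightarrow> q \<in> fst c \<Longrightarrow> fst (chart_jet c Y q) = Y q"
  by (rule fst_chart_jet[OF _ inj_on_chart])

lemma smooth_mapD: "smooth_map \<A> Y \<Longrightarrow> c \<in> \<A> \<Longrightarrow> C_infinity_on (Y \<circ> chart_inv c) (chart_image c)"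
  by (simp add: smooth_map_def smooth_in_chart_def)

lemma smooth_map_continuous:
  assumes "smooth_map \<A> Y"
  shows "continuous_on UNIV Y"
proof (rule continuous_at_imp_continuous_on, rule ballI)
  fix q
  obtain c where c: "c \<in> \<A>" "q \<in> fst c" using chart_cover by blast
  have "continuous_on (fst c) (\<lambda>q. (Y \<circ> chart_inv c) (snd c q))"
    by (rule continuous_on_compose2[OF C_infinity_on_continuous[OF smooth_mapD[OF assms c(1)]] chart_cont(1)[OF c(1)]])
      (simp add: chart_image_def)
  then have "continuous_on (fst c) Y"
    by (rule continuous_on_eq) (simp add: chart_inverse[OF c(1)])
  then show "isCont Y q" using c chart_open continuous_on_eq_continuous_at by blast
qed

definition trans :: "('a, 'm) chart \<Rightarrow> ('a, 'm) chart \<Rightarrow> 'a \<Rightarrow> real ^ 'm ^ 'm" where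
  "trans c d q = matrix (frechet_derivative (snd d \<circ> chart_inv c) (at (snd c q)))"

lemma trans_derivative:
  assumes c: "c \<in> \<A>" "q \<in> fst c" and d: "d \<in> \<A>" "q \<in> fst d"
  shows "((snd d \<circ> chart_inv c) has_derivative (*v) (trans c d q)) (at (snd c q))"
proof -
  have "C_infinity_on (snd d \<circ> chart_inv c) (snd c ` (fst c \<inter> fst d))"
    using atlas c(1) d(1) unfolding smooth_atlas_def by blast
  then have D: "((snd d \<circ> chart_inv c) has_derivative frechet_derivative (snd d \<circ> chart_inv c) (at (snd c q))) (at (snd c q))"
    by (rule C_infinity_on_D) (use c d in auto)
  then have "linear (frechet_derivative (snd d \<circ> chart_inv c) (at (snd c q)))" by (rule has_derivative_linear)
  then have "frechet_derivative (snd d \<circ> chart_inv c) (at (snd c q)) = (*v) (trans c d q)"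
    by (simp add: trans_def fun_eq_iff matrix_works)
  with D show ?thesis by (simp only:)
qed

text \<open>The two transition maps are inverse to each other near the point, so by the chain rule
  their Jacobians are inverse matrices.\<close>

lemma trans_det:
  assumes c: "c \<in> \<A>" "q \<in> fst c" and d: "d \<in> \<A>" "q \<in> fst d"
  shows "det (trans c d q) \<noteq> 0"
proof -
  let ?\<psi> = "snd d \<circ> chart_inv c" and ?\<psi>' = "snd c \<circ> chart_inv d"
  have \<psi>q: "?\<psi> (snd c q) = snd d q" by (simp add: chart_inverse[OF c(1)] c)
  have D': "(?\<psi>' has_derivative (*v) (trans d c q)) (at (?\<psi> (snd c q)))"
    unfolding \<psi>q by (rule trans_derivative[OF d c])
  have "((\<lambda>u. ?\<psi>' (?\<psi> u)) has_derivative (\<lambda>v. trans d c q *v (trans c d q *v v))) (at (snd c q))"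
    by (rule has_derivative_compose[OF trans_derivative[OF c d] D'])
  moreover have "((\<lambda>u. ?\<psi>' (?\<psi> u)) has_derivative (\<lambda>v. v)) (at (snd c q))"
  proof (rule has_derivative_transform_within_open[OF has_derivative_ident])
    show "open (snd c ` (fst c \<inter> fst d))" by (intro chart_image_open[OF c(1)] open_Int chart_open(1) c d) auto
    show "snd c q \<in> snd c ` (fst c \<inter> fst d)" using c d by auto
    show "u = ?\<psi>' (?\<psi> u)" if "u \<in> snd c ` (fst c \<inter> fst d)" for u
      using that chart_inverse[OF c(1)] chart_inverse[OF d(1)] by auto
  qed
  ultimately have eq: "(\<lambda>v. trans d c q *v (trans c d q *v v)) = (\<lambda>v. v)" by (rule has_derivative_unique)
  have "trans d c q ** trans c d q = mat 1"
    unfolding matrix_eq matrix_vector_mul_assoc[symmetric] matrix_vector_mul_lid using fun_cong[OF eq] by auto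
  then have "det (trans d c q) * det (trans c d q) = 1" using det_mul det_I by metis
  then show ?thesis by auto
qed

lemma chart_D_trans:
  assumes c: "c \<in> \<A>" "q \<in> fst c" and d: "d \<in> \<A>" "q \<in> fst d"
    and Y: "(Y \<circ> chart_inv d) differentiable (at (snd d q))"
  shows "chart_D c Y q v = chart_D d Y q (trans c d q *v v)"
proof -
  let ?\<psi> = "snd d \<circ> chart_inv c"
  have \<psi>q: "?\<psi> (snd c q) = snd d q" by (simp add: chart_inverse[OF c(1)] c)
  have "((Y \<circ> chart_inv d) has_derivative chart_D d Y q) (at (?\<psi> (snd c q)))"
    using Y unfolding \<psi>q chart_D_def[abs_def] by (rule frechet_derivative_works[THEN iffD1])
  from has_derivative_compose[OF trans_derivative[OF c d] this]
  have "((Y \<circ> chart_inv c) has_derivative (\<lambda>v. chart_D d Y q (trans c d q *v v))) (at (snd c q))"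
  proof (rule has_derivative_transform_within_open)
    show "open (snd c ` (fst c \<inter> fst d))" by (intro chart_image_open[OF c(1)] open_Int chart_open(1) c d) auto
    show "snd c q \<in> snd c ` (fst c \<inter> fst d)" using c d by auto
    show "(Y \<circ> chart_inv d) (?\<psi> u) = (Y \<circ> chart_inv c) u" if "u \<in> snd c ` (fst c \<inter> fst d)" for u
      using that chart_inverse[OF c(1)] chart_inverse[OF d(1)] by auto
  qed
  then show ?thesis unfolding chart_D_def[of c] by (simp add: frechet_derivative_eqI)
qed

lemma chart_jet_trans:
  assumes c: "c \<in> \<A>" "q \<in> fst c" and d: "d \<in> \<A>" "q \<in> fst d"
    and Y: "(Y \<circ> chart_inv d) differentiable (at (snd d q))"
  shows "chart_jet c Y q = jet_map (trans c d q) (chart_jet d Y q)"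
proof -
  have "linear (chart_D d Y q)" unfolding chart_D_def[abs_def] by (rule linear_frechet_derivative[OF Y])
  then have "chart_D c Y q (axis i 1) = (\<Sum>k\<in>UNIV. trans c d q $ k $ i *\<^sub>R chart_D d Y q (axis k 1))" for i
    unfolding chart_D_trans[OF assms] by (subst frechet_derivative_axis_sum) (auto simp: matrix_vector_mult_basis column_def)
  then show ?thesis
    by (simp add: prod_eq_iff jet_map_def fst_chart_jet' c d vec_eq_iff snd_chart_jet)
qed

lemma immersion_smooth: "immersion \<A> y \<Longrightarrow> smooth_map \<A> y"
  by (simp add: immersion_def)

lemma smooth_map_differentiable:
  assumes "smooth_map \<A> Y" "c \<in> \<A>" "q \<in> fst c"
  shows "(Y \<circ> chart_inv c) differentiable (at (snd c q))"
  by (rule C_infinity_on_differentiable[OF smooth_mapD[OF assms(1,2)] chart_inverse(2)[OF assms(2,3)]])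

lemma chart_D_linear:
  assumes "smooth_map \<A> Y" "c \<in> \<A>" "q \<in> fst c"
  shows "linear (chart_D c Y q)"
  unfolding chart_D_def[abs_def] by (rule linear_frechet_derivative[OF smooth_map_differentiable[OF assms]])

lemma chart_D_sum:
  assumes "smooth_map \<A> Y" "c \<in> \<A>" "q \<in> fst c"
  shows "chart_D c Y q v = (\<Sum>i\<in>UNIV. v $ i *\<^sub>R snd (chart_jet c Y q) $ i)"
  unfolding snd_chart_jet by (rule frechet_derivative_axis_sum[OF chart_D_linear[OF assms]])

text \<open>Injectivity of the differential is linear independence of the coordinate velocities,
  which is positivity of their Gram determinant.\<close>

lemma immersion_iff_regular:
  "immersion \<A> y \<longleftrightarrow> smooth_map \<A> y \<and> (\<forall>c\<in>\<A>. \<forall>q\<in>fst c. chart_jet c y q \<in> regular_jets)"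
proof -
  have "inj (chart_D c y q) \<longleftrightarrow> chart_jet c y q \<in> regular_jets"
    if y: "smooth_map \<A> y" and c: "c \<in> \<A>" "q \<in> fst c" for c q
  proof -
    have "inj (chart_D c y q) \<longleftrightarrow> (\<forall>v. (\<Sum>i\<in>UNIV. v $ i *\<^sub>R snd (chart_jet c y q) $ i) = 0 \<longrightarrow> v = 0)"
      by (simp add: linear_injective_0[OF chart_D_linear[OF y c]] chart_D_sum[OF y c])
    then show ?thesis
      unfolding regular_jets_def mem_Collect_eq
      using independent_imp_det_gram_pos[of "snd (chart_jet c y q)"]
        det_gram_pos_imp_independent[of "snd (chart_jet c y q)"] by (metis less_irrefl)
  qed
  then show ?thesis unfolding immersion_def by blast
qed

lemma immersion_regular:
  "immersion \<A> y \<Longrightarrow> c \<in> \<A> \<Longrightarrow> q \<in> fst c \<Longrightarrow> chart_jet c y q \<in> regular_jets"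
  by (simp add: immersion_iff_regular)

lemma immersion_regular_image:
  assumes "immersion \<A> y" "c \<in> \<A>"
  shows "jet (y \<circ> chart_inv c) ` chart_image c \<subseteq> regular_jets"
proof (rule image_subsetI)
  fix u assume u: "u \<in> chart_image c"
  show "jet (y \<circ> chart_inv c) u \<in> regular_jets"
    using immersion_regular[OF assms chart_inverse(4)[OF assms(2) u]]
    by (simp only: chart_jet_def chart_inverse(3)[OF assms(2) u])
qed

section \<open>Tangent spaces, normal spaces and the normal projection\<close>

lemma tangent_space_eq:
  assumes "smooth_map \<A> x" "c \<in> \<A>" "q \<in> fst c"
  shows "tangent_space \<A> x q = range (chart_D c x q)"
proof
  show "range (chart_D c x q) \<subseteq> tangent_space \<A> x q"
    using assms by (auto simp: tangent_space_def)
  show "tangent_space \<A> x q \<subseteq> range (chart_D c x q)"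
  proof
    fix w assume "w \<in> tangent_space \<A> x q"
    then obtain d v where d: "d \<in> \<A>" "q \<in> fst d" and w: "w = chart_D d x q v"
      by (auto simp: tangent_space_def)
    show "w \<in> range (chart_D c x q)"
      unfolding w chart_D_trans[OF d assms(2,3) smooth_map_differentiable[OF assms]] by simp
  qed
qed

lemma normal_space_iff:
  assumes "smooth_map \<A> x" "c \<in> \<A>" "q \<in> fst c"
  shows "n \<in> normal_space \<A> x q \<longleftrightarrow> (\<forall>k. n \<bullet> snd (chart_jet c x q) $ k = 0)"
proof
  assume "n \<in> normal_space \<A> x q"
  then show "\<forall>k. n \<bullet> snd (chart_jet c x q) $ k = 0"
    by (auto simp: normal_space_def orthogonal_comp_def orthogonal_def tangent_space_eq[OF assms] snd_chart_jet inner_commute)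
next
  assume "\<forall>k. n \<bullet> snd (chart_jet c x q) $ k = 0"
  then have "n \<bullet> chart_D c x q v = 0" for v
    by (simp add: chart_D_sum[OF assms] inner_sum_right)
  then show "n \<in> normal_space \<A> x q"
    by (auto simp: normal_space_def orthogonal_comp_def orthogonal_def tangent_space_eq[OF assms] inner_commute)
qed

text \<open>Two candidates differ by a vector that is both tangent and normal, hence zero; this
  evaluates the definite description in \<open>normal_part\<close>.\<close>

lemma normal_part_unique:
  assumes "smooth_map \<A> x" "n \<in> normal_space \<A> x q" "w - n \<in> tangent_space \<A> x q"
  shows "normal_part \<A> x q w = n"
  unfolding normal_part_def
proof (rule the_equality)
  fix n' assume n': "n' \<in> normal_space \<A> x q \<and> w - n' \<in> tangent_space \<A> x q"
  obtain c where c: "c \<in> \<A>" "q \<in> fst c" using chart_cover by blast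
  have "subspace (tangent_space \<A> x q)"
    unfolding tangent_space_eq[OF assms(1) c] by (rule linear_subspace_image[OF chart_D_linear[OF assms(1) c] subspace_UNIV])
  from subspace_diff[OF this assms(3), of "w - n'"]
  have "(w - n) - (w - n') \<in> tangent_space \<A> x q" using n' by blast
  moreover have "n' - n \<in> normal_space \<A> x q"
    unfolding normal_space_def by (rule subspace_diff[OF subspace_orthogonal_comp])
      (use n' assms in \<open>auto simp: normal_space_def\<close>)
  ultimately have "orthogonal (n' - n) (n' - n)"
    by (simp add: normal_space_def orthogonal_comp_def)
  then show "n' = n" by (simp add: orthogonal_def)
qed (use assms in auto)

lemma normal_part_eq:
  assumes "immersion \<A> x" "c \<in> \<A>" "q \<in> fst c"
  shows "normal_part \<A> x q w = frame_normal (snd (chart_jet c x q)) w"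
proof (rule normal_part_unique)
  note x = immersion_smooth[OF assms(1)]
  have det: "det (gram (snd (chart_jet c x q))) \<noteq> 0"
    using immersion_regular[OF assms] by (rule regular_jets_det)
  show "smooth_map \<A> x" by fact
  show "frame_normal (snd (chart_jet c x q)) w \<in> normal_space \<A> x q"
    unfolding normal_space_iff[OF x assms(2,3)] using frame_normal_orthogonal[OF det] by blast
  show "w - frame_normal (snd (chart_jet c x q)) w \<in> tangent_space \<A> x q"
    unfolding tangent_space_eq[OF x assms(2,3)] frame_normal_def
    using chart_D_sum[OF x assms(2,3)] by (auto intro!: rangeI simp: image_iff)
qed

lemma normal_part_properties:
  assumes "immersion \<A> x"
  shows "normal_part \<A> x q w \<in> normal_space \<A> x q" "w - normal_part \<A> x q w \<in> tangent_space \<A> x q"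
    "n \<in> normal_space \<A> x q \<Longrightarrow> normal_part \<A> x q w \<bullet> n = w \<bullet> n"
    "linear (normal_part \<A> x q)"
proof -
  note x = immersion_smooth[OF assms(1)]
  obtain c where c: "c \<in> \<A>" "q \<in> fst c" using chart_cover by blast
  have det: "det (gram (snd (chart_jet c x q))) \<noteq> 0"
    using immersion_regular[OF assms c] by (rule regular_jets_det)
  show 1: "normal_part \<A> x q w \<in> normal_space \<A> x q" for w
    unfolding normal_space_iff[OF x c] normal_part_eq[OF assms c] using frame_normal_orthogonal[OF det] by blast
  show 2: "w - normal_part \<A> x q w \<in> tangent_space \<A> x q" for w
    unfolding tangent_space_eq[OF x c] frame_normal_def normal_part_eq[OF assms c]
    using chart_D_sum[OF x c] by (auto intro!: rangeI simp: image_iff)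
  show "normal_part \<A> x q w \<bullet> n = w \<bullet> n" if "n \<in> normal_space \<A> x q"
  proof -
    have "(w - normal_part \<A> x q w) \<bullet> n = 0"
      using 2 that by (auto simp: normal_space_def orthogonal_comp_def orthogonal_def)
    then show ?thesis by (simp add: inner_diff_left)
  qed
  have subT: "subspace (tangent_space \<A> x q)"
    unfolding tangent_space_eq[OF x c] by (rule linear_subspace_image[OF chart_D_linear[OF x c] subspace_UNIV])
  have subN: "subspace (normal_space \<A> x q)"
    unfolding normal_space_def by (rule subspace_orthogonal_comp)
  show "linear (normal_part \<A> x q)"
  proof (rule linearI)
    fix a b
    have "(a - normal_part \<A> x q a) + (b - normal_part \<A> x q b) \<in> tangent_space \<A> x q"
      using 2 subspace_add[OF subT] by blast
    then show "normal_part \<A> x q (a + b) = normal_part \<A> x q a + normal_part \<A> x q b"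
      by (intro normal_part_unique x subspace_add[OF subN] 1) (simp add: algebra_simps)
  next
    fix r a
    have "r *\<^sub>R (a - normal_part \<A> x q a) \<in> tangent_space \<A> x q"
      using 2 subspace_scale[OF subT] by blast
    then show "normal_part \<A> x q (r *\<^sub>R a) = r *\<^sub>R normal_part \<A> x q a"
      by (intro normal_part_unique x subspace_scale[OF subN] 1) (simp add: algebra_simps)
  qed
qed

section \<open>The volume measure\<close>

definition vol :: "('a, 'm) chart \<Rightarrow> ('a \<Rightarrow> 'e::euclidean_space) \<Rightarrow> 'a \<Rightarrow> real" where
  "vol c y q = sqrt (det (metric_matrix c y q))"

lemma vol_pos:
  assumes "immersion \<A> y" "c \<in> \<A>" "q \<in> fst c"
  shows "0 < vol c y q"
  using immersion_regular[OF assms] by (simp add: vol_def metric_matrix_eq_gram regular_jets_def)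

lemma lagr_eq_vol:
  assumes "c \<in> \<A>" "q \<in> fst c"
  shows "lagr (chart_jet c y q) = exp (- (1/2) * (y q \<bullet> y q)) * vol c y q"
  by (simp add: lagr_def vol_def metric_matrix_eq_gram fst_chart_jet'[OF assms])

lemma vol_transition:
  assumes "det A \<noteq> 0" "chart_jet c y q = jet_map A (chart_jet d y q)"
  shows "vol c y q = \<bar>det A\<bar> * vol d y q"
  by (simp add: vol_def metric_matrix_eq_gram assms gram_jet_map det_mul real_sqrt_mult)

lemma continuous_on_vol:
  assumes "immersion \<A> y" "c \<in> \<A>"
  shows "continuous_on (chart_image c) (\<lambda>u. vol c y (chart_inv c u))"
proof -
  have "C_infinity_on (\<lambda>u. sqrt (det (gram (snd (jet (y \<circ> chart_inv c) u))))) (chart_image c)"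
    using chart_open(2)[OF assms(2)] smooth_mapD[OF immersion_smooth[OF assms(1)] assms(2)]
      immersion_regular_image[OF assms]
    by (intro C_infinity_on_sqrt_compose C_infinity_on_det C_infinity_on_compose[OF _ open_UNIV C_infinity_on_jet C_infinity_on_gram])
      (auto simp: regular_jets_def)
  then have "continuous_on (chart_image c) (\<lambda>u. sqrt (det (gram (snd (jet (y \<circ> chart_inv c) u)))))"
    by (rule C_infinity_on_continuous)
  then show ?thesis
    by (rule continuous_on_eq) (simp add: vol_def metric_matrix_eq_gram chart_jet_def chart_inverse[OF assms(2)])
qed

text \<open>The Riemannian volume of one chart domain, as a Borel measure on the whole manifold.
  Outside the chart image the parametrisation is replaced by an arbitrary constant, which makes it
  measurable everywhere; the density vanishes there.\<close>

definition chart_measure :: "('a, 'm) chart \<Rightarrow> ('a \<Rightarrow> 'e::euclidean_space) \<Rightarrow> 'a measure" where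
  "chart_measure c y = distr
     (density lborel (\<lambda>u. ennreal (indicator (chart_image c) u * vol c y (chart_inv c u)))) borel
     (\<lambda>u. if u \<in> chart_image c then chart_inv c u else undefined)"

lemma chart_inv_measurable [measurable]:
  assumes "c \<in> \<A>"
  shows "(\<lambda>u. if u \<in> chart_image c then chart_inv c u else undefined) \<in> borel_measurable borel"
proof (rule borel_measurableI)
  fix V :: "'a set" assume "open V"
  have "(\<lambda>u. if u \<in> chart_image c then chart_inv c u else undefined) -` V \<inter> space borel =
      (chart_image c \<inter> chart_inv c -` V) \<union> (if undefined \<in> V then - chart_image c else {})"
    by (auto split: if_splits)
  moreover have "open (chart_image c \<inter> chart_inv c -` V)"
    using continuous_open_preimage[OF chart_cont(2)[OF assms] chart_open(2)[OF assms] \<open>open V\<close>] .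
  ultimately show "(\<lambda>u. if u \<in> chart_image c then chart_inv c u else undefined) -` V \<inter> space borel \<in> sets borel"
    using chart_open(2)[OF assms] by auto
qed

lemma vol_measurable:
  assumes "immersion \<A> y" "c \<in> \<A>"
  shows "(\<lambda>u. indicator (chart_image c) u * vol c y (chart_inv c u)) \<in> borel_measurable borel"
  using borel_measurable_continuous_on_indicator[OF borel_open[OF chart_open(2)[OF assms(2)]] continuous_on_vol[OF assms]]
  by simp

lemma snd_chart_borel:
  assumes "c \<in> \<A>" "E \<in> sets borel" "E \<subseteq> fst c"
  shows "snd c ` E \<in> sets borel"
proof -
  have "snd c ` E = chart_image c \<inter> ((\<lambda>u. if u \<in> chart_image c then chart_inv c u else undefined) -` E \<inter> space borel)"
    unfolding chart_image_inter[OF assms(1,3)] by auto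
  then show ?thesis
    using measurable_sets[OF chart_inv_measurable[OF assms(1)] assms(2)] borel_open[OF chart_open(2)[OF assms(1)]] by auto
qed

lemma sets_chart_measure [simp]: "sets (chart_measure c y) = sets borel"
  by (simp add: chart_measure_def)

lemma emeasure_chart_measure_full:
  assumes y: "immersion \<A> y" and c: "c \<in> \<A>" and E: "E \<in> sets borel"
  shows "emeasure (chart_measure c y) E =
    (\<integral>\<^sup>+u. ennreal (indicator (snd c ` (E \<inter> fst c)) u * vol c y (chart_inv c u)) \<partial>lborel)"
proof -
  let ?i = "\<lambda>u. if u \<in> chart_image c then chart_inv c u else undefined"
  have m: "(\<lambda>u. ennreal (indicator (chart_image c) u * vol c y (chart_inv c u))) \<in> borel_measurable lborel"
    using vol_measurable[OF y c] by simp
  have "emeasure (chart_measure c y) E =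
      emeasure (density lborel (\<lambda>u. ennreal (indicator (chart_image c) u * vol c y (chart_inv c u)))) (?i -` E)"
    unfolding chart_measure_def using chart_inv_measurable[OF c] E by (subst emeasure_distr) auto
  also have "\<dots> = (\<integral>\<^sup>+u. ennreal (indicator (chart_image c) u * vol c y (chart_inv c u)) * indicator (?i -` E) u \<partial>lborel)"
    using measurable_sets[OF chart_inv_measurable[OF c] E] by (intro emeasure_density m) auto
  also have "\<dots> = (\<integral>\<^sup>+u. ennreal (indicator (snd c ` (E \<inter> fst c)) u * vol c y (chart_inv c u)) \<partial>lborel)"
  proof (rule nn_integral_cong)
    fix u
    have "u \<in> snd c ` (E \<inter> fst c) \<longleftrightarrow> u \<in> chart_image c \<and> ?i u \<in> E"
      using chart_image_inter[OF c, of "E \<inter> fst c"] chart_inverse[OF c] by auto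
    then show "ennreal (indicator (chart_image c) u * vol c y (chart_inv c u)) * indicator (?i -` E) u =
        ennreal (indicator (snd c ` (E \<inter> fst c)) u * vol c y (chart_inv c u))"
      by (auto simp: indicator_def)
  qed
  finally show ?thesis .
qed

text \<open>Change of variables for the transition map: the absolute value of its Jacobian
  determinant is exactly the factor by which the volume densities of the two charts differ.\<close>

lemma emeasure_chart_measure_transition:
  assumes y: "immersion \<A> y" and c: "c \<in> \<A>" and d: "d \<in> \<A>" and E: "E \<in> sets borel" "E \<subseteq> fst c" "E \<subseteq> fst d"
  shows "emeasure (chart_measure c y) E = emeasure (chart_measure d y) E"
proof -
  define \<psi> where "\<psi> = snd d \<circ> chart_inv c"
  have qE: "q \<in> fst c" "q \<in> fst d" if "q \<in> E" for q using that E by auto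
  have im: "\<psi> ` snd c ` E = snd d ` E"
    unfolding image_image \<psi>_def comp_def
    by (rule image_cong) (simp_all add: chart_inverse(1)[OF c qE(1)])
  define A where "A = trans c d"
  have A1: "det (A q) \<noteq> 0" if "q \<in> E" for q
    unfolding A_def by (rule trans_det[OF c qE(1)[OF that] d qE(2)[OF that]])
  have A2: "(\<psi> has_derivative (*v) (A q)) (at (snd c q))" if "q \<in> E" for q
    unfolding A_def \<psi>_def by (rule trans_derivative[OF c qE(1)[OF that] d qE(2)[OF that]])
  have A3: "chart_jet c y q = jet_map (A q) (chart_jet d y q)" if "q \<in> E" for q
    unfolding A_def
    by (rule chart_jet_trans[OF c qE(1)[OF that] d qE(2)[OF that] smooth_map_differentiable[OF immersion_smooth[OF y] d qE(2)[OF that]]])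
  define \<psi>' where "\<psi>' u = (*v) (A (chart_inv c u))" for u
  define f where "f v = vol d y (chart_inv d v)" for v
  have uE: "u \<in> snd c ` E \<Longrightarrow> chart_inv c u \<in> E" "u \<in> snd c ` E \<Longrightarrow> snd c (chart_inv c u) = u" for u
    using E chart_inverse[OF c] by auto
  have eq: "\<bar>det (matrix (\<psi>' u))\<bar> * f (\<psi> u) = vol c y (chart_inv c u)" if "u \<in> snd c ` E" for u
  proof -
    note q = uE[OF that]
    have "chart_inv d (\<psi> u) = chart_inv c u" using q E chart_inverse[OF d] by (auto simp: \<psi>_def)
    then show ?thesis
      using vol_transition[OF A1[OF q(1)] A3[OF q(1)]] by (simp add: f_def \<psi>'_def)
  qed
  have mf: "(\<lambda>v. indicator (snd d ` E) v * f v) \<in> borel_measurable borel"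
  proof -
    have "(\<lambda>v. indicator (snd d ` E) v * (indicator (chart_image d) v * f v)) \<in> borel_measurable borel"
      unfolding f_def using snd_chart_borel[OF d E(1,3)]
      by (intro borel_measurable_times[OF _ vol_measurable[OF y d]]) simp
    moreover have "(\<lambda>v. indicator (snd d ` E) v * (indicator (chart_image d) v * f v)) = (\<lambda>v. indicator (snd d ` E) v * f v)"
      using E by (auto simp: fun_eq_iff indicator_def chart_image_def)
    ultimately show ?thesis by simp
  qed
  have mg: "(\<lambda>u. indicator (snd c ` E) u * vol c y (chart_inv c u)) \<in> borel_measurable borel"
  proof -
    have "(\<lambda>v. indicator (snd c ` E) v * (indicator (chart_image c) v * vol c y (chart_inv c v))) \<in> borel_measurable borel"
      using snd_chart_borel[OF c E(1,2)] by (intro borel_measurable_times[OF _ vol_measurable[OF y c]]) simp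
    moreover have "(\<lambda>v. indicator (snd c ` E) v * (indicator (chart_image c) v * vol c y (chart_inv c v))) =
        (\<lambda>v. indicator (snd c ` E) v * vol c y (chart_inv c v))"
      using E by (auto simp: fun_eq_iff indicator_def chart_image_def)
    ultimately show ?thesis by simp
  qed
  have eq': "indicator (snd c ` E) u * (\<bar>det (matrix (\<psi>' u))\<bar> * f (\<psi> u)) = indicator (snd c ` E) u * vol c y (chart_inv c u)" for u
    using eq by (auto simp: indicator_def)
  have "(\<integral>\<^sup>+v. ennreal (indicator (\<psi> ` snd c ` E) v * f v) \<partial>lborel) =
      (\<integral>\<^sup>+u. ennreal (indicator (snd c ` E) u * (\<bar>det (matrix (\<psi>' u))\<bar> * f (\<psi> u))) \<partial>lborel)"
  proof (rule nn_integral_change_of_variables)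
    show "snd c ` E \<in> sets borel" by (rule snd_chart_borel[OF c E(1,2)])
    show "(\<psi> has_derivative \<psi>' u) (at u)" if "u \<in> snd c ` E" for u
      using A2[OF uE(1)[OF that]] uE(2)[OF that] by (simp add: \<psi>'_def)
    show "inj_on \<psi> (snd c ` E)"
    proof (rule inj_onI)
      fix u v assume uv: "u \<in> snd c ` E" "v \<in> snd c ` E" "\<psi> u = \<psi> v"
      have inv: "chart_inv d (\<psi> w) = chart_inv c w" if "w \<in> snd c ` E" for w
        using chart_inverse(1)[OF d qE(2)[OF uE(1)[OF that]]] by (simp add: \<psi>_def)
      have "chart_inv c u = chart_inv c v"
        unfolding inv[OF uv(1), symmetric] inv[OF uv(2), symmetric] uv(3) ..
      from arg_cong[OF this, of "snd c"] show "u = v" unfolding uE(2)[OF uv(1)] uE(2)[OF uv(2)] .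
    qed
    show "0 \<le> f v" if "v \<in> \<psi> ` snd c ` E" for v
    proof -
      from that[unfolded im] obtain q where q: "q \<in> E" "v = snd d q" by blast
      show ?thesis
        unfolding f_def q(2) chart_inverse(1)[OF d qE(2)[OF q(1)]]
        by (rule less_imp_le[OF vol_pos[OF y d qE(2)[OF q(1)]]])
    qed
  qed (use mf mg in \<open>simp_all add: im eq'\<close>)
  from this[unfolded im eq', unfolded f_def] show ?thesis
    unfolding emeasure_chart_measure_full[OF y c E(1)] emeasure_chart_measure_full[OF y d E(1)]
      Int_absorb2[OF E(2)] Int_absorb2[OF E(3)] by (rule sym)
qed

lemma emeasure_chart_measure_Int:
  assumes y: "immersion \<A> y" and c: "c \<in> \<A>" and E: "E \<in> sets borel"
  shows "emeasure (chart_measure c y) (E \<inter> fst c) = emeasure (chart_measure c y) E"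
  using E borel_open[OF chart_open(1)[OF c]]
  by (simp add: emeasure_chart_measure_full[OF y c] Int_assoc)

text \<open>Second countability makes the manifold a Lindelof space, so the volume measure can be
  assembled from countably many charts.\<close>

lemma countable_chart_cover:
  obtains s where "\<And>n :: nat. s n \<in> \<A>" "(\<Union>n. fst (s n)) = UNIV"
proof -
  have op: "open S" if "S \<in> fst ` \<A>" for S using that chart_open(1) by blast
  obtain F where F: "F \<subseteq> fst ` \<A>" "countable F" "\<Union>F = \<Union>(fst ` \<A>)"
    using Lindelof[OF op] by metis
  have cov: "\<Union>(fst ` \<A>) = UNIV" using atlas unfolding smooth_atlas_def by blast
  then have ne: "F \<noteq> {}" using F by auto
  define s where "s n = (SOME c. c \<in> \<A> \<and> fst c = from_nat_into F n)" for n
  have s: "s n \<in> \<A> \<and> fst (s n) = from_nat_into F n" for n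
    unfolding s_def by (rule someI_ex) (use from_nat_into[OF ne, of n] F(1) in blast)
  have "(\<Union>n. fst (s n)) = \<Union>(range (from_nat_into F))" using s by simp
  also have "\<dots> = UNIV" unfolding range_from_nat_into[OF ne F(2)] F(3) by (rule cov)
  finally have "(\<Union>n. fst (s n)) = UNIV" .
  with s show thesis by (intro that[of s]) (simp_all only:)
qed

definition volume_property :: "('a \<Rightarrow> 'e::euclidean_space) \<Rightarrow> 'a measure \<Rightarrow> bool" where
  "volume_property y \<mu> \<longleftrightarrow> sets \<mu> = sets borel \<and>
     (\<forall>c\<in>\<A>. \<forall>E\<in>sets borel. E \<subseteq> fst c \<longrightarrow> emeasure \<mu> E = emeasure (chart_measure c y) E)"

lemma volume_measure_eq_The:
  assumes "immersion \<A> y"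
  shows "volume_measure \<A> y = (THE \<mu>. volume_property y \<mu>)"
proof -
  have "(\<integral>\<^sup>+ u \<in> snd c ` E. ennreal (sqrt (det (metric_matrix c y (chart_inv c u)))) \<partial>lborel) =
      emeasure (chart_measure c y) E" if "c \<in> \<A>" "E \<in> sets borel" "E \<subseteq> fst c" for c E
    unfolding emeasure_chart_measure_full[OF assms that(1,2)] Int_absorb2[OF that(3)]
    by (rule nn_integral_cong) (simp add: vol_def split: split_indicator)
  then have "(sets \<mu> = sets borel \<and> (\<forall>c\<in>\<A>. \<forall>E\<in>sets borel. E \<subseteq> fst c \<longrightarrow> emeasure \<mu> E =
      (\<integral>\<^sup>+ u \<in> snd c ` E. ennreal (sqrt (det (metric_matrix c y (chart_inv c u)))) \<partial>lborel))) \<longleftrightarrow>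
      volume_property y \<mu>" for \<mu> :: "'a measure"
    unfolding volume_property_def by (simp cong: ball_cong)
  then show ?thesis unfolding volume_measure_def by simp
qed

text \<open>The disjointed chart domains cut every Borel set into countably many pieces, each inside
  one chart where the measure is prescribed; uniqueness follows.\<close>

lemma volume_property_sum:
  assumes s: "\<And>n :: nat. s n \<in> \<A>" "(\<Union>n. fst (s n)) = UNIV" and \<mu>: "volume_property y \<mu>" and E: "E \<in> sets borel"
  shows "emeasure \<mu> E = (\<Sum>n. emeasure (chart_measure (s n) y) (E \<inter> disjointed (\<lambda>n. fst (s n)) n))"
proof -
  let ?D = "disjointed (\<lambda>n. fst (s n))"
  have D: "?D n \<in> sets borel" for n
    unfolding disjointed_def by (intro sets.Diff sets.finite_UN borel_open chart_open(1) s) auto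
  have sub: "?D n \<subseteq> fst (s n)" for n by (auto simp: disjointed_def)
  have [simp]: "sets \<mu> = sets borel" using \<mu> by (simp add: volume_property_def)
  have "(\<Sum>n. emeasure \<mu> (E \<inter> ?D n)) = emeasure \<mu> (\<Union>n. E \<inter> ?D n)"
    using disjoint_family_disjointed[of "\<lambda>n. fst (s n)"] D E
    by (intro suminf_emeasure) (auto simp: disjoint_family_on_def)
  also have "(\<Union>n. E \<inter> ?D n) = E" using UN_disjointed_eq[of "\<lambda>n. fst (s n)"] s(2) by auto
  finally have "emeasure \<mu> E = (\<Sum>n. emeasure \<mu> (E \<inter> ?D n))" by simp
  moreover have "emeasure \<mu> (E \<inter> ?D n) = emeasure (chart_measure (s n) y) (E \<inter> ?D n)" for n
    using \<mu> s(1) sub[of n] D E unfolding volume_property_def by (meson Int_lower2 order_trans sets.Int)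
  ultimately show ?thesis by simp
qed

lemma volume_property_unique:
  assumes "volume_property y \<mu>" "volume_property y \<nu>"
  shows "\<mu> = \<nu>"
proof (rule measure_eqI)
  obtain s where s: "\<And>n :: nat. s n \<in> \<A>" "(\<Union>n. fst (s n)) = UNIV" using countable_chart_cover by blast
  show "sets \<mu> = sets \<nu>" using assms by (simp add: volume_property_def)
  fix E assume "E \<in> sets \<mu>"
  then have "E \<in> sets borel" using assms by (simp add: volume_property_def)
  then show "emeasure \<mu> E = emeasure \<nu> E"
    using volume_property_sum[OF s assms(1)] volume_property_sum[OF s assms(2)] by simp
qed

text \<open>The sum formula forced by uniqueness is taken as the definition. Agreement with an
  arbitrary chart follows piece by piece from the transition law.\<close>

lemma volume_property_exists:
  assumes y: "immersion \<A> y"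
  shows "\<exists>\<mu>. volume_property y \<mu>"
proof -
  obtain s where s: "\<And>n :: nat. s n \<in> \<A>" "(\<Union>n. fst (s n)) = UNIV" using countable_chart_cover by blast
  let ?D = "disjointed (\<lambda>n. fst (s n))"
  have D: "?D n \<in> sets borel" for n
    unfolding disjointed_def by (intro sets.Diff sets.finite_UN borel_open chart_open(1) s) auto
  have sub: "?D n \<subseteq> fst (s n)" for n by (auto simp: disjointed_def)
  define f where "f E = (\<Sum>n. emeasure (chart_measure (s n) y) (E \<inter> ?D n))" for E
  define \<mu> where "\<mu> = measure_of UNIV (sets borel) f"
  have sets: "sets \<mu> = sets (borel :: 'a measure)"
    using sets_measure_of[of "sets (borel :: 'a measure)" UNIV f] sets.sigma_sets_eq[of "borel :: 'a measure"]
    by (simp add: \<mu>_def)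
  have em: "emeasure \<mu> E = f E" if "E \<in> sets borel" for E
  proof (rule emeasure_measure_of[OF \<mu>_def])
    show "countably_additive (sets \<mu>) f"
    proof (rule countably_additiveI)
      fix A :: "nat \<Rightarrow> 'a set"
      assume A: "range A \<subseteq> sets \<mu>" "disjoint_family A"
      have "(\<Sum>i. emeasure (chart_measure (s n) y) (A i \<inter> ?D n)) =
          emeasure (chart_measure (s n) y) ((\<Union>i. A i) \<inter> ?D n)" for n
      proof -
        have "(\<Sum>i. emeasure (chart_measure (s n) y) (A i \<inter> ?D n)) = emeasure (chart_measure (s n) y) (\<Union>i. A i \<inter> ?D n)"
          using A D by (intro suminf_emeasure) (auto simp: disjoint_family_on_def sets)
        then show ?thesis by (simp add: Int_UN_distrib2)
      qed
      then have "f (\<Union>i. A i) = (\<Sum>n. \<Sum>i. emeasure (chart_measure (s n) y) (A i \<inter> ?D n))"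
        by (simp add: f_def)
      \<comment> \<open>The double series is reordered by reading the outer sum as an integral over
        counting measure.\<close>
      also have "\<dots> = (\<integral>\<^sup>+n. (\<Sum>i. emeasure (chart_measure (s n) y) (A i \<inter> ?D n)) \<partial>count_space UNIV)"
        by (rule nn_integral_count_space_nat[symmetric])
      also have "\<dots> = (\<Sum>i. \<integral>\<^sup>+n. emeasure (chart_measure (s n) y) (A i \<inter> ?D n) \<partial>count_space UNIV)"
        by (rule nn_integral_suminf) auto
      also have "\<dots> = (\<Sum>i. f (A i))"
        unfolding f_def nn_integral_count_space_nat ..
      finally show "(\<Sum>i. f (A i)) = f (\<Union>i. A i)" by simp
    qed
    show "positive (sets \<mu>) f" by (simp add: positive_def f_def)
  qed (use that sets in auto)
  have "emeasure \<mu> E = emeasure (chart_measure c y) E" if c: "c \<in> \<A>" and E: "E \<in> sets borel" "E \<subseteq> fst c" for c E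
  proof -
    have "emeasure (chart_measure (s n) y) (E \<inter> ?D n) = emeasure (chart_measure c y) (E \<inter> ?D n)" for n
      by (rule emeasure_chart_measure_transition[OF y s(1) c]) (use E D sub in blast)+
    then have "f E = (\<Sum>n. emeasure (chart_measure c y) (E \<inter> ?D n))" by (simp add: f_def)
    also have "\<dots> = emeasure (chart_measure c y) (\<Union>n. E \<inter> ?D n)"
      using disjoint_family_disjointed[of "\<lambda>n. fst (s n)"] D E
      by (intro suminf_emeasure) (auto simp: disjoint_family_on_def)
    also have "(\<Union>n. E \<inter> ?D n) = E" using UN_disjointed_eq[of "\<lambda>n. fst (s n)"] s(2) by auto
    finally show ?thesis using em[OF E(1)] by simp
  qed
  with sets show ?thesis unfolding volume_property_def by blast
qed

lemma volume_property_volume_measure: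
  assumes "immersion \<A> y"
  shows "volume_property y (volume_measure \<A> y)"
  unfolding volume_measure_eq_The[OF assms]
  by (rule theI', rule ex_ex1I[OF volume_property_exists[OF assms] volume_property_unique])

lemma sets_volume_measure:
  "immersion \<A> y \<Longrightarrow> sets (volume_measure \<A> y) = sets borel"
  "immersion \<A> y \<Longrightarrow> space (volume_measure \<A> y) = UNIV"
proof -
  assume y: "immersion \<A> y"
  show 1: "sets (volume_measure \<A> y) = sets borel"
    using volume_property_volume_measure[OF y] by (simp add: volume_property_def)
  show "space (volume_measure \<A> y) = UNIV" using sets_eq_imp_space_eq[OF 1] by simp
qed

text \<open>Restriction to a chart domain is expressed as a density, a form to which the integral
  rules for \<open>density\<close> and \<open>distr\<close> apply.\<close>

lemma density_volume_measure_chart: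
  assumes y: "immersion \<A> y" and c: "c \<in> \<A>"
  shows "density (volume_measure \<A> y) (indicator (fst c)) = chart_measure c y"
proof (rule measure_eqI)
  note V = volume_property_volume_measure[OF y]
  show "sets (density (volume_measure \<A> y) (indicator (fst c))) = sets (chart_measure c y)"
    by (simp add: sets_volume_measure[OF y])
  fix E assume "E \<in> sets (density (volume_measure \<A> y) (indicator (fst c)))"
  then have E: "E \<in> sets borel" by (simp add: sets_volume_measure[OF y])
  have Uc: "fst c \<in> sets borel" using chart_open(1)[OF c] by simp
  have "emeasure (density (volume_measure \<A> y) (indicator (fst c))) E = emeasure (volume_measure \<A> y) (fst c \<inter> E)"
  proof -
    have "indicator (fst c) \<in> borel_measurable (volume_measure \<A> y)"
      by (rule borel_measurable_indicator) (simp add: sets_volume_measure(1)[OF y] Uc)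
    then have "emeasure (density (volume_measure \<A> y) (indicator (fst c))) E =
        (\<integral>\<^sup>+q. indicator (fst c) q * indicator E q \<partial>volume_measure \<A> y)"
      by (rule emeasure_density) (simp add: sets_volume_measure(1)[OF y] E)
    also have "\<dots> = (\<integral>\<^sup>+q. indicator (fst c \<inter> E) q \<partial>volume_measure \<A> y)"
      by (rule nn_integral_cong) (simp split: split_indicator)
    also have "\<dots> = emeasure (volume_measure \<A> y) (fst c \<inter> E)"
      by (rule nn_integral_indicator) (use E Uc in \<open>simp add: sets_volume_measure(1)[OF y]\<close>)
    finally show ?thesis .
  qed
  also have "\<dots> = emeasure (chart_measure c y) (fst c \<inter> E)"
  proof -
    have "fst c \<inter> E \<in> sets borel" "fst c \<inter> E \<subseteq> fst c" using E Uc by auto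
    then show ?thesis using V c unfolding volume_property_def by blast
  qed
  also have "\<dots> = emeasure (chart_measure c y) E"
    using emeasure_chart_measure_Int[OF y c E] by (simp add: Int_commute)
  finally show "emeasure (density (volume_measure \<A> y) (indicator (fst c))) E = emeasure (chart_measure c y) E" .
qed

lemma nn_integral_volume_chart:
  assumes y: "immersion \<A> y" and c: "c \<in> \<A>" and h: "h \<in> borel_measurable borel" "\<And>q. q \<notin> fst c \<Longrightarrow> h q = 0"
  shows "(\<integral>\<^sup>+q. h q \<partial>volume_measure \<A> y) =
    (\<integral>\<^sup>+u. ennreal (indicator (chart_image c) u * vol c y (chart_inv c u)) * h (chart_inv c u) \<partial>lborel)"
proof -
  let ?i = "\<lambda>u. if u \<in> chart_image c then chart_inv c u else undefined"
  have Uc: "fst c \<in> sets borel" using chart_open(1)[OF c] by simp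
  have hV: "h \<in> borel_measurable (volume_measure \<A> y)"
    using h(1) by (simp add: measurable_cong_sets[OF sets_volume_measure(1)[OF y] refl])
  have iV: "indicator (fst c) \<in> borel_measurable (volume_measure \<A> y)"
    by (rule borel_measurable_indicator) (simp add: sets_volume_measure(1)[OF y] Uc)
  have "(\<integral>\<^sup>+q. h q \<partial>volume_measure \<A> y) = (\<integral>\<^sup>+q. indicator (fst c) q * h q \<partial>volume_measure \<A> y)"
    by (rule nn_integral_cong) (use h(2) in \<open>auto simp: indicator_def\<close>)
  also have "\<dots> = (\<integral>\<^sup>+q. h q \<partial>density (volume_measure \<A> y) (indicator (fst c)))"
    by (rule nn_integral_density[OF iV hV, symmetric])
  also have "\<dots> = (\<integral>\<^sup>+u. h (?i u) \<partial>density lborel (\<lambda>u. ennreal (indicator (chart_image c) u * vol c y (chart_inv c u))))"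
    unfolding density_volume_measure_chart[OF y c] chart_measure_def
    by (rule nn_integral_distr) (use chart_inv_measurable[OF c] h(1) in simp_all)
  also have "\<dots> = (\<integral>\<^sup>+u. ennreal (indicator (chart_image c) u * vol c y (chart_inv c u)) * h (?i u) \<partial>lborel)"
    by (rule nn_integral_density)
      (use vol_measurable[OF y c] measurable_compose[OF chart_inv_measurable[OF c] h(1)] in simp_all)
  also have "\<dots> = (\<integral>\<^sup>+u. ennreal (indicator (chart_image c) u * vol c y (chart_inv c u)) * h (chart_inv c u) \<partial>lborel)"
    by (rule nn_integral_cong) (simp split: split_indicator)
  finally show ?thesis .
qed

lemma integral_volume_chart:
  fixes h :: "'a \<Rightarrow> real"
  assumes y: "immersion \<A> y" and c: "c \<in> \<A>" and h: "h \<in> borel_measurable borel" "\<And>q. q \<notin> fst c \<Longrightarrow> h q = 0"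
  shows "(\<integral>q. h q \<partial>volume_measure \<A> y) =
    (\<integral>u. indicator (chart_image c) u * (vol c y (chart_inv c u) * h (chart_inv c u)) \<partial>lborel)"
proof -
  let ?i = "\<lambda>u. if u \<in> chart_image c then chart_inv c u else undefined"
  have Uc: "fst c \<in> sets borel" using chart_open(1)[OF c] by simp
  have hV: "h \<in> borel_measurable (volume_measure \<A> y)"
    using h(1) by (simp add: measurable_cong_sets[OF sets_volume_measure(1)[OF y] refl])
  have iV: "(indicator (fst c) :: 'a \<Rightarrow> real) \<in> borel_measurable (volume_measure \<A> y)"
    by (rule borel_measurable_indicator) (simp add: sets_volume_measure(1)[OF y] Uc)
  have "(\<integral>q. h q \<partial>volume_measure \<A> y) = (\<integral>q. indicator (fst c) q *\<^sub>R h q \<partial>volume_measure \<A> y)"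
    by (rule Bochner_Integration.integral_cong) (use h(2) in \<open>auto simp: indicator_def\<close>)
  also have "\<dots> = (\<integral>q. h q \<partial>density (volume_measure \<A> y) (\<lambda>q. ennreal (indicator (fst c) q)))"
    by (rule integral_density[OF hV iV, symmetric]) simp
  also have "(\<lambda>q. ennreal (indicator (fst c) q)) = (indicator (fst c) :: 'a \<Rightarrow> ennreal)"
    by (auto simp: indicator_def fun_eq_iff)
  also have "(\<integral>q. h q \<partial>density (volume_measure \<A> y) (indicator (fst c))) =
      (\<integral>u. h (?i u) \<partial>density lborel (\<lambda>u. ennreal (indicator (chart_image c) u * vol c y (chart_inv c u))))"
    unfolding density_volume_measure_chart[OF y c] chart_measure_def
    by (rule integral_distr) (use chart_inv_measurable[OF c] h(1) in simp_all)
  also have "\<dots> = (\<integral>u. (indicator (chart_image c) u * vol c y (chart_inv c u)) *\<^sub>R h (?i u) \<partial>lborel)"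
  proof (rule integral_density)
    show "AE u in lborel. 0 \<le> indicator (chart_image c) u * vol c y (chart_inv c u)"
    proof (rule AE_I2)
      fix u show "0 \<le> indicator (chart_image c) u * vol c y (chart_inv c u)"
        using vol_pos[OF y c chart_inverse(4)[OF c], of u] by (auto simp: indicator_def)
    qed
  qed (use vol_measurable[OF y c] measurable_compose[OF chart_inv_measurable[OF c] h(1)] in simp_all)
  also have "\<dots> = (\<integral>u. indicator (chart_image c) u * (vol c y (chart_inv c u) * h (chart_inv c u)) \<partial>lborel)"
    by (rule Bochner_Integration.integral_cong) (simp_all split: split_indicator)
  finally show ?thesis .
qed

end

section \<open>Smooth maps, localisation and compactly supported integrands\<close>

context manifold
begin

lemma smooth_map_const: "smooth_map \<A> (\<lambda>q. k)"
  by (simp add: smooth_map_def smooth_in_chart_def comp_def)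

lemma smooth_map_add:
  assumes "smooth_map \<A> Y" "smooth_map \<A> Z"
  shows "smooth_map \<A> (\<lambda>q. Y q + Z q)"
  using assms chart_open(2) unfolding smooth_map_def smooth_in_chart_def comp_def
  by (intro ballI C_infinity_on_add) blast+

lemma smooth_map_diff:
  assumes "smooth_map \<A> Y" "smooth_map \<A> Z"
  shows "smooth_map \<A> (\<lambda>q. Y q - Z q)"
  using assms chart_open(2) unfolding smooth_map_def smooth_in_chart_def comp_def
  by (intro ballI C_infinity_on_diff) blast+

lemma smooth_map_scaleR:
  assumes "smooth_map \<A> f" "smooth_map \<A> Z"
  shows "smooth_map \<A> (\<lambda>q. f q *\<^sub>R Z q)"
  using assms chart_open(2) unfolding smooth_map_def smooth_in_chart_def comp_def
  by (intro ballI C_infinity_on_scaleR) blast+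

lemma smooth_map_mult:
  fixes f g :: "'a \<Rightarrow> real"
  assumes "smooth_map \<A> f" "smooth_map \<A> g"
  shows "smooth_map \<A> (\<lambda>q. f q * g q)"
  using smooth_map_scaleR[OF assms] by simp

lemma smooth_map_inner:
  fixes Y Z :: "'a \<Rightarrow> 'e::euclidean_space"
  assumes "smooth_map \<A> Y" "smooth_map \<A> Z"
  shows "smooth_map \<A> (\<lambda>q. Y q \<bullet> Z q)"
  using assms chart_open(2) unfolding smooth_map_def smooth_in_chart_def comp_def
  by (intro ballI C_infinity_on_inner) blast+

lemma smooth_map_sum:
  assumes "\<And>i. i \<in> I \<Longrightarrow> smooth_map \<A> (f i)"
  shows "smooth_map \<A> (\<lambda>q. \<Sum>i\<in>I. f i q)"
  using assms chart_open(2) unfolding smooth_map_def smooth_in_chart_def comp_def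
  by (intro ballI C_infinity_on_sum) blast+

lemma smooth_map_compose_real:
  fixes f :: "'a \<Rightarrow> real" and g :: "real \<Rightarrow> real"
  assumes "smooth_map \<A> f" "C_infinity_on g UNIV"
  shows "smooth_map \<A> (\<lambda>q. g (f q))"
  unfolding smooth_map_def smooth_in_chart_def comp_def
proof
  fix c assume c: "c \<in> \<A>"
  show "C_infinity_on (\<lambda>u. g (f (chart_inv c u))) (chart_image c)"
    by (rule C_infinity_on_compose[OF chart_open(2)[OF c] open_UNIV smooth_mapD[OF assms(1) c, unfolded comp_def] assms(2)]) simp
qed

lemma smooth_map_local:
  assumes "\<And>q. \<exists>V. open V \<and> q \<in> V \<and> (\<forall>c\<in>\<A>. C_infinity_on (Y \<circ> chart_inv c) (snd c ` (V \<inter> fst c)))"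
  shows "smooth_map \<A> Y"
  unfolding smooth_map_def smooth_in_chart_def
proof
  fix c assume c: "c \<in> \<A>"
  show "C_infinity_on (Y \<circ> chart_inv c) (chart_image c)"
  proof (rule C_infinity_on_local)
    fix u assume u: "u \<in> chart_image c"
    from assms[of "chart_inv c u"] obtain V where V: "open V" "chart_inv c u \<in> V"
      "\<forall>c\<in>\<A>. C_infinity_on (Y \<circ> chart_inv c) (snd c ` (V \<inter> fst c))" by blast
    have "open (snd c ` (V \<inter> fst c))"
      by (intro chart_image_open[OF c] open_Int V chart_open(1)[OF c]) simp
    moreover have "u \<in> snd c ` (V \<inter> fst c)"
      using V(2) chart_inverse(3,4)[OF c u] by (intro image_eqI[of _ _ "chart_inv c u"]) simp_all
    ultimately show "\<exists>T. u \<in> T \<and> open T \<and> C_infinity_on (Y \<circ> chart_inv c) T"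
      using bspec[OF V(3) c] by (intro exI[of _ "snd c ` (V \<inter> fst c)"] conjI)
  qed
qed

lemma smooth_map_vanishing_outside:
  assumes V: "open V" "\<And>c. c \<in> \<A> \<Longrightarrow> C_infinity_on (Y \<circ> chart_inv c) (snd c ` (V \<inter> fst c))"
    and K: "closed K" "K \<subseteq> V" "\<And>q. q \<notin> K \<Longrightarrow> Y q = 0"
  shows "smooth_map \<A> Y"
proof (rule smooth_map_local)
  fix q
  show "\<exists>V. open V \<and> q \<in> V \<and> (\<forall>c\<in>\<A>. C_infinity_on (Y \<circ> chart_inv c) (snd c ` (V \<inter> fst c)))"
  proof (cases "q \<in> V")
    case True
    then show ?thesis using V by (intro exI[of _ V] conjI ballI)
  next
    case False
    have "C_infinity_on (Y \<circ> chart_inv c) (snd c ` (- K \<inter> fst c))" if c: "c \<in> \<A>" for c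
    proof -
      have op: "open (snd c ` (- K \<inter> fst c))"
        by (intro chart_image_open[OF c] open_Int open_Compl K chart_open(1)[OF c]) simp
      have "(Y \<circ> chart_inv c) u = 0" if "u \<in> snd c ` (- K \<inter> fst c)" for u
      proof -
        from that obtain r where r: "u = snd c r" "r \<notin> K" "r \<in> fst c" by blast
        then show ?thesis by (simp add: chart_inverse(1)[OF c] K(3))
      qed
      then show ?thesis using C_infinity_on_cong[OF op, of "Y \<circ> chart_inv c" "\<lambda>_. 0"] by simp
    qed
    moreover have "open (- K)" "q \<in> - K" using K False by auto
    ultimately show ?thesis by (intro exI[of _ "- K"] conjI ballI)
  qed
qed

lemma smooth_on_preimage:
  assumes "smooth_map \<A> Y" "c \<in> \<A>"
  shows "C_infinity_on (Y \<circ> chart_inv c) (snd c ` (V \<inter> fst c))"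
  by (rule C_infinity_on_subset[OF smooth_mapD[OF assms]]) (auto simp: chart_image_def)

text \<open>The quotient is smooth where \<open>s\<close> is positive and vanishes off the closed
  set \<open>K\<close>, so zeros of \<open>s\<close> away from \<open>K\<close> do no harm. This
  serves to normalise a sum of bumps that is positive only on \<open>K\<close>.\<close>

lemma smooth_map_divide_support:
  fixes Y :: "'a \<Rightarrow> 'e::euclidean_space"
  assumes Y: "smooth_map \<A> Y" and s: "smooth_map \<A> s" and K: "closed K" "\<And>q. q \<notin> K \<Longrightarrow> Y q = 0"
    and pos: "\<And>q. q \<in> K \<Longrightarrow> 0 < s q"
  shows "smooth_map \<A> (\<lambda>q. inverse (s q) *\<^sub>R Y q)"
proof (rule smooth_map_vanishing_outside[of "{q. 0 < s q}" _ K])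
  show op: "open {q. 0 < s q}"
    by (rule open_Collect_less[OF continuous_on_const smooth_map_continuous[OF s]])
  show "C_infinity_on ((\<lambda>q. inverse (s q) *\<^sub>R Y q) \<circ> chart_inv c) (snd c ` ({q. 0 < s q} \<inter> fst c))"
    if c: "c \<in> \<A>" for c
  proof -
    have opc: "open (snd c ` ({q. 0 < s q} \<inter> fst c))"
      by (intro chart_image_open[OF c] open_Int op chart_open(1)[OF c]) simp
    have nz: "s (chart_inv c u) \<noteq> 0" if "u \<in> snd c ` ({q. 0 < s q} \<inter> fst c)" for u
    proof -
      from that obtain r where "u = snd c r" "0 < s r" "r \<in> fst c" by blast
      then show ?thesis by (simp add: chart_inverse(1)[OF c])
    qed
    show ?thesis
      unfolding comp_def
      by (rule C_infinity_on_scaleR[OF opc C_infinity_on_inverse[OF opc] ])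
        (use smooth_on_preimage[OF s c] smooth_on_preimage[OF Y c] nz in \<open>simp_all only: comp_def not_False_eq_True\<close>)
  qed
  show "closed K" by (rule K)
  show "K \<subseteq> {q. 0 < s q}" using pos by blast
  show "inverse (s q) *\<^sub>R Y q = 0" if "q \<notin> K" for q using K(2)[OF that] by simp
qed

text \<open>A bump in coordinates, extended by zero. The extension is smooth because the support
  lies in a compact set, which is closed in a Hausdorff space; the coordinate set \<open>K\<close>
  is recorded for the integrals computed in the chart.\<close>

lemma chart_bump:
  assumes c: "c \<in> \<A>" "q0 \<in> fst c"
  obtains b :: "'a \<Rightarrow> real" and K where "smooth_map \<A> b" "compact K" "K \<subseteq> chart_image c" "0 < b q0" "\<And>q. 0 \<le> b q"
    "\<And>q. b q \<noteq> 0 \<Longrightarrow> q \<in> fst c \<and> snd c q \<in> K" "compact (chart_inv c ` K)"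
proof -
  obtain \<delta> where \<delta>: "0 < \<delta>" "cball (snd c q0) \<delta> \<subseteq> chart_image c"
    using open_contains_cball_eq[OF chart_open(2)[OF c(1)]] chart_inverse(2)[OF c] by blast
  define K where "K = cball (snd c q0) \<delta>"
  define g where "g u = bump ((u - snd c q0) \<bullet> (u - snd c q0) / \<delta>\<^sup>2)" for u
  define b where "b q = (if q \<in> fst c then g (snd c q) else 0)" for q
  have Cg: "C_infinity_on g S" for S
  proof -
    have "C_infinity_on (\<lambda>u. (u - snd c q0) \<bullet> (u - snd c q0) / \<delta>\<^sup>2) UNIV"
      using \<delta>(1) by (intro C_infinity_on_divide C_infinity_on_inner C_infinity_on_diff C_infinity_on_const C_infinity_on_id) auto
    then have "C_infinity_on g UNIV"
      unfolding g_def by (rule C_infinity_on_compose[OF open_UNIV open_UNIV _ C_infinity_on_bump]) simp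
    then show ?thesis by (rule C_infinity_on_subset) simp
  qed
  have gK: "u \<in> K" if "g u \<noteq> 0" for u
  proof -
    have "(u - snd c q0) \<bullet> (u - snd c q0) / \<delta>\<^sup>2 < 1"
      using that bump_simps(3) unfolding g_def by (meson not_less)
    then have "(norm (u - snd c q0))\<^sup>2 < \<delta>\<^sup>2" using \<delta>(1) by (simp add: power2_norm_eq_inner divide_less_eq)
    then have "norm (u - snd c q0) < \<delta>" using \<delta>(1) by (simp add: power_less_imp_less_base)
    then show ?thesis by (simp add: K_def dist_norm norm_minus_commute)
  qed
  have K: "compact K" "K \<subseteq> chart_image c" using \<delta> by (auto simp: K_def)
  have cK: "compact (chart_inv c ` K)"
    by (rule compact_continuous_image[OF continuous_on_subset[OF chart_cont(2)[OF c(1)] K(2)] K(1)])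
  have bK: "q \<in> fst c \<and> snd c q \<in> K" if "b q \<noteq> 0" for q
    using that gK by (simp add: b_def split: if_splits)
  have "smooth_map \<A> b"
  proof (rule smooth_map_vanishing_outside[of "fst c" _ "chart_inv c ` K"])
    show "open (fst c)" by (rule chart_open(1)[OF c(1)])
    show "closed (chart_inv c ` K)" using cK by (rule compact_imp_closed)
    show "chart_inv c ` K \<subseteq> fst c" using chart_inverse(4)[OF c(1)] K(2) by blast
    show "b q = 0" if "q \<notin> chart_inv c ` K" for q
    proof (rule ccontr)
      assume "b q \<noteq> 0"
      from bK[OF this] have "q = chart_inv c (snd c q)" "snd c q \<in> K" by (simp_all add: chart_inverse(1)[OF c(1)])
      with that show False by blast
    qed
    show "C_infinity_on (b \<circ> chart_inv d) (snd d ` (fst c \<inter> fst d))" if d: "d \<in> \<A>" for d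
    proof -
      have op: "open (snd d ` (fst c \<inter> fst d))"
        by (intro chart_image_open[OF d] open_Int chart_open(1) c d) simp
      have "C_infinity_on (snd c \<circ> chart_inv d) (snd d ` (fst c \<inter> fst d))"
        unfolding Int_commute[of "fst c"] using atlas c(1) d unfolding smooth_atlas_def by blast
      then have "C_infinity_on (\<lambda>u. g ((snd c \<circ> chart_inv d) u)) (snd d ` (fst c \<inter> fst d))"
        by (rule C_infinity_on_compose[OF op open_UNIV _ Cg]) simp
      also have "?this \<longleftrightarrow> ?thesis"
      proof (rule C_infinity_on_cong[OF op])
        fix u assume "u \<in> snd d ` (fst c \<inter> fst d)"
        then obtain r where "u = snd d r" "r \<in> fst c" "r \<in> fst d" by blast
        then show "g ((snd c \<circ> chart_inv d) u) = (b \<circ> chart_inv d) u"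
          by (simp add: b_def chart_inverse(1)[OF d])
      qed
      finally show ?thesis .
    qed
  qed
  moreover have "0 < b q0" using c(2) by (simp add: b_def g_def bump_simps)
  moreover have "0 \<le> b q" for q by (simp add: b_def g_def bump_simps)
  ultimately show thesis using K bK cK by (intro that[of b K])
qed

text \<open>An unnormalised partition of unity on \<open>K\<close>: each bump lives in one chart and
  their sum is positive on \<open>K\<close>. The index set consists of points of the manifold, a
  bump being chosen around each point.\<close>

lemma finite_bump_cover:
  assumes K: "compact K"
  shows "\<exists>(I :: 'a set) (b :: 'a \<Rightarrow> 'a \<Rightarrow> real) ch L. finite I \<and>
    (\<forall>i\<in>I. ch i \<in> \<A> \<and> smooth_map \<A> (b i) \<and> compact (L i) \<and> L i \<subseteq> chart_image (ch i)) \<and>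
    (\<forall>i\<in>I. \<forall>q. b i q \<noteq> 0 \<longrightarrow> q \<in> fst (ch i) \<and> snd (ch i) q \<in> L i) \<and>
    (\<forall>q\<in>K. 0 < (\<Sum>i\<in>I. b i q))"
proof -
  have "\<exists>x. fst x \<in> \<A> \<and> smooth_map \<A> (fst (snd x)) \<and> compact (snd (snd x)) \<and> snd (snd x) \<subseteq> chart_image (fst x) \<and>
      (0::real) < fst (snd x) i \<and> (\<forall>q. 0 \<le> fst (snd x) q) \<and>
      (\<forall>q. fst (snd x) q \<noteq> 0 \<longrightarrow> q \<in> fst (fst x) \<and> snd (fst x) q \<in> snd (snd x))" for i
  proof -
    obtain c where c: "c \<in> \<A>" "i \<in> fst c" using chart_cover by blast
    show ?thesis
    proof (rule chart_bump[OF c])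
      fix b :: "'a \<Rightarrow> real" and L
      assume "smooth_map \<A> b" "compact L" "L \<subseteq> chart_image c" "0 < b i" "\<And>q. 0 \<le> b q"
        "\<And>q. b q \<noteq> 0 \<Longrightarrow> q \<in> fst c \<and> snd c q \<in> L"
      with c(1) show ?thesis by (intro exI[of _ "(c, b, L)"]) simp
    qed
  qed
  then obtain x where x: "\<And>i. fst (x i) \<in> \<A> \<and> smooth_map \<A> (fst (snd (x i))) \<and> compact (snd (snd (x i))) \<and>
      snd (snd (x i)) \<subseteq> chart_image (fst (x i)) \<and>
      (0::real) < fst (snd (x i)) i \<and> (\<forall>q. 0 \<le> fst (snd (x i)) q) \<and>
      (\<forall>q. fst (snd (x i)) q \<noteq> 0 \<longrightarrow> q \<in> fst (fst (x i)) \<and> snd (fst (x i)) q \<in> snd (snd (x i)))" by metis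
  define ch b L where "ch i = fst (x i)" and "b i = fst (snd (x i))" and "L i = snd (snd (x i))" for i
  note x' = x[folded ch_def b_def L_def]
  have op: "open {q. 0 < b i q}" for i
    by (rule open_Collect_less[OF continuous_on_const smooth_map_continuous]) (use x' in blast)
  have "K \<subseteq> (\<Union>i\<in>K. {q. 0 < b i q})" using x' by blast
  then obtain I where I: "I \<subseteq> K" "finite I" "K \<subseteq> (\<Union>i\<in>I. {q. 0 < b i q})"
    using compactE_image[OF K, of K "\<lambda>i. {q. 0 < b i q}"] op by blast
  have "0 < (\<Sum>i\<in>I. b i q)" if q: "q \<in> K" for q
  proof -
    obtain i where "i \<in> I" "0 < b i q" using I(3) q by blast
    then show ?thesis using I(2) x' by (intro sum_pos2[of I i]) blast+
  qed
  with I(2) x' show ?thesis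
    by (intro exI[of _ I] exI[of _ b] exI[of _ ch] exI[of _ L] conjI ballI allI impI) blast+
qed

text \<open>Finitely many compact sets inside single charts cover \<open>K\<close>, and on their
  coordinate images the volume density is continuous, hence integrable.\<close>

lemma emeasure_volume_compact:
  assumes y: "immersion \<A> y" and K: "compact K"
  shows "emeasure (volume_measure \<A> y) K < \<infinity>"
proof -
  let ?\<mu> = "volume_measure \<A> y"
  obtain I :: "'a set" and b :: "'a \<Rightarrow> 'a \<Rightarrow> real" and ch L where I: "finite I"
    "\<forall>i\<in>I. ch i \<in> \<A> \<and> smooth_map \<A> (b i) \<and> compact (L i) \<and> L i \<subseteq> chart_image (ch i)"
    "\<forall>i\<in>I. \<forall>q. b i q \<noteq> 0 \<longrightarrow> q \<in> fst (ch i) \<and> snd (ch i) q \<in> L i"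
    "\<forall>q\<in>K. 0 < (\<Sum>i\<in>I. b i q)" using finite_bump_cover[OF K] by (elim exE conjE)
  define E where "E i = chart_inv (ch i) ` L i" for i
  have E: "compact (E i)" "E i \<subseteq> fst (ch i)" "snd (ch i) ` E i = L i" if i: "i \<in> I" for i
  proof -
    note Ii = bspec[OF I(2) i]
    show "compact (E i)" unfolding E_def
      by (rule compact_continuous_image[OF continuous_on_subset[OF chart_cont(2)]]) (use Ii in blast)+
    show "E i \<subseteq> fst (ch i)" unfolding E_def using chart_inverse(4) Ii by blast
    have "snd (ch i) (chart_inv (ch i) u) = u" if "u \<in> L i" for u using chart_inverse(3) Ii that by blast
    then show "snd (ch i) ` E i = L i" unfolding E_def image_image by simp
  qed
  have fin: "emeasure ?\<mu> (E i) < \<infinity>" if i: "i \<in> I" for i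
  proof -
    note Ii = bspec[OF I(2) i]
    have Eb: "E i \<in> sets borel" using borel_compact[OF E(1)[OF i]] .
    have "emeasure ?\<mu> (E i) = emeasure (chart_measure (ch i) y) (E i)"
      using volume_property_volume_measure[OF y] Ii Eb E(2)[OF i] unfolding volume_property_def by blast
    also have "\<dots> = (\<integral>\<^sup>+u. ennreal (indicator (L i) u * vol (ch i) y (chart_inv (ch i) u)) \<partial>lborel)"
      using emeasure_chart_measure_full[OF y _ Eb] Ii by (simp add: Int_absorb2[OF E(2)[OF i]] E(3)[OF i])
    also have "\<dots> < \<infinity>"
    proof -
      have cont: "continuous_on (L i) (\<lambda>u. vol (ch i) y (chart_inv (ch i) u))"
        by (rule continuous_on_subset[OF continuous_on_vol[OF y]]) (use Ii in blast)+
      have "integrable lborel (\<lambda>u. indicator (L i) u *\<^sub>R vol (ch i) y (chart_inv (ch i) u))"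
        by (rule borel_integrable_compact[OF _ cont]) (use Ii in blast)
      then have "(\<integral>\<^sup>+u. ennreal (norm (indicator (L i) u *\<^sub>R vol (ch i) y (chart_inv (ch i) u))) \<partial>lborel) < \<infinity>"
        by (simp add: integrable_iff_bounded)
      moreover have "norm (indicator (L i) u *\<^sub>R vol (ch i) y (chart_inv (ch i) u)) =
          indicator (L i) u * vol (ch i) y (chart_inv (ch i) u)" for u
      proof (cases "u \<in> L i")
        case True
        have "chart_inv (ch i) u \<in> fst (ch i)" using chart_inverse(4) Ii True by blast
        then have "0 < vol (ch i) y (chart_inv (ch i) u)" using vol_pos[OF y] Ii by blast
        then show ?thesis by simp
      qed simp
      ultimately show ?thesis by (simp only:)
    qed
    finally show ?thesis .
  qed
  have "emeasure ?\<mu> K \<le> emeasure ?\<mu> (\<Union>i\<in>I. E i)"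
  proof (rule emeasure_mono)
    show "K \<subseteq> (\<Union>i\<in>I. E i)"
    proof
      fix q assume "q \<in> K"
      then have "(\<Sum>i\<in>I. b i q) \<noteq> 0" using I(4) by force
      then obtain i where i: "i \<in> I" "b i q \<noteq> 0" by (meson sum.neutral)
      have "q = chart_inv (ch i) (snd (ch i) q)" using bspec[OF I(3) i(1)] bspec[OF I(2) i(1)] i(2) chart_inverse(1) by metis
      then have "q \<in> E i" unfolding E_def using bspec[OF I(3) i(1)] i(2) by blast
      then show "q \<in> (\<Union>i\<in>I. E i)" using i(1) by blast
    qed
    show "(\<Union>i\<in>I. E i) \<in> sets ?\<mu>"
      unfolding sets_volume_measure(1)[OF y] using E(1) I(1) borel_compact by (intro sets.finite_UN) blast+
  qed
  also have "emeasure ?\<mu> (\<Union>i\<in>I. E i) \<le> (\<Sum>i\<in>I. emeasure ?\<mu> (E i))"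
    by (rule emeasure_subadditive_finite[OF I(1)]) (use E(1) borel_compact sets_volume_measure(1)[OF y] in blast)
  also have "\<dots> < \<infinity>" using fin I(1) by (simp add: less_top[symmetric])
  finally show ?thesis .
qed

lemma integrable_volume_compact_support:
  fixes h :: "'a \<Rightarrow> real"
  assumes y: "immersion \<A> y" and K: "compact K" and h: "h \<in> borel_measurable borel"
    and bound: "\<And>q. q \<in> K \<Longrightarrow> \<bar>h q\<bar> \<le> C" and zero: "\<And>q. q \<notin> K \<Longrightarrow> h q = 0"
  shows "integrable (volume_measure \<A> y) h"
proof (rule integrableI_bounded_set[where A=K and B=C])
  show "K \<in> sets (volume_measure \<A> y)" using borel_compact[OF K] by (simp add: sets_volume_measure(1)[OF y])
  show "h \<in> borel_measurable (volume_measure \<A> y)"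
    using h by (simp add: measurable_cong_sets[OF sets_volume_measure(1)[OF y] refl])
  show "emeasure (volume_measure \<A> y) K < \<infinity>" by (rule emeasure_volume_compact[OF y K])
  show "AE q\<in>K in volume_measure \<A> y. norm (h q) \<le> C" using bound by simp
qed (use zero in auto)

lemma integrable_volume_continuous:
  fixes h :: "'a \<Rightarrow> real"
  assumes y: "immersion \<A> y" and K: "compact K" and h: "continuous_on UNIV h"
    and zero: "\<And>q. q \<notin> K \<Longrightarrow> h q = 0"
  shows "integrable (volume_measure \<A> y) h"
proof -
  have "compact (h ` K)" by (rule compact_continuous_image[OF continuous_on_subset[OF h] K]) simp
  from compact_imp_bounded[OF this] obtain C where "\<And>q. q \<in> K \<Longrightarrow> \<bar>h q\<bar> \<le> C"
    unfolding bounded_iff by auto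
  then show ?thesis
    using integrable_volume_compact_support[OF y K borel_measurable_continuous_onI[OF h] _ zero] by blast
qed

end

section \<open>Global first and second variation\<close>

lemma jet_cong:
  assumes "open U" "u \<in> U" "\<And>v. v \<in> U \<Longrightarrow> f v = g v" "f differentiable (at u)"
  shows "jet f u = jet g u"
  using frechet_derivative_transform_within_open[OF assms(4,1,2,3)] assms(2,3) by (simp add: jet_def)

context manifold
begin

definition pick :: "'a \<Rightarrow> ('a, 'm) chart" where
  "pick q = (SOME c. c \<in> \<A> \<and> q \<in> fst c)"

lemma pick: "pick q \<in> \<A>" "q \<in> fst (pick q)"
proof -
  have "pick q \<in> \<A> \<and> q \<in> fst (pick q)"
    unfolding pick_def by (rule someI_ex) (use chart_cover[of q] in blast)
  then show "pick q \<in> \<A>" "q \<in> fst (pick q)" by blast+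
qed

text \<open>
  The densities of the weighted volume of \<open>z\<close> and of its first and second variations with respect to
  the volume measure of \<open>y\<close>. They do not depend on the chart picked at each point.
\<close>

definition weight0 :: "('a \<Rightarrow> 'e::euclidean_space) \<Rightarrow> ('a \<Rightarrow> 'e) \<Rightarrow> 'a \<Rightarrow> real" where
  "weight0 y z q = lagr (chart_jet (pick q) z q) / vol (pick q) y q"

definition weight1 :: "('a \<Rightarrow> 'e::euclidean_space) \<Rightarrow> ('a \<Rightarrow> 'e) \<Rightarrow> ('a \<Rightarrow> 'e) \<Rightarrow> 'a \<Rightarrow> real" where
  "weight1 y z W q = dlagr (chart_jet (pick q) z q) (chart_jet (pick q) W q) / vol (pick q) y q"

definition weight2 :: "('a \<Rightarrow> 'e::euclidean_space) \<Rightarrow> ('a \<Rightarrow> 'e) \<Rightarrow> ('a \<Rightarrow> 'e) \<Rightarrow> ('a \<Rightarrow> 'e) \<Rightarrow> 'a \<Rightarrow> real" where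
  "weight2 y z \<alpha> \<beta> q = ddlagr (chart_jet (pick q) z q) (chart_jet (pick q) \<alpha> q) (chart_jet (pick q) \<beta> q) / vol (pick q) y q"

lemma chart_jet_pick:
  assumes "smooth_map \<A> z" "c \<in> \<A>" "q \<in> fst c"
  shows "chart_jet c z q = jet_map (trans c (pick q) q) (chart_jet (pick q) z q)"
  by (rule chart_jet_trans[OF assms(2,3) pick smooth_map_differentiable[OF assms(1) pick]])

lemma vol_pick:
  assumes "smooth_map \<A> y" "c \<in> \<A>" "q \<in> fst c"
  shows "vol c y q = \<bar>det (trans c (pick q) q)\<bar> * vol (pick q) y q"
  by (rule vol_transition[OF trans_det[OF assms(2,3) pick] chart_jet_pick[OF assms]])

lemma weight0_chart:
  assumes "smooth_map \<A> y" "smooth_map \<A> z" "c \<in> \<A>" "q \<in> fst c"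
  shows "weight0 y z q = lagr (chart_jet c z q) / vol c y q"
  using trans_det[OF assms(3,4) pick]
  by (simp add: weight0_def chart_jet_pick[OF assms(2-4)] vol_pick[OF assms(1,3,4)] lagr_jet_map)

lemma regular_pick:
  assumes "smooth_map \<A> z" "c \<in> \<A>" "q \<in> fst c" "chart_jet c z q \<in> regular_jets"
  shows "chart_jet (pick q) z q \<in> regular_jets"
  using assms(4) unfolding chart_jet_pick[OF assms(1-3)] jet_map_regular[OF trans_det[OF assms(2,3) pick]] .

lemma weight1_chart:
  assumes "smooth_map \<A> y" "smooth_map \<A> z" "smooth_map \<A> W" "c \<in> \<A>" "q \<in> fst c" "chart_jet c z q \<in> regular_jets"
  shows "weight1 y z W q = dlagr (chart_jet c z q) (chart_jet c W q) / vol c y q"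
  using trans_det[OF assms(4,5) pick]
  by (simp add: weight1_def chart_jet_pick[OF assms(2,4,5)] chart_jet_pick[OF assms(3-5)] vol_pick[OF assms(1,4,5)]
      dlagr_jet_map regular_pick[OF assms(2,4-6)])

lemma weight2_chart:
  assumes "smooth_map \<A> y" "smooth_map \<A> z" "smooth_map \<A> \<alpha>" "smooth_map \<A> \<beta>"
    "c \<in> \<A>" "q \<in> fst c" "chart_jet c z q \<in> regular_jets"
  shows "weight2 y z \<alpha> \<beta> q = ddlagr (chart_jet c z q) (chart_jet c \<alpha> q) (chart_jet c \<beta> q) / vol c y q"
  using trans_det[OF assms(5,6) pick]
  by (simp add: weight2_def chart_jet_pick[OF assms(2,5,6)] chart_jet_pick[OF assms(3,5,6)]
      chart_jet_pick[OF assms(4-6)] vol_pick[OF assms(1,5,6)] ddlagr_jet_map regular_pick[OF assms(2,5-7)])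

lemma continuous_on_charts:
  assumes "\<And>c. c \<in> \<A> \<Longrightarrow> continuous_on (chart_image c) (\<lambda>u. h (chart_inv c u))"
  shows "continuous_on UNIV h"
proof (rule continuous_at_imp_continuous_on, rule ballI)
  fix q
  let ?c = "pick q"
  have "continuous_on (fst ?c) (\<lambda>q. h (chart_inv ?c (snd ?c q)))"
    by (rule continuous_on_compose2[OF assms[OF pick(1)] chart_cont(1)[OF pick(1)]])
      (simp add: chart_image_def)
  then have "continuous_on (fst ?c) h"
    by (rule continuous_on_eq) (simp add: chart_inverse(1)[OF pick(1)])
  then show "isCont h q"
    using continuous_on_eq_continuous_at[OF chart_open(1)[OF pick(1)[of q]]] pick(2) by blast
qed

lemma chart_jet_inv:
  "c \<in> \<A> \<Longrightarrow> u \<in> chart_image c \<Longrightarrow> chart_jet c Y (chart_inv c u) = jet (Y \<circ> chart_inv c) u"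
  by (simp add: chart_jet_def chart_inverse(3))

lemma vol_pos_inv: "immersion \<A> y \<Longrightarrow> c \<in> \<A> \<Longrightarrow> u \<in> chart_image c \<Longrightarrow> 0 < vol c y (chart_inv c u)"
  by (rule vol_pos[OF _ _ chart_inverse(4)])

lemma weight1_chart_inv:
  assumes "immersion \<A> y" "smooth_map \<A> W" "c \<in> \<A>" "u \<in> chart_image c"
  shows "vol c y (chart_inv c u) * weight1 y y W (chart_inv c u) =
    dlagr (jet (y \<circ> chart_inv c) u) (jet (W \<circ> chart_inv c) u)"
  using weight1_chart[OF immersion_smooth[OF assms(1)] immersion_smooth[OF assms(1)] assms(2,3) chart_inverse(4)[OF assms(3,4)]
      immersion_regular[OF assms(1,3) chart_inverse(4)[OF assms(3,4)]]] vol_pos_inv[OF assms(1,3,4)]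
  by (simp add: chart_jet_inv[OF assms(3,4)])

lemma weight2_chart_inv:
  assumes "immersion \<A> y" "smooth_map \<A> \<alpha>" "smooth_map \<A> \<beta>" "c \<in> \<A>" "u \<in> chart_image c"
  shows "vol c y (chart_inv c u) * weight2 y y \<alpha> \<beta> (chart_inv c u) =
    ddlagr (jet (y \<circ> chart_inv c) u) (jet (\<alpha> \<circ> chart_inv c) u) (jet (\<beta> \<circ> chart_inv c) u)"
  using weight2_chart[OF immersion_smooth[OF assms(1)] immersion_smooth[OF assms(1)] assms(2-4) chart_inverse(4)[OF assms(4,5)]
      immersion_regular[OF assms(1,4) chart_inverse(4)[OF assms(4,5)]]] vol_pos_inv[OF assms(1,4,5)]
  by (simp add: chart_jet_inv[OF assms(4,5)])

text \<open>The chart picked at a point may jump from point to point, so continuity is read off in a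
  fixed chart, where the same function has a smooth numerator and a continuous positive
  denominator.\<close>

lemma continuous_weight1:
  assumes y: "immersion \<A> y" and W: "smooth_map \<A> W"
  shows "continuous_on UNIV (weight1 y y W)"
proof (rule continuous_on_charts)
  fix c assume c: "c \<in> \<A>"
  have "C_infinity_on (\<lambda>u. dlagr (jet (y \<circ> chart_inv c) u) (jet (W \<circ> chart_inv c) u)) (chart_image c)"
    by (intro C_infinity_on_dlagr chart_open(2) C_infinity_on_jet smooth_mapD immersion_smooth y W c immersion_regular_image)
  then have "continuous_on (chart_image c)
      (\<lambda>u. dlagr (jet (y \<circ> chart_inv c) u) (jet (W \<circ> chart_inv c) u) / vol c y (chart_inv c u))"
    by (intro continuous_on_divide C_infinity_on_continuous continuous_on_vol y c)
      (use vol_pos_inv[OF y c] in force)+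
  then show "continuous_on (chart_image c) (\<lambda>u. weight1 y y W (chart_inv c u))"
    by (rule continuous_on_eq) (simp add: weight1_chart_inv[OF y W c, symmetric] less_imp_neq[OF vol_pos_inv[OF y c], symmetric])
qed

lemma continuous_weight2:
  assumes y: "immersion \<A> y" and \<alpha>: "smooth_map \<A> \<alpha>" and \<beta>: "smooth_map \<A> \<beta>"
  shows "continuous_on UNIV (weight2 y y \<alpha> \<beta>)"
proof (rule continuous_on_charts)
  fix c assume c: "c \<in> \<A>"
  have "C_infinity_on (\<lambda>u. ddlagr (jet (y \<circ> chart_inv c) u) (jet (\<alpha> \<circ> chart_inv c) u) (jet (\<beta> \<circ> chart_inv c) u)) (chart_image c)"
    by (intro C_infinity_on_ddlagr chart_open(2) C_infinity_on_jet smooth_mapD immersion_smooth y \<alpha> \<beta> c immersion_regular_image)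
  then have "continuous_on (chart_image c)
      (\<lambda>u. ddlagr (jet (y \<circ> chart_inv c) u) (jet (\<alpha> \<circ> chart_inv c) u) (jet (\<beta> \<circ> chart_inv c) u) / vol c y (chart_inv c u))"
    by (intro continuous_on_divide C_infinity_on_continuous continuous_on_vol y c)
      (use vol_pos_inv[OF y c] in force)+
  then show "continuous_on (chart_image c) (\<lambda>u. weight2 y y \<alpha> \<beta> (chart_inv c u))"
    by (rule continuous_on_eq) (simp add: weight2_chart_inv[OF y \<alpha> \<beta> c, symmetric] less_imp_neq[OF vol_pos_inv[OF y c], symmetric])
qed

lemma chart_jet_add:
  assumes "smooth_map \<A> Y" "smooth_map \<A> Z" "c \<in> \<A>" "q \<in> fst c"
  shows "chart_jet c (\<lambda>q. Y q + Z q) q = chart_jet c Y q + chart_jet c Z q"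
  using jet_add[OF smooth_map_differentiable[OF assms(1,3,4)] smooth_map_differentiable[OF assms(2,3,4)]]
  by (simp add: chart_jet_def comp_def)

lemma chart_jet_scaleR:
  assumes "smooth_map \<A> Y" "c \<in> \<A>" "q \<in> fst c"
  shows "chart_jet c (\<lambda>q. r *\<^sub>R Y q) q = r *\<^sub>R chart_jet c Y q"
  using jet_scaleR[OF smooth_map_differentiable[OF assms]] by (simp add: chart_jet_def comp_def)

lemma chart_jet_const_zero: "chart_jet c (\<lambda>q. 0) q = 0"
  by (simp add: chart_jet_def comp_def jet_def zero_prod_def vec_eq_iff)

lemma chart_jet_sum:
  assumes "finite I" "\<And>i. i \<in> I \<Longrightarrow> smooth_map \<A> (Y i)" "c \<in> \<A>" "q \<in> fst c"
  shows "chart_jet c (\<lambda>q. \<Sum>i\<in>I. Y i q) q = (\<Sum>i\<in>I. chart_jet c (Y i) q)"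
  using assms(1,2)
proof (induction I rule: finite_induct)
  case empty
  then show ?case by (simp add: chart_jet_const_zero)
next
  case (insert i I)
  have "chart_jet c (\<lambda>q. Y i q + (\<Sum>i\<in>I. Y i q)) q = chart_jet c (Y i) q + chart_jet c (\<lambda>q. \<Sum>i\<in>I. Y i q) q"
    by (rule chart_jet_add[OF _ _ assms(3,4)]) (use insert.prems in \<open>auto intro: smooth_map_sum\<close>)
  then show ?case using insert by simp
qed

lemma chart_jet_vanishing:
  assumes "closed K" "\<And>q. q \<notin> K \<Longrightarrow> Y q = 0" "c \<in> \<A>" "q \<in> fst c" "q \<notin> K"
  shows "chart_jet c Y q = 0"
  unfolding chart_jet_def
proof (rule jet_vanishing)
  show "open (snd c ` (- K \<inter> fst c))"
    by (intro chart_image_open[OF assms(3)] open_Int open_Compl assms chart_open(1)) simp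
  show "snd c q \<in> snd c ` (- K \<inter> fst c)" using assms by blast
  show "(Y \<circ> chart_inv c) v = 0" if "v \<in> snd c ` (- K \<inter> fst c)" for v
  proof -
    from that obtain r where "v = snd c r" "r \<notin> K" "r \<in> fst c" by blast
    then show ?thesis by (simp add: chart_inverse(1)[OF assms(3)] assms(2))
  qed
qed

lemma weight1_vanishing:
  assumes "closed K" "\<And>q. q \<notin> K \<Longrightarrow> W q = 0" "q \<notin> K" "chart_jet (pick q) z q \<in> regular_jets"
  shows "weight1 y z W q = 0"
proof -
  have "chart_jet (pick q) W q = 0"
    by (rule chart_jet_vanishing[OF assms(1) _ pick assms(3)]) (rule assms(2))
  then show ?thesis by (simp add: weight1_def linear_0[OF linear_dlagr[OF assms(4)]])
qed

lemma weight2_vanishing: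
  assumes "closed K" "\<And>q. q \<notin> K \<Longrightarrow> \<beta> q = 0" "q \<notin> K" "chart_jet (pick q) z q \<in> regular_jets"
  shows "weight2 y z \<alpha> \<beta> q = 0"
proof -
  have "chart_jet (pick q) \<beta> q = 0"
    by (rule chart_jet_vanishing[OF assms(1) _ pick assms(3)]) (rule assms(2))
  then show ?thesis by (simp add: weight2_def linear_0[OF linear_ddlagr[OF assms(4)]])
qed

text \<open>The pieces are the bumps divided by their sum, times \<open>Y\<close>. Each piece is
  recorded as a pointwise multiple of \<open>Y\<close> so that tangency of \<open>Y\<close> passes
  to the pieces.\<close>

lemma split_compact_support:
  fixes Y :: "'a \<Rightarrow> 'e::euclidean_space"
  assumes Y: "smooth_map \<A> Y" and K: "compact K" "\<forall>q. q \<notin> K \<longrightarrow> Y q = 0"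
  shows "\<exists>(I :: 'a set) Z f ch L. finite I \<and>
    (\<forall>i\<in>I. ch i \<in> \<A> \<and> smooth_map \<A> (Z i) \<and> compact (L i) \<and> L i \<subseteq> chart_image (ch i) \<and>
      (\<forall>q. Z i q \<noteq> 0 \<longrightarrow> q \<in> fst (ch i) \<and> snd (ch i) q \<in> L i) \<and> (\<forall>q. Z i q = f i q *\<^sub>R Y q)) \<and>
    (\<forall>q. Y q = (\<Sum>i\<in>I. Z i q))"
proof -
  obtain I :: "'a set" and b :: "'a \<Rightarrow> 'a \<Rightarrow> real" and ch L where I: "finite I"
    "\<forall>i\<in>I. ch i \<in> \<A> \<and> smooth_map \<A> (b i) \<and> compact (L i) \<and> L i \<subseteq> chart_image (ch i)"
    "\<forall>i\<in>I. \<forall>q. b i q \<noteq> 0 \<longrightarrow> q \<in> fst (ch i) \<and> snd (ch i) q \<in> L i"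
    "\<forall>q\<in>K. 0 < (\<Sum>i\<in>I. b i q)" using finite_bump_cover[OF K(1)] by (elim exE conjE)
  define s where "s q = (\<Sum>i\<in>I. b i q)" for q
  define f where "f i q = b i q * inverse (s q)" for i q
  define Z where "Z i q = b i q *\<^sub>R (inverse (s q) *\<^sub>R Y q)" for i q
  have s: "smooth_map \<A> s" unfolding s_def by (rule smooth_map_sum) (use I(2) in blast)
  have pos: "0 < s q" if "q \<in> K" for q using bspec[OF I(4) that] unfolding s_def .
  have Y': "smooth_map \<A> (\<lambda>q. inverse (s q) *\<^sub>R Y q)"
    by (rule smooth_map_divide_support[OF Y s compact_imp_closed[OF K(1)] K(2)[rule_format] pos])
  have "Y q = (\<Sum>i\<in>I. Z i q)" for q
  proof (cases "q \<in> K")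
    case True
    then have "s q \<noteq> 0" using pos by force
    then show ?thesis unfolding Z_def scaleR_left.sum[symmetric] s_def[symmetric] by simp
  qed (simp add: K(2) Z_def)
  moreover have "ch i \<in> \<A> \<and> smooth_map \<A> (Z i) \<and> compact (L i) \<and> L i \<subseteq> chart_image (ch i) \<and>
      (\<forall>q. Z i q \<noteq> 0 \<longrightarrow> q \<in> fst (ch i) \<and> snd (ch i) q \<in> L i) \<and> (\<forall>q. Z i q = f i q *\<^sub>R Y q)" if i: "i \<in> I" for i
  proof (intro conjI allI impI)
    show "ch i \<in> \<A>" "compact (L i)" "L i \<subseteq> chart_image (ch i)" using bspec[OF I(2) i] by blast+
    show "smooth_map \<A> (Z i)" unfolding Z_def by (rule smooth_map_scaleR[OF _ Y']) (use bspec[OF I(2) i] in blast)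
    show "Z i q = f i q *\<^sub>R Y q" for q by (simp add: Z_def f_def)
    fix q assume "Z i q \<noteq> 0"
    then have "b i q \<noteq> 0" by (auto simp: Z_def)
    then show "q \<in> fst (ch i)" "snd (ch i) q \<in> L i" using bspec[OF I(3) i] by blast+
  qed
  ultimately show ?thesis using I(1)
    by (intro exI[of _ I] exI[of _ Z] exI[of _ f] exI[of _ ch] exI[of _ L] conjI ballI allI) blast+
qed

lemma chart_support:
  assumes c: "c \<in> \<A>" and L: "compact L" "L \<subseteq> chart_image c" "\<forall>q. Z q \<noteq> 0 \<longrightarrow> q \<in> fst c \<and> snd c q \<in> L"
  shows "compact (chart_inv c ` L)" "chart_inv c ` L \<subseteq> fst c" "\<And>q. q \<notin> chart_inv c ` L \<Longrightarrow> Z q = 0"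
    "\<And>u. u \<in> chart_image c - L \<Longrightarrow> Z (chart_inv c u) = 0"
proof -
  show "compact (chart_inv c ` L)"
    by (rule compact_continuous_image[OF continuous_on_subset[OF chart_cont(2)[OF c] L(2)] L(1)])
  show "chart_inv c ` L \<subseteq> fst c" using chart_inverse(4)[OF c] L(2) by blast
  show "Z q = 0" if "q \<notin> chart_inv c ` L" for q
  proof (rule ccontr)
    assume "Z q \<noteq> 0"
    from L(3)[rule_format, OF this] have "q = chart_inv c (snd c q)" "snd c q \<in> L" by (simp_all add: chart_inverse(1)[OF c])
    with that show False by blast
  qed
  show "Z (chart_inv c u) = 0" if u: "u \<in> chart_image c - L" for u
  proof (rule ccontr)
    assume "Z (chart_inv c u) \<noteq> 0"
    from L(3)[rule_format, OF this] have "snd c (chart_inv c u) \<in> L" by blast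
    moreover have "snd c (chart_inv c u) = u" using chart_inverse(3)[OF c] u by blast
    ultimately show False using u by simp
  qed
qed

definition critical :: "('a \<Rightarrow> 'e::euclidean_space) \<Rightarrow> bool" where
  "critical y \<longleftrightarrow> immersion \<A> y \<and> (\<forall>c\<in>\<A>. critical_on (chart_image c) (y \<circ> chart_inv c))"

lemma integral_weight1_zero:
  fixes y :: "'a \<Rightarrow> 'e::euclidean_space"
  assumes crit: "critical y" and W: "smooth_map \<A> W" and K: "compact K" "\<And>q. q \<notin> K \<Longrightarrow> W q = 0"
  shows "(\<integral>q. weight1 y y W q \<partial>volume_measure \<A> y) = 0"
proof -
  have y: "immersion \<A> y" using crit by (simp add: critical_def)
  have K2: "\<forall>q. q \<notin> K \<longrightarrow> W q = 0" using K(2) by blast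
  obtain I :: "'a set" and Z f ch L where I: "finite I"
    "\<forall>i\<in>I. ch i \<in> \<A> \<and> smooth_map \<A> (Z i) \<and> compact (L i) \<and> L i \<subseteq> chart_image (ch i) \<and>
      (\<forall>q. Z i q \<noteq> 0 \<longrightarrow> q \<in> fst (ch i) \<and> snd (ch i) q \<in> L i) \<and> (\<forall>q. Z i q = f i q *\<^sub>R W q)"
    "\<forall>q. W q = (\<Sum>i\<in>I. Z i q)" using split_compact_support[OF W K(1) K2] by (elim exE conjE)
  have piece: "integrable (volume_measure \<A> y) (weight1 y y (Z i)) \<and> (\<integral>q. weight1 y y (Z i) q \<partial>volume_measure \<A> y) = 0"
    if i: "i \<in> I" for i
  proof -
    have c: "ch i \<in> \<A>" and Zi: "smooth_map \<A> (Z i)" and L: "compact (L i)" "L i \<subseteq> chart_image (ch i)"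
      "\<forall>q. Z i q \<noteq> 0 \<longrightarrow> q \<in> fst (ch i) \<and> snd (ch i) q \<in> L i" using bspec[OF I(2) i] by blast+
    note S = chart_support[OF c L]
    have zero: "weight1 y y (Z i) q = 0" if "q \<notin> chart_inv (ch i) ` L i" for q
      by (rule weight1_vanishing[OF compact_imp_closed[OF S(1)] S(3) that immersion_regular[OF y pick]])
    note cont = continuous_weight1[OF y Zi]
    have "(\<integral>q. weight1 y y (Z i) q \<partial>volume_measure \<A> y) =
        (\<integral>u. indicator (chart_image (ch i)) u * (vol (ch i) y (chart_inv (ch i) u) * weight1 y y (Z i) (chart_inv (ch i) u)) \<partial>lborel)"
      by (rule integral_volume_chart[OF y c borel_measurable_continuous_onI[OF cont]]) (use zero S(2) in blast)
    also have "\<dots> = (\<integral>u. indicator (chart_image (ch i)) u * dlagr (jet (y \<circ> chart_inv (ch i)) u) (jet (Z i \<circ> chart_inv (ch i)) u) \<partial>lborel)"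
      by (rule Bochner_Integration.integral_cong) (simp_all add: weight1_chart_inv[OF y Zi c] split: split_indicator)
    also have "\<dots> = 0"
      by (rule first_variation_zero[OF _ smooth_mapD[OF Zi c] L(1,2)])
        (use crit c S(4) in \<open>simp_all add: critical_def\<close>)
    finally show ?thesis using integrable_volume_continuous[OF y S(1) cont zero] by blast
  qed
  have "weight1 y y W q = (\<Sum>i\<in>I. weight1 y y (Z i) q)" for q
  proof -
    have "W = (\<lambda>q. \<Sum>i\<in>I. Z i q)" using I(3) by blast
    then have "chart_jet (pick q) W q = (\<Sum>i\<in>I. chart_jet (pick q) (Z i) q)"
      using chart_jet_sum[OF I(1) _ pick, of Z q] I(2) by simp
    then show ?thesis
      by (simp add: weight1_def linear_sum[OF linear_dlagr[OF immersion_regular[OF y pick]]] sum_divide_distrib)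
  qed
  then have "(\<integral>q. weight1 y y W q \<partial>volume_measure \<A> y) = (\<integral>q. (\<Sum>i\<in>I. weight1 y y (Z i) q) \<partial>volume_measure \<A> y)"
    by simp
  also have "\<dots> = 0" using piece by simp
  finally show ?thesis .
qed

text \<open>Linearity in \<tau> localises the claim to charts. There a tangential field is the
  derivative of the immersion along its coordinate field \<open>T\<close>, which is the situation of
  \<open>second_variation_tangential_zero\<close>.\<close>

lemma integral_weight2_tangential_zero:
  fixes y :: "'a \<Rightarrow> 'e::euclidean_space"
  assumes crit: "critical y" and \<tau>: "smooth_map \<A> \<tau>" and \<omega>: "smooth_map \<A> \<omega>"
    and tang: "\<And>q. \<tau> q \<in> tangent_space \<A> y q"
    and K: "compact K" "\<And>q. q \<notin> K \<Longrightarrow> \<tau> q = 0"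
  shows "(\<integral>q. weight2 y y \<omega> \<tau> q \<partial>volume_measure \<A> y) = 0"
proof -
  have y: "immersion \<A> y" using crit by (simp add: critical_def)
  note ys = immersion_smooth[OF y]
  have K2: "\<forall>q. q \<notin> K \<longrightarrow> \<tau> q = 0" using K(2) by blast
  obtain I :: "'a set" and Z f ch L where I: "finite I"
    "\<forall>i\<in>I. ch i \<in> \<A> \<and> smooth_map \<A> (Z i) \<and> compact (L i) \<and> L i \<subseteq> chart_image (ch i) \<and>
      (\<forall>q. Z i q \<noteq> 0 \<longrightarrow> q \<in> fst (ch i) \<and> snd (ch i) q \<in> L i) \<and> (\<forall>q. Z i q = f i q *\<^sub>R \<tau> q)"
    "\<forall>q. \<tau> q = (\<Sum>i\<in>I. Z i q)" using split_compact_support[OF \<tau> K(1) K2] by (elim exE conjE)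
  have piece: "integrable (volume_measure \<A> y) (weight2 y y \<omega> (Z i)) \<and> (\<integral>q. weight2 y y \<omega> (Z i) q \<partial>volume_measure \<A> y) = 0"
    if i: "i \<in> I" for i
  proof -
    have c: "ch i \<in> \<A>" and Zi: "smooth_map \<A> (Z i)" and L: "compact (L i)" "L i \<subseteq> chart_image (ch i)"
      "\<forall>q. Z i q \<noteq> 0 \<longrightarrow> q \<in> fst (ch i) \<and> snd (ch i) q \<in> L i" and fZ: "\<And>q. Z i q = f i q *\<^sub>R \<tau> q"
      using bspec[OF I(2) i] by blast+
    note S = chart_support[OF c L]
    have zero: "weight2 y y \<omega> (Z i) q = 0" if "q \<notin> chart_inv (ch i) ` L i" for q
      by (rule weight2_vanishing[OF compact_imp_closed[OF S(1)] S(3) that immersion_regular[OF y pick]])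
    note cont = continuous_weight2[OF y \<omega> Zi]
    define U where "U = chart_image (ch i)"
    define Y where "Y = y \<circ> chart_inv (ch i)"
    define R where "R = Z i \<circ> chart_inv (ch i)"
    \<comment> \<open>The coordinates of the vector \<open>R u\<close> in the frame, computed with
      the inverse Gram matrix so that they depend smoothly on the point.\<close>
    define T where "T u = matrix_inv (gram (snd (jet Y u))) *v (\<chi> k. R u \<bullet> snd (jet Y u) $ k)" for u
    have U: "open U" unfolding U_def by (rule chart_open(2)[OF c])
    have CY: "C_infinity_on Y U" unfolding Y_def U_def by (rule smooth_mapD[OF ys c])
    have CR: "C_infinity_on R U" unfolding R_def U_def by (rule smooth_mapD[OF Zi c])
    have reg: "jet Y u \<in> regular_jets" if "u \<in> U" for u
      using immersion_regular_image[OF y c] that unfolding Y_def U_def by blast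
    note CJ = C_infinity_on_jet[OF U CY]
    have CG: "C_infinity_on (\<lambda>u. gram (snd (jet Y u)) $ k $ l) U" for k l
      unfolding gram_nth by (intro C_infinity_on_inner C_infinity_on_vec_nth C_infinity_on_snd CJ U)
    have CT: "C_infinity_on T U"
      unfolding T_def matrix_vector_mult_def
      by (intro C_infinity_on_vec C_infinity_on_sum C_infinity_on_mult C_infinity_on_matrix_inv[OF U CG] U)
        (use regular_jets_det[OF reg] C_infinity_on_inner[OF U CR C_infinity_on_vec_nth[OF U C_infinity_on_snd[OF U CJ]]] in simp_all)
    have RT: "R u = frechet_derivative Y (at u) (T u)" if u: "u \<in> U" for u
    proof -
      let ?q = "chart_inv (ch i) u"
      have q: "?q \<in> fst (ch i)" by (rule chart_inverse(4)[OF c u[unfolded U_def]])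
      have sub: "subspace (tangent_space \<A> y ?q)"
        unfolding tangent_space_eq[OF ys c q] by (rule linear_subspace_image[OF chart_D_linear[OF ys c q] subspace_UNIV])
      have "Z i ?q \<in> tangent_space \<A> y ?q" unfolding fZ by (rule subspace_scale[OF sub tang])
      moreover have "0 \<in> normal_space \<A> y ?q" unfolding normal_space_iff[OF ys c q] by simp
      ultimately have "normal_part \<A> y ?q (Z i ?q) = 0" by (intro normal_part_unique[OF ys]) simp_all
      then have "frame_normal (snd (jet Y u)) (R u) = 0"
        unfolding normal_part_eq[OF y c q] by (simp add: chart_jet_inv[OF c u[unfolded U_def]] Y_def R_def)
      then have "R u = (\<Sum>k\<in>UNIV. T u $ k *\<^sub>R snd (jet Y u) $ k)"
        by (simp add: frame_normal_def T_def)
      also have "\<dots> = frechet_derivative Y (at u) (T u)"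
      proof -
        have "linear (frechet_derivative Y (at u))"
          using C_infinity_on_D[OF CY u] by (rule has_derivative_linear)
        from frechet_derivative_axis_sum[OF this, of "T u"] show ?thesis by (simp add: jet_def)
      qed
      finally show ?thesis .
    qed
    have jetR: "jet R u = jet (\<lambda>u. frechet_derivative Y (at u) (T u)) u" if u: "u \<in> U" for u
      by (rule jet_cong[OF U u RT C_infinity_on_differentiable[OF CR u]])
    have "(\<integral>q. weight2 y y \<omega> (Z i) q \<partial>volume_measure \<A> y) =
        (\<integral>u. indicator U u * (vol (ch i) y (chart_inv (ch i) u) * weight2 y y \<omega> (Z i) (chart_inv (ch i) u)) \<partial>lborel)"
      unfolding U_def
      by (rule integral_volume_chart[OF y c borel_measurable_continuous_onI[OF cont]]) (use zero S(2) in blast)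
    also have "\<dots> = (\<integral>u. indicator U u * ddlagr (jet Y u) (jet (\<omega> \<circ> chart_inv (ch i)) u)
        (jet (\<lambda>u. frechet_derivative Y (at u) (T u)) u) \<partial>lborel)"
      by (rule Bochner_Integration.integral_cong)
        (simp_all add: weight2_chart_inv[OF y \<omega> Zi c, folded U_def Y_def R_def] jetR split: split_indicator)
    also have "\<dots> = 0"
    proof (rule second_variation_tangential_zero[OF _ CT _ L(1)])
      show "critical_on U Y" using crit c by (simp add: critical_def U_def Y_def)
      show "C_infinity_on (\<omega> \<circ> chart_inv (ch i)) U" unfolding U_def by (rule smooth_mapD[OF \<omega> c])
      show "L i \<subseteq> U" using L(2) by (simp add: U_def)
      show "T u = 0" if "u \<in> U - L i" for u
        using S(4)[OF that[unfolded U_def]] by (simp add: T_def R_def zero_vec_def[symmetric])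
    qed
    finally show ?thesis using integrable_volume_continuous[OF y S(1) cont zero] by blast
  qed
  have "weight2 y y \<omega> \<tau> q = (\<Sum>i\<in>I. weight2 y y \<omega> (Z i) q)" for q
  proof -
    have "\<tau> = (\<lambda>q. \<Sum>i\<in>I. Z i q)" using I(3) by blast
    then have "chart_jet (pick q) \<tau> q = (\<Sum>i\<in>I. chart_jet (pick q) (Z i) q)"
      using chart_jet_sum[OF I(1) _ pick, of Z q] I(2) by simp
    then show ?thesis
      by (simp add: weight2_def linear_sum[OF linear_ddlagr[OF immersion_regular[OF y pick]]] sum_divide_distrib)
  qed
  then have "(\<integral>q. weight2 y y \<omega> \<tau> q \<partial>volume_measure \<A> y) = (\<integral>q. (\<Sum>i\<in>I. weight2 y y \<omega> (Z i) q) \<partial>volume_measure \<A> y)"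
    by simp
  also have "\<dots> = 0" using piece by simp
  finally show ?thesis .
qed

end

section \<open>The second derivative of the weighted volume along a linear variation\<close>

context manifold
begin

lemma smooth_map_line:
  assumes "smooth_map \<A> y" "smooth_map \<A> \<eta>"
  shows "smooth_map \<A> (\<lambda>q. y q + t *\<^sub>R \<eta> q)"
  by (intro smooth_map_add smooth_map_scaleR smooth_map_const assms)

lemma chart_jet_line:
  assumes "smooth_map \<A> y" "smooth_map \<A> \<eta>" "c \<in> \<A>" "q \<in> fst c"
  shows "chart_jet c (\<lambda>q. y q + t *\<^sub>R \<eta> q) q = chart_jet c y q + t *\<^sub>R chart_jet c \<eta> q"
  using chart_jet_add[OF assms(1) smooth_map_scaleR[OF smooth_map_const assms(2)] assms(3,4), of t]
    chart_jet_scaleR[OF assms(2-4), of t] by simp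

lemma regular_pick_iff:
  assumes "smooth_map \<A> z" "c \<in> \<A>" "q \<in> fst c"
  shows "chart_jet c z q \<in> regular_jets \<longleftrightarrow> chart_jet (pick q) z q \<in> regular_jets"
  unfolding chart_jet_pick[OF assms] jet_map_regular[OF trans_det[OF assms(2,3) pick]] ..

lemma continuous_imp_bounded_compact:
  fixes h :: "'b::topological_space \<Rightarrow> real"
  assumes "compact D" "continuous_on D h"
  shows "\<exists>C. \<forall>p\<in>D. \<bar>h p\<bar> \<le> C"
proof -
  from compact_imp_bounded[OF compact_continuous_image[OF assms(2,1)]] show ?thesis
    unfolding bounded_iff by simp
qed

text \<open>Jet and weights depend continuously on point and time jointly, and regularity is an open
  condition, so everything is controlled on a compact neighbourhood of \<open>(u0, 0)\<close> in
  coordinates and time.\<close>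

lemma local_variation_bounds:
  fixes y \<eta> :: "'a \<Rightarrow> 'e::euclidean_space"
  assumes y: "immersion \<A> y" and \<eta>: "smooth_map \<A> \<eta>"
  shows "\<exists>V \<delta> C. open V \<and> q0 \<in> V \<and> 0 < \<delta> \<and> (\<forall>q\<in>V. \<forall>t. \<bar>t\<bar> < \<delta> \<longrightarrow>
    chart_jet (pick q) (\<lambda>q. y q + t *\<^sub>R \<eta> q) q \<in> regular_jets \<and>
    \<bar>weight0 y (\<lambda>q. y q + t *\<^sub>R \<eta> q) q\<bar> \<le> C \<and>
    \<bar>weight1 y (\<lambda>q. y q + t *\<^sub>R \<eta> q) \<eta> q\<bar> \<le> C \<and>
    \<bar>weight2 y (\<lambda>q. y q + t *\<^sub>R \<eta> q) \<eta> \<eta> q\<bar> \<le> C)"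
proof -
  note ys = immersion_smooth[OF y]
  define c where "c = pick q0"
  have c: "c \<in> \<A>" "q0 \<in> fst c" using pick by (simp_all add: c_def)
  define U where "U = chart_image c"
  have U: "open U" unfolding U_def by (rule chart_open(2)[OF c(1)])
  define Y where "Y = y \<circ> chart_inv c"
  define E where "E = \<eta> \<circ> chart_inv c"
  have CY: "C_infinity_on (jet Y) U" and CE: "C_infinity_on (jet E) U"
    unfolding Y_def E_def U_def by (intro C_infinity_on_jet chart_open(2) smooth_mapD ys \<eta> c)+
  define S where "S = U \<times> (UNIV :: real set)"
  have S: "open S" unfolding S_def by (intro open_Times U open_UNIV)
  define j where "j p = jet Y (fst p) + snd p *\<^sub>R jet E (fst p)" for p
  have Cfst: "C_infinity_on (\<lambda>p :: (real ^ 'm) \<times> real. fst p) S'" "C_infinity_on (\<lambda>p :: (real ^ 'm) \<times> real. snd p) S'"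
    if "open S'" for S'
    by (rule C_infinity_on_fst[OF that C_infinity_on_id], rule C_infinity_on_snd[OF that C_infinity_on_id])
  have Cjet: "C_infinity_on (\<lambda>p. jet Y (fst p)) S" "C_infinity_on (\<lambda>p. jet E (fst p)) S"
    by (rule C_infinity_on_compose[OF S U Cfst(1)[OF S] CY], force simp: S_def,
        rule C_infinity_on_compose[OF S U Cfst(1)[OF S] CE], force simp: S_def)
  have Cj: "C_infinity_on j S"
    unfolding j_def by (intro C_infinity_on_add C_infinity_on_scaleR Cjet Cfst S)
  define O' where "O' = S \<inter> j -` regular_jets"
  have O': "open O'" unfolding O'_def
    by (rule continuous_open_preimage[OF C_infinity_on_continuous[OF Cj] S open_regular_jets])
  have O'S: "O' \<subseteq> S" and jO: "j ` O' \<subseteq> regular_jets" by (auto simp: O'_def)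
  note CjO = C_infinity_on_subset[OF Cj O'S] and CEO = C_infinity_on_subset[OF Cjet(2) O'S]
  define v where "v p = vol c y (chart_inv c (fst p))" for p :: "(real ^ 'm) \<times> real"
  have cv: "continuous_on O' v" unfolding v_def
    by (rule continuous_on_compose2[OF continuous_on_vol[OF y c(1)] continuous_on_fst[OF continuous_on_id]])
      (use O'S in \<open>auto simp: S_def U_def\<close>)
  have vpos: "v p \<noteq> 0" if "p \<in> O'" for p
  proof -
    have "fst p \<in> chart_image c" using that O'S by (auto simp: S_def U_def)
    from vol_pos_inv[OF y c(1) this] show ?thesis by (simp add: v_def)
  qed
  have c0: "continuous_on O' (\<lambda>p. lagr (j p) / v p)"
    by (intro continuous_on_divide cv C_infinity_on_continuous[OF C_infinity_on_compose[OF O' open_regular_jets CjO C_infinity_on_lagr jO]])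
      (use vpos in blast)
  have c1: "continuous_on O' (\<lambda>p. dlagr (j p) (jet E (fst p)) / v p)"
    by (intro continuous_on_divide cv C_infinity_on_continuous[OF C_infinity_on_dlagr[OF O' CjO CEO jO]]) (use vpos in blast)
  have c2: "continuous_on O' (\<lambda>p. ddlagr (j p) (jet E (fst p)) (jet E (fst p)) / v p)"
    by (intro continuous_on_divide cv C_infinity_on_continuous[OF C_infinity_on_ddlagr[OF O' CjO CEO CEO jO]]) (use vpos in blast)
  define u0 where "u0 = snd c q0"
  have u0: "u0 \<in> U" unfolding u0_def U_def by (rule chart_inverse(2)[OF c])
  have "(u0, 0) \<in> O'"
    using u0 immersion_regular[OF y c] by (simp add: O'_def S_def j_def chart_jet_def u0_def Y_def)
  then obtain r where r: "0 < r" "cball (u0, 0) r \<subseteq> O'" using O' open_contains_cball by blast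
  define D where "D = cball (u0, 0 :: real) r"
  have D: "compact D" "D \<subseteq> O'" using r by (auto simp: D_def)
  obtain C0 where C0: "\<forall>p\<in>D. \<bar>lagr (j p) / v p\<bar> \<le> C0"
    using continuous_imp_bounded_compact[OF D(1) continuous_on_subset[OF c0 D(2)]] by blast
  obtain C1 where C1: "\<forall>p\<in>D. \<bar>dlagr (j p) (jet E (fst p)) / v p\<bar> \<le> C1"
    using continuous_imp_bounded_compact[OF D(1) continuous_on_subset[OF c1 D(2)]] by blast
  obtain C2 where C2: "\<forall>p\<in>D. \<bar>ddlagr (j p) (jet E (fst p)) (jet E (fst p)) / v p\<bar> \<le> C2"
    using continuous_imp_bounded_compact[OF D(1) continuous_on_subset[OF c2 D(2)]] by blast
  \<comment> \<open>Half of the radius for the space variable and half for time keep the pair inside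
    the ball of radius \<open>r\<close>.\<close>
  define V where "V = fst c \<inter> snd c -` ball u0 (r / 2)"
  have V: "open V" unfolding V_def
    by (rule continuous_open_preimage[OF chart_cont(1)[OF c(1)] chart_open(1)[OF c(1)] open_ball])
  have q0: "q0 \<in> V" using c(2) r(1) by (simp add: V_def u0_def)
  have "chart_jet (pick q) (\<lambda>q. y q + t *\<^sub>R \<eta> q) q \<in> regular_jets \<and>
    \<bar>weight0 y (\<lambda>q. y q + t *\<^sub>R \<eta> q) q\<bar> \<le> max C0 (max C1 C2) \<and>
    \<bar>weight1 y (\<lambda>q. y q + t *\<^sub>R \<eta> q) \<eta> q\<bar> \<le> max C0 (max C1 C2) \<and>
    \<bar>weight2 y (\<lambda>q. y q + t *\<^sub>R \<eta> q) \<eta> \<eta> q\<bar> \<le> max C0 (max C1 C2)" if q: "q \<in> V" and t: "\<bar>t\<bar> < r / 2" for q t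
  proof -
    have qc: "q \<in> fst c" and du: "dist u0 (snd c q) < r / 2" using q by (auto simp: V_def)
    define p where "p = (snd c q, t)"
    have "dist (u0, 0) p \<le> dist u0 (snd c q) + \<bar>t\<bar>"
      unfolding p_def dist_Pair_Pair using sqrt_sum_squares_le_sum[of "dist u0 (snd c q)" "\<bar>t\<bar>"] by (simp add: dist_real_def)
    then have pD: "p \<in> D" using du t by (simp add: D_def)
    note smt = smooth_map_line[OF ys \<eta>, of t]
    have jp: "j p = chart_jet c (\<lambda>q. y q + t *\<^sub>R \<eta> q) q"
      unfolding chart_jet_line[OF ys \<eta> c(1) qc] by (simp add: j_def p_def chart_jet_def Y_def E_def)
    have Ep: "jet E (fst p) = chart_jet c \<eta> q" by (simp add: p_def chart_jet_def E_def)
    have vp: "v p = vol c y q" by (simp add: v_def p_def chart_inverse(1)[OF c(1) qc])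
    have reg: "chart_jet c (\<lambda>q. y q + t *\<^sub>R \<eta> q) q \<in> regular_jets"
      unfolding jp[symmetric] using pD D(2) jO by blast
    show ?thesis
      using regular_pick[OF smt c(1) qc reg] bspec[OF C0 pD] bspec[OF C1 pD] bspec[OF C2 pD]
      unfolding weight0_chart[OF ys smt c(1) qc] weight1_chart[OF ys smt \<eta> c(1) qc reg]
        weight2_chart[OF ys smt \<eta> \<eta> c(1) qc reg] jp Ep vp by (simp add: le_max_iff_disj)
  qed
  then show ?thesis using V q0 r(1)
    by - (rule exI[of _ V], rule exI[of _ "r / 2"], rule exI[of _ "max C0 (max C1 C2)"], simp)
qed

lemma uniform_variation_bounds:
  fixes y \<eta> :: "'a \<Rightarrow> 'e::euclidean_space"
  assumes y: "immersion \<A> y" and \<eta>: "smooth_map \<A> \<eta>" and K: "compact K"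
  shows "\<exists>\<delta>>0. \<exists>C\<ge>0. \<forall>q\<in>K. \<forall>t. \<bar>t\<bar> < \<delta> \<longrightarrow>
    chart_jet (pick q) (\<lambda>q. y q + t *\<^sub>R \<eta> q) q \<in> regular_jets \<and>
    \<bar>weight0 y (\<lambda>q. y q + t *\<^sub>R \<eta> q) q\<bar> \<le> C \<and>
    \<bar>weight1 y (\<lambda>q. y q + t *\<^sub>R \<eta> q) \<eta> q\<bar> \<le> C \<and>
    \<bar>weight2 y (\<lambda>q. y q + t *\<^sub>R \<eta> q) \<eta> \<eta> q\<bar> \<le> C"
proof -
  define P where "P q t C \<longleftrightarrow> chart_jet (pick q) (\<lambda>q. y q + t *\<^sub>R \<eta> q) q \<in> regular_jets \<and>
    \<bar>weight0 y (\<lambda>q. y q + t *\<^sub>R \<eta> q) q\<bar> \<le> C \<and>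
    \<bar>weight1 y (\<lambda>q. y q + t *\<^sub>R \<eta> q) \<eta> q\<bar> \<le> C \<and>
    \<bar>weight2 y (\<lambda>q. y q + t *\<^sub>R \<eta> q) \<eta> \<eta> q\<bar> \<le> C" for q t C
  have mono: "P q t C'" if "P q t C" "C \<le> C'" for q t C C' using that unfolding P_def by linarith
  have "\<forall>q0. \<exists>V \<delta> C. open V \<and> q0 \<in> V \<and> 0 < \<delta> \<and> (\<forall>q\<in>V. \<forall>t. \<bar>t\<bar> < \<delta> \<longrightarrow> P q t C)"
    unfolding P_def using local_variation_bounds[OF y \<eta>] by (rule allI)
  then obtain V \<delta> C where V: "\<forall>q0. open (V q0) \<and> q0 \<in> V q0 \<and> 0 < \<delta> q0 \<and> (\<forall>q\<in>V q0. \<forall>t. \<bar>t\<bar> < \<delta> q0 \<longrightarrow> P q t (C q0))"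
    by metis
  have "K \<subseteq> (\<Union>i\<in>K. V i)" using V by blast
  then obtain I where I: "I \<subseteq> K" "finite I" "K \<subseteq> (\<Union>i\<in>I. V i)"
    using compactE_image[OF K, of K V] V by metis
  \<comment> \<open>The inserted values 1 and 0 make minimum and maximum meaningful when the finite
    cover is empty; the 0 also makes \<open>M\<close> nonnegative.\<close>
  define d where "d = Min (insert 1 (\<delta> ` I))"
  define M where "M = Max (insert 0 (C ` I))"
  have "d > 0" unfolding d_def using V I(2) by (subst Min_gr_iff) auto
  moreover have "M \<ge> 0" unfolding M_def using I(2) by (intro Max_ge) auto
  moreover have "P q t M" if q: "q \<in> K" and t: "\<bar>t\<bar> < d" for q t
  proof -
    obtain i where i: "i \<in> I" "q \<in> V i" using I(3) q by blast
    have "d \<le> \<delta> i" unfolding d_def using I(2) i(1) by (intro Min_le) auto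
    then have "P q t (C i)" using V i(2) t by force
    moreover have "C i \<le> M" unfolding M_def using I(2) i(1) by (intro Max_ge) auto
    ultimately show ?thesis by (rule mono)
  qed
  ultimately show ?thesis unfolding P_def by blast
qed

lemma weight0_nonneg:
  assumes "immersion \<A> y" "immersion \<A> z"
  shows "0 \<le> weight0 y z q"
  unfolding weight0_def
  using lagr_pos[OF immersion_regular[OF assms(2) pick]] vol_pos[OF assms(1) pick]
  by (intro divide_nonneg_nonneg less_imp_le)

lemma continuous_vol_ratio:
  assumes y: "immersion \<A> y" and z: "immersion \<A> z"
  shows "continuous_on UNIV (\<lambda>q. vol (pick q) z q / vol (pick q) y q)"
    and "c \<in> \<A> \<Longrightarrow> q \<in> fst c \<Longrightarrow> vol (pick q) z q / vol (pick q) y q = vol c z q / vol c y q"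
proof -
  show ratio: "vol (pick q) z q / vol (pick q) y q = vol c z q / vol c y q" if "c \<in> \<A>" "q \<in> fst c" for c q
    unfolding vol_pick[OF immersion_smooth[OF y] that] vol_pick[OF immersion_smooth[OF z] that]
    using trans_det[OF that pick] by simp
  show "continuous_on UNIV (\<lambda>q. vol (pick q) z q / vol (pick q) y q)"
  proof (rule continuous_on_charts)
    fix c assume c: "c \<in> \<A>"
    have "continuous_on (chart_image c) (\<lambda>u. vol c z (chart_inv c u) / vol c y (chart_inv c u))"
      by (intro continuous_on_divide continuous_on_vol y z c) (use vol_pos_inv[OF y c] in force)
    then show "continuous_on (chart_image c)
        (\<lambda>u. vol (pick (chart_inv c u)) z (chart_inv c u) / vol (pick (chart_inv c u)) y (chart_inv c u))"
      by (rule continuous_on_eq) (rule ratio[OF c chart_inverse(4)[OF c], symmetric])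
  qed
qed

text \<open>Every volume measure is a density over that of one fixed immersion, so the weighted
  volume along a variation becomes a parameter integral over a fixed measure. The factors from a
  change of chart cancel in the ratio.\<close>

lemma volume_measure_density:
  assumes y: "immersion \<A> y" and z: "immersion \<A> z"
  shows "volume_measure \<A> z = density (volume_measure \<A> y) (\<lambda>q. ennreal (vol (pick q) z q / vol (pick q) y q))"
proof (rule volume_property_unique[OF volume_property_volume_measure[OF z]])
  let ?J = "\<lambda>q. vol (pick q) z q / vol (pick q) y q"
  have J: "(\<lambda>q. ennreal (?J q)) \<in> borel_measurable borel"
    using borel_measurable_continuous_onI[OF continuous_vol_ratio(1)[OF y z]] by simp
  show "volume_property z (density (volume_measure \<A> y) (\<lambda>q. ennreal (?J q)))"
    unfolding volume_property_def
  proof (intro conjI ballI impI)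
    show "sets (density (volume_measure \<A> y) (\<lambda>q. ennreal (?J q))) = sets borel"
      by (simp add: sets_volume_measure(1)[OF y])
    fix c E assume c: "c \<in> \<A>" and E: "E \<in> sets borel" "E \<subseteq> fst c"
    have "emeasure (density (volume_measure \<A> y) (\<lambda>q. ennreal (?J q))) E =
        (\<integral>\<^sup>+q. ennreal (?J q) * indicator E q \<partial>volume_measure \<A> y)"
      by (rule emeasure_density)
        (use J E(1) in \<open>simp_all add: sets_volume_measure(1)[OF y] measurable_cong_sets[OF sets_volume_measure(1)[OF y] refl]\<close>)
    also have "\<dots> = (\<integral>\<^sup>+u. ennreal (indicator (chart_image c) u * vol c y (chart_inv c u)) *
        (ennreal (?J (chart_inv c u)) * indicator E (chart_inv c u)) \<partial>lborel)"
      by (rule nn_integral_volume_chart[OF y c]) (use J E in \<open>auto simp: indicator_def\<close>)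
    also have "\<dots> = (\<integral>\<^sup>+u. ennreal (indicator (snd c ` E) u * vol c z (chart_inv c u)) \<partial>lborel)"
    proof (rule nn_integral_cong)
      fix u
      show "ennreal (indicator (chart_image c) u * vol c y (chart_inv c u)) *
          (ennreal (?J (chart_inv c u)) * indicator E (chart_inv c u)) =
          ennreal (indicator (snd c ` E) u * vol c z (chart_inv c u))"
      proof (cases "u \<in> chart_image c")
        case True
        note q = chart_inverse(4)[OF c True]
        have "u \<in> snd c ` E \<longleftrightarrow> chart_inv c u \<in> E"
          unfolding chart_image_inter[OF c E(2)] using True by simp
        moreover have "ennreal (vol c y (chart_inv c u)) * ennreal (?J (chart_inv c u)) = ennreal (vol c z (chart_inv c u))"
          unfolding continuous_vol_ratio(2)[OF y z c q]
          using vol_pos[OF y c q] by (subst ennreal_mult'[symmetric]) auto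
        ultimately show ?thesis using True by (simp add: indicator_def)
      next
        case False
        then have "u \<notin> snd c ` E" using E(2) by (auto simp: chart_image_def)
        then show ?thesis using False by simp
      qed
    qed
    also have "\<dots> = emeasure (chart_measure c z) E"
      by (simp add: emeasure_chart_measure_full[OF z c E(1)] Int_absorb2[OF E(2)])
    finally show "emeasure (density (volume_measure \<A> y) (\<lambda>q. ennreal (?J q))) E = emeasure (chart_measure c z) E" .
  qed
qed

lemma continuous_weight0:
  assumes y: "immersion \<A> y" and z: "immersion \<A> z"
  shows "continuous_on UNIV (weight0 y z)"
proof -
  have eq: "weight0 y z = (\<lambda>q. exp (- (1/2) * (z q \<bullet> z q)) * (vol (pick q) z q / vol (pick q) y q))"
    by (simp add: weight0_def lagr_eq_vol[OF pick] fun_eq_iff)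
  show ?thesis unfolding eq
    by (intro continuous_intros continuous_vol_ratio[OF y z] smooth_map_continuous[OF immersion_smooth[OF z]])
qed

lemma V_functional_eq:
  assumes y: "immersion \<A> y" and z: "immersion \<A> z"
  shows "V_functional \<A> (\<lambda>_. 0) z = (\<integral>\<^sup>+q. ennreal (weight0 y z q) \<partial>volume_measure \<A> y)"
    and "enn2real (V_functional \<A> (\<lambda>_. 0) z) = (\<integral>q. weight0 y z q \<partial>volume_measure \<A> y)"
proof -
  have m: "f \<in> borel_measurable (volume_measure \<A> y)" if "f \<in> borel_measurable borel" for f :: "'a \<Rightarrow> 'c::topological_space"
    using that by (simp add: measurable_cong_sets[OF sets_volume_measure(1)[OF y] refl])
  have J: "(\<lambda>q. ennreal (vol (pick q) z q / vol (pick q) y q)) \<in> borel_measurable (volume_measure \<A> y)"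
    by (rule m) (use borel_measurable_continuous_onI[OF continuous_vol_ratio(1)[OF y z]] in simp)
  have "continuous_on UNIV (\<lambda>q. exp (- (1/2) * (norm (z q - 0))\<^sup>2))"
    by (intro continuous_intros smooth_map_continuous[OF immersion_smooth[OF z]])
  then have e: "(\<lambda>q. ennreal (exp (- (1/2) * (norm (z q - 0))\<^sup>2))) \<in> borel_measurable (volume_measure \<A> y)"
    using borel_measurable_continuous_onI by (intro m) simp
  have "V_functional \<A> (\<lambda>_. 0) z =
      (\<integral>\<^sup>+q. ennreal (vol (pick q) z q / vol (pick q) y q) * ennreal (exp (- (1/2) * (norm (z q - 0))\<^sup>2)) \<partial>volume_measure \<A> y)"
    unfolding V_functional_def volume_measure_density[OF y z] by (rule nn_integral_density[OF J e])
  also have "\<dots> = (\<integral>\<^sup>+q. ennreal (weight0 y z q) \<partial>volume_measure \<A> y)"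
  proof (rule nn_integral_cong)
    fix q
    have "weight0 y z q = (vol (pick q) z q / vol (pick q) y q) * exp (- (1/2) * (norm (z q - 0))\<^sup>2)"
      by (simp add: weight0_def lagr_eq_vol[OF pick] power2_norm_eq_inner)
    then show "ennreal (vol (pick q) z q / vol (pick q) y q) * ennreal (exp (- (1/2) * (norm (z q - 0))\<^sup>2)) = ennreal (weight0 y z q)"
      by (simp only: ennreal_mult''[OF exp_ge_zero])
  qed
  finally show 1: "V_functional \<A> (\<lambda>_. 0) z = (\<integral>\<^sup>+q. ennreal (weight0 y z q) \<partial>volume_measure \<A> y)" .
  \<comment> \<open>For an infinite value the equation reads 0 = 0, by the default values of
    \<open>enn2real\<close> and of the Bochner integral.\<close>
  show "enn2real (V_functional \<A> (\<lambda>_. 0) z) = (\<integral>q. weight0 y z q \<partial>volume_measure \<A> y)"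
    unfolding 1 by (rule integral_eq_nn_integral[symmetric])
      (use m[OF borel_measurable_continuous_onI[OF continuous_weight0[OF y z]]] weight0_nonneg[OF y z] in auto)
qed

text \<open>Outside \<open>K\<close> the jets of \<open>z t\<close> do not depend on
  \<open>t\<close>, so the integrand changes on a compact set only, where the uniform bounds provide
  one dominating function for both differentiations. Finiteness of the weighted volume takes care of
  the unchanged part.\<close>

lemma second_derivative_V_functional:
  fixes y \<eta> :: "'a \<Rightarrow> 'e::euclidean_space"
  assumes y: "immersion \<A> y" and \<eta>: "smooth_map \<A> \<eta>" and K: "compact K" "\<And>q. q \<notin> K \<Longrightarrow> \<eta> q = 0"
    and fin: "V_functional \<A> (\<lambda>_. 0) y < \<infinity>"
  shows "\<exists>\<delta>>0. (\<forall>t. \<bar>t\<bar> < \<delta> \<longrightarrow> immersion \<A> (\<lambda>q. y q + t *\<^sub>R \<eta> q)) \<and>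
    (deriv ^^ 2) (\<lambda>t. enn2real (V_functional \<A> (\<lambda>_. 0) (\<lambda>q. y q + t *\<^sub>R \<eta> q))) 0 =
      (\<integral>q. weight2 y y \<eta> \<eta> q \<partial>volume_measure \<A> y)"
proof -
  note ys = immersion_smooth[OF y]
  define z where "z t q = y q + t *\<^sub>R \<eta> q" for t q
  let ?\<mu> = "volume_measure \<A> y"
  obtain \<delta> C where \<delta>: "\<delta> > 0" and C: "C \<ge> 0" and bd: "\<forall>q\<in>K. \<forall>t. \<bar>t\<bar> < \<delta> \<longrightarrow>
    chart_jet (pick q) (z t) q \<in> regular_jets \<and> \<bar>weight0 y (z t) q\<bar> \<le> C \<and>
    \<bar>weight1 y (z t) \<eta> q\<bar> \<le> C \<and> \<bar>weight2 y (z t) \<eta> \<eta> q\<bar> \<le> C"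
    using uniform_variation_bounds[OF y \<eta> K(1)] unfolding z_def by blast
  have zs: "smooth_map \<A> (z t)" for t unfolding z_def by (rule smooth_map_line[OF ys \<eta>])
  have jz: "chart_jet (pick q) (z t) q = chart_jet (pick q) y q + t *\<^sub>R chart_jet (pick q) \<eta> q" for t q
    unfolding z_def by (rule chart_jet_line[OF ys \<eta> pick])
  have j0: "chart_jet (pick q) \<eta> q = 0" if "q \<notin> K" for q
    by (rule chart_jet_vanishing[OF compact_imp_closed[OF K(1)] _ pick that]) (rule K(2))
  have reg: "chart_jet (pick q) (z t) q \<in> regular_jets" if "\<bar>t\<bar> < \<delta>" for t q
  proof (cases "q \<in> K")
    case True
    then show ?thesis using bd that by blast
  next
    case False
    then show ?thesis using immersion_regular[OF y pick[of q]] by (simp add: jz j0)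
  qed
  have zimm: "immersion \<A> (z t)" if "\<bar>t\<bar> < \<delta>" for t
    unfolding immersion_iff_regular using zs reg[OF that] regular_pick_iff[OF zs] by blast
  have z0: "z 0 = y" by (simp add: z_def fun_eq_iff)
  define w where "w q = C * indicator K q" for q
  have wint: "integrable ?\<mu> w"
    by (rule integrable_volume_compact_support[OF y K(1), of _ C])
      (use borel_compact[OF K(1)] C in \<open>auto simp: w_def[abs_def]\<close>)
  have int0: "integrable ?\<mu> (weight0 y (z t))" if t: "\<bar>t\<bar> < \<delta>" for t
  proof -
    have "integrable ?\<mu> (weight0 y y)"
    proof (rule integrableI_nonneg)
      show "weight0 y y \<in> borel_measurable ?\<mu>"
        using borel_measurable_continuous_onI[OF continuous_weight0[OF y y]]
        by (simp add: measurable_cong_sets[OF sets_volume_measure(1)[OF y] refl])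
      show "AE q in ?\<mu>. 0 \<le> weight0 y y q" using weight0_nonneg[OF y y] by simp
      show "(\<integral>\<^sup>+q. ennreal (weight0 y y q) \<partial>?\<mu>) < \<infinity>" using fin V_functional_eq(1)[OF y y] by simp
    qed
    moreover have "integrable ?\<mu> (\<lambda>q. weight0 y (z t) q - weight0 y y q)"
    proof (rule integrable_volume_compact_support[OF y K(1), of _ "C + C"])
      show "(\<lambda>q. weight0 y (z t) q - weight0 y y q) \<in> borel_measurable borel"
        by (intro borel_measurable_diff borel_measurable_continuous_onI continuous_weight0 y zimm t)
      show "\<bar>weight0 y (z t) q - weight0 y y q\<bar> \<le> C + C" if "q \<in> K" for q
      proof -
        have "\<bar>weight0 y (z t) q\<bar> \<le> C" "\<bar>weight0 y (z 0) q\<bar> \<le> C" using bd that t \<delta> by auto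
        then show ?thesis unfolding z0 by linarith
      qed
      show "weight0 y (z t) q - weight0 y y q = 0" if "q \<notin> K" for q
        by (simp add: weight0_def jz j0[OF that])
    qed
    ultimately have "integrable ?\<mu> (\<lambda>q. weight0 y y q + (weight0 y (z t) q - weight0 y y q))"
      by (rule Bochner_Integration.integrable_add)
    then show ?thesis by simp
  qed
  have d0: "((\<lambda>t. weight0 y (z t) q) has_real_derivative weight1 y (z t) \<eta> q) (at t)" if "\<bar>t\<bar> < \<delta>" for t q
    unfolding weight0_def weight1_def jz
    by (intro DERIV_cdivide DERIV_along_line has_derivative_lagr reg[OF that, unfolded jz])
  have d1: "((\<lambda>t. weight1 y (z t) \<eta> q) has_real_derivative weight2 y (z t) \<eta> \<eta> q) (at t)" if "\<bar>t\<bar> < \<delta>" for t q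
    unfolding weight1_def weight2_def jz
    by (intro DERIV_cdivide DERIV_along_line has_derivative_dlagr_const reg[OF that, unfolded jz])
  have b1: "\<bar>weight1 y (z t) \<eta> q\<bar> \<le> w q" and b2: "\<bar>weight2 y (z t) \<eta> \<eta> q\<bar> \<le> w q" if "\<bar>t\<bar> < \<delta>" for t q
  proof -
    have "\<bar>weight1 y (z t) \<eta> q\<bar> \<le> w q \<and> \<bar>weight2 y (z t) \<eta> \<eta> q\<bar> \<le> w q"
    proof (cases "q \<in> K")
      case True
      then show ?thesis using bd that by (simp add: w_def)
    next
      case False
      have "weight1 y (z t) \<eta> q = 0"
        by (rule weight1_vanishing[OF compact_imp_closed[OF K(1)] _ False reg[OF that]]) (rule K(2))
      moreover have "weight2 y (z t) \<eta> \<eta> q = 0"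
        by (rule weight2_vanishing[OF compact_imp_closed[OF K(1)] _ False reg[OF that]]) (rule K(2))
      ultimately show ?thesis by (simp add: w_def False)
    qed
    then show "\<bar>weight1 y (z t) \<eta> q\<bar> \<le> w q" "\<bar>weight2 y (z t) \<eta> \<eta> q\<bar> \<le> w q" by blast+
  qed
  have D1: "((\<lambda>t. \<integral>q. weight0 y (z t) q \<partial>?\<mu>) has_real_derivative (\<integral>q. weight1 y (z t0) \<eta> q \<partial>?\<mu>)) (at t0) \<and>
      integrable ?\<mu> (weight1 y (z t0) \<eta>)" if t0: "\<bar>t0\<bar> < \<delta>" for t0
  proof -
    have near: "\<bar>t\<bar> < \<delta>" if "\<bar>t - t0\<bar> < \<delta> - \<bar>t0\<bar>" for t using that by linarith
    have pos: "0 < \<delta> - \<bar>t0\<bar>" using t0 by simp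
    show ?thesis
      using has_real_derivative_integral[OF pos int0[OF near] d0[OF near] b1[OF near] wint] by blast
  qed
  have D2: "((\<lambda>t. \<integral>q. weight1 y (z t) \<eta> q \<partial>?\<mu>) has_real_derivative (\<integral>q. weight2 y (z 0) \<eta> \<eta> q \<partial>?\<mu>)) (at 0)"
  proof (rule has_real_derivative_integral(1)[OF \<delta> _ _ _ wint])
    show "integrable ?\<mu> (weight1 y (z t) \<eta>)" if "\<bar>t - 0\<bar> < \<delta>" for t using D1[of t] that by simp
    show "((\<lambda>t. weight1 y (z t) \<eta> q) has_real_derivative weight2 y (z t) \<eta> \<eta> q) (at t)" if "\<bar>t - 0\<bar> < \<delta>" for t q
      using d1[of t q] that by simp
    show "\<bar>weight2 y (z t) \<eta> \<eta> q\<bar> \<le> w q" if "\<bar>t - 0\<bar> < \<delta>" for t q using b2[of t q] that by simp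
  qed
  define F where "F t = enn2real (V_functional \<A> (\<lambda>_. 0) (z t))" for t
  have op: "open {-\<delta><..<\<delta>}" by simp
  \<comment> \<open>The first derivative is identified on a whole interval, as the iterated
    \<open>deriv\<close> requires.\<close>
  have "deriv F t = (\<integral>q. weight1 y (z t) \<eta> q \<partial>?\<mu>)" if t: "t \<in> {-\<delta><..<\<delta>}" for t
  proof (rule DERIV_imp_deriv, rule has_field_derivative_transform_within_open[OF _ op t])
    show "((\<lambda>t. \<integral>q. weight0 y (z t) q \<partial>?\<mu>) has_real_derivative (\<integral>q. weight1 y (z t) \<eta> q \<partial>?\<mu>)) (at t)"
      using D1[of t] t by auto
    show "(\<integral>q. weight0 y (z s) q \<partial>?\<mu>) = F s" if "s \<in> {-\<delta><..<\<delta>}" for s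
      unfolding F_def using V_functional_eq(2)[OF y zimm[of s]] that by auto
  qed
  then have "(deriv F has_real_derivative (\<integral>q. weight2 y (z 0) \<eta> \<eta> q \<partial>?\<mu>)) (at 0)"
    by (intro has_field_derivative_transform_within_open[OF D2 op]) (use \<delta> in auto)
  then have "deriv (deriv F) 0 = (\<integral>q. weight2 y y \<eta> \<eta> q \<partial>?\<mu>)"
    unfolding z0 by (rule DERIV_imp_deriv)
  then have "(deriv ^^ 2) F 0 = (\<integral>q. weight2 y y \<eta> \<eta> q \<partial>?\<mu>)" by (simp add: numeral_2_eq_2)
  then show ?thesis using \<delta> zimm unfolding F_def z_def[abs_def] by blast
qed

end

section \<open>The reduction to a self-shrinker\<close>

lemma frechet_derivative_diff_const:
  fixes f :: "'a::real_normed_vector \<Rightarrow> 'b::real_normed_vector"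
  shows "frechet_derivative (\<lambda>u. f u - k) F = frechet_derivative f F"
proof -
  have "((\<lambda>u. f u - k) has_derivative D) F \<longleftrightarrow> (f has_derivative D) F" for D
  proof
    assume "((\<lambda>u. f u - k) has_derivative D) F"
    from has_derivative_add[OF this has_derivative_const[of k]] show "(f has_derivative D) F" by simp
  next
    assume "(f has_derivative D) F"
    from has_derivative_diff[OF this has_derivative_const[of k]] show "((\<lambda>u. f u - k) has_derivative D) F" by simp
  qed
  then show ?thesis by (simp add: frechet_derivative_def)
qed

lemma chart_D_diff_const: "chart_D c (\<lambda>q. x q - k) = chart_D c x"
  by (simp add: fun_eq_iff chart_D_def comp_def frechet_derivative_diff_const)

lemma metric_matrix_diff_const: "metric_matrix c (\<lambda>q. x q - k) = metric_matrix c x"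
  by (simp add: fun_eq_iff metric_matrix_def induced_metric_def chart_D_diff_const)

lemma
  shows tangent_space_diff_const: "tangent_space \<A> (\<lambda>q. x q - k) = tangent_space \<A> x"
    and normal_space_diff_const: "normal_space \<A> (\<lambda>q. x q - k) = normal_space \<A> x"
    and normal_part_diff_const: "normal_part \<A> (\<lambda>q. x q - k) = normal_part \<A> x"
    and volume_measure_diff_const: "volume_measure \<A> (\<lambda>q. x q - k) = volume_measure \<A> x"
proof -
  show 1: "tangent_space \<A> (\<lambda>q. x q - k) = tangent_space \<A> x"
    by (simp add: fun_eq_iff tangent_space_def chart_D_diff_const)
  show 2: "normal_space \<A> (\<lambda>q. x q - k) = normal_space \<A> x"
    by (simp add: fun_eq_iff normal_space_def 1)
  show "normal_part \<A> (\<lambda>q. x q - k) = normal_part \<A> x"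
    by (simp add: fun_eq_iff normal_part_def 1 2)
  show "volume_measure \<A> (\<lambda>q. x q - k) = volume_measure \<A> x"
    by (simp add: volume_measure_def metric_matrix_diff_const)
qed

context manifold
begin

lemma has_derivative_chart_D:
  assumes "smooth_map \<A> Y" "c \<in> \<A>" "q \<in> fst c"
  shows "((\<lambda>u. Y (chart_inv c u)) has_derivative chart_D c Y q) (at (snd c q))"
  using smooth_map_differentiable[OF assms] unfolding chart_D_def[abs_def] frechet_derivative_works comp_def
  by simp

lemma chart_D_eqI: "((\<lambda>u. Y (chart_inv c u)) has_derivative D) (at (snd c q)) \<Longrightarrow> chart_D c Y q = D"
  by (simp add: chart_D_def[abs_def] comp_def frechet_derivative_eqI)

lemma chart_D_inner:
  fixes Y Z :: "'a \<Rightarrow> 'e::euclidean_space"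
  assumes "smooth_map \<A> Y" "smooth_map \<A> Z" "c \<in> \<A>" "q \<in> fst c"
  shows "chart_D c (\<lambda>q. Y q \<bullet> Z q) q v = Y q \<bullet> chart_D c Z q v + chart_D c Y q v \<bullet> Z q"
  using chart_D_eqI[OF has_derivative_inner[OF has_derivative_chart_D[OF assms(1,3,4)] has_derivative_chart_D[OF assms(2-4)]]]
  by (simp add: chart_inverse(1)[OF assms(3,4)])

lemma smooth_map_chart_D_local:
  assumes "smooth_map \<A> Y" "c \<in> \<A>" "q \<in> fst c"
  shows "((\<lambda>u. chart_D c Y (chart_inv c u) w) has_derivative chart_D c (\<lambda>r. chart_D c Y r w) q) (at (snd c q))"
    and "u \<in> chart_image c \<Longrightarrow>
      frechet_derivative (\<lambda>u. frechet_derivative (Y \<circ> chart_inv c) (at u) w) (at u) v =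
      chart_D c (\<lambda>r. chart_D c Y r w) (chart_inv c u) v"
proof -
  let ?f = "\<lambda>u. frechet_derivative (Y \<circ> chart_inv c) (at u) w"
  have eq: "?f u = chart_D c Y (chart_inv c u) w" if "u \<in> chart_image c" for u
    by (simp add: chart_D_def chart_inverse(3)[OF assms(2) that])
  have D: "?f differentiable (at u)" if "u \<in> chart_image c" for u
    by (rule C_infinity_on_differentiable[OF C_infinity_on_frechet[OF smooth_mapD[OF assms(1,2)]] that])
  have *: "((\<lambda>u. chart_D c Y (chart_inv c u) w) has_derivative frechet_derivative ?f (at u)) (at u)"
    if "u \<in> chart_image c" for u
    using frechet_derivative_works[THEN iffD1, OF D[OF that]]
    by (rule has_derivative_transform_within_open[OF _ chart_open(2)[OF assms(2)] that]) (rule eq)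
  have **: "chart_D c (\<lambda>r. chart_D c Y r w) (chart_inv c u) = frechet_derivative ?f (at u)" if "u \<in> chart_image c" for u
    by (rule chart_D_eqI) (use *[OF that] in \<open>simp add: chart_inverse(3)[OF assms(2) that]\<close>)
  show "frechet_derivative ?f (at u) v = chart_D c (\<lambda>r. chart_D c Y r w) (chart_inv c u) v" if "u \<in> chart_image c"
    unfolding **[OF that] ..
  have u: "snd c q \<in> chart_image c" using assms(3) by (simp add: chart_image_def)
  show "((\<lambda>u. chart_D c Y (chart_inv c u) w) has_derivative chart_D c (\<lambda>r. chart_D c Y r w) q) (at (snd c q))"
    using *[OF u] **[OF u] by (simp add: chart_inverse(1)[OF assms(2,3)])
qed

text \<open>\<open>f\<close> is constant on coordinate balls, so every set described through the
  values of \<open>f\<close> is open; connectedness leaves a single value.\<close>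

lemma zero_derivative_imp_constant:
  fixes f :: "'a \<Rightarrow> 'e::euclidean_space"
  assumes conn: "connected (UNIV :: 'a set)" and f: "smooth_map \<A> f"
    and zero: "\<And>c q v. c \<in> \<A> \<Longrightarrow> q \<in> fst c \<Longrightarrow> chart_D c f q v = 0"
  shows "f q = f q0"
proof -
  have "\<exists>V. open V \<and> q \<in> V \<and> (\<forall>r\<in>V. f r = f q)" for q
  proof -
    obtain c where c: "c \<in> \<A>" "q \<in> fst c" using chart_cover by blast
    have "snd c q \<in> chart_image c" using c by (simp add: chart_image_def)
    then obtain e where e: "e > 0" "ball (snd c q) e \<subseteq> chart_image c"
      using chart_open(2)[OF c(1)] open_contains_ball by blast
    define V where "V = fst c \<inter> snd c -` ball (snd c q) e"
    have "open V" unfolding V_def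
      by (rule continuous_open_preimage[OF chart_cont(1)[OF c(1)] chart_open(1)[OF c(1)] open_ball])
    moreover have "q \<in> V" using c e(1) by (simp add: V_def)
    moreover have "f r = f q" if r: "r \<in> V" for r
    proof -
      have rc: "r \<in> fst c" "snd c r \<in> ball (snd c q) e" using r by (auto simp: V_def)
      have "\<exists>k. \<forall>u\<in>ball (snd c q) e. f (chart_inv c u) = k"
      proof (rule has_derivative_zero_constant[OF convex_ball])
        fix u assume u: "u \<in> ball (snd c q) e"
        then have u': "u \<in> chart_image c" using e(2) by blast
        from has_derivative_chart_D[OF f c(1) chart_inverse(4)[OF c(1) u']]
        have "((\<lambda>u. f (chart_inv c u)) has_derivative (\<lambda>v. 0)) (at u)"
          by (simp add: chart_inverse(3)[OF c(1) u'] ext[of "chart_D c f (chart_inv c u)" "\<lambda>v. 0", OF zero[OF c(1) chart_inverse(4)[OF c(1) u']]])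
        then show "((\<lambda>u. f (chart_inv c u)) has_derivative (\<lambda>v. 0)) (at u within ball (snd c q) e)"
          by (rule has_derivative_at_withinI)
      qed
      then obtain k where k: "\<forall>u\<in>ball (snd c q) e. f (chart_inv c u) = k" ..
      show ?thesis
        using bspec[OF k rc(2)] bspec[OF k, of "snd c q"] e(1) by (simp add: chart_inverse(1)[OF c(1)] rc(1) c(2))
    qed
    ultimately show ?thesis by (intro exI[of _ V] conjI ballI)
  qed
  note loc = this
  have op: "open {q. P (f q)}" for P
    unfolding open_subopen[of "{q. P (f q)}"]
  proof
    fix r assume r: "r \<in> {q. P (f q)}"
    from loc[of r] obtain V where V: "open V" "r \<in> V" "\<forall>s\<in>V. f s = f r" by blast
    have "V \<subseteq> {q. P (f q)}"
    proof
      fix s assume "s \<in> V"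
      then have "f s = f r" using V(3) by blast
      then show "s \<in> {q. P (f q)}" using r by simp
    qed
    then show "\<exists>T. open T \<and> r \<in> T \<and> T \<subseteq> {q. P (f q)}" using V(1,2) by blast
  qed
  have "{q. f q = f q0} \<inter> UNIV = {} \<or> {q. f q \<noteq> f q0} \<inter> UNIV = {}"
    by (rule connectedD[OF conn op op]) auto
  then show ?thesis by blast
qed

text \<open>The derivative of a parallel normal field is tangential because its normal part
  vanishes. Differentiating the orthogonality of \<open>N\<close> to the coordinate fields gives the
  Weingarten equation in the third claim.\<close>

lemma parallel_normal_field_derivative:
  fixes x :: "'a \<Rightarrow> 'e::euclidean_space"
  assumes x: "immersion \<A> x" and N: "parallel_normal_field \<A> x N" and c: "c \<in> \<A>" "q \<in> fst c"
  shows "chart_D c N q v \<in> tangent_space \<A> x q" "N q \<bullet> chart_D c N q v = 0"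
    "second_fundamental_form \<A> c x q v w \<bullet> N q = - (chart_D c N q v \<bullet> chart_D c x q w)"
proof -
  note xs = immersion_smooth[OF x]
  have Ns: "smooth_map \<A> N" and Nn: "N r \<in> normal_space \<A> x r" for r
    using N by (simp_all add: parallel_normal_field_def normal_field_def)
  have "normal_part \<A> x q (chart_D c N q v) = 0"
    using N c by (simp add: parallel_normal_field_def normal_connection_def)
  then show t: "chart_D c N q v \<in> tangent_space \<A> x q"
    using normal_part_properties(2)[OF x, of "chart_D c N q v" q] by simp
  show "N q \<bullet> chart_D c N q v = 0"
    using Nn[of q] t by (auto simp: normal_space_def orthogonal_comp_def orthogonal_def inner_commute)
  have orth: "N r \<bullet> chart_D c x r w = 0" if "r \<in> fst c" for r
    using Nn[of r] c that by (auto simp: normal_space_def orthogonal_comp_def orthogonal_def inner_commute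
        tangent_space_eq[OF xs c(1) that])
  have D: "((\<lambda>u. N (chart_inv c u) \<bullet> chart_D c x (chart_inv c u) w) has_derivative
      (\<lambda>v. N (chart_inv c (snd c q)) \<bullet> chart_D c (\<lambda>r. chart_D c x r w) q v +
        chart_D c N q v \<bullet> chart_D c x (chart_inv c (snd c q)) w)) (at (snd c q))"
    by (rule has_derivative_inner[OF has_derivative_chart_D[OF Ns c] smooth_map_chart_D_local(1)[OF xs c]])
  have "((\<lambda>u. N (chart_inv c u) \<bullet> chart_D c x (chart_inv c u) w) has_derivative (\<lambda>v. 0)) (at (snd c q))"
    by (rule has_derivative_transform_within_open[OF has_derivative_const[of 0] chart_open(2)[OF c(1)]])
      (use c(2) orth[OF chart_inverse(4)[OF c(1)]] in \<open>auto simp: chart_image_def\<close>)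
  from has_derivative_unique[OF D this, THEN fun_cong, of v]
  have "N q \<bullet> chart_D c (\<lambda>r. chart_D c x r w) q v = - (chart_D c N q v \<bullet> chart_D c x q w)"
    by (simp add: chart_inverse(1)[OF c])
  then show "second_fundamental_form \<A> c x q v w \<bullet> N q = - (chart_D c N q v \<bullet> chart_D c x q w)"
    unfolding second_fundamental_form_def normal_part_properties(3)[OF x Nn] by (simp only: inner_commute)
qed

lemma parallel_weingarten_zero_imp_constant:
  fixes x \<xi> :: "'a \<Rightarrow> 'e::euclidean_space"
  assumes conn: "connected (UNIV :: 'a set)" and x: "immersion \<A> x" and \<xi>: "parallel_normal_field \<A> x \<xi>"
    and W: "\<forall>c\<in>\<A>. \<forall>q\<in>fst c. \<forall>v. weingarten \<A> c x \<xi> q v = 0"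
  shows "\<xi> q = \<xi> q0"
proof (rule zero_derivative_imp_constant[OF conn])
  show "smooth_map \<A> \<xi>" using \<xi> by (simp add: parallel_normal_field_def normal_field_def)
  fix c q v assume c: "c \<in> \<A>" "q \<in> fst c"
  note xs = immersion_smooth[OF x]
  note P = parallel_normal_field_derivative[OF x \<xi> c]
  from P(1)[of v] obtain a where a: "chart_D c \<xi> q v = chart_D c x q a"
    unfolding tangent_space_eq[OF xs c] by blast
  have inj: "inj (chart_D c x q)" using x c unfolding immersion_def by blast
  have lin: "linear (chart_D c x q)" by (rule chart_D_linear[OF xs c])
  \<comment> \<open>By the Weingarten equation the shape operator in direction \<xi> sends
    \<open>v\<close> to \<open>- a\<close>; injectivity of the differential makes the description
    definite.\<close>
  have "weingarten \<A> c x \<xi> q v = - a"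
    unfolding weingarten_def
  proof (rule the_equality)
    show "\<forall>w. induced_metric c x q (- a) w = second_fundamental_form \<A> c x q v w \<bullet> \<xi> q"
      by (simp add: P(3) a induced_metric_def linear_neg[OF lin])
  next
    fix b assume b: "\<forall>w. induced_metric c x q b w = second_fundamental_form \<A> c x q v w \<bullet> \<xi> q"
    then have "chart_D c x q (b + a) \<bullet> chart_D c x q w = 0" for w
      by (simp add: P(3) a induced_metric_def linear_add[OF lin] inner_add_left)
    then have "chart_D c x q (b + a) = 0" using inner_eq_zero_iff by blast
    then have "chart_D c x q (b + a) = chart_D c x q 0" by (simp add: linear_0[OF lin])
    then have "b + a = 0" by (rule injD[OF inj])
    then show "b = - a" by (simp add: add_eq_0_iff2)
  qed
  then have "a = 0" using W c by simp
  then show "chart_D c \<xi> q v = 0" by (simp add: a linear_0[OF lin])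
qed

lemma immersion_diff_const:
  assumes "immersion \<A> x"
  shows "immersion \<A> (\<lambda>q. x q - k)"
  using assms smooth_map_diff[OF immersion_smooth[OF assms] smooth_map_const[of k]]
  by (simp add: immersion_def chart_D_diff_const)

text \<open>Paired with a normal vector, the defining equation of the submanifold is the normal
  Euler-Lagrange equation of \<open>x - k\<close>; subtracting a constant leaves metric, normal
  spaces and second derivatives unchanged.\<close>

lemma critical_diff_const:
  fixes x :: "'a \<Rightarrow> 'e::euclidean_space"
  assumes xi: "xi_submanifold \<A> x (\<lambda>_. k)"
  shows "critical (\<lambda>q. x q - k)"
proof -
  have x: "immersion \<A> x" using xi by (simp add: xi_submanifold_def)
  note y = immersion_diff_const[OF x, of k]
  note ys = immersion_smooth[OF y] and xs = immersion_smooth[OF x]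
  have "critical_on (chart_image c) ((\<lambda>q. x q - k) \<circ> chart_inv c)" if c: "c \<in> \<A>" for c
  proof (rule critical_onI)
    show "open (chart_image c)" by (rule chart_open(2)[OF c])
    show "C_infinity_on ((\<lambda>q. x q - k) \<circ> chart_inv c) (chart_image c)" by (rule smooth_mapD[OF ys c])
    show "jet ((\<lambda>q. x q - k) \<circ> chart_inv c) ` chart_image c \<subseteq> regular_jets"
      by (rule immersion_regular_image[OF y c])
    fix u n assume u: "u \<in> chart_image c" and n: "\<And>j. n \<bullet> snd (jet ((\<lambda>q. x q - k) \<circ> chart_inv c) u) $ j = 0"
    define q where "q = chart_inv c u"
    have q: "q \<in> fst c" "snd c q = u" unfolding q_def using chart_inverse(3,4)[OF c u] by simp_all
    have jq: "jet ((\<lambda>q. x q - k) \<circ> chart_inv c) u = chart_jet c (\<lambda>q. x q - k) q"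
      by (simp add: chart_jet_def q(2))
    have "n \<in> normal_space \<A> (\<lambda>q. x q - k) q"
      unfolding normal_space_iff[OF ys c q(1)] using n by (simp add: jq)
    then have nn: "n \<in> normal_space \<A> x q" by (simp add: normal_space_diff_const)
    have B: "gram (snd (jet ((\<lambda>q. x q - k) \<circ> chart_inv c) u)) = metric_matrix c x q"
      unfolding jq metric_matrix_eq_gram[symmetric]
      by (simp add: metric_matrix_def induced_metric_def chart_D_diff_const)
    have D: "frechet_derivative (\<lambda>u. frechet_derivative ((\<lambda>q. x q - k) \<circ> chart_inv c) (at u) (axis j 1)) (at u) (axis i 1) =
        chart_D c (\<lambda>r. chart_D c x r (axis j 1)) q (axis i 1)" for i j
      using smooth_map_chart_D_local(2)[OF ys c q(1) u, of "axis j 1" "axis i 1"]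
      by (simp add: chart_D_diff_const q_def)
    have "mean_curvature_vector \<A> c x q + normal_part \<A> x q (x q) = k"
      using xi c q(1) by (simp add: xi_submanifold_def)
    then have "mean_curvature_vector \<A> c x q \<bullet> n + normal_part \<A> x q (x q) \<bullet> n = k \<bullet> n"
      by (metis inner_add_left)
    moreover have "mean_curvature_vector \<A> c x q \<bullet> n =
        (\<Sum>i\<in>UNIV. \<Sum>j\<in>UNIV. matrix_inv (metric_matrix c x q) $ i $ j *\<^sub>R
          chart_D c (\<lambda>r. chart_D c x r (axis j 1)) q (axis i 1)) \<bullet> n"
      by (simp add: mean_curvature_vector_def inner_sum_left second_fundamental_form_def
          normal_part_properties(3)[OF x nn])
    moreover have "normal_part \<A> x q (x q) \<bullet> n = x q \<bullet> n" by (rule normal_part_properties(3)[OF x nn])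
    ultimately show "(\<Sum>i\<in>UNIV. \<Sum>j\<in>UNIV. matrix_inv (gram (snd (jet ((\<lambda>q. x q - k) \<circ> chart_inv c) u))) $ i $ j *\<^sub>R
         frechet_derivative (\<lambda>u. frechet_derivative ((\<lambda>q. x q - k) \<circ> chart_inv c) (at u) (axis j 1)) (at u) (axis i 1)) \<bullet> n =
         - (((\<lambda>q. x q - k) \<circ> chart_inv c) u \<bullet> n)"
      unfolding B D by (simp add: q_def[symmetric] inner_diff_left)
  qed
  then show ?thesis using y by (simp add: critical_def)
qed

end

section \<open>The stability inequality with cutoffs\<close>

context manifold
begin

lemma smooth_map_normal_part:
  fixes x w :: "'a \<Rightarrow> 'e::euclidean_space"
  assumes x: "immersion \<A> x" and w: "smooth_map \<A> w"
  shows "smooth_map \<A> (\<lambda>q. normal_part \<A> x q (w q))"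
  unfolding smooth_map_def smooth_in_chart_def
proof
  fix c assume c: "c \<in> \<A>"
  note op = chart_open(2)[OF c]
  note sx = smooth_mapD[OF immersion_smooth[OF x] c]
  have eq: "((\<lambda>q. normal_part \<A> x q (w q)) \<circ> chart_inv c) u = frame_normal (snd (jet (x \<circ> chart_inv c) u)) ((w \<circ> chart_inv c) u)"
    if "u \<in> chart_image c" for u
    by (simp add: normal_part_eq[OF x c chart_inverse(4)[OF c that]] chart_jet_inv[OF c that])
  have det: "det (gram (snd (jet (x \<circ> chart_inv c) u))) \<noteq> 0" if "u \<in> chart_image c" for u
    by (rule regular_jets_det) (use immersion_regular_image[OF x c] that in blast)
  have "C_infinity_on (\<lambda>u. frame_normal (snd (jet (x \<circ> chart_inv c) u)) ((w \<circ> chart_inv c) u)) (chart_image c)"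
    by (rule C_infinity_on_frame_normal[OF op C_infinity_on_snd[OF op C_infinity_on_jet[OF op sx]] det smooth_mapD[OF w c]])
  also have "?this \<longleftrightarrow> C_infinity_on ((\<lambda>q. normal_part \<A> x q (w q)) \<circ> chart_inv c) (chart_image c)"
    by (rule C_infinity_on_cong[OF op, symmetric]) (rule eq)
  finally show "C_infinity_on ((\<lambda>q. normal_part \<A> x q (w q)) \<circ> chart_inv c) (chart_image c)" .
qed

text \<open>The case \<phi> = \<open>g (y q \<bullet> y q)\<close> of
  \<open>ddlagr_constant_direction\<close>. The differential of \<phi> pairs the velocities with
  \<open>y\<close> and multiplies by twice the derivative of \<open>g\<close>, so the squared
  gradient is four times the squared derivative of \<open>g\<close> times the squared length of the
  tangential part of \<open>y\<close>.\<close>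

lemma cutoff_density:
  fixes y :: "'a \<Rightarrow> 'e::euclidean_space" and g :: "real \<Rightarrow> real" and a :: 'e
  assumes y: "immersion \<A> y" and g: "C_infinity_on g UNIV"
  shows "weight2 y y (\<lambda>q. g (y q \<bullet> y q) *\<^sub>R a) (\<lambda>q. g (y q \<bullet> y q) *\<^sub>R a) q +
      weight1 y y (\<lambda>q. ((g (y q \<bullet> y q))\<^sup>2 * (y q \<bullet> a)) *\<^sub>R a) q =
    exp (- (1/2) * (y q \<bullet> y q)) *
      ((4 * (deriv g (y q \<bullet> y q))\<^sup>2 * (y q \<bullet> y q - normal_part \<A> y q (y q) \<bullet> normal_part \<A> y q (y q)) - (g (y q \<bullet> y q))\<^sup>2) *
        (normal_part \<A> y q a \<bullet> normal_part \<A> y q a))"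
proof -
  note ys = immersion_smooth[OF y]
  let ?c = "pick q"
  define j where "j = chart_jet ?c y q"
  define p where "p = snd j"
  define s where "s = y q \<bullet> y q"
  define B where "B = matrix_inv (gram p)"
  define Y where "Y = (\<chi> i. y q \<bullet> p $ i)"
  define \<alpha> where "\<alpha> = (2 * deriv g s) *\<^sub>R Y"
  define b where "b = (\<chi> i. a \<bullet> p $ i)"
  have j1: "fst j = y q" unfolding j_def by (rule fst_chart_jet'[OF pick])
  have p: "chart_D ?c y q (axis i 1) = p $ i" for i by (simp add: p_def j_def snd_chart_jet)
  have reg: "j \<in> regular_jets" unfolding j_def by (rule immersion_regular[OF y pick])
  have det: "det (gram p) \<noteq> 0" unfolding p_def by (rule regular_jets_det[OF reg])
  note inv = chart_inverse(1)[OF pick, of q]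
  have hy: "((\<lambda>u. y (chart_inv ?c u)) has_derivative chart_D ?c y q) (at (snd ?c q))"
    by (rule has_derivative_chart_D[OF ys pick])
  have hs: "((\<lambda>u. y (chart_inv ?c u) \<bullet> y (chart_inv ?c u)) has_derivative (\<lambda>v. 2 * (y q \<bullet> chart_D ?c y q v))) (at (snd ?c q))"
    using has_derivative_inner[OF hy hy] by (simp add: inv inner_commute)
  have "(g has_real_derivative deriv g s) (at s)"
    using C_infinity_on_differentiable[OF g, of s] DERIV_deriv_iff_real_differentiable by blast
  then have "(g has_derivative (*) (deriv g s)) (at ((\<lambda>u. y (chart_inv ?c u) \<bullet> y (chart_inv ?c u)) (snd ?c q)))"
    by (simp add: has_field_derivative_def inv s_def)
  from has_derivative_compose[OF hs this]
  have hg: "((\<lambda>u. g (y (chart_inv ?c u) \<bullet> y (chart_inv ?c u))) has_derivative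
      (\<lambda>v. deriv g s * (2 * (y q \<bullet> chart_D ?c y q v)))) (at (snd ?c q))" .
  have h\<zeta>: "((\<lambda>u. g (y (chart_inv ?c u) \<bullet> y (chart_inv ?c u)) *\<^sub>R a) has_derivative
      (\<lambda>v. (deriv g s * (2 * (y q \<bullet> chart_D ?c y q v))) *\<^sub>R a)) (at (snd ?c q))"
    by (rule has_derivative_scaleR_left[OF hg])
  have h\<psi>: "((\<lambda>u. ((g (y (chart_inv ?c u) \<bullet> y (chart_inv ?c u)))\<^sup>2 * (y (chart_inv ?c u) \<bullet> a)) *\<^sub>R a) has_derivative
      (\<lambda>v. ((g s)\<^sup>2 * (chart_D ?c y q v \<bullet> a) +
        2 * (deriv g s * (2 * (y q \<bullet> chart_D ?c y q v))) * g s * (y q \<bullet> a)) *\<^sub>R a)) (at (snd ?c q))"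
    using has_derivative_scaleR_left[OF has_derivative_mult[OF has_derivative_power[OF hg, of 2] has_derivative_inner_left[OF hy, of a]], of a]
    by (simp add: inv s_def mult_ac)
  have j\<zeta>: "chart_jet ?c (\<lambda>q. g (y q \<bullet> y q) *\<^sub>R a) q = (g s *\<^sub>R a, \<chi> i. \<alpha> $ i *\<^sub>R a)"
    by (simp add: prod_eq_iff fst_chart_jet'[OF pick] vec_eq_iff snd_chart_jet chart_D_eqI[OF h\<zeta>] p s_def \<alpha>_def Y_def)
  have j\<psi>: "chart_jet ?c (\<lambda>q. ((g (y q \<bullet> y q))\<^sup>2 * (y q \<bullet> a)) *\<^sub>R a) q =
      (((g s)\<^sup>2 * (fst j \<bullet> a)) *\<^sub>R a, \<chi> i. ((2 * g s * (fst j \<bullet> a)) *\<^sub>R \<alpha> + (g s)\<^sup>2 *\<^sub>R b) $ i *\<^sub>R a)"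
    unfolding prod_eq_iff vec_eq_iff fst_chart_jet'[OF pick] snd_chart_jet fst_conv snd_conv chart_D_eqI[OF h\<psi>] p
    by (simp add: s_def \<alpha>_def Y_def b_def j1 scaleR_left.add mult_ac inner_commute[of a "p $ i" for i])
  have na: "normal_part \<A> y q w \<bullet> normal_part \<A> y q w = w \<bullet> w - (\<chi> i. w \<bullet> p $ i) \<bullet> (B *v (\<chi> i. w \<bullet> p $ i))" for w
    unfolding normal_part_eq[OF y pick] B_def j_def[symmetric] p_def[symmetric] by (rule frame_normal_norm[OF det])
  have \<alpha>B: "\<alpha> \<bullet> (B *v \<alpha>) = 4 * (deriv g s)\<^sup>2 * (Y \<bullet> (B *v Y))"
    by (simp add: \<alpha>_def matrix_vector_mult_scaleR power2_eq_square)
  have "weight2 y y (\<lambda>q. g (y q \<bullet> y q) *\<^sub>R a) (\<lambda>q. g (y q \<bullet> y q) *\<^sub>R a) q +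
      weight1 y y (\<lambda>q. ((g (y q \<bullet> y q))\<^sup>2 * (y q \<bullet> a)) *\<^sub>R a) q =
      lagr j * ((\<alpha> \<bullet> (B *v \<alpha>) - (g s)\<^sup>2) * (a \<bullet> a - b \<bullet> (B *v b))) / vol ?c y q"
    unfolding weight2_def weight1_def j\<zeta> j\<psi> add_divide_distrib[symmetric] j_def[symmetric]
    using ddlagr_constant_direction[OF reg, of "g s" a \<alpha>] by (simp add: B_def p_def b_def)
  also have "\<dots> = exp (- (1/2) * s) * ((\<alpha> \<bullet> (B *v \<alpha>) - (g s)\<^sup>2) * (a \<bullet> a - b \<bullet> (B *v b)))"
    using vol_pos[OF y pick, of q] by (simp add: j_def lagr_eq_vol[OF pick] s_def)
  also have "a \<bullet> a - b \<bullet> (B *v b) = normal_part \<A> y q a \<bullet> normal_part \<A> y q a" by (simp add: na b_def)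
  also have "\<alpha> \<bullet> (B *v \<alpha>) = 4 * (deriv g s)\<^sup>2 * (s - normal_part \<A> y q (y q) \<bullet> normal_part \<A> y q (y q))"
    by (simp add: \<alpha>B na Y_def s_def)
  finally show ?thesis by (simp only: s_def)
qed

text \<open>With \<zeta> the cutoff times \<open>a\<close>, the normal field is \<eta> = \<zeta> -
  \<tau> for a tangential \<tau>. The terms involving \<tau> integrate to zero, and the first
  variation along \<psi>, also of integral zero, is added to reach the pointwise formula of
  \<open>cutoff_density\<close>.\<close>

lemma second_variation_cutoff:
  fixes y :: "'a \<Rightarrow> 'e::euclidean_space" and g :: "real \<Rightarrow> real" and a :: 'e
  assumes crit: "critical y" and g: "C_infinity_on g UNIV" and K: "compact K" "\<And>q. q \<notin> K \<Longrightarrow> g (y q \<bullet> y q) = 0"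
  defines "\<eta> \<equiv> \<lambda>q. g (y q \<bullet> y q) *\<^sub>R normal_part \<A> y q a"
  shows "(\<integral>q. weight2 y y \<eta> \<eta> q \<partial>volume_measure \<A> y) = (\<integral>q. exp (- (1/2) * (y q \<bullet> y q)) *
      ((4 * (deriv g (y q \<bullet> y q))\<^sup>2 * (y q \<bullet> y q - normal_part \<A> y q (y q) \<bullet> normal_part \<A> y q (y q)) - (g (y q \<bullet> y q))\<^sup>2) *
        (normal_part \<A> y q a \<bullet> normal_part \<A> y q a)) \<partial>volume_measure \<A> y)"
    and "integrable (volume_measure \<A> y) (\<lambda>q. exp (- (1/2) * (y q \<bullet> y q)) *
      ((4 * (deriv g (y q \<bullet> y q))\<^sup>2 * (y q \<bullet> y q - normal_part \<A> y q (y q) \<bullet> normal_part \<A> y q (y q)) - (g (y q \<bullet> y q))\<^sup>2) *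
        (normal_part \<A> y q a \<bullet> normal_part \<A> y q a)))"
    and "smooth_map \<A> \<eta>"
proof -
  have y: "immersion \<A> y" using crit by (simp add: critical_def)
  note ys = immersion_smooth[OF y]
  let ?\<mu> = "volume_measure \<A> y"
  define \<zeta> where "\<zeta> q = g (y q \<bullet> y q) *\<^sub>R a" for q
  define \<psi> where "\<psi> q = ((g (y q \<bullet> y q))\<^sup>2 * (y q \<bullet> a)) *\<^sub>R a" for q
  define \<tau> where "\<tau> q = \<zeta> q - \<eta> q" for q
  \<comment> \<open>Chosen so that the quadratic form at \<zeta> - \<tau> is its value at \<zeta>
    plus the pairing of \<omega> with \<tau>; a single use of the tangential lemma then
    suffices.\<close>
  define \<omega> where "\<omega> q = \<tau> q + (-2) *\<^sub>R \<zeta> q" for q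
  have gs: "smooth_map \<A> (\<lambda>q. g (y q \<bullet> y q))"
    by (intro smooth_map_compose_real[OF _ g] smooth_map_inner ys)
  show \<eta>s: "smooth_map \<A> \<eta>" unfolding \<eta>_def
    by (intro smooth_map_scaleR gs smooth_map_normal_part[OF y] smooth_map_const)
  have \<zeta>s: "smooth_map \<A> \<zeta>" unfolding \<zeta>_def[abs_def] by (intro smooth_map_scaleR gs smooth_map_const)
  have \<psi>s: "smooth_map \<A> \<psi>" unfolding \<psi>_def[abs_def] power2_eq_square
    by (intro smooth_map_scaleR smooth_map_mult smooth_map_inner gs ys smooth_map_const)
  have \<tau>s: "smooth_map \<A> \<tau>" unfolding \<tau>_def[abs_def] by (rule smooth_map_diff[OF \<zeta>s \<eta>s])
  have \<omega>s: "smooth_map \<A> \<omega>" unfolding \<omega>_def[abs_def]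
    by (intro smooth_map_add smooth_map_scaleR \<tau>s \<zeta>s smooth_map_const)
  have tang: "\<tau> q \<in> tangent_space \<A> y q" for q
    using normal_part_properties(2)[OF y, of "\<zeta> q" q]
    by (simp add: \<tau>_def \<eta>_def \<zeta>_def linear_cmul[OF normal_part_properties(4)[OF y]])
  have z\<zeta>: "\<zeta> q = 0" and z\<psi>: "\<psi> q = 0" and z\<tau>: "\<tau> q = 0" if "q \<notin> K" for q
    using K(2)[OF that] by (simp_all add: \<zeta>_def \<psi>_def \<tau>_def \<eta>_def)
  note cl = compact_imp_closed[OF K(1)]
  have v2: "weight2 y y \<beta> \<gamma> q = 0" if "q \<notin> K" "\<And>q. q \<notin> K \<Longrightarrow> \<gamma> q = 0" for \<beta> \<gamma> :: "'a \<Rightarrow> 'e" and q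
    by (rule weight2_vanishing[OF cl that(2) that(1) immersion_regular[OF y pick]])
  have v1: "weight1 y y \<psi> q = 0" if "q \<notin> K" for q
    by (rule weight1_vanishing[OF cl z\<psi> that immersion_regular[OF y pick]])
  have i\<zeta>: "integrable ?\<mu> (weight2 y y \<zeta> \<zeta>)"
    by (rule integrable_volume_continuous[OF y K(1) continuous_weight2[OF y \<zeta>s \<zeta>s] v2[OF _ z\<zeta>]])
  have i\<tau>: "integrable ?\<mu> (weight2 y y \<omega> \<tau>)"
    by (rule integrable_volume_continuous[OF y K(1) continuous_weight2[OF y \<omega>s \<tau>s] v2[OF _ z\<tau>]])
  have i\<psi>: "integrable ?\<mu> (weight1 y y \<psi>)"
    by (rule integrable_volume_continuous[OF y K(1) continuous_weight1[OF y \<psi>s] v1])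
  have expand: "weight2 y y \<eta> \<eta> q = weight2 y y \<zeta> \<zeta> q + weight2 y y \<omega> \<tau> q" for q
  proof -
    let ?j = "chart_jet (pick q) y q" and ?Z = "chart_jet (pick q) \<zeta> q" and ?T = "chart_jet (pick q) \<tau> q"
    have reg: "?j \<in> regular_jets" by (rule immersion_regular[OF y pick])
    have E: "chart_jet (pick q) \<eta> q = ?Z + (-1) *\<^sub>R ?T"
    proof -
      have "\<eta> = (\<lambda>q. \<zeta> q + (-1) *\<^sub>R \<tau> q)" by (simp add: fun_eq_iff \<tau>_def)
      then show ?thesis using chart_jet_line[OF \<zeta>s \<tau>s pick, of q "-1"] by simp
    qed
    have O: "chart_jet (pick q) \<omega> q = ?T + (-2) *\<^sub>R ?Z"
      unfolding \<omega>_def[abs_def] by (rule chart_jet_line[OF \<tau>s \<zeta>s pick])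
    have "ddlagr ?j (?Z + (-1) *\<^sub>R ?T) (?Z + (-1) *\<^sub>R ?T) = ddlagr ?j ?Z ?Z + ddlagr ?j (?T + (-2) *\<^sub>R ?Z) ?T"
      by (simp only: linear_add[OF linear_ddlagr[OF reg]] linear_cmul[OF linear_ddlagr[OF reg]]
          linear_add[OF linear_ddlagr_left[OF reg]] linear_cmul[OF linear_ddlagr_left[OF reg]])
        (simp add: ddlagr_commute[OF reg, of ?T ?Z])
    then show ?thesis by (simp add: weight2_def E O add_divide_distrib)
  qed
  have "(\<integral>q. weight2 y y \<eta> \<eta> q \<partial>?\<mu>) = (\<integral>q. weight2 y y \<zeta> \<zeta> q \<partial>?\<mu>) + (\<integral>q. weight2 y y \<omega> \<tau> q \<partial>?\<mu>)"
    unfolding expand by (rule Bochner_Integration.integral_add[OF i\<zeta> i\<tau>])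
  also have "(\<integral>q. weight2 y y \<omega> \<tau> q \<partial>?\<mu>) = 0"
    by (rule integral_weight2_tangential_zero[OF crit \<tau>s \<omega>s tang K(1) z\<tau>])
  also have "0 = (\<integral>q. weight1 y y \<psi> q \<partial>?\<mu>)"
    by (rule integral_weight1_zero[OF crit \<psi>s K(1) z\<psi>, symmetric])
  also have "(\<integral>q. weight2 y y \<zeta> \<zeta> q \<partial>?\<mu>) + (\<integral>q. weight1 y y \<psi> q \<partial>?\<mu>) = (\<integral>q. weight2 y y \<zeta> \<zeta> q + weight1 y y \<psi> q \<partial>?\<mu>)"
    by (rule Bochner_Integration.integral_add[OF i\<zeta> i\<psi>, symmetric])
  finally show "(\<integral>q. weight2 y y \<eta> \<eta> q \<partial>?\<mu>) = (\<integral>q. exp (- (1/2) * (y q \<bullet> y q)) *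
      ((4 * (deriv g (y q \<bullet> y q))\<^sup>2 * (y q \<bullet> y q - normal_part \<A> y q (y q) \<bullet> normal_part \<A> y q (y q)) - (g (y q \<bullet> y q))\<^sup>2) *
        (normal_part \<A> y q a \<bullet> normal_part \<A> y q a)) \<partial>?\<mu>)"
    unfolding \<zeta>_def[abs_def] \<psi>_def[abs_def] cutoff_density[OF y g] .
  show "integrable ?\<mu> (\<lambda>q. exp (- (1/2) * (y q \<bullet> y q)) *
      ((4 * (deriv g (y q \<bullet> y q))\<^sup>2 * (y q \<bullet> y q - normal_part \<A> y q (y q) \<bullet> normal_part \<A> y q (y q)) - (g (y q \<bullet> y q))\<^sup>2) *
        (normal_part \<A> y q a \<bullet> normal_part \<A> y q a)))"
    using Bochner_Integration.integrable_add[OF i\<zeta> i\<psi>]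
    unfolding \<zeta>_def[abs_def] \<psi>_def[abs_def] cutoff_density[OF y g] .
qed

end

lemma V_functional_diff_const:
  "V_functional \<A> (\<lambda>_. k) z = V_functional \<A> (\<lambda>_. 0) (\<lambda>q. z q - k)"
  by (simp add: V_functional_def volume_measure_diff_const)

lemma C_infinity_on_bump_scaled: "C_infinity_on (\<lambda>s. bump (s / r)) UNIV"
proof -
  have "C_infinity_on (\<lambda>s. s * inverse r) UNIV"
    by (intro C_infinity_on_mult C_infinity_on_id C_infinity_on_const open_UNIV)
  from C_infinity_on_compose[OF open_UNIV open_UNIV this C_infinity_on_bump] show ?thesis
    by (simp add: divide_inverse)
qed

lemma DERIV_bump: "(bump has_real_derivative deriv bump s) (at s)"
  using C_infinity_on_differentiable[OF C_infinity_on_bump, of s] DERIV_deriv_iff_real_differentiable by blast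

lemma deriv_bump_scaled: "deriv (\<lambda>s. bump (s / r)) s = deriv bump (s / r) / r"
  by (rule DERIV_imp_deriv) (use DERIV_chain2[OF DERIV_bump DERIV_cdivide[OF DERIV_ident]] in simp)

text \<open>The scaled profile is constant beyond \<open>s = r\<close> and has a derivative of size
  \<open>1 / r\<close> before, whence a bound \<open>C / r\<close>. With \<open>s\<close> the
  squared distance this bounds the squared gradient of the cutoff by \<open>4 * C / r\<close>, where
  \<open>r\<close> is the square of the cutoff radius.\<close>

lemma deriv_bump_bound: "\<exists>C\<ge>0. \<forall>r>0. \<forall>s\<ge>0. (deriv (\<lambda>s. bump (s / r)) s)\<^sup>2 * s \<le> C / r"
proof -
  have "continuous_on {0..1} (\<lambda>s. frechet_derivative bump (at s) 1)"
    by (rule continuous_on_subset[OF C_infinity_on_continuous[OF C_infinity_on_frechet[OF C_infinity_on_bump]]]) simp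
  moreover have "frechet_derivative bump (at s) 1 = deriv bump s" for s
    using frechet_derivative_eqI[OF DERIV_bump[of s, unfolded has_field_derivative_def]] by simp
  ultimately have "continuous_on {0..1} (deriv bump)" by simp
  then have "compact (deriv bump ` {0..1})" by (rule compact_continuous_image) simp
  from compact_imp_bounded[OF this] obtain C where C: "\<forall>s\<in>{0..1}. \<bar>deriv bump s\<bar> \<le> C"
    unfolding bounded_iff by auto
  have zero: "deriv bump s = 0" if "1 < s" for s
  proof (rule DERIV_imp_deriv)
    show "(bump has_real_derivative 0) (at s)"
      by (rule has_field_derivative_transform_within_open[of "\<lambda>_. 0" _ _ "{1<..}"]) (use that bump_simps(3) in auto)
  qed
  show ?thesis
  proof (intro exI[of _ "C\<^sup>2"] conjI allI impI)
    fix r s :: real assume r: "0 < r" and s: "0 \<le> s"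
    show "(deriv (\<lambda>s. bump (s / r)) s)\<^sup>2 * s \<le> C\<^sup>2 / r"
    proof (cases "s \<le> r")
      case True
      then have "\<bar>deriv bump (s / r)\<bar> \<le> C" using bspec[OF C, of "s / r"] r s by simp
      then have "(deriv bump (s / r))\<^sup>2 \<le> C\<^sup>2" by (metis abs_ge_zero power2_abs power_mono)
      then have "(deriv bump (s / r))\<^sup>2 * s \<le> C\<^sup>2 * r" using True s by (intro mult_mono) auto
      then have "(deriv bump (s / r))\<^sup>2 * s / r\<^sup>2 \<le> C\<^sup>2 * r / r\<^sup>2" by (rule divide_right_mono) simp
      then show ?thesis using r by (simp add: deriv_bump_scaled power_divide power2_eq_square)
    next
      case False
      then have "deriv bump (s / r) = 0" using zero r by simp
      then show ?thesis using r by (simp add: deriv_bump_scaled)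
    qed
  qed simp
qed

context manifold
begin

text \<open>The linear variation of \<open>x\<close> along the cutoff times the normal part of
  \<open>a\<close> is admissible: it has no second time derivative, properness gives compact
  support, and pairing with a parallel normal field sees only \<open>a\<close> because that field is
  normal.\<close>

lemma stability_cutoff:
  fixes x :: "'a \<Rightarrow> 'e::euclidean_space"
  assumes proper: "properly_immersed \<A> x" and stab: "W_stable \<A> x (\<lambda>_. k)" and r: "0 < r"
    and vp: "\<And>N. parallel_normal_field \<A> x N \<Longrightarrow>
      (\<integral>q. bump ((x q - k) \<bullet> (x q - k) / r) * (a \<bullet> N q) * exp (- (1/2) * ((x q - k) \<bullet> (x q - k))) \<partial>volume_measure \<A> x) = 0"
  defines "y \<equiv> \<lambda>q. x q - k" and "g \<equiv> \<lambda>s. bump (s / r)"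
  shows "0 \<le> (\<integral>q. exp (- (1/2) * (y q \<bullet> y q)) *
      ((4 * (deriv g (y q \<bullet> y q))\<^sup>2 * (y q \<bullet> y q - normal_part \<A> y q (y q) \<bullet> normal_part \<A> y q (y q)) - (g (y q \<bullet> y q))\<^sup>2) *
        (normal_part \<A> y q a \<bullet> normal_part \<A> y q a)) \<partial>volume_measure \<A> y)"
    and "integrable (volume_measure \<A> y) (\<lambda>q. exp (- (1/2) * (y q \<bullet> y q)) *
      ((4 * (deriv g (y q \<bullet> y q))\<^sup>2 * (y q \<bullet> y q - normal_part \<A> y q (y q) \<bullet> normal_part \<A> y q (y q)) - (g (y q \<bullet> y q))\<^sup>2) *
        (normal_part \<A> y q a \<bullet> normal_part \<A> y q a)))"
proof -
  have xi: "xi_submanifold \<A> x (\<lambda>_. k)" and finx: "V_functional \<A> (\<lambda>_. k) x < \<infinity>"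
    using stab by (simp_all add: W_stable_def)
  have x: "immersion \<A> x" using xi by (simp add: xi_submanifold_def)
  have crit: "critical y" unfolding y_def by (rule critical_diff_const[OF xi])
  have y: "immersion \<A> y" using crit by (simp add: critical_def)
  have fin: "V_functional \<A> (\<lambda>_. 0) y < \<infinity>" using finx V_functional_diff_const[of \<A> k x] by (simp add: y_def)
  have g: "C_infinity_on g UNIV" unfolding g_def by (rule C_infinity_on_bump_scaled)
  \<comment> \<open>Sublevel sets of the squared distance are preimages of closed balls, compact by
    properness.\<close>
  define K where "K b = {q. y q \<bullet> y q \<le> b}" for b
  have K: "compact (K b)" for b
  proof -
    have "K b = x -` cball k (sqrt b)"
      by (auto simp: K_def y_def dist_norm norm_eq_sqrt_inner[of "k - _"] inner_diff_left inner_diff_right inner_commute)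
    then show ?thesis using proper by (simp add: properly_immersed_def)
  qed
  have gK: "g (y q \<bullet> y q) = 0" if "q \<notin> K r" for q
    using that r by (simp add: K_def g_def bump_simps)
  define \<eta> where "\<eta> q = g (y q \<bullet> y q) *\<^sub>R normal_part \<A> y q a" for q
  have \<eta>s: "smooth_map \<A> \<eta>"
    unfolding \<eta>_def[abs_def] by (rule second_variation_cutoff(3)[OF crit g K[of r] gK])
  have \<eta>K: "\<eta> q = 0" if "q \<notin> K r" for q using gK[OF that] by (simp add: \<eta>_def)
  have npy: "normal_part \<A> y = normal_part \<A> x" unfolding y_def by (rule normal_part_diff_const)
  have "\<exists>\<delta>>0. (\<forall>t. \<bar>t\<bar> < \<delta> \<longrightarrow> immersion \<A> (\<lambda>q. y q + t *\<^sub>R \<eta> q)) \<and>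
    (deriv ^^ 2) (\<lambda>t. enn2real (V_functional \<A> (\<lambda>_. 0) (\<lambda>q. y q + t *\<^sub>R \<eta> q))) 0 =
      (\<integral>q. weight2 y y \<eta> \<eta> q \<partial>volume_measure \<A> y)"
    by (rule second_derivative_V_functional[OF y \<eta>s K[of r] \<eta>K fin])
  then obtain \<delta> where \<delta>: "\<delta> > 0"
    "\<forall>t. \<bar>t\<bar> < \<delta> \<longrightarrow> immersion \<A> (\<lambda>q. y q + t *\<^sub>R \<eta> q)"
    "(deriv ^^ 2) (\<lambda>t. enn2real (V_functional \<A> (\<lambda>_. 0) (\<lambda>q. y q + t *\<^sub>R \<eta> q))) 0 =
      (\<integral>q. weight2 y y \<eta> \<eta> q \<partial>volume_measure \<A> y)" by (elim exE conjE)
  define F where "F q t = x q + t *\<^sub>R \<eta> q" for q t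
  have td: "time_deriv F q t = \<eta> q" for q t
    unfolding time_deriv_def F_def[abs_def]
    by (rule vector_derivative_at) (auto intro!: derivative_eq_intros)
  have var: "variation \<A> x \<delta> F"
    unfolding variation_def
  proof (intro conjI ballI allI)
    show "0 < \<delta>" by (rule \<delta>(1))
    show "F q 0 = x q" for q by (simp add: F_def)
    fix t assume t: "t \<in> {-\<delta><..<\<delta>}"
    have "immersion \<A> (\<lambda>q. y q + t *\<^sub>R \<eta> q)" using \<delta>(2) t by auto
    from immersion_diff_const[OF this, of "- k"] show "immersion \<A> (\<lambda>q. F q t)"
      by (simp add: F_def y_def algebra_simps)
  next
    fix c assume c: "c \<in> \<A>"
    have op: "open (chart_image c \<times> {-\<delta><..<\<delta>})" by (intro open_Times chart_open(2)[OF c] open_greaterThanLessThan)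
    have f: "C_infinity_on (\<lambda>p. Y (chart_inv c (fst p))) (chart_image c \<times> {-\<delta><..<\<delta>})"
      if "smooth_map \<A> Y" for Y :: "'a \<Rightarrow> 'e"
      by (rule C_infinity_on_compose[OF op chart_open(2)[OF c] C_infinity_on_fst[OF op C_infinity_on_id] smooth_mapD[OF that c, unfolded comp_def]]) auto
    have "C_infinity_on (\<lambda>p. x (chart_inv c (fst p)) + snd p *\<^sub>R \<eta> (chart_inv c (fst p))) (chart_image c \<times> {-\<delta><..<\<delta>})"
      by (intro C_infinity_on_add C_infinity_on_scaleR op f immersion_smooth[OF x] \<eta>s C_infinity_on_snd C_infinity_on_id)
    then show "C_infinity_on (\<lambda>(u, t). F (chart_inv c u) t) (chart_image c \<times> {-\<delta><..<\<delta>})"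
      by (simp add: F_def case_prod_unfold)
  qed
  have cont: "continuous_on UNIV (\<lambda>q. y q \<bullet> y q)"
    by (intro continuous_intros smooth_map_continuous[OF immersion_smooth[OF y]])
  have comp: "compact_variation \<A> x \<delta> F"
    unfolding compact_variation_def
  \<comment> \<open>Level \<open>r + 1\<close> leaves room around the support, which lies in the
    closed level \<open>r\<close>, so that an open relatively compact set contains it.\<close>
  proof (intro conjI var exI[of _ "{q. y q \<bullet> y q < r + 1}"] ballI)
    show "open {q. y q \<bullet> y q < r + 1}" by (rule open_Collect_less[OF cont continuous_on_const])
    have "closure {q. y q \<bullet> y q < r + 1} \<subseteq> K (r + 1)"
      by (rule closure_minimal[OF _ compact_imp_closed[OF K]]) (auto simp: K_def)
    then show "compact (closure {q. y q \<bullet> y q < r + 1})"       using compact_Int_closed[OF K[of "r + 1"] closed_closure, of "{q. y q \<bullet> y q < r + 1}"] by (simp add: Int_absorb1)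
    fix t
    have "{q. time_deriv F q t \<noteq> 0} \<subseteq> K r" using \<eta>K by (auto simp: td)
    then have "closure {q. time_deriv F q t \<noteq> 0} \<subseteq> K r" by (rule closure_minimal[OF _ compact_imp_closed[OF K]])
    then show "closure {q. time_deriv F q t \<noteq> 0} \<subseteq> {q. y q \<bullet> y q < r + 1}" by (auto simp: K_def)
  qed
  have vf: "variation_field F = \<eta>" by (simp add: fun_eq_iff variation_field_def td)
  have nf: "normal_field \<A> x \<eta>"
    unfolding normal_field_def
  proof (intro conjI allI \<eta>s)
    show "\<eta> q \<in> normal_space \<A> x q" for q
      using normal_part_properties(1)[OF x, of q "g (y q \<bullet> y q) *\<^sub>R a"]
      by (simp add: \<eta>_def npy linear_cmul[OF normal_part_properties(4)[OF x]])
  qed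
  have "time_deriv (time_deriv F) q 0 = 0" for q
  proof -
    have "time_deriv F = (\<lambda>q t. \<eta> q)" by (simp add: fun_eq_iff td)
    then show ?thesis by (simp add: time_deriv_def[of "\<lambda>q t. \<eta> q"])
  qed
  then have SN: "SN_variation \<A> x \<delta> F" using var nf by (simp add: SN_variation_def vf)
  have VP: "VP_variation \<A> x (\<lambda>_. k) \<delta> F"
    unfolding VP_variation_def
  proof (intro conjI SN allI impI)
    fix N assume N: "parallel_normal_field \<A> x N"
    then have "N q \<in> normal_space \<A> x q" for q by (simp add: parallel_normal_field_def normal_field_def)
    then have "(variation_field F q \<bullet> N q) * exp (- (1/2) * (norm (x q - k))\<^sup>2) =
        bump ((x q - k) \<bullet> (x q - k) / r) * (a \<bullet> N q) * exp (- (1/2) * ((x q - k) \<bullet> (x q - k)))" for q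
      by (simp add: vf \<eta>_def npy normal_part_properties(3)[OF x] power2_norm_eq_inner g_def normal_part_diff_const y_def)
    then show "(LINT q|volume_measure \<A> x. (variation_field F q \<bullet> N q) * exp (- (1/2) * (norm (x q - k))\<^sup>2)) = 0"
      using vp[OF N] by simp
  qed
  have "0 \<le> (deriv ^^ 2) (\<lambda>t. enn2real (V_functional \<A> (\<lambda>_. k) (\<lambda>q. F q t))) 0"
    using stab comp VP unfolding W_stable_def by blast
  also have "(\<lambda>t. enn2real (V_functional \<A> (\<lambda>_. k) (\<lambda>q. F q t))) =
      (\<lambda>t. enn2real (V_functional \<A> (\<lambda>_. 0) (\<lambda>q. y q + t *\<^sub>R \<eta> q)))"
    by (simp add: V_functional_diff_const[of _ k] F_def y_def algebra_simps)
  also note \<delta>(3)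
  also have "(\<integral>q. weight2 y y \<eta> \<eta> q \<partial>volume_measure \<A> y) = (\<integral>q. exp (- (1/2) * (y q \<bullet> y q)) *
      ((4 * (deriv g (y q \<bullet> y q))\<^sup>2 * (y q \<bullet> y q - normal_part \<A> y q (y q) \<bullet> normal_part \<A> y q (y q)) - (g (y q \<bullet> y q))\<^sup>2) *
        (normal_part \<A> y q a \<bullet> normal_part \<A> y q a)) \<partial>volume_measure \<A> y)"
    unfolding \<eta>_def[abs_def] by (rule second_variation_cutoff(1)[OF crit g K[of r] gK])
  finally show "0 \<le> (\<integral>q. exp (- (1/2) * (y q \<bullet> y q)) *
      ((4 * (deriv g (y q \<bullet> y q))\<^sup>2 * (y q \<bullet> y q - normal_part \<A> y q (y q) \<bullet> normal_part \<A> y q (y q)) - (g (y q \<bullet> y q))\<^sup>2) *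
        (normal_part \<A> y q a \<bullet> normal_part \<A> y q a)) \<partial>volume_measure \<A> y)" .
  show "integrable (volume_measure \<A> y) (\<lambda>q. exp (- (1/2) * (y q \<bullet> y q)) *
      ((4 * (deriv g (y q \<bullet> y q))\<^sup>2 * (y q \<bullet> y q - normal_part \<A> y q (y q) \<bullet> normal_part \<A> y q (y q)) - (g (y q \<bullet> y q))\<^sup>2) *
        (normal_part \<A> y q a \<bullet> normal_part \<A> y q a)))" by (rule second_variation_cutoff(2)[OF crit g K[of r] gK])
qed


lemma borel_measurable_volume:
  assumes "immersion \<A> y" "continuous_on UNIV h"
  shows "h \<in> borel_measurable (volume_measure \<A> y)"
  using borel_measurable_continuous_onI[OF assms(2)]
  by (simp add: measurable_cong_sets[OF sets_volume_measure(1)[OF assms(1)] refl])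

text \<open>Nonempty open sets have positive volume, because the volume density is positive and
  nonempty open sets of coordinates are not negligible.\<close>

lemma volume_integral_zero_imp_zero:
  fixes h :: "'a \<Rightarrow> real"
  assumes y: "immersion \<A> y" and h: "continuous_on UNIV h" "\<And>q. 0 \<le> h q"
    and int: "integrable (volume_measure \<A> y) h" "(\<integral>q. h q \<partial>volume_measure \<A> y) = 0"
  shows "h q = 0"
proof (rule ccontr)
  assume q: "h q \<noteq> 0"
  obtain c where c: "c \<in> \<A>" "q \<in> fst c" using chart_cover by blast
  define V where "V = {q. h q \<noteq> 0} \<inter> fst c"
  have V: "open V" "V \<subseteq> fst c" "q \<in> V"
    unfolding V_def using q c h(1) chart_open(1)[OF c(1)]
    by (auto intro!: open_Int open_Collect_neq continuous_on_const)
  have "AE q in volume_measure \<A> y. h q = 0"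
    using integral_nonneg_eq_0_iff_AE[OF int(1)] h(2) int(2) by simp
  then have "emeasure (volume_measure \<A> y) {q. h q \<noteq> 0} = 0"
    using AE_iff_measurable[of "{q. h q \<noteq> 0}" "volume_measure \<A> y" "\<lambda>q. h q = 0"]
      open_Collect_neq[OF h(1) continuous_on_const[of _ 0]] by (simp add: sets_volume_measure[OF y])
  moreover have "emeasure (volume_measure \<A> y) V \<le> emeasure (volume_measure \<A> y) {q. h q \<noteq> 0}"
    by (rule emeasure_mono) (use open_Collect_neq[OF h(1) continuous_on_const[of _ 0]] in \<open>auto simp: V_def sets_volume_measure[OF y]\<close>)
  moreover have "emeasure (volume_measure \<A> y) V = emeasure (chart_measure c y) V"
  proof -
    have "V \<in> sets borel" using V(1) by simp
    then show ?thesis using volume_property_volume_measure[OF y] c(1) V(2) unfolding volume_property_def by blast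
  qed
  ultimately have "emeasure (chart_measure c y) V = 0" by simp
  then have z: "(\<integral>\<^sup>+u. ennreal (indicator (snd c ` V) u * vol c y (chart_inv c u)) \<partial>lborel) = 0"
    using emeasure_chart_measure_full[OF y c(1), of V] V(1) by (simp add: Int_absorb2[OF V(2)])
  have W: "open (snd c ` V)" by (rule chart_image_open[OF c(1) V(1,2)])
  have sub: "snd c ` V \<subseteq> chart_image c" using V(2) by (auto simp: chart_image_def)
  have "(\<lambda>u. indicator (snd c ` V) u * vol c y (chart_inv c u)) \<in> borel_measurable borel"
    using borel_measurable_continuous_on_indicator[OF borel_open[OF W] continuous_on_subset[OF continuous_on_vol[OF y c(1)] sub]]
    by simp
  then have ae: "AE u in lborel. ennreal (indicator (snd c ` V) u * vol c y (chart_inv c u)) = 0"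
    using z by (subst (asm) nn_integral_0_iff_AE) auto
  have out: "u \<notin> snd c ` V" if "ennreal (indicator (snd c ` V) u * vol c y (chart_inv c u)) = 0" for u
  proof
    assume u: "u \<in> snd c ` V"
    then have "vol c y (chart_inv c u) \<le> 0" using that by (simp add: ennreal_eq_0_iff)
    moreover have "0 < vol c y (chart_inv c u)" by (rule vol_pos_inv[OF y c(1)]) (use sub u in blast)
    ultimately show False by simp
  qed
  have "AE u in lborel. u \<notin> snd c ` V" by (rule eventually_mono[OF ae out])
  then have "snd c ` V \<in> null_sets lborel" using AE_iff_null_sets[of "snd c ` V" lborel] W by simp
  then have "negligible (snd c ` V)" by (simp add: negligible_iff_null_sets null_sets_completionI)
  then show False using open_not_negligible[OF W] V(3) by blast
qed

lemma normal_part_norm: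
  assumes "immersion \<A> x"
  shows "normal_part \<A> x q a \<bullet> normal_part \<A> x q a \<le> a \<bullet> a"
proof -
  let ?n = "normal_part \<A> x q a"
  have "?n \<bullet> ?n = a \<bullet> ?n"
    by (rule normal_part_properties(3)[OF assms normal_part_properties(1)[OF assms]])
  then have "(a - ?n) \<bullet> (a - ?n) = a \<bullet> a - ?n \<bullet> ?n"
    by (simp add: inner_diff_left inner_diff_right inner_commute)
  then show ?thesis using inner_ge_zero[of "a - ?n"] by simp
qed

lemma continuous_normal_part_norm:
  assumes "immersion \<A> x"
  shows "continuous_on UNIV (\<lambda>q. normal_part \<A> x q a \<bullet> normal_part \<A> x q a)"
  by (intro smooth_map_continuous smooth_map_inner smooth_map_normal_part assms smooth_map_const)

lemma integrable_gauss:
  fixes y :: "'a \<Rightarrow> 'e::euclidean_space" and h :: "'a \<Rightarrow> real"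
  assumes y: "immersion \<A> y" and fin: "V_functional \<A> (\<lambda>_. 0) y < \<infinity>"
    and h: "continuous_on UNIV h" "\<And>q. \<bar>h q\<bar> \<le> B"
  shows "integrable (volume_measure \<A> y) (\<lambda>q. exp (- (1/2) * (y q \<bullet> y q)) * h q)"
proof -
  have E: "continuous_on UNIV (\<lambda>q. exp (- (1/2) * (y q \<bullet> y q)))"
    by (intro continuous_intros smooth_map_continuous[OF immersion_smooth[OF y]])
  have "integrable (volume_measure \<A> y) (\<lambda>q. exp (- (1/2) * (y q \<bullet> y q)))"
  proof (rule integrableI_nonneg[OF borel_measurable_volume[OF y E]])
    show "(\<integral>\<^sup>+q. ennreal (exp (- (1/2) * (y q \<bullet> y q))) \<partial>volume_measure \<A> y) < \<infinity>"
      using fin by (simp add: V_functional_def power2_norm_eq_inner)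
  qed simp
  then have "integrable (volume_measure \<A> y) (\<lambda>q. B * exp (- (1/2) * (y q \<bullet> y q)))"
    by (rule integrable_mult_right)
  then show ?thesis
  proof (rule Bochner_Integration.integrable_bound)
    show "(\<lambda>q. exp (- (1/2) * (y q \<bullet> y q)) * h q) \<in> borel_measurable (volume_measure \<A> y)"
      by (rule borel_measurable_volume[OF y continuous_on_mult[OF E h(1)]])
    show "AE q in volume_measure \<A> y. norm (exp (- (1/2) * (y q \<bullet> y q)) * h q) \<le> norm (B * exp (- (1/2) * (y q \<bullet> y q)))"
    proof (rule AE_I2)
      fix q
      have "\<bar>h q\<bar> \<le> \<bar>B\<bar>" using h(2)[of q] by linarith
      then show "norm (exp (- (1/2) * (y q \<bullet> y q)) * h q) \<le> norm (B * exp (- (1/2) * (y q \<bullet> y q)))"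
        by (simp add: abs_mult mult.commute mult_right_mono)
    qed
  qed
qed

text \<open>In the gradient term the tangential part of \<open>y\<close> is estimated by
  \<open>y\<close> itself and the squared normal part of \<open>a\<close> by
  \<open>a \<bullet> a\<close>; the cutoff derivative then leaves a factor
  \<open>1 / r\<close>.\<close>

lemma stability_bound:
  fixes x :: "'a \<Rightarrow> 'e::euclidean_space"
  assumes proper: "properly_immersed \<A> x" and stab: "W_stable \<A> x (\<lambda>_. k)"
  defines "s \<equiv> \<lambda>q. (x q - k) \<bullet> (x q - k)"
  shows "\<exists>C. \<forall>r>0. \<forall>a. (\<forall>N. parallel_normal_field \<A> x N \<longrightarrow>
        (\<integral>q. bump (s q / r) * (a \<bullet> N q) * exp (- (1/2) * s q) \<partial>volume_measure \<A> x) = 0) \<longrightarrow>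
      (\<integral>q. exp (- (1/2) * s q) * ((bump (s q / r))\<^sup>2 * (normal_part \<A> x q a \<bullet> normal_part \<A> x q a)) \<partial>volume_measure \<A> x)
        \<le> C * (a \<bullet> a) / r"
proof -
  have xi: "xi_submanifold \<A> x (\<lambda>_. k)" and finx: "V_functional \<A> (\<lambda>_. k) x < \<infinity>"
    using stab by (simp_all add: W_stable_def)
  have x: "immersion \<A> x" using xi by (simp add: xi_submanifold_def)
  note y = immersion_diff_const[OF x, of k]
  have fin: "V_functional \<A> (\<lambda>_. 0) (\<lambda>q. x q - k) < \<infinity>" using finx V_functional_diff_const[of \<A> k x] by simp
  obtain D where D: "D \<ge> 0" "\<forall>r>0. \<forall>s\<ge>0. (deriv (\<lambda>s. bump (s / r)) s)\<^sup>2 * s \<le> D / r"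
    using deriv_bump_bound by blast
  let ?\<mu> = "volume_measure \<A> x"
  define E where "E q = exp (- (1/2) * s q)" for q
  define w where "w a q = normal_part \<A> x q a \<bullet> normal_part \<A> x q a" for a q
  have wb: "0 \<le> w a q" "w a q \<le> a \<bullet> a" for a q by (simp_all add: w_def normal_part_norm[OF x])
  have conts: "continuous_on UNIV s"
    unfolding s_def by (intro continuous_intros smooth_map_continuous[OF immersion_smooth[OF x]])
  have contw: "continuous_on UNIV (w a)" for a
    unfolding w_def[abs_def] by (rule continuous_normal_part_norm[OF x])
  have gauss: "integrable ?\<mu> (\<lambda>q. E q * h q)" if "continuous_on UNIV h" "\<And>q. \<bar>h q\<bar> \<le> B" for h B
    using integrable_gauss[OF y fin that(1), of B] that(2) by (simp add: E_def s_def volume_measure_diff_const)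
  show ?thesis
  \<comment> \<open>\<open>D\<close> bounds the scaled cutoff derivative, 4 is the factor in the
    squared gradient, and the integral is the weighted volume.\<close>
  proof (intro exI[of _ "4 * D * (\<integral>q. E q \<partial>?\<mu>)"] allI impI)
    fix r :: real and a assume r: "0 < r" and vp: "\<forall>N. parallel_normal_field \<A> x N \<longrightarrow>
        (\<integral>q. bump (s q / r) * (a \<bullet> N q) * exp (- (1/2) * s q) \<partial>volume_measure \<A> x) = 0"
    define g where "g s = bump (s / r)" for s
    have vp': "(\<integral>q. bump ((x q - k) \<bullet> (x q - k) / r) * (a \<bullet> N q) * exp (- (1/2) * ((x q - k) \<bullet> (x q - k))) \<partial>volume_measure \<A> x) = 0"
      if "parallel_normal_field \<A> x N" for N
      using vp that by (simp add: s_def)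
    define n where "n q = normal_part \<A> x q (x q - k) \<bullet> normal_part \<A> x q (x q - k)" for q
    define f where "f q = E q * ((4 * (deriv g (s q))\<^sup>2 * (s q - n q) - (g (s q))\<^sup>2) * w a q)" for q
    have f0: "0 \<le> (\<integral>q. f q \<partial>?\<mu>)"
      using stability_cutoff(1)[OF proper stab r vp']
      unfolding f_def E_def s_def n_def w_def g_def[abs_def] volume_measure_diff_const normal_part_diff_const .
    have fi: "integrable ?\<mu> f"
      using stability_cutoff(2)[OF proper stab r vp']
      unfolding f_def[abs_def] E_def s_def n_def w_def g_def[abs_def] volume_measure_diff_const normal_part_diff_const .
    have gb: "0 \<le> g (s q)" "g (s q) \<le> 1" for q
      using r by (simp_all add: g_def bump_simps bump_le_1 s_def)
    have contg: "continuous_on UNIV (\<lambda>q. g (s q))"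
      using continuous_on_compose2[OF C_infinity_on_continuous[OF C_infinity_on_bump_scaled[of r]] conts] by (simp add: g_def)
    have g2: "(g (s q))\<^sup>2 * w a q \<le> a \<bullet> a" "0 \<le> (g (s q))\<^sup>2 * w a q" for q
    proof -
      have "(g (s q))\<^sup>2 \<le> 1" using gb by (simp add: power_le_one)
      then have "(g (s q))\<^sup>2 * w a q \<le> 1 * w a q" by (rule mult_right_mono[OF _ wb(1)])
      then show "(g (s q))\<^sup>2 * w a q \<le> a \<bullet> a" using wb(2)[of a q] by simp
      show "0 \<le> (g (s q))\<^sup>2 * w a q" using wb(1) by simp
    qed
    have i1: "integrable ?\<mu> (\<lambda>q. E q * ((g (s q))\<^sup>2 * w a q))"
      by (rule gauss[of _ "a \<bullet> a"]) (use g2 in \<open>auto intro!: continuous_on_mult continuous_on_power contg contw\<close>)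
    have i2: "integrable ?\<mu> (\<lambda>q. E q * (4 * (D / r) * (a \<bullet> a)))"
      by (rule gauss[of _ "\<bar>4 * (D / r) * (a \<bullet> a)\<bar>"]) (auto intro: continuous_on_const)
    have "f q \<le> E q * (4 * (D / r) * (a \<bullet> a)) - E q * ((g (s q))\<^sup>2 * w a q)" for q
    proof -
      have s0: "0 \<le> s q" by (simp add: s_def)
      have "(deriv g (s q))\<^sup>2 * (s q - n q) \<le> (deriv g (s q))\<^sup>2 * s q"
        by (rule mult_left_mono) (simp_all add: n_def)
      also have "\<dots> \<le> D / r" using D(2) r s0 by (simp add: g_def[abs_def])
      finally have 1: "(deriv g (s q))\<^sup>2 * (s q - n q) \<le> D / r" .
      have "(deriv g (s q))\<^sup>2 * (s q - n q) * w a q \<le> (D / r) * (a \<bullet> a)"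
        by (rule order_trans[OF mult_right_mono[OF 1 wb(1)] mult_left_mono[OF wb(2)]]) (use D(1) r in simp)
      then have "4 * (deriv g (s q))\<^sup>2 * (s q - n q) * w a q - (g (s q))\<^sup>2 * w a q \<le> 4 * (D / r) * (a \<bullet> a) - (g (s q))\<^sup>2 * w a q"
        by simp
      then have "E q * (4 * (deriv g (s q))\<^sup>2 * (s q - n q) * w a q - (g (s q))\<^sup>2 * w a q) \<le> E q * (4 * (D / r) * (a \<bullet> a) - (g (s q))\<^sup>2 * w a q)"
        by (rule mult_left_mono) (simp add: E_def)
      then show ?thesis by (simp add: f_def algebra_simps)
    qed
    then have "(\<integral>q. f q \<partial>?\<mu>) \<le> (\<integral>q. E q * (4 * (D / r) * (a \<bullet> a)) - E q * ((g (s q))\<^sup>2 * w a q) \<partial>?\<mu>)"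
      by (intro integral_mono fi Bochner_Integration.integrable_diff i1 i2)
    also have "\<dots> = (\<integral>q. E q \<partial>?\<mu>) * (4 * (D / r) * (a \<bullet> a)) - (\<integral>q. E q * ((g (s q))\<^sup>2 * w a q) \<partial>?\<mu>)"
      unfolding Bochner_Integration.integral_diff[OF i2 i1] integral_mult_left_zero ..
    finally have "(\<integral>q. E q * ((g (s q))\<^sup>2 * w a q) \<partial>?\<mu>) \<le> (\<integral>q. E q \<partial>?\<mu>) * (4 * (D / r) * (a \<bullet> a))"
      using f0 by simp
    then show "(\<integral>q. exp (- (1/2) * s q) * ((bump (s q / r))\<^sup>2 * (normal_part \<A> x q a \<bullet> normal_part \<A> x q a)) \<partial>?\<mu>)
        \<le> 4 * D * (\<integral>q. E q \<partial>?\<mu>) * (a \<bullet> a) / r"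
      by (simp add: E_def g_def w_def mult_ac)
  qed
qed

end

section \<open>Rigidity\<close>

context manifold
begin

lemma chart_D_add_scaleR:
  fixes Y Z :: "'a \<Rightarrow> 'e::euclidean_space"
  assumes "smooth_map \<A> Y" "smooth_map \<A> Z" "c \<in> \<A>" "q \<in> fst c"
  shows "chart_D c (\<lambda>q. Y q + r *\<^sub>R Z q) q v = chart_D c Y q v + r *\<^sub>R chart_D c Z q v"
  using chart_D_eqI[OF has_derivative_add[OF has_derivative_chart_D[OF assms(1,3,4)]
      has_derivative_scaleR_right[OF has_derivative_chart_D[OF assms(2-4)]]]] by simp

lemma parallel_normal_field_add_scaleR:
  fixes x M N :: "'a \<Rightarrow> 'e::euclidean_space"
  assumes x: "immersion \<A> x" and M: "parallel_normal_field \<A> x M" and N: "parallel_normal_field \<A> x N"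
  shows "parallel_normal_field \<A> x (\<lambda>q. M q + r *\<^sub>R N q)"
proof -
  have s: "smooth_map \<A> M" "smooth_map \<A> N"
    and n: "M q \<in> normal_space \<A> x q" "N q \<in> normal_space \<A> x q" for q
    using M N by (simp_all add: parallel_normal_field_def normal_field_def)
  have "M q + r *\<^sub>R N q \<in> normal_space \<A> x q" for q
    using n[of q] unfolding normal_space_def by (intro subspace_add subspace_scale subspace_orthogonal_comp)
  moreover have "normal_connection \<A> c x (\<lambda>q. M q + r *\<^sub>R N q) q v = 0" if c: "c \<in> \<A>" "q \<in> fst c" for c q v
  proof -
    have "normal_connection \<A> c x M q v = 0" "normal_connection \<A> c x N q v = 0"
      using M N c by (simp_all add: parallel_normal_field_def)
    then show ?thesis
      by (simp add: normal_connection_def chart_D_add_scaleR[OF s c] linear_add[OF normal_part_properties(4)[OF x]]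
          linear_cmul[OF normal_part_properties(4)[OF x]])
  qed
  ultimately show ?thesis
    unfolding parallel_normal_field_def normal_field_def
    by (intro conjI allI ballI smooth_map_line s)
qed

lemma parallel_normal_field_sum:
  fixes x :: "'a \<Rightarrow> 'e::euclidean_space"
  assumes x: "immersion \<A> x" and M: "parallel_normal_field \<A> x M" and N: "\<And>i. i \<in> I \<Longrightarrow> parallel_normal_field \<A> x (N i)"
    and I: "finite I"
  shows "parallel_normal_field \<A> x (\<lambda>q. M q + (\<Sum>i\<in>I. r i *\<^sub>R N i q))"
  using I N
proof (induction I rule: finite_induct)
  case empty
  then show ?case using M by simp
next
  case (insert i I)
  have "parallel_normal_field \<A> x (\<lambda>q. (M q + (\<Sum>i\<in>I. r i *\<^sub>R N i q)) + r i *\<^sub>R N i q)"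
    by (rule parallel_normal_field_add_scaleR[OF x]) (use insert in auto)
  then show ?case using insert.hyps by (simp add: algebra_simps)
qed

text \<open>A parallel normal field has constant length, its derivative being tangential.\<close>

lemma parallel_normal_field_zero:
  fixes x :: "'a \<Rightarrow> 'e::euclidean_space"
  assumes conn: "connected (UNIV :: 'a set)" and x: "immersion \<A> x" and N: "parallel_normal_field \<A> x N" and "N q0 = 0"
  shows "N q = 0"
proof -
  have s: "smooth_map \<A> N" using N by (simp add: parallel_normal_field_def normal_field_def)
  have "N q \<bullet> N q = N q0 \<bullet> N q0"
  proof (rule zero_derivative_imp_constant[OF conn smooth_map_inner[OF s s]])
    show "chart_D c (\<lambda>q. N q \<bullet> N q) q v = 0" if "c \<in> \<A>" "q \<in> fst c" for c q v
      using parallel_normal_field_derivative(2)[OF x N that] by (simp add: chart_D_inner[OF s s that] inner_commute)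
  qed
  then show ?thesis using \<open>N q0 = 0\<close> by simp
qed

lemma dim_tangent_space:
  fixes x :: "'a \<Rightarrow> 'e::euclidean_space"
  assumes x: "immersion \<A> x"
  shows "subspace (tangent_space \<A> x q)" "dim (tangent_space \<A> x q) = CARD('m)"
    "dim (normal_space \<A> x q) + CARD('m) = DIM('e)"
proof -
  obtain c where c: "c \<in> \<A>" "q \<in> fst c" using chart_cover by blast
  note T = tangent_space_eq[OF immersion_smooth[OF x] c] and lin = chart_D_linear[OF immersion_smooth[OF x] c]
  have inj: "inj (chart_D c x q)" using x c unfolding immersion_def by blast
  show S: "subspace (tangent_space \<A> x q)"
    unfolding T by (rule linear_subspace_image[OF lin subspace_UNIV])
  show d: "dim (tangent_space \<A> x q) = CARD('m)"
    unfolding T using dim_image_eq[OF lin inj_on_subset[OF inj subset_UNIV], of UNIV] by simp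
  have "normal_space \<A> x q = {y \<in> UNIV. \<forall>v\<in>tangent_space \<A> x q. orthogonal v y}"
    by (simp add: normal_space_def orthogonal_comp_def)
  then show "dim (normal_space \<A> x q) + CARD('m) = DIM('e)"
    using dim_subspace_orthogonal_to_vectors[OF S subspace_UNIV subset_UNIV] by (simp add: d)
qed

text \<open>
  A parallel normal field is determined by its value at one point, so the constraint on the test
  vector amounts to at most \<open>p\<close> linear equations.
\<close>

lemma test_vector:
  fixes x :: "'a \<Rightarrow> 'e::euclidean_space"
  assumes conn: "connected (UNIV :: 'a set)" and x: "immersion \<A> x" and Z: "dim Z < CARD('m)"
    and \<rho>: "continuous_on UNIV \<rho>" and K: "compact K" "\<And>q. q \<notin> K \<Longrightarrow> \<rho> q = 0"
  shows "\<exists>a. norm a = 1 \<and> (\<forall>z\<in>Z. a \<bullet> z = 0) \<and>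
    (\<forall>N. parallel_normal_field \<A> x N \<longrightarrow> (\<integral>q. \<rho> q * (a \<bullet> N q) \<partial>volume_measure \<A> x) = 0)"
proof -
  let ?\<mu> = "volume_measure \<A> x" and ?P = "parallel_normal_field \<A> x"
  have Ps: "smooth_map \<A> N" and Pn: "N q \<in> normal_space \<A> x q" if "?P N" for N q
    using that by (simp_all add: parallel_normal_field_def normal_field_def)
  have int: "integrable ?\<mu> (\<lambda>q. \<rho> q * (a \<bullet> N q))" if "?P N" for a N
    by (rule integrable_volume_continuous[OF x K(1)])
      (use K(2) in \<open>auto intro!: continuous_intros \<rho> smooth_map_continuous[OF Ps[OF that]]\<close>)
  \<comment> \<open>An arbitrary base point: evaluation there embeds the space of parallel normal
    fields linearly into one normal space.\<close>
  define q0 where "q0 = (undefined :: 'a)"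
  obtain T where T: "T \<subseteq> {N q0 | N. ?P N}" "independent T" "{N q0 | N. ?P N} \<subseteq> span T" "card T = dim {N q0 | N. ?P N}"
    by (rule basis_exists)
  have finT: "finite T" by (rule independent_imp_finite[OF T(2)])
  have "\<forall>v\<in>T. \<exists>N. ?P N \<and> N q0 = v" using T(1) by blast
  from bchoice[OF this] obtain M where M: "\<forall>v\<in>T. ?P (M v) \<and> M v q0 = v" ..
  \<comment> \<open>The constraint integral is linear in \<open>a\<close>; \<open>J v\<close> is the
    vector representing it for the parallel field with value \<open>v\<close> at
    \<open>q0\<close>.\<close>
  define J where "J v = (\<Sum>b\<in>Basis. (\<integral>q. \<rho> q * (b \<bullet> M v q) \<partial>?\<mu>) *\<^sub>R b)" for v
  have J: "a \<bullet> J v = (\<integral>q. \<rho> q * (a \<bullet> M v q) \<partial>?\<mu>)" if v: "v \<in> T" for a v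
  proof -
    have "a \<bullet> M v q = (\<Sum>b\<in>Basis. (a \<bullet> b) * (b \<bullet> M v q))" for q
      by (simp add: euclidean_inner[of a "M v q"] inner_commute[of "M v q"])
    then have "(\<integral>q. \<rho> q * (a \<bullet> M v q) \<partial>?\<mu>) = (\<integral>q. (\<Sum>b\<in>Basis. (a \<bullet> b) * (\<rho> q * (b \<bullet> M v q))) \<partial>?\<mu>)"
      by (simp add: sum_distrib_left mult_ac)
    also have "\<dots> = (\<Sum>b\<in>Basis. (a \<bullet> b) * (\<integral>q. \<rho> q * (b \<bullet> M v q) \<partial>?\<mu>))"
      by (subst Bochner_Integration.integral_sum) (use M v int in auto)
    also have "\<dots> = a \<bullet> J v" by (simp add: J_def inner_sum_right mult.commute)
    finally show ?thesis ..
  qed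
  obtain BZ where BZ: "BZ \<subseteq> Z" "independent BZ" "Z \<subseteq> span BZ" "card BZ = dim Z" by (rule basis_exists)
  \<comment> \<open>Fewer than \<open>CARD('m)\<close> conditions come from \<open>Z\<close> and at
    most as many as the codimension from \<open>T\<close>, so a nonzero vector remains.\<close>
  have "dim (Z \<union> J ` T) \<le> card (BZ \<union> J ` T)"
  proof (rule dim_le_card)
    have "span BZ \<subseteq> span (BZ \<union> J ` T)" by (rule span_mono) simp
    then show "Z \<union> J ` T \<subseteq> span (BZ \<union> J ` T)" using BZ(3) by (auto intro: span_base)
    show "finite (BZ \<union> J ` T)" using independent_imp_finite[OF BZ(2)] finT by simp
  qed
  also have "\<dots> \<le> card BZ + card (J ` T)" by (rule card_Un_le)
  also have "\<dots> \<le> dim Z + card T" using card_image_le[OF finT, of J] BZ(4) by simp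
  also have "card T \<le> dim (normal_space \<A> x q0)"
    unfolding T(4) by (rule dim_subset) (use Pn in blast)
  finally have "dim (Z \<union> J ` T) < DIM('e)" using Z dim_tangent_space(3)[OF x, of q0] by linarith
  then obtain b where b: "b \<noteq> 0" "\<And>w. w \<in> span (Z \<union> J ` T) \<Longrightarrow> orthogonal b w"
    by (rule orthogonal_to_subspace_exists) blast
  define a where "a = b /\<^sub>R norm b"
  have orth: "a \<bullet> w = 0" if "w \<in> Z \<union> J ` T" for w
    using b(2)[OF span_base[OF that]] by (simp add: a_def orthogonal_def)
  have "(\<integral>q. \<rho> q * (a \<bullet> N q) \<partial>?\<mu>) = 0" if N: "?P N" for N
  proof -
    have "N q0 \<in> span T" using T(3) N by blast
    then obtain r where r: "N q0 = (\<Sum>v\<in>T. r v *\<^sub>R v)" using span_finite[OF finT] by auto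
    \<comment> \<open>The difference between \<open>N\<close> and its expansion in the chosen fields
      is parallel and vanishes at \<open>q0\<close>, hence everywhere; the finitely many conditions
      therefore cover all \<open>N\<close>.\<close>
    have par: "?P (\<lambda>q. N q + (\<Sum>v\<in>T. (- r v) *\<^sub>R M v q))"
      by (rule parallel_normal_field_sum[OF x N _ finT]) (use M in blast)
    have "(\<Sum>v\<in>T. r v *\<^sub>R M v q0) = N q0" unfolding r by (rule sum.cong) (use M in auto)
    then have "N q0 + (\<Sum>v\<in>T. (- r v) *\<^sub>R M v q0) = 0" by (simp add: sum_negf)
    from parallel_normal_field_zero[OF conn x par this]
    have "N q = (\<Sum>v\<in>T. r v *\<^sub>R M v q)" for q by (simp add: sum_negf)
    then have "(\<integral>q. \<rho> q * (a \<bullet> N q) \<partial>?\<mu>) = (\<integral>q. (\<Sum>v\<in>T. r v * (\<rho> q * (a \<bullet> M v q))) \<partial>?\<mu>)"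
      by (simp add: inner_sum_right sum_distrib_left mult_ac)
    also have "\<dots> = (\<Sum>v\<in>T. r v * (\<integral>q. \<rho> q * (a \<bullet> M v q) \<partial>?\<mu>))"
      by (subst Bochner_Integration.integral_sum) (use M int in auto)
    also have "\<dots> = (\<Sum>v\<in>T. r v * (a \<bullet> J v))" by (rule sum.cong) (simp_all add: J)
    also have "\<dots> = 0" using orth by simp
    finally show ?thesis .
  qed
  moreover have "norm a = 1" using b(1) by (simp add: a_def)
  ultimately show ?thesis using orth by (intro exI[of _ a]) blast
qed

lemma stable_dim_tangential_constants:
  fixes x :: "'a \<Rightarrow> 'e::euclidean_space"
  assumes conn: "connected (UNIV :: 'a set)" and proper: "properly_immersed \<A> x" and stab: "W_stable \<A> x (\<lambda>_. k)"
  shows "CARD('m) \<le> dim {a. \<forall>q. normal_part \<A> x q a = 0}" (is "_ \<le> dim ?Z")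
proof (rule ccontr)
  assume "\<not> CARD('m) \<le> dim ?Z"
  then have dZ: "dim ?Z < CARD('m)" by simp
  have xi: "xi_submanifold \<A> x (\<lambda>_. k)" and finx: "V_functional \<A> (\<lambda>_. k) x < \<infinity>"
    using stab by (simp_all add: W_stable_def)
  have x: "immersion \<A> x" using xi by (simp add: xi_submanifold_def)
  note y = immersion_diff_const[OF x, of k]
  have fin: "V_functional \<A> (\<lambda>_. 0) (\<lambda>q. x q - k) < \<infinity>" using finx V_functional_diff_const[of \<A> k x] by simp
  let ?\<mu> = "volume_measure \<A> x"
  define s where "s q = (x q - k) \<bullet> (x q - k)" for q
  define E where "E q = exp (- (1/2) * s q)" for q
  define w where "w a q = normal_part \<A> x q a \<bullet> normal_part \<A> x q a" for a q
  have wb: "0 \<le> w a q" "w a q \<le> a \<bullet> a" for a q by (simp_all add: w_def normal_part_norm[OF x])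
  have conts: "continuous_on UNIV s"
    unfolding s_def[abs_def] by (intro continuous_intros smooth_map_continuous[OF immersion_smooth[OF x]])
  have contE: "continuous_on UNIV E" unfolding E_def[abs_def] by (intro continuous_intros conts)
  have contw: "continuous_on UNIV (w a)" for a
    unfolding w_def[abs_def] by (rule continuous_normal_part_norm[OF x])
  have contb: "continuous_on UNIV (\<lambda>q. bump (s q / r))" for r
    by (rule continuous_on_compose2[OF C_infinity_on_continuous[OF C_infinity_on_bump_scaled] conts]) simp
  have gauss: "integrable ?\<mu> (\<lambda>q. E q * h q)" if "continuous_on UNIV h" "\<And>q. \<bar>h q\<bar> \<le> B" for h B
    using integrable_gauss[OF y fin that(1), of B] that(2) by (simp add: E_def s_def volume_measure_diff_const)
  obtain C where C: "\<forall>r>0. \<forall>a. (\<forall>N. parallel_normal_field \<A> x N \<longrightarrow>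
        (\<integral>q. bump (s q / r) * (a \<bullet> N q) * E q \<partial>?\<mu>) = 0) \<longrightarrow>
      (\<integral>q. E q * ((bump (s q / r))\<^sup>2 * w a q) \<partial>?\<mu>) \<le> C * (a \<bullet> a) / r"
    using stability_bound[OF proper stab, folded s_def, folded E_def w_def] ..
  \<comment> \<open>One test vector for each squared cutoff radius \<open>Suc n\<close>; it changes
    with \<open>n\<close> because the cutoff enters the constraint.\<close>
  have "\<forall>n. \<exists>a. norm a = 1 \<and> (\<forall>z\<in>?Z. a \<bullet> z = 0) \<and>
      (\<integral>q. E q * ((bump (s q / real (Suc n)))\<^sup>2 * w a q) \<partial>?\<mu>) \<le> C / real (Suc n)"
  proof
    fix n
    let ?r = "real (Suc n)"
    have r: "?r > 0" by simp
    have K: "compact (x -` cball k (sqrt ?r))" using proper by (simp add: properly_immersed_def)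
    have zero: "bump (s q / ?r) * E q = 0" if "q \<notin> x -` cball k (sqrt ?r)" for q
    proof -
      have "dist k (x q) = sqrt (s q)"
        unfolding s_def norm_eq_sqrt_inner[symmetric] by (simp add: dist_norm norm_minus_commute)
      then have "\<not> sqrt (s q) \<le> sqrt ?r" using that by simp
      then have "1 \<le> s q / ?r" by (simp add: field_simps)
      then show ?thesis by (simp add: bump_simps)
    qed
    have "\<exists>a. norm a = 1 \<and> (\<forall>z\<in>?Z. a \<bullet> z = 0) \<and>
      (\<forall>N. parallel_normal_field \<A> x N \<longrightarrow> (\<integral>q. (bump (s q / ?r) * E q) * (a \<bullet> N q) \<partial>?\<mu>) = 0)"
      by (rule test_vector[OF conn x dZ continuous_on_mult[OF contb contE] K zero])
    then obtain a where a: "norm a = 1" "\<forall>z\<in>?Z. a \<bullet> z = 0"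
      "\<forall>N. parallel_normal_field \<A> x N \<longrightarrow> (\<integral>q. (bump (s q / ?r) * E q) * (a \<bullet> N q) \<partial>?\<mu>) = 0"
      by (elim exE conjE)
    have "(\<integral>q. E q * ((bump (s q / ?r))\<^sup>2 * w a q) \<partial>?\<mu>) \<le> C * (a \<bullet> a) / ?r"
      using C r a(3) by (simp add: mult_ac)
    then show "\<exists>a. norm a = 1 \<and> (\<forall>z\<in>?Z. a \<bullet> z = 0) \<and>
      (\<integral>q. E q * ((bump (s q / ?r))\<^sup>2 * w a q) \<partial>?\<mu>) \<le> C / ?r"
      using a(1,2) by (intro exI[of _ a]) (simp add: dot_square_norm)
  qed
  from choice[OF this] obtain a where a: "\<forall>n. norm (a n) = 1 \<and> (\<forall>z\<in>?Z. a n \<bullet> z = 0) \<and>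
      (\<integral>q. E q * ((bump (s q / real (Suc n)))\<^sup>2 * w (a n) q) \<partial>?\<mu>) \<le> C / real (Suc n)" ..
  \<comment> \<open>The ambient space has finite dimension, so its unit sphere is compact and the
    varying test vectors subconverge.\<close>
  have "\<forall>n. a n \<in> sphere 0 1" using a by simp
  then obtain l \<sigma> where l: "l \<in> sphere 0 1" and \<sigma>: "strict_mono \<sigma>" and lim: "(a \<circ> \<sigma>) \<longlonglongrightarrow> l"
    using compact_sphere[of 0 1] unfolding compact_def by blast
  have lim': "(\<lambda>n. a (\<sigma> n)) \<longlonglongrightarrow> l" using lim by (simp add: comp_def)
  have inv: "(\<lambda>n. t / real (Suc (\<sigma> n))) \<longlonglongrightarrow> 0" for t
    using LIMSEQ_subseq_LIMSEQ[OF tendsto_mult_right_zero[OF LIMSEQ_inverse_real_of_nat, of t] \<sigma>]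
    by (simp add: comp_def divide_inverse)
  \<comment> \<open>Cutoff and test vector move together; the Gaussian weight itself dominates, as
    the cutoff and the normal part of a unit vector have size at most 1.\<close>
  have "(\<lambda>n. \<integral>q. E q * ((bump (s q / real (Suc (\<sigma> n))))\<^sup>2 * w (a (\<sigma> n)) q) \<partial>?\<mu>) \<longlonglongrightarrow> (\<integral>q. E q * w l q \<partial>?\<mu>)"
  proof (rule integral_dominated_convergence)
    show "(\<lambda>q. E q * w l q) \<in> borel_measurable ?\<mu>"
      by (intro borel_measurable_volume[OF x] continuous_on_mult contE contw)
    show "(\<lambda>q. E q * ((bump (s q / real (Suc (\<sigma> n))))\<^sup>2 * w (a (\<sigma> n)) q)) \<in> borel_measurable ?\<mu>" for n
      by (intro borel_measurable_volume[OF x] continuous_on_mult continuous_on_power contE contw contb)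
    show "integrable ?\<mu> (\<lambda>q. E q * 1)" by (rule gauss[of _ 1]) auto
    show "AE q in ?\<mu>. (\<lambda>n. E q * ((bump (s q / real (Suc (\<sigma> n))))\<^sup>2 * w (a (\<sigma> n)) q)) \<longlonglongrightarrow> E q * w l q"
    proof (rule AE_I2)
      fix q
      have "(\<lambda>n. bump (s q / real (Suc (\<sigma> n)))) \<longlonglongrightarrow> bump 0"
        by (rule isCont_tendsto_compose[OF DERIV_isCont[OF DERIV_bump] inv])
      moreover have "(\<lambda>n. normal_part \<A> x q (a (\<sigma> n))) \<longlonglongrightarrow> normal_part \<A> x q l"
        by (rule bounded_linear.tendsto[OF linear_conv_bounded_linear[THEN iffD1, OF normal_part_properties(4)[OF x]] lim'])
      ultimately have "(\<lambda>n. E q * ((bump (s q / real (Suc (\<sigma> n))))\<^sup>2 * w (a (\<sigma> n)) q)) \<longlonglongrightarrow> E q * ((bump 0)\<^sup>2 * w l q)"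
        unfolding w_def by (intro tendsto_intros)
      then show "(\<lambda>n. E q * ((bump (s q / real (Suc (\<sigma> n))))\<^sup>2 * w (a (\<sigma> n)) q)) \<longlonglongrightarrow> E q * w l q"
        by (simp add: bump_simps)
    qed
    show "AE q in ?\<mu>. norm (E q * ((bump (s q / real (Suc (\<sigma> n))))\<^sup>2 * w (a (\<sigma> n)) q)) \<le> E q * 1" for n
    proof (rule AE_I2)
      fix q
      have "0 \<le> bump (s q / real (Suc (\<sigma> n)))" "bump (s q / real (Suc (\<sigma> n))) \<le> 1"
        by (simp_all add: bump_simps bump_le_1 s_def)
      then have "(bump (s q / real (Suc (\<sigma> n))))\<^sup>2 \<le> 1" by (simp add: power_le_one)
      moreover have "w (a (\<sigma> n)) q \<le> 1" using wb(2)[of "a (\<sigma> n)" q] a by (simp add: dot_square_norm)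
      ultimately have "(bump (s q / real (Suc (\<sigma> n))))\<^sup>2 * w (a (\<sigma> n)) q \<le> 1"
        by (intro mult_le_one wb(1))
      then show "norm (E q * ((bump (s q / real (Suc (\<sigma> n))))\<^sup>2 * w (a (\<sigma> n)) q)) \<le> E q * 1"
        by (simp add: abs_mult wb(1) E_def)
    qed
  qed
  then have "(\<integral>q. E q * w l q \<partial>?\<mu>) \<le> 0"
    by (rule LIMSEQ_le[OF _ inv[of C]]) (use a in blast)
  moreover have "0 \<le> (\<integral>q. E q * w l q \<partial>?\<mu>)" by (rule Bochner_Integration.integral_nonneg) (simp add: E_def wb(1))
  ultimately have "(\<integral>q. E q * w l q \<partial>?\<mu>) = 0" by simp
  moreover have "integrable ?\<mu> (\<lambda>q. E q * w l q)"
    by (rule gauss[OF contw, of _ "l \<bullet> l"]) (simp add: wb)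
  ultimately have "E q * w l q = 0" for q
    by (intro volume_integral_zero_imp_zero[OF x continuous_on_mult[OF contE contw]]) (simp_all add: E_def wb(1))
  then have "l \<in> ?Z" by (simp add: E_def w_def)
  \<comment> \<open>Every \<open>a n\<close> is orthogonal to \<open>?Z\<close>, in particular to
    the limit \<open>l\<close>, which makes \<open>l\<close> orthogonal to itself.\<close>
  have "(\<lambda>n. a (\<sigma> n) \<bullet> l) \<longlonglongrightarrow> l \<bullet> l" by (intro tendsto_intros lim')
  moreover have "(\<lambda>n. a (\<sigma> n) \<bullet> l) = (\<lambda>n. 0)" using a \<open>l \<in> ?Z\<close> by blast
  ultimately have "l \<bullet> l = 0" using LIMSEQ_unique[OF _ tendsto_const] by metis
  then show False using l by simp
qed


text \<open>Near a limit point \<open>l\<close> only the part of the image inside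
  \<open>cball l 1\<close> matters, and this part is the continuous image of a compact set.\<close>

lemma properly_immersed_closed_range:
  fixes x :: "'a \<Rightarrow> 'e::euclidean_space"
  assumes proper: "properly_immersed \<A> x"
  shows "closed (range x)"
proof (rule closure_subset_eq[THEN iffD1])
  show "closure (range x) \<subseteq> range x"
  proof
    fix l assume l: "l \<in> closure (range x)"
    let ?K = "x ` (x -` cball l 1)"
    have "compact (x -` cball l 1)" using proper by (simp add: properly_immersed_def)
    moreover have "continuous_on (x -` cball l 1) x"
      using proper smooth_map_continuous[OF immersion_smooth] continuous_on_subset
      unfolding properly_immersed_def by blast
    ultimately have "closed ?K" by (intro compact_imp_closed compact_continuous_image)
    moreover have "l \<in> closure ?K"
      unfolding closure_approachable
    proof (intro allI impI)
      fix e :: real assume "0 < e"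
      then obtain q where q: "dist (x q) l < min e 1"
        using l[unfolded closure_approachable, rule_format, of "min e 1"] by auto
      then have "x q \<in> ?K" by (auto simp: dist_commute)
      then show "\<exists>z\<in>?K. dist z l < e" using q by (intro bexI[of _ "x q"]) simp_all
    qed
    ultimately show "l \<in> range x" by auto
  qed
qed

lemma constant_tangent_space_imp_plane:
  fixes x :: "'a \<Rightarrow> 'e::euclidean_space"
  assumes conn: "connected (UNIV :: 'a set)" and proper: "properly_immersed \<A> x"
    and Z: "\<And>q. tangent_space \<A> x q = Z"
  shows "m_plane CARD('m) (range x)"
proof -
  have x: "immersion \<A> x" using proper by (simp add: properly_immersed_def)
  note xs = immersion_smooth[OF x]
  define q0 where "q0 = (undefined :: 'a)"
  have subZ: "subspace Z" and dimZ: "dim Z = CARD('m)"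
    using dim_tangent_space(1,2)[OF x, of q0] by (simp_all add: Z)
  have xZ: "x q - x q0 \<in> Z" for q
  proof -
    \<comment> \<open>Pairing \<open>x\<close> with a vector orthogonal to \<open>Z\<close> gives a
      function with zero derivative, so the displacement from the base point has no component off
      \<open>Z\<close>.\<close>
    have orth: "(x q - x q0) \<bullet> w = 0" if w: "\<And>z. z \<in> Z \<Longrightarrow> orthogonal w z" for w
    proof -
      have "x q \<bullet> w = x q0 \<bullet> w"
      proof (rule zero_derivative_imp_constant[OF conn smooth_map_inner[OF xs smooth_map_const]])
        fix c q v assume c: "c \<in> \<A>" "q \<in> fst c"
        have "chart_D c x q v \<in> Z" using tangent_space_eq[OF xs c] Z by blast
        from w[OF this] have "chart_D c x q v \<bullet> w = 0" by (simp add: orthogonal_def inner_commute)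
        moreover have "chart_D c (\<lambda>q. x q \<bullet> w) q = (\<lambda>v. chart_D c x q v \<bullet> w)"
          by (rule chart_D_eqI[OF has_derivative_inner_left[OF has_derivative_chart_D[OF xs c]]])
        ultimately show "chart_D c (\<lambda>q. x q \<bullet> w) q v = 0" by simp
      qed
      then show ?thesis by (simp add: inner_diff_left)
    qed
    obtain u w where uw: "u \<in> span Z" "\<And>z. z \<in> span Z \<Longrightarrow> orthogonal w z" "x q - x q0 = u + w"
      by (rule orthogonal_subspace_decomp_exists) blast
    have "(x q - x q0) \<bullet> w = 0" by (rule orth[OF uw(2)[OF span_base]])
    moreover have "u \<bullet> w = 0" using uw(2)[OF uw(1)] by (simp add: orthogonal_def inner_commute)
    ultimately have "w = 0" using uw(3) by (simp add: inner_add_left)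
    then show ?thesis using uw(1,3) span_eq_iff[THEN iffD2, OF subZ] by simp
  qed
  \<comment> \<open>Linear coordinates on \<open>Z\<close> turn \<open>x\<close> into a map
    \<open>G\<close> between spaces of equal dimension, to which an open mapping theorem
    applies.\<close>
  obtain \<pi> :: "'e \<Rightarrow> real ^ 'm" and \<iota> where \<pi>: "linear \<pi>" "linear \<iota>" "\<pi> ` Z = UNIV" "\<iota> ` UNIV = Z"
    "\<And>z. z \<in> Z \<Longrightarrow> \<iota> (\<pi> z) = z" "\<And>v. v \<in> UNIV \<Longrightarrow> \<pi> (\<iota> v) = v"
    by (rule isometries_subspaces[OF subZ subspace_UNIV, where ?'b = "real ^ 'm"]) (auto simp: dimZ)
  define G where "G q = \<pi> (x q - x q0)" for q
  have xG: "x q = x q0 + \<iota> (G q)" for q using \<pi>(5)[OF xZ[of q]] by (simp add: G_def)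
  have "closed (range G)"
  proof -
    have "range G = (\<lambda>v. x q0 + \<iota> v) -` range x"
    proof (intro set_eqI iffI)
      fix v assume "v \<in> range G"
      then obtain q where "v = G q" by blast
      then show "v \<in> (\<lambda>v. x q0 + \<iota> v) -` range x" using rangeI[of x q] by (simp add: xG[symmetric])
    next
      fix v assume "v \<in> (\<lambda>v. x q0 + \<iota> v) -` range x"
      then obtain q where "x q0 + \<iota> v = x q" by auto
      then have "\<iota> v = \<iota> (G q)" using xG[of q] by simp
      then have "\<pi> (\<iota> v) = \<pi> (\<iota> (G q))" by (rule arg_cong)
      then have "v = G q" unfolding \<pi>(6)[OF UNIV_I] .
      then show "v \<in> range G" by blast
    qed
    moreover have "continuous_on UNIV (\<lambda>v. x q0 + \<iota> v)"
      by (intro continuous_on_add continuous_on_const linear_continuous_on linear_conv_bounded_linear[THEN iffD1] \<pi>(2))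
    ultimately show ?thesis
      using closed_vimage[OF properly_immersed_closed_range[OF proper]] by simp
  qed
  moreover have "open (range G)"
    unfolding open_contains_ball
  proof
    fix v assume "v \<in> range G"
    then obtain q where v: "v = G q" by blast
    obtain c where c: "c \<in> \<A>" "q \<in> fst c" using chart_cover by blast
    have lp: "bounded_linear \<pi>" using \<pi>(1) linear_conv_bounded_linear by blast
    have derf: "((\<lambda>u. G (chart_inv c u)) has_derivative (\<lambda>v. \<pi> (chart_D c x q v))) (at (snd c q))"
      unfolding G_def
      using bounded_linear.has_derivative[OF lp has_derivative_diff[OF has_derivative_chart_D[OF xs c] has_derivative_const]] by simp
    have lin: "linear (chart_D c x q)" by (rule chart_D_linear[OF xs c])
    have inj: "inj (chart_D c x q)" using x c unfolding immersion_def by blast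
    have \<pi>lin: "linear (\<lambda>v. \<pi> (chart_D c x q v))" using linear_compose[OF lin \<pi>(1)] by (simp add: comp_def)
    have \<pi>inj: "inj (\<lambda>v. \<pi> (chart_D c x q v))"
    proof (rule injI)
      fix a b assume ab: "\<pi> (chart_D c x q a) = \<pi> (chart_D c x q b)"
      have "chart_D c x q w \<in> Z" for w using tangent_space_eq[OF xs c] Z by blast
      then have "chart_D c x q a = chart_D c x q b" using ab \<pi>(5) by metis
      then show "a = b" by (rule injD[OF inj])
    qed
    \<comment> \<open>The differential of \<open>G\<close> in the chart is injective between equal
      dimensions, hence has the linear inverse that the open mapping theorem asks for.\<close>
    obtain g where g: "linear g" "\<forall>v. g (\<pi> (chart_D c x q v)) = v" "\<forall>v. \<pi> (chart_D c x q (g v)) = v"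
      using linear_injective_isomorphism[OF \<pi>lin \<pi>inj refl] by (elim exE conjE)
    have gid: "(\<lambda>v. \<pi> (chart_D c x q v)) \<circ> g = id" using g(3) by (simp add: fun_eq_iff)
    have "G (chart_inv c (snd c q)) \<in> interior ((\<lambda>u. G (chart_inv c u)) ` chart_image c)"
    proof (rule sussmann_open_mapping[OF chart_open(2)[OF c(1)] _ chart_inverse(2)[OF c] derf _ gid])
      show "continuous_on (chart_image c) (\<lambda>u. G (chart_inv c u))"
        unfolding G_def using C_infinity_on_continuous[OF smooth_mapD[OF xs c(1)]]
        by (intro bounded_linear.continuous_on[OF lp] continuous_intros) (simp add: comp_def)
      show "bounded_linear g" using g(1) linear_conv_bounded_linear by blast
      show "snd c q \<in> interior (chart_image c)"
        using chart_inverse(2)[OF c] chart_open(2)[OF c(1)] by (simp add: interior_open)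
    qed simp
    then have "v \<in> interior ((\<lambda>u. G (chart_inv c u)) ` chart_image c)" by (simp add: v chart_inverse(1)[OF c])
    then obtain e where "e > 0" "ball v e \<subseteq> (\<lambda>u. G (chart_inv c u)) ` chart_image c"
      by (auto simp: mem_interior)
    then show "\<exists>e>0. ball v e \<subseteq> range G" by blast
  qed
  ultimately have "range G = UNIV" using clopen[of "range G"] by blast
  then have "range x = (\<lambda>z. x q0 + z) ` Z"
  proof -
    have "range x = (\<lambda>z. x q0 + z) ` \<iota> ` range G" unfolding image_image by (rule image_cong[OF refl xG])
    then show ?thesis using \<open>range G = UNIV\<close> \<pi>(4) by simp
  qed
  moreover have "affine ((\<lambda>z. x q0 + z) ` Z)"
    using affine_translation[of Z "x q0"] subspace_imp_affine[OF subZ] by simp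
  moreover have "aff_dim ((\<lambda>z. x q0 + z) ` Z) = int CARD('m)"
    by (simp add: aff_dim_translation_eq aff_dim_subspace[OF subZ] dimZ)
  ultimately show ?thesis by (simp add: m_plane_def)
qed

text \<open>The constant vectors that are tangent everywhere form a subspace of each tangent space,
  and the dimension bound makes the inclusion an equality; so all tangent spaces coincide.\<close>

lemma stable_imp_plane:
  fixes x :: "'a \<Rightarrow> 'e::euclidean_space"
  assumes conn: "connected (UNIV :: 'a set)" and proper: "properly_immersed \<A> x" and stab: "W_stable \<A> x (\<lambda>_. k)"
  shows "m_plane CARD('m) (range x)"
proof (rule constant_tangent_space_imp_plane[OF conn proper])
  fix q
  let ?Z = "{a. \<forall>q. normal_part \<A> x q a = 0}"
  have x: "immersion \<A> x" using proper by (simp add: properly_immersed_def)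
  note lin = normal_part_properties(4)[OF x]
  have "subspace ?Z"
    by (rule subspaceI) (simp_all add: linear_0[OF lin] linear_add[OF lin] linear_cmul[OF lin])
  moreover have "?Z \<subseteq> tangent_space \<A> x q"
  proof
    fix a assume "a \<in> ?Z"
    then show "a \<in> tangent_space \<A> x q" using normal_part_properties(2)[OF x, of a q] by simp
  qed
  ultimately show "tangent_space \<A> x q = ?Z"
    using subspace_dim_equal[of ?Z "tangent_space \<A> x q"] dim_tangent_space(1,2)[OF x, of q]
      stable_dim_tangential_constants[OF conn proper stab] by simp
qed

end

theorem corollary7p2:
  fixes \<A> :: "('a::{t2_space, second_countable_topology}, 'm::finite) chart set"
    and x \<xi> :: "'a \<Rightarrow> real ^ ('m + 'p::finite)"
  assumes "smooth_atlas \<A>"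
    and "connected (UNIV :: 'a set)"
    and "xi_submanifold \<A> x \<xi>"
    and "properly_immersed \<A> x"
    and "complete_immersion \<A> x"
    and "W_stable \<A> x \<xi>"
    and "flat_normal_bundle \<A> x"
    and "\<forall>c\<in>\<A>. \<forall>q\<in>fst c. \<forall>v. weingarten \<A> c x \<xi> q v = 0"
  shows "m_plane CARD('m) (range x)"
proof -
  interpret manifold \<A> by unfold_locales (rule assms(1))
  have "immersion \<A> x" "parallel_normal_field \<A> x \<xi>" using assms(3) by (simp_all add: xi_submanifold_def)
  \<comment> \<open>As \<xi> is constant, its value can be read off at any point, here
    \<open>undefined\<close>.\<close>
  then have "\<xi> = (\<lambda>_. \<xi> undefined)"
    by (intro ext) (rule parallel_weingarten_zero_imp_constant[OF assms(2) _ _ assms(8)])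
  then have "W_stable \<A> x (\<lambda>_. \<xi> undefined)" using assms(6) by simp
  then show ?thesis by (rule stable_imp_plane[OF assms(2,4)])
qed

end
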